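(* Let $G$ be a finite group and $\alpha\in Z^3(G,k^* )$ a normalised 3-cocycle. The monoidal centre $\mathcal{Z}(\mathcal{V}(G,\alpha))$ is isomorphic, as a braided monoidal category, to the category $\mathcal{Z}(G,\alpha)$. The canonical forgetful functor $\mathcal{Z}(\mathcal{V}(G,\alpha))\to\mathcal{V}(G,\alpha)$ corresponds to the functor $\mathcal{Z}(G,\alpha)\to\mathcal{V}(G,\alpha)$ forgetting the $G$-action.
   Context: $k$ is an algebraically closed field of characteristic zero, $k^*$ its multiplicative group; vector spaces are finite dimensional. Normalised 3-cocycles of $G$ are functions $\alpha:G^3\to k^*$ with $\alpha(g,h,l)\alpha(f,gh,l)\alpha(f,g,h)=\alpha(fg,h,l)\alpha(f,g,hl)$ and $\alpha(f,g,h)=1$ whenever one of $f,g,h$ is the identity $e$. With ${}^{g}h=ghg^{-1}$ put $$\alpha(f,g|h)=\alpha(f,g,h)^{-1}\alpha(f,{}^{g}h,g)\alpha({}^{fg}h,f,g)^{-1},\qquad \alpha(f|g,h)=\alpha(f,g,h)\alpha({}^{f}g,f,h)^{-1}\alpha({}^{f}g,{}^{f}h,f).$$ $\mathcal{V}(G,\alpha)$ is the fusion category of $G$-graded vector spaces and grading preserving maps, with $(V\otimes U)_g=\bigoplus_{fh=g}V_f\otimes U_h$ and associativity constraint $V\otimes(U\otimes W)\to(V\otimes U)\otimes W$, $v\otimes(u\otimes w)\mapsto\alpha(f,g,h)(v\otimes u)\otimes w$ for $v\in V_f,u\in U_g,w\in W_h$. The monoidal centre $\mathcal{Z}(\mathcal{C})$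 has objects $(X,x)$ with $X\in\mathcal{C}$ and $x_V:V\otimes X\to X\otimes V$ a natural isomorphism (half-braiding) satisfying the usual coherence (hexagon) condition; its braiding is $c_{(X,x),(Y,y)}=y_X$. The braided monoidal category $\mathcal{Z}(G,\alpha)$: objects are $G$-graded vector spaces $X=\bigoplus_gX_g$ with an $\alpha$-projective $G$-action, i.e. automorphisms $v\mapsto f.v$ for $f\in G$ with $f.X_g=X_{fgf^{-1}}$ and $(fg).v=\alpha(f,g|h)\,f.(g.v)$ for $v\in X_h$; morphisms preserve grading and action. Tensor product: graded tensor product with $f.(x\otimes y)=\alpha(f|g,h)(f.x\otimes f.y)$ for $x\in X_g,y\in Y_h$; associativity constraint as in $\mathcal{V}(G,\alpha)$; unit $k$ in degree $e$ with trivial action; braiding $c_{X,Y}(x\otimes y)=f.y\otimes x$ for $x\in X_f$. *)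

theory Defs
  imports "HOL-Algebra.Algebraic_Closure" "HOL-Algebra.Module" "HOL.Hull"
begin

(* frees the letter X, which HOL-Algebra uses for the polynomial variable *)
no_notation var (\<open>X\<index>\<close>)

section \<open>Categories, monoidal categories, braided monoidal categories\<close>

record ('o, 'm) category =
  Obj :: "'o set"
  Arr :: "'m set"
  Dom :: "'m \<Rightarrow> 'o"
  Cod :: "'m \<Rightarrow> 'o"
  Idn :: "'o \<Rightarrow> 'm"
  Cmp :: "'m \<Rightarrow> 'm \<Rightarrow> 'm"  (infixr \<open>\<bullet>\<index>\<close> 55)

definition Hom :: "('o, 'm, 'x) category_scheme \<Rightarrow> 'o \<Rightarrow> 'o \<Rightarrow> 'm set" where
  "Hom C A B = {f \<in> Arr C. Dom C f = A \<and> Cod C f = B}"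

definition inverse_arrows :: "('o, 'm, 'x) category_scheme \<Rightarrow> 'm \<Rightarrow> 'm \<Rightarrow> bool" where
  "inverse_arrows C f g \<longleftrightarrow>
     f \<in> Arr C \<and> g \<in> Hom C (Cod C f) (Dom C f) \<and>
     g \<bullet>\<^bsub>C\<^esub> f = Idn C (Dom C f) \<and> f \<bullet>\<^bsub>C\<^esub> g = Idn C (Cod C f)"

definition Iso :: "('o, 'm, 'x) category_scheme \<Rightarrow> 'o \<Rightarrow> 'o \<Rightarrow> 'm set" where
  "Iso C A B = {f \<in> Hom C A B. \<exists>g. inverse_arrows C f g}"

definition Inv :: "('o, 'm, 'x) category_scheme \<Rightarrow> 'm \<Rightarrow> 'm" where
  "Inv C f = (THE g. inverse_arrows C f g)"

locale category =
  fixes C :: "('o, 'm, 'x) category_scheme" (structure)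
  assumes dom_cod: "f \<in> Arr C \<Longrightarrow> Dom C f \<in> Obj C \<and> Cod C f \<in> Obj C"
    and idn: "A \<in> Obj C \<Longrightarrow> Idn C A \<in> Hom C A A"
    and cmp: "\<lbrakk>f \<in> Hom C A B; g \<in> Hom C B D\<rbrakk> \<Longrightarrow> g \<bullet> f \<in> Hom C A D"
    and idn_left: "f \<in> Hom C A B \<Longrightarrow> Idn C B \<bullet> f = f"
    and idn_right: "f \<in> Hom C A B \<Longrightarrow> f \<bullet> Idn C A = f"
    and cmp_assoc: "\<lbrakk>f \<in> Hom C A B; g \<in> Hom C B D; h \<in> Hom C D E\<rbrakk>
           \<Longrightarrow> (h \<bullet> g) \<bullet> f = h \<bullet> (g \<bullet> f)"

text \<open>The associativity constraint points in the direction
  \<open>A \<boxtimes> (B \<boxtimes> D) \<rightarrow> (A \<boxtimes> B) \<boxtimes> D\<close>.\<close>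

record ('o, 'm) monoidal_category = "('o, 'm) category" +
  TObj :: "'o \<Rightarrow> 'o \<Rightarrow> 'o"  (infixl \<open>\<boxtimes>\<index>\<close> 70)
  TArr :: "'m \<Rightarrow> 'm \<Rightarrow> 'm"  (infixl \<open>\<star>\<index>\<close> 70)
  Unit :: "'o"
  Assoc :: "'o \<Rightarrow> 'o \<Rightarrow> 'o \<Rightarrow> 'm"
  LUnit :: "'o \<Rightarrow> 'm"
  RUnit :: "'o \<Rightarrow> 'm"

locale monoidal_category = category C
  for C :: "('o, 'm, 'x) monoidal_category_scheme" (structure) +
  assumes tensor_obj: "\<lbrakk>A \<in> Obj C; B \<in> Obj C\<rbrakk> \<Longrightarrow> A \<boxtimes> B \<in> Obj C"
    and tensor_arr: "\<lbrakk>f \<in> Hom C A A'; g \<in> Hom C B B'\<rbrakk>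
           \<Longrightarrow> f \<star> g \<in> Hom C (A \<boxtimes> B) (A' \<boxtimes> B')"
    and tensor_idn: "\<lbrakk>A \<in> Obj C; B \<in> Obj C\<rbrakk>
           \<Longrightarrow> Idn C A \<star> Idn C B = Idn C (A \<boxtimes> B)"
    and tensor_cmp: "\<lbrakk>f \<in> Hom C A A'; f' \<in> Hom C A' A''; g \<in> Hom C B B'; g' \<in> Hom C B' B''\<rbrakk>
           \<Longrightarrow> (f' \<bullet> f) \<star> (g' \<bullet> g) = (f' \<star> g') \<bullet> (f \<star> g)"
    and unit_obj: "Unit C \<in> Obj C"
    and assoc_iso: "\<lbrakk>A \<in> Obj C; B \<in> Obj C; D \<in> Obj C\<rbrakk>
           \<Longrightarrow> Assoc C A B D \<in> Iso C (A \<boxtimes> (B \<boxtimes> D)) ((A \<boxtimes> B) \<boxtimes> D)"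
    and lunit_iso: "A \<in> Obj C \<Longrightarrow> LUnit C A \<in> Iso C (Unit C \<boxtimes> A) A"
    and runit_iso: "A \<in> Obj C \<Longrightarrow> RUnit C A \<in> Iso C (A \<boxtimes> Unit C) A"
    and assoc_natural: "\<lbrakk>f \<in> Hom C A A'; g \<in> Hom C B B'; h \<in> Hom C D D'\<rbrakk>
           \<Longrightarrow> Assoc C A' B' D' \<bullet> (f \<star> (g \<star> h)) = ((f \<star> g) \<star> h) \<bullet> Assoc C A B D"
    and lunit_natural: "f \<in> Hom C A A'
           \<Longrightarrow> LUnit C A' \<bullet> (Idn C (Unit C) \<star> f) = f \<bullet> LUnit C A"
    and runit_natural: "f \<in> Hom C A A'
           \<Longrightarrow> RUnit C A' \<bullet> (f \<star> Idn C (Unit C)) = f \<bullet> RUnit C A"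
    and pentagon: "\<lbrakk>A \<in> Obj C; B \<in> Obj C; D \<in> Obj C; E \<in> Obj C\<rbrakk>
           \<Longrightarrow> Assoc C (A \<boxtimes> B) D E \<bullet> Assoc C A B (D \<boxtimes> E) =
               (Assoc C A B D \<star> Idn C E) \<bullet> Assoc C A (B \<boxtimes> D) E \<bullet> (Idn C A \<star> Assoc C B D E)"
    and triangle: "\<lbrakk>A \<in> Obj C; B \<in> Obj C\<rbrakk>
           \<Longrightarrow> (RUnit C A \<star> Idn C B) \<bullet> Assoc C A (Unit C) B = Idn C A \<star> LUnit C B"

record ('o, 'm) braided_category = "('o, 'm) monoidal_category" +
  Braid :: "'o \<Rightarrow> 'o \<Rightarrow> 'm"

locale braided_category = monoidal_category C
  for C :: "('o, 'm, 'x) braided_category_scheme" (structure) +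
  assumes braid_iso: "\<lbrakk>A \<in> Obj C; B \<in> Obj C\<rbrakk>
           \<Longrightarrow> Braid C A B \<in> Iso C (A \<boxtimes> B) (B \<boxtimes> A)"
    and braid_natural: "\<lbrakk>f \<in> Hom C A A'; g \<in> Hom C B B'\<rbrakk>
           \<Longrightarrow> Braid C A' B' \<bullet> (f \<star> g) = (g \<star> f) \<bullet> Braid C A B"
    and hexagon1: "\<lbrakk>A \<in> Obj C; B \<in> Obj C; D \<in> Obj C\<rbrakk>
           \<Longrightarrow> Braid C A (B \<boxtimes> D) =
               Assoc C B D A \<bullet> (Idn C B \<star> Braid C A D) \<bullet> Inv C (Assoc C B A D)
                 \<bullet> (Braid C A B \<star> Idn C D) \<bullet> Assoc C A B D"
    and hexagon2: "\<lbrakk>A \<in> Obj C; B \<in> Obj C; D \<in> Obj C\<rbrakk>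
           \<Longrightarrow> Braid C (A \<boxtimes> B) D \<bullet> Assoc C A B D =
               Inv C (Assoc C D A B) \<bullet> (Braid C A D \<star> Idn C B) \<bullet> Assoc C A D B
                 \<bullet> (Idn C A \<star> Braid C B D)"

locale cat_functor = C: category C + D: category D
  for C :: "('o, 'm, 'x) category_scheme" and D :: "('p, 'n, 'y) category_scheme" +
  fixes Fo :: "'o \<Rightarrow> 'p" and Fa :: "'m \<Rightarrow> 'n"
  assumes functor_obj: "A \<in> Obj C \<Longrightarrow> Fo A \<in> Obj D"
    and functor_arr: "f \<in> Hom C A B \<Longrightarrow> Fa f \<in> Hom D (Fo A) (Fo B)"
    and functor_idn: "A \<in> Obj C \<Longrightarrow> Fa (Idn C A) = Idn D (Fo A)"
    and functor_cmp: "\<lbrakk>f \<in> Hom C A B; g \<in> Hom C B E\<rbrakk>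
           \<Longrightarrow> Fa (g \<bullet>\<^bsub>C\<^esub> f) = Fa g \<bullet>\<^bsub>D\<^esub> Fa f"

text \<open>An isomorphism of braided monoidal categories: an isomorphism of categories (bijective on
  objects and on arrows) carrying the whole braided monoidal structure of \<open>C\<close> to that of \<open>D\<close>.\<close>

locale braided_isomorphism =
  cat_functor C D Fo Fa + C: braided_category C + D: braided_category D
  for C :: "('o, 'm, 'x) braided_category_scheme"
    and D :: "('p, 'n, 'y) braided_category_scheme"
    and Fo :: "'o \<Rightarrow> 'p" and Fa :: "'m \<Rightarrow> 'n" +
  assumes bij_obj: "bij_betw Fo (Obj C) (Obj D)"
    and bij_arr: "bij_betw Fa (Arr C) (Arr D)"
    and preserves_tensor_obj: "\<lbrakk>A \<in> Obj C; B \<in> Obj C\<rbrakk>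
           \<Longrightarrow> Fo (A \<boxtimes>\<^bsub>C\<^esub> B) = Fo A \<boxtimes>\<^bsub>D\<^esub> Fo B"
    and preserves_tensor_arr: "\<lbrakk>f \<in> Arr C; g \<in> Arr C\<rbrakk>
           \<Longrightarrow> Fa (f \<star>\<^bsub>C\<^esub> g) = Fa f \<star>\<^bsub>D\<^esub> Fa g"
    and preserves_unit: "Fo (Unit C) = Unit D"
    and preserves_assoc: "\<lbrakk>A \<in> Obj C; B \<in> Obj C; E \<in> Obj C\<rbrakk>
           \<Longrightarrow> Fa (Assoc C A B E) = Assoc D (Fo A) (Fo B) (Fo E)"
    and preserves_lunit: "A \<in> Obj C \<Longrightarrow> Fa (LUnit C A) = LUnit D (Fo A)"
    and preserves_runit: "A \<in> Obj C \<Longrightarrow> Fa (RUnit C A) = RUnit D (Fo A)"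
    and preserves_braid: "\<lbrakk>A \<in> Obj C; B \<in> Obj C\<rbrakk>
           \<Longrightarrow> Fa (Braid C A B) = Braid D (Fo A) (Fo B)"


section \<open>The monoidal centre\<close>

text \<open>A half-braiding is a family indexed by the objects of \<open>C\<close>; it is required to be
  \<^const>\<open>extensional\<close> so that two half-braidings with the same components are equal.\<close>

definition half_braiding ::
    "('o, 'm, 'x) monoidal_category_scheme \<Rightarrow> 'o \<Rightarrow> ('o \<Rightarrow> 'm) \<Rightarrow> bool" where
  "half_braiding C X x \<longleftrightarrow>
     x \<in> extensional (Obj C) \<and>
     (\<forall>V \<in> Obj C. x V \<in> Iso C (V \<boxtimes>\<^bsub>C\<^esub> X) (X \<boxtimes>\<^bsub>C\<^esub> V)) \<and>
     (\<forall>V \<in> Obj C. \<forall>U \<in> Obj C. \<forall>f \<in> Hom C V U.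
        (Idn C X \<star>\<^bsub>C\<^esub> f) \<bullet>\<^bsub>C\<^esub> x V = x U \<bullet>\<^bsub>C\<^esub> (f \<star>\<^bsub>C\<^esub> Idn C X)) \<and>
     (\<forall>V \<in> Obj C. \<forall>U \<in> Obj C.
        x (V \<boxtimes>\<^bsub>C\<^esub> U) \<bullet>\<^bsub>C\<^esub> Assoc C V U X =
        Inv C (Assoc C X V U) \<bullet>\<^bsub>C\<^esub> (x V \<star>\<^bsub>C\<^esub> Idn C U) \<bullet>\<^bsub>C\<^esub> Assoc C V X U
          \<bullet>\<^bsub>C\<^esub> (Idn C V \<star>\<^bsub>C\<^esub> x U))"

text \<open>The half-braiding of \<open>(X, x) \<otimes> (Y, y)\<close>, with components \<open>V \<boxtimes> (X \<boxtimes> Y) \<rightarrow> (X \<boxtimes> Y) \<boxtimes> V\<close>.\<close>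

definition tensor_half_braiding ::
    "('o, 'm, 'x) monoidal_category_scheme \<Rightarrow> 'o \<times> ('o \<Rightarrow> 'm) \<Rightarrow> 'o \<times> ('o \<Rightarrow> 'm) \<Rightarrow> 'o \<Rightarrow> 'm" where
  "tensor_half_braiding C = (\<lambda>(X, x) (Y, y). \<lambda>V \<in> Obj C.
     Assoc C X Y V \<bullet>\<^bsub>C\<^esub> (Idn C X \<star>\<^bsub>C\<^esub> y V) \<bullet>\<^bsub>C\<^esub> Inv C (Assoc C X V Y)
       \<bullet>\<^bsub>C\<^esub> (x V \<star>\<^bsub>C\<^esub> Idn C Y) \<bullet>\<^bsub>C\<^esub> Assoc C V X Y)"

text \<open>An arrow of the centre is a triple (domain, underlying arrow of \<open>C\<close>, codomain).\<close>

type_synonym ('o, 'm) centre_obj = "'o \<times> ('o \<Rightarrow> 'm)"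
type_synonym ('o, 'm) centre_arr = "('o, 'm) centre_obj \<times> 'm \<times> ('o, 'm) centre_obj"

definition centre_tensor ::
    "('o, 'm, 'x) monoidal_category_scheme \<Rightarrow>
     ('o, 'm) centre_obj \<Rightarrow> ('o, 'm) centre_obj \<Rightarrow> ('o, 'm) centre_obj" where
  "centre_tensor C A B = (fst A \<boxtimes>\<^bsub>C\<^esub> fst B, tensor_half_braiding C A B)"

definition centre_unit :: "('o, 'm, 'x) monoidal_category_scheme \<Rightarrow> ('o, 'm) centre_obj" where
  "centre_unit C = (Unit C, \<lambda>V \<in> Obj C. Inv C (LUnit C V) \<bullet>\<^bsub>C\<^esub> RUnit C V)"

definition centre ::
    "('o, 'm, 'x) monoidal_category_scheme \<Rightarrow>
     (('o, 'm) centre_obj, ('o, 'm) centre_arr) braided_category" where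
  "centre C =
    \<lparr> Obj = {(X, x). X \<in> Obj C \<and> half_braiding C X x},
      Arr = {((X, x), f, (Y, y)) | X x f Y y.
               X \<in> Obj C \<and> half_braiding C X x \<and> Y \<in> Obj C \<and> half_braiding C Y y \<and>
               f \<in> Hom C X Y \<and>
               (\<forall>V \<in> Obj C. (f \<star>\<^bsub>C\<^esub> Idn C V) \<bullet>\<^bsub>C\<^esub> x V = y V \<bullet>\<^bsub>C\<^esub> (Idn C V \<star>\<^bsub>C\<^esub> f))},
      Dom = (\<lambda>(A, f, B). A),
      Cod = (\<lambda>(A, f, B). B),
      Idn = (\<lambda>A. (A, Idn C (fst A), A)),
      Cmp = (\<lambda>(B', g, D) (A, f, B). (A, g \<bullet>\<^bsub>C\<^esub> f, D)),
      TObj = centre_tensor C,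
      TArr = (\<lambda>(A, f, B) (A', f', B'). (centre_tensor C A A', f \<star>\<^bsub>C\<^esub> f', centre_tensor C B B')),
      Unit = centre_unit C,
      Assoc = (\<lambda>A B D. (centre_tensor C A (centre_tensor C B D),
                         Assoc C (fst A) (fst B) (fst D),
                         centre_tensor C (centre_tensor C A B) D)),
      LUnit = (\<lambda>A. (centre_tensor C (centre_unit C) A, LUnit C (fst A), A)),
      RUnit = (\<lambda>A. (centre_tensor C A (centre_unit C), RUnit C (fst A), A)),
      Braid = (\<lambda>(X, x) (Y, y). (centre_tensor C (X, x) (Y, y), y X,
                                 centre_tensor C (Y, y) (X, x))) \<rparr>"

definition centre_forget_obj :: "('o, 'm) centre_obj \<Rightarrow> 'o" where
  "centre_forget_obj = (\<lambda>(X, x). X)"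

definition centre_forget_arr :: "('o, 'm) centre_arr \<Rightarrow> 'm" where
  "centre_forget_arr = (\<lambda>(A, f, B). f)"


section \<open>Finite dimensional vector spaces and tensor products\<close>

text \<open>Vector spaces are HOL-Algebra modules over the field \<open>K\<close> whose carrier is a set of elements
  of the type \<open>'v\<close>, which acts as the universe.  (The fields for multiplication and one of
  a \<open>module\<close> record carry no information; records that differ only there, or outside
  the carrier, are simply distinct isomorphic spaces.)\<close>

definition fd_space :: "('k, 'r) ring_scheme \<Rightarrow> ('k, 'v) module \<Rightarrow> bool" where
  "fd_space K V \<longleftrightarrow> module K V \<and>
     (\<exists>B. finite B \<and> B \<subseteq> carrier V \<and>
        (\<forall>v \<in> carrier V. \<exists>c \<in> B \<rightarrow> carrier K. v = (\<Oplus>\<^bsub>V\<^esub>b\<in>B. c b \<odot>\<^bsub>V\<^esub> b)))"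

definition is_linear ::
    "('k, 'r) ring_scheme \<Rightarrow> ('k, 'v) module \<Rightarrow> ('k, 'v) module \<Rightarrow> ('v \<Rightarrow> 'v) \<Rightarrow> bool" where
  "is_linear K V W \<phi> \<longleftrightarrow>
     \<phi> \<in> carrier V \<rightarrow> carrier W \<and>
     (\<forall>v \<in> carrier V. \<forall>u \<in> carrier V. \<phi> (v \<oplus>\<^bsub>V\<^esub> u) = \<phi> v \<oplus>\<^bsub>W\<^esub> \<phi> u) \<and>
     (\<forall>c \<in> carrier K. \<forall>v \<in> carrier V. \<phi> (c \<odot>\<^bsub>V\<^esub> v) = c \<odot>\<^bsub>W\<^esub> \<phi> v)"

definition is_bilinear ::
    "('k, 'r) ring_scheme \<Rightarrow> ('k, 'v) module \<Rightarrow> ('k, 'v) module \<Rightarrow> ('k, 'v) module \<Rightarrow>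
     ('v \<Rightarrow> 'v \<Rightarrow> 'v) \<Rightarrow> bool" where
  "is_bilinear K V U W b \<longleftrightarrow>
     (\<forall>v \<in> carrier V. is_linear K U W (\<lambda>u. b v u)) \<and>
     (\<forall>u \<in> carrier U. is_linear K V W (\<lambda>v. b v u))"

definition Lin ::
    "('k, 'r) ring_scheme \<Rightarrow> ('k, 'v) module \<Rightarrow> ('k, 'v) module \<Rightarrow> ('v \<Rightarrow> 'v) set" where
  "Lin K V W = {\<phi>. \<phi> \<in> extensional (carrier V) \<and> is_linear K V W \<phi>}"

definition lin_span :: "('k, 'r) ring_scheme \<Rightarrow> ('k, 'v) module \<Rightarrow> 'v set \<Rightarrow> 'v set" where
  "lin_span K V S = (\<lambda>N. submodule N K V) hull S"

text \<open>The monoidal category of vector spaces depends on a choice of a tensor product \<open>V \<otimes> U\<close>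
  (a space together with a universal bilinear map \<open>v, u \<mapsto> v \<otimes> u\<close>) for every pair of spaces and
  of a copy of the field inside the universe, given by a one-dimensional space and its generator
  (the image of \<open>1\<close>).  The lemma at the end of this theory provides such a choice for
  every field.\<close>

record ('k, 'v) tensor_choice =
  tspace :: "('k, 'v) module \<Rightarrow> ('k, 'v) module \<Rightarrow> ('k, 'v) module"
  tvec :: "('k, 'v) module \<Rightarrow> ('k, 'v) module \<Rightarrow> 'v \<Rightarrow> 'v \<Rightarrow> 'v"
  uspace :: "('k, 'v) module"
  uvec :: "'v"

locale tensor_products =
  fixes K :: "'k ring" and T :: "('k, 'v) tensor_choice"
  assumes tspace_fd: "\<lbrakk>fd_space K V; fd_space K U\<rbrakk> \<Longrightarrow> fd_space K (tspace T V U)"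
    and tvec_bilinear: "\<lbrakk>fd_space K V; fd_space K U\<rbrakk>
           \<Longrightarrow> is_bilinear K V U (tspace T V U) (tvec T V U)"
    and tensor_universal: "\<lbrakk>fd_space K V; fd_space K U; fd_space K W; is_bilinear K V U W b\<rbrakk>
           \<Longrightarrow> \<exists>!\<phi>. \<phi> \<in> Lin K (tspace T V U) W \<and>
                 (\<forall>v \<in> carrier V. \<forall>u \<in> carrier U. \<phi> (tvec T V U v u) = b v u)"
    and uspace_fd: "fd_space K (uspace T)"
    and uvec_closed: "uvec T \<in> carrier (uspace T)"
    and uvec_generator: "v \<in> carrier (uspace T)
           \<Longrightarrow> \<exists>!c. c \<in> carrier K \<and> v = c \<odot>\<^bsub>uspace T\<^esub> uvec T"


section \<open>Normalised 3-cocycles\<close>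

definition normalised_3_cocycle ::
    "('g, 'a) monoid_scheme \<Rightarrow> 'k ring \<Rightarrow> ('g \<Rightarrow> 'g \<Rightarrow> 'g \<Rightarrow> 'k) \<Rightarrow> bool" where
  "normalised_3_cocycle G K \<alpha> \<longleftrightarrow>
     (\<forall>f \<in> carrier G. \<forall>g \<in> carrier G. \<forall>h \<in> carrier G. \<alpha> f g h \<in> Units K) \<and>
     (\<forall>f \<in> carrier G. \<forall>g \<in> carrier G. \<forall>h \<in> carrier G. \<forall>l \<in> carrier G.
        \<alpha> g h l \<otimes>\<^bsub>K\<^esub> \<alpha> f (g \<otimes>\<^bsub>G\<^esub> h) l \<otimes>\<^bsub>K\<^esub> \<alpha> f g h =
        \<alpha> (f \<otimes>\<^bsub>G\<^esub> g) h l \<otimes>\<^bsub>K\<^esub> \<alpha> f g (h \<otimes>\<^bsub>G\<^esub> l)) \<and>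
     (\<forall>f \<in> carrier G. \<forall>g \<in> carrier G. \<forall>h \<in> carrier G.
        f = \<one>\<^bsub>G\<^esub> \<or> g = \<one>\<^bsub>G\<^esub> \<or> h = \<one>\<^bsub>G\<^esub> \<longrightarrow> \<alpha> f g h = \<one>\<^bsub>K\<^esub>)"

definition conj_by :: "('g, 'a) monoid_scheme \<Rightarrow> 'g \<Rightarrow> 'g \<Rightarrow> 'g" where
  "conj_by G g h = g \<otimes>\<^bsub>G\<^esub> h \<otimes>\<^bsub>G\<^esub> inv\<^bsub>G\<^esub> g"

text \<open>\<open>\<alpha>(f,g|h)\<close> and \<open>\<alpha>(f|g,h)\<close>\<close>

definition action_cocycle ::
    "('g, 'a) monoid_scheme \<Rightarrow> 'k ring \<Rightarrow> ('g \<Rightarrow> 'g \<Rightarrow> 'g \<Rightarrow> 'k) \<Rightarrow> 'g \<Rightarrow> 'g \<Rightarrow> 'g \<Rightarrow> 'k" where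
  "action_cocycle G K \<alpha> f g h =
     inv\<^bsub>K\<^esub> (\<alpha> f g h) \<otimes>\<^bsub>K\<^esub> \<alpha> f (conj_by G g h) g
       \<otimes>\<^bsub>K\<^esub> inv\<^bsub>K\<^esub> (\<alpha> (conj_by G (f \<otimes>\<^bsub>G\<^esub> g) h) f g)"

definition tensor_cocycle ::
    "('g, 'a) monoid_scheme \<Rightarrow> 'k ring \<Rightarrow> ('g \<Rightarrow> 'g \<Rightarrow> 'g \<Rightarrow> 'k) \<Rightarrow> 'g \<Rightarrow> 'g \<Rightarrow> 'g \<Rightarrow> 'k" where
  "tensor_cocycle G K \<alpha> f g h =
     \<alpha> f g h \<otimes>\<^bsub>K\<^esub> inv\<^bsub>K\<^esub> (\<alpha> (conj_by G f g) f h)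
       \<otimes>\<^bsub>K\<^esub> \<alpha> (conj_by G f g) (conj_by G f h) f"


section \<open>Graded vector spaces\<close>

record ('g, 'k, 'v) graded =
  space :: "('k, 'v) module"
  piece :: "'g \<Rightarrow> 'v set"

text \<open>The space is the internal direct sum of its homogeneous pieces.\<close>

definition graded_space ::
    "('g, 'a) monoid_scheme \<Rightarrow> 'k ring \<Rightarrow> ('g, 'k, 'v) graded \<Rightarrow> bool" where
  "graded_space G K X \<longleftrightarrow>
     fd_space K (space X) \<and>
     piece X \<in> extensional (carrier G) \<and>
     (\<forall>g \<in> carrier G. submodule (piece X g) K (space X)) \<and>
     (\<forall>v \<in> carrier (space X). \<exists>!c. c \<in> (\<Pi>\<^sub>E g \<in> carrier G. piece X g) \<and>
        v = (\<Oplus>\<^bsub>space X\<^esub>g\<in>carrier G. c g))"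

definition graded_tensor ::
    "('g, 'a) monoid_scheme \<Rightarrow> 'k ring \<Rightarrow> ('k, 'v) tensor_choice \<Rightarrow>
     ('g, 'k, 'v) graded \<Rightarrow> ('g, 'k, 'v) graded \<Rightarrow> ('g, 'k, 'v) graded" where
  "graded_tensor G K T X Y =
     \<lparr> space = tspace T (space X) (space Y),
       piece = (\<lambda>g \<in> carrier G. lin_span K (tspace T (space X) (space Y))
         {tvec T (space X) (space Y) x y | x y f h.
            f \<in> carrier G \<and> h \<in> carrier G \<and> f \<otimes>\<^bsub>G\<^esub> h = g \<and> x \<in> piece X f \<and> y \<in> piece Y h}) \<rparr>"

definition graded_unit ::
    "('g, 'a) monoid_scheme \<Rightarrow> ('k, 'v) tensor_choice \<Rightarrow> ('g, 'k, 'v) graded" where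
  "graded_unit G T =
     \<lparr> space = uspace T,
       piece = (\<lambda>g \<in> carrier G. if g = \<one>\<^bsub>G\<^esub> then carrier (uspace T) else {\<zero>\<^bsub>uspace T\<^esub>}) \<rparr>"

text \<open>The linear map \<open>X \<otimes> Y \<rightarrow> Z\<close> with \<open>x \<otimes> y \<mapsto> b g h x y\<close> for \<open>x \<in> X\<^sub>g\<close>, \<open>y \<in> Y\<^sub>h\<close>.\<close>

definition tensor_lift ::
    "('g, 'a) monoid_scheme \<Rightarrow> 'k ring \<Rightarrow> ('k, 'v) tensor_choice \<Rightarrow>
     ('g, 'k, 'v) graded \<Rightarrow> ('g, 'k, 'v) graded \<Rightarrow> ('k, 'v) module \<Rightarrow>
     ('g \<Rightarrow> 'g \<Rightarrow> 'v \<Rightarrow> 'v \<Rightarrow> 'v) \<Rightarrow> 'v \<Rightarrow> 'v" where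
  "tensor_lift G K T X Y Z b =
     (THE \<phi>. \<phi> \<in> Lin K (tspace T (space X) (space Y)) Z \<and>
        (\<forall>g \<in> carrier G. \<forall>h \<in> carrier G. \<forall>x \<in> piece X g. \<forall>y \<in> piece Y h.
           \<phi> (tvec T (space X) (space Y) x y) = b g h x y))"

definition tensor_map ::
    "('g, 'a) monoid_scheme \<Rightarrow> 'k ring \<Rightarrow> ('k, 'v) tensor_choice \<Rightarrow>
     ('g, 'k, 'v) graded \<Rightarrow> ('g, 'k, 'v) graded \<Rightarrow> ('v \<Rightarrow> 'v) \<Rightarrow>
     ('g, 'k, 'v) graded \<Rightarrow> ('g, 'k, 'v) graded \<Rightarrow> ('v \<Rightarrow> 'v) \<Rightarrow> 'v \<Rightarrow> 'v" where
  "tensor_map G K T X Y \<phi> X' Y' \<phi>' =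
     tensor_lift G K T X X' (tspace T (space Y) (space Y'))
       (\<lambda>g h x x'. tvec T (space Y) (space Y') (\<phi> x) (\<phi>' x'))"

definition assoc_map ::
    "('g, 'a) monoid_scheme \<Rightarrow> 'k ring \<Rightarrow> ('k, 'v) tensor_choice \<Rightarrow> ('g \<Rightarrow> 'g \<Rightarrow> 'g \<Rightarrow> 'k) \<Rightarrow>
     ('g, 'k, 'v) graded \<Rightarrow> ('g, 'k, 'v) graded \<Rightarrow> ('g, 'k, 'v) graded \<Rightarrow> 'v \<Rightarrow> 'v" where
  "assoc_map G K T \<alpha> X Y Z =
     (let V = space X; U = space Y; W = space Z;
          S = tspace T V (tspace T U W); R = tspace T (tspace T V U) W
      in THE \<phi>. \<phi> \<in> Lin K S R \<and>
        (\<forall>f \<in> carrier G. \<forall>g \<in> carrier G. \<forall>h \<in> carrier G.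
           \<forall>v \<in> piece X f. \<forall>u \<in> piece Y g. \<forall>w \<in> piece Z h.
             \<phi> (tvec T V (tspace T U W) v (tvec T U W u w)) =
             \<alpha> f g h \<odot>\<^bsub>R\<^esub> tvec T (tspace T V U) W (tvec T V U v u) w))"

definition lunit_map :: "'k ring \<Rightarrow> ('k, 'v) tensor_choice \<Rightarrow> ('g, 'k, 'v) graded \<Rightarrow> 'v \<Rightarrow> 'v" where
  "lunit_map K T X =
     (THE \<phi>. \<phi> \<in> Lin K (tspace T (uspace T) (space X)) (space X) \<and>
        (\<forall>x \<in> carrier (space X). \<phi> (tvec T (uspace T) (space X) (uvec T) x) = x))"

definition runit_map :: "'k ring \<Rightarrow> ('k, 'v) tensor_choice \<Rightarrow> ('g, 'k, 'v) graded \<Rightarrow> 'v \<Rightarrow> 'v" where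
  "runit_map K T X =
     (THE \<phi>. \<phi> \<in> Lin K (tspace T (space X) (uspace T)) (space X) \<and>
        (\<forall>x \<in> carrier (space X). \<phi> (tvec T (space X) (uspace T) x (uvec T)) = x))"


section \<open>The category \<open>\<V>(G,\<alpha>)\<close>\<close>

text \<open>An arrow is a triple (domain, map, codomain).\<close>

type_synonym ('g, 'k, 'v) graded_arr =
  "('g, 'k, 'v) graded \<times> ('v \<Rightarrow> 'v) \<times> ('g, 'k, 'v) graded"

definition VCat ::
    "('g, 'a) monoid_scheme \<Rightarrow> 'k ring \<Rightarrow> ('k, 'v) tensor_choice \<Rightarrow> ('g \<Rightarrow> 'g \<Rightarrow> 'g \<Rightarrow> 'k) \<Rightarrow>
     (('g, 'k, 'v) graded, ('g, 'k, 'v) graded_arr) monoidal_category" where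
  "VCat G K T \<alpha> =
    \<lparr> Obj = {X. graded_space G K X},
      Arr = {(X, \<phi>, Y). graded_space G K X \<and> graded_space G K Y \<and>
               \<phi> \<in> Lin K (space X) (space Y) \<and>
               (\<forall>g \<in> carrier G. \<phi> ` piece X g \<subseteq> piece Y g)},
      Dom = (\<lambda>(X, \<phi>, Y). X),
      Cod = (\<lambda>(X, \<phi>, Y). Y),
      Idn = (\<lambda>X. (X, \<lambda>v \<in> carrier (space X). v, X)),
      Cmp = (\<lambda>(Y', \<psi>, Z) (X, \<phi>, Y). (X, compose (carrier (space X)) \<psi> \<phi>, Z)),
      TObj = graded_tensor G K T,
      TArr = (\<lambda>(X, \<phi>, Y) (X', \<phi>', Y').
        (graded_tensor G K T X X', tensor_map G K T X Y \<phi> X' Y' \<phi>', graded_tensor G K T Y Y')),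
      Unit = graded_unit G T,
      Assoc = (\<lambda>X Y Z. (graded_tensor G K T X (graded_tensor G K T Y Z),
                         assoc_map G K T \<alpha> X Y Z,
                         graded_tensor G K T (graded_tensor G K T X Y) Z)),
      LUnit = (\<lambda>X. (graded_tensor G K T (graded_unit G T) X, lunit_map K T X, X)),
      RUnit = (\<lambda>X. (graded_tensor G K T X (graded_unit G T), runit_map K T X, X)) \<rparr>"


section \<open>The category \<open>\<Z>(G,\<alpha>)\<close>\<close>

type_synonym ('g, 'k, 'v) action_obj = "('g, 'k, 'v) graded \<times> ('g \<Rightarrow> 'v \<Rightarrow> 'v)"
type_synonym ('g, 'k, 'v) action_arr =
  "('g, 'k, 'v) action_obj \<times> ('v \<Rightarrow> 'v) \<times> ('g, 'k, 'v) action_obj"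

definition projective_action ::
    "('g, 'a) monoid_scheme \<Rightarrow> 'k ring \<Rightarrow> ('g \<Rightarrow> 'g \<Rightarrow> 'g \<Rightarrow> 'k) \<Rightarrow>
     ('g, 'k, 'v) graded \<Rightarrow> ('g \<Rightarrow> 'v \<Rightarrow> 'v) \<Rightarrow> bool" where
  "projective_action G K \<alpha> X \<rho> \<longleftrightarrow>
     \<rho> \<in> extensional (carrier G) \<and>
     (\<forall>f \<in> carrier G. \<rho> f \<in> Lin K (space X) (space X) \<and>
        bij_betw (\<rho> f) (carrier (space X)) (carrier (space X))) \<and>
     (\<forall>f \<in> carrier G. \<forall>g \<in> carrier G. \<rho> f ` piece X g = piece X (conj_by G f g)) \<and>
     (\<forall>f \<in> carrier G. \<forall>g \<in> carrier G. \<forall>h \<in> carrier G. \<forall>v \<in> piece X h.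
        \<rho> (f \<otimes>\<^bsub>G\<^esub> g) v = action_cocycle G K \<alpha> f g h \<odot>\<^bsub>space X\<^esub> \<rho> f (\<rho> g v))"

definition action_tensor ::
    "('g, 'a) monoid_scheme \<Rightarrow> 'k ring \<Rightarrow> ('k, 'v) tensor_choice \<Rightarrow> ('g \<Rightarrow> 'g \<Rightarrow> 'g \<Rightarrow> 'k) \<Rightarrow>
     ('g, 'k, 'v) action_obj \<Rightarrow> ('g, 'k, 'v) action_obj \<Rightarrow> ('g, 'k, 'v) action_obj" where
  "action_tensor G K T \<alpha> = (\<lambda>(X, \<rho>) (Y, \<sigma>).
     let V = tspace T (space X) (space Y)
     in (graded_tensor G K T X Y,
         \<lambda>f \<in> carrier G. tensor_lift G K T X Y V
           (\<lambda>g h x y. tensor_cocycle G K \<alpha> f g h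
              \<odot>\<^bsub>V\<^esub> tvec T (space X) (space Y) (\<rho> f x) (\<sigma> f y))))"

definition action_unit ::
    "('g, 'a) monoid_scheme \<Rightarrow> ('k, 'v) tensor_choice \<Rightarrow> ('g, 'k, 'v) action_obj" where
  "action_unit G T = (graded_unit G T, \<lambda>f \<in> carrier G. \<lambda>v \<in> carrier (uspace T). v)"

definition ZCat ::
    "('g, 'a) monoid_scheme \<Rightarrow> 'k ring \<Rightarrow> ('k, 'v) tensor_choice \<Rightarrow> ('g \<Rightarrow> 'g \<Rightarrow> 'g \<Rightarrow> 'k) \<Rightarrow>
     (('g, 'k, 'v) action_obj, ('g, 'k, 'v) action_arr) braided_category" where
  "ZCat G K T \<alpha> =
    \<lparr> Obj = {(X, \<rho>). graded_space G K X \<and> projective_action G K \<alpha> X \<rho>},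
      Arr = {((X, \<rho>), \<phi>, (Y, \<sigma>)) | X \<rho> \<phi> Y \<sigma>.
               graded_space G K X \<and> projective_action G K \<alpha> X \<rho> \<and>
               graded_space G K Y \<and> projective_action G K \<alpha> Y \<sigma> \<and>
               \<phi> \<in> Lin K (space X) (space Y) \<and>
               (\<forall>g \<in> carrier G. \<phi> ` piece X g \<subseteq> piece Y g) \<and>
               (\<forall>f \<in> carrier G. \<forall>v \<in> carrier (space X). \<phi> (\<rho> f v) = \<sigma> f (\<phi> v))},
      Dom = (\<lambda>(A, \<phi>, B). A),
      Cod = (\<lambda>(A, \<phi>, B). B),
      Idn = (\<lambda>A. (A, \<lambda>v \<in> carrier (space (fst A)). v, A)),
      Cmp = (\<lambda>(B', \<psi>, D) (A, \<phi>, B). (A, compose (carrier (space (fst A))) \<psi> \<phi>, D)),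
      TObj = action_tensor G K T \<alpha>,
      TArr = (\<lambda>(A, \<phi>, B) (A', \<phi>', B').
        (action_tensor G K T \<alpha> A A',
         tensor_map G K T (fst A) (fst B) \<phi> (fst A') (fst B') \<phi>',
         action_tensor G K T \<alpha> B B')),
      Unit = action_unit G T,
      Assoc = (\<lambda>A B D. (action_tensor G K T \<alpha> A (action_tensor G K T \<alpha> B D),
                         assoc_map G K T \<alpha> (fst A) (fst B) (fst D),
                         action_tensor G K T \<alpha> (action_tensor G K T \<alpha> A B) D)),
      LUnit = (\<lambda>A. (action_tensor G K T \<alpha> (action_unit G T) A, lunit_map K T (fst A), A)),
      RUnit = (\<lambda>A. (action_tensor G K T \<alpha> A (action_unit G T), runit_map K T (fst A), A)),
      Braid = (\<lambda>(X, \<rho>) (Y, \<sigma>).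
        (action_tensor G K T \<alpha> (X, \<rho>) (Y, \<sigma>),
         tensor_lift G K T X Y (tspace T (space Y) (space X))
           (\<lambda>f g x y. tvec T (space Y) (space X) (\<sigma> f y) x),
         action_tensor G K T \<alpha> (Y, \<sigma>) (X, \<rho>))) \<rparr>"

definition action_forget_obj :: "('g, 'k, 'v) action_obj \<Rightarrow> ('g, 'k, 'v) graded" where
  "action_forget_obj = (\<lambda>(X, \<rho>). X)"

definition action_forget_arr :: "('g, 'k, 'v) action_arr \<Rightarrow> ('g, 'k, 'v) graded_arr" where
  "action_forget_arr = (\<lambda>((X, \<rho>), \<phi>, (Y, \<sigma>)). (X, \<phi>, Y))"


section \<open>Every field has a universe with tensor products\<close>

text \<open>The type below contains the field and all formal sums \<open>v\<^sub>1 \<otimes> u\<^sub>1 + \<dots> + v\<^sub>n \<otimes> u\<^sub>n\<close> of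
  its own elements.  Two formal sums are identified when every bilinear map takes the same value
  on them, and every class is represented by one of its members.\<close>

datatype 'k tens = Scalar 'k | Formal "('k tens \<times> 'k tens) list"

primrec summands :: "'k tens \<Rightarrow> ('k tens \<times> 'k tens) list" where
  "summands (Formal xs) = xs"
| "summands (Scalar c) = []"

definition formal_value ::
    "('k, 'v) module \<Rightarrow> ('v \<Rightarrow> 'v \<Rightarrow> 'v) \<Rightarrow> ('v \<times> 'v) list \<Rightarrow> 'v" where
  "formal_value W b xs = foldr (\<lambda>(v, u) s. b v u \<oplus>\<^bsub>W\<^esub> s) xs \<zero>\<^bsub>W\<^esub>"

definition formal_eq ::
    "'k ring \<Rightarrow> ('k, 'v) module \<Rightarrow> ('k, 'v) module \<Rightarrow> ('v \<times> 'v) list \<Rightarrow> ('v \<times> 'v) list \<Rightarrow> bool" where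
  "formal_eq K V U xs ys \<longleftrightarrow>
     (\<forall>W b. fd_space K W \<and> is_bilinear K V U W b \<longrightarrow> formal_value W b xs = formal_value W b ys)"

definition formal_sums :: "('k, 'v) module \<Rightarrow> ('k, 'v) module \<Rightarrow> ('v \<times> 'v) list set" where
  "formal_sums V U = lists (carrier V \<times> carrier U)"

definition formal_class ::
    "'k ring \<Rightarrow> ('k, 'k tens) module \<Rightarrow> ('k, 'k tens) module \<Rightarrow> ('k tens \<times> 'k tens) list \<Rightarrow> 'k tens"
  where "formal_class K V U xs = Formal (SOME ys. ys \<in> formal_sums V U \<and> formal_eq K V U xs ys)"

definition formal_scale ::
    "('k, 'v) module \<Rightarrow> 'k \<Rightarrow> ('v \<times> 'v) list \<Rightarrow> ('v \<times> 'v) list" where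
  "formal_scale V c xs = map (\<lambda>(v, u). (c \<odot>\<^bsub>V\<^esub> v, u)) xs"

definition formal_tensor ::
    "'k ring \<Rightarrow> ('k, 'k tens) module \<Rightarrow> ('k, 'k tens) module \<Rightarrow> ('k, 'k tens) module" where
  "formal_tensor K V U =
    \<lparr> carrier = formal_class K V U ` formal_sums V U,
      monoid.mult = undefined, one = undefined,
      zero = formal_class K V U [],
      add = (\<lambda>s t. formal_class K V U (summands s @ summands t)),
      smult = (\<lambda>c t. formal_class K V U (formal_scale V c (summands t))) \<rparr>"

definition formal_choice :: "'k ring \<Rightarrow> ('k, 'k tens) tensor_choice" where
  "formal_choice K =
    \<lparr> tspace = formal_tensor K,
      tvec = (\<lambda>V U v u. formal_class K V U [(v, u)]),
      uspace = \<lparr> carrier = Scalar ` carrier K, monoid.mult = undefined, one = undefined,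
                 zero = Scalar \<zero>\<^bsub>K\<^esub>,
                 add = (\<lambda>s t. case (s, t) of (Scalar a, Scalar b) \<Rightarrow> Scalar (a \<oplus>\<^bsub>K\<^esub> b)),
                 smult = (\<lambda>c t. case t of Scalar a \<Rightarrow> Scalar (c \<otimes>\<^bsub>K\<^esub> a)) \<rparr>,
      uvec = Scalar \<one>\<^bsub>K\<^esub> \<rparr>"

lemma linear_finsum:
  assumes V: "module K V" and W: "module K W" and \<phi>: "is_linear K V W \<phi>"
    and "finite B" and "f \<in> B \<rightarrow> carrier V"
  shows "\<phi> (\<Oplus>\<^bsub>V\<^esub>b\<in>B. f b) = (\<Oplus>\<^bsub>W\<^esub>b\<in>B. \<phi> (f b))"
proof -
  interpret V: module K V by fact
  interpret W: module K W by fact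
  have z: "\<phi> \<zero>\<^bsub>V\<^esub> = \<zero>\<^bsub>W\<^esub>"
  proof -
    have "\<phi> (\<zero>\<^bsub>K\<^esub> \<odot>\<^bsub>V\<^esub> \<zero>\<^bsub>V\<^esub>) = \<zero>\<^bsub>K\<^esub> \<odot>\<^bsub>W\<^esub> \<phi> \<zero>\<^bsub>V\<^esub>"
      using \<phi> unfolding is_linear_def by blast
    moreover have "\<phi> \<zero>\<^bsub>V\<^esub> \<in> carrier W"
      using \<phi> unfolding is_linear_def by blast
    ultimately show ?thesis by (simp add: W.smult_l_null)
  qed
  from \<open>finite B\<close> \<open>f \<in> B \<rightarrow> carrier V\<close> show ?thesis
  proof (induction B)
    case empty
    then show ?case by (simp add: z)
  next
    case (insert x F)
    have f: "f x \<in> carrier V" "f \<in> F \<rightarrow> carrier V" using insert.prems by auto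
    have g: "(\<lambda>b. \<phi> (f b)) \<in> insert x F \<rightarrow> carrier W"
      using insert.prems \<phi> unfolding is_linear_def by blast
    then have g': "(\<lambda>b. \<phi> (f b)) \<in> F \<rightarrow> carrier W" "\<phi> (f x) \<in> carrier W" by auto
    have "(\<Oplus>\<^bsub>V\<^esub>b\<in>F. f b) \<in> carrier V" using f by simp
    then have "\<phi> (f x \<oplus>\<^bsub>V\<^esub> (\<Oplus>\<^bsub>V\<^esub>b\<in>F. f b)) = \<phi> (f x) \<oplus>\<^bsub>W\<^esub> \<phi> (\<Oplus>\<^bsub>V\<^esub>b\<in>F. f b)"
      using \<phi> f unfolding is_linear_def by blast
    then show ?case
      using insert f g' by (simp add: V.M.finsum_insert W.M.finsum_insert)
  qed
qed

lemma finsum_combinations_submodule: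
  assumes "module K V" and "finite B" and "B \<subseteq> carrier V"
  shows "submodule {\<Oplus>\<^bsub>V\<^esub>b\<in>B. c b \<odot>\<^bsub>V\<^esub> b | c. c \<in> B \<rightarrow> carrier K} K V" (is "submodule ?S K V")
proof -
  interpret V: module K V by fact
  have memI: "(\<Oplus>\<^bsub>V\<^esub>b\<in>B. c b \<odot>\<^bsub>V\<^esub> b) \<in> ?S" if "c \<in> B \<rightarrow> carrier K" for c
    using that by (intro CollectI exI[of _ c] conjI refl)
  have memE: "\<exists>c \<in> B \<rightarrow> carrier K. x = (\<Oplus>\<^bsub>V\<^esub>b\<in>B. c b \<odot>\<^bsub>V\<^esub> b)" if "x \<in> ?S" for x
    using that by (simp add: Bex_def conj_commute)
  have cl: "(\<lambda>b. c b \<odot>\<^bsub>V\<^esub> b) \<in> B \<rightarrow> carrier V" if "c \<in> B \<rightarrow> carrier K" for c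
    using that assms by auto
  have add: "x \<oplus>\<^bsub>V\<^esub> y \<in> ?S" if xS: "x \<in> ?S" and yS: "y \<in> ?S" for x y
  proof -
    obtain c where c: "c \<in> B \<rightarrow> carrier K" "x = (\<Oplus>\<^bsub>V\<^esub>b\<in>B. c b \<odot>\<^bsub>V\<^esub> b)"
      using memE[OF xS] ..
    obtain d where d: "d \<in> B \<rightarrow> carrier K" "y = (\<Oplus>\<^bsub>V\<^esub>b\<in>B. d b \<odot>\<^bsub>V\<^esub> b)"
      using memE[OF yS] ..
    have "x \<oplus>\<^bsub>V\<^esub> y = (\<Oplus>\<^bsub>V\<^esub>b\<in>B. c b \<odot>\<^bsub>V\<^esub> b \<oplus>\<^bsub>V\<^esub> d b \<odot>\<^bsub>V\<^esub> b)"
      using V.M.finsum_addf[OF cl[OF c(1)] cl[OF d(1)]] c d by simp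
    also have "\<dots> = (\<Oplus>\<^bsub>V\<^esub>b\<in>B. (c b \<oplus>\<^bsub>K\<^esub> d b) \<odot>\<^bsub>V\<^esub> b)"
      using c d assms by (intro V.M.finsum_cong') (auto simp: V.smult_l_distr Pi_iff subset_iff)
    finally have "x \<oplus>\<^bsub>V\<^esub> y = \<dots>" .
    moreover have "(\<lambda>b. c b \<oplus>\<^bsub>K\<^esub> d b) \<in> B \<rightarrow> carrier K" using c d by auto
    ultimately show ?thesis using memI by (simp only:)
  qed
  have smul: "a \<odot>\<^bsub>V\<^esub> x \<in> ?S" if aK: "a \<in> carrier K" and xS: "x \<in> ?S" for a x
  proof -
    obtain c where c: "c \<in> B \<rightarrow> carrier K" "x = (\<Oplus>\<^bsub>V\<^esub>b\<in>B. c b \<odot>\<^bsub>V\<^esub> b)"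
      using memE[OF xS] ..
    have "a \<odot>\<^bsub>V\<^esub> x = (\<Oplus>\<^bsub>V\<^esub>b\<in>B. a \<odot>\<^bsub>V\<^esub> (c b \<odot>\<^bsub>V\<^esub> b))"
      using V.finsum_smult_ldistr[OF assms(2) aK cl[OF c(1)]] c by simp
    also have "\<dots> = (\<Oplus>\<^bsub>V\<^esub>b\<in>B. (a \<otimes>\<^bsub>K\<^esub> c b) \<odot>\<^bsub>V\<^esub> b)"
      using c aK assms
      by (intro V.M.finsum_cong') (auto simp: V.smult_assoc1 Pi_iff subset_iff)
    finally have "a \<odot>\<^bsub>V\<^esub> x = \<dots>" .
    moreover have "(\<lambda>b. a \<otimes>\<^bsub>K\<^esub> c b) \<in> B \<rightarrow> carrier K" using c aK by auto
    ultimately show ?thesis using memI by (simp only:)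
  qed
  have sub: "?S \<subseteq> carrier V"
  proof
    fix x assume "x \<in> ?S"
    from memE[OF this] obtain c where "c \<in> B \<rightarrow> carrier K" "x = (\<Oplus>\<^bsub>V\<^esub>b\<in>B. c b \<odot>\<^bsub>V\<^esub> b)"
      ..
    then show "x \<in> carrier V" using cl by (simp add: V.M.finsum_closed)
  qed
  have zero: "\<zero>\<^bsub>V\<^esub> \<in> ?S"
  proof -
    have "(\<Oplus>\<^bsub>V\<^esub>b\<in>B. \<zero>\<^bsub>K\<^esub> \<odot>\<^bsub>V\<^esub> b) = (\<Oplus>\<^bsub>V\<^esub>b\<in>B. \<zero>\<^bsub>V\<^esub>)"
      using assms by (intro V.M.finsum_cong') (auto simp: subset_iff)
    then have "\<zero>\<^bsub>V\<^esub> = (\<Oplus>\<^bsub>V\<^esub>b\<in>B. \<zero>\<^bsub>K\<^esub> \<odot>\<^bsub>V\<^esub> b)" by simp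
    then show ?thesis using memI[of "\<lambda>_. \<zero>\<^bsub>K\<^esub>"] by simp
  qed
  show ?thesis
  proof (rule V.submoduleI[OF sub zero])
    fix a assume a: "a \<in> ?S"
    then have "(\<ominus>\<^bsub>K\<^esub> \<one>\<^bsub>K\<^esub>) \<odot>\<^bsub>V\<^esub> a \<in> ?S" by (intro smul) auto
    moreover have "(\<ominus>\<^bsub>K\<^esub> \<one>\<^bsub>K\<^esub>) \<odot>\<^bsub>V\<^esub> a = \<ominus>\<^bsub>V\<^esub> a"
      using a sub by (simp add: V.smult_l_minus subset_iff)
    ultimately show "\<ominus>\<^bsub>V\<^esub> a \<in> ?S" by simp
  next
    show "x \<oplus>\<^bsub>V\<^esub> y \<in> ?S" if "x \<in> ?S" "y \<in> ?S" for x y by (rule add[OF that])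
    show "a \<odot>\<^bsub>V\<^esub> x \<in> ?S" if "a \<in> carrier K" "x \<in> ?S" for a x by (rule smul[OF that])
  qed
qed

lemma combination_single:
  assumes "module K V" and "finite B" and "B \<subseteq> carrier V" and "x \<in> B"
  shows "x \<in> {\<Oplus>\<^bsub>V\<^esub>b\<in>B. c b \<odot>\<^bsub>V\<^esub> b | c. c \<in> B \<rightarrow> carrier K}"
proof -
  interpret V: module K V by fact
  have "(\<Oplus>\<^bsub>V\<^esub>b\<in>B. (if b = x then \<one>\<^bsub>K\<^esub> else \<zero>\<^bsub>K\<^esub>) \<odot>\<^bsub>V\<^esub> b)
      = (\<Oplus>\<^bsub>V\<^esub>b\<in>B. if x = b then (\<lambda>b. b) b else \<zero>\<^bsub>V\<^esub>)"
    using assms by (intro V.M.finsum_cong') (auto simp: subset_iff)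
  also have "\<dots> = x"
    using assms by (intro V.M.finsum_singleton) auto
  finally have "x = (\<Oplus>\<^bsub>V\<^esub>b\<in>B. (if b = x then \<one>\<^bsub>K\<^esub> else \<zero>\<^bsub>K\<^esub>) \<odot>\<^bsub>V\<^esub> b)" by simp
  then show ?thesis
    by (intro CollectI exI[of _ "\<lambda>b. if b = x then \<one>\<^bsub>K\<^esub> else \<zero>\<^bsub>K\<^esub>"]) auto
qed

lemma submodule_finsum:
  assumes "module K V" and N: "submodule N K V" and "finite B" and "f \<in> B \<rightarrow> N"
  shows "(\<Oplus>\<^bsub>V\<^esub>b\<in>B. f b) \<in> N"
  using assms(3,4)
proof (induction B)
  interpret V: module K V by fact
  note * = V.submoduleE[OF N]
  {
    case empty
    then show ?case using subgroup.one_closed[OF submodule.axioms(1)[OF N]] by simp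
  next
    case (insert x F)
    then have "f \<in> insert x F \<rightarrow> carrier V" using *(1) by blast
    then show ?case using insert *(5) by (simp add: V.M.finsum_insert Pi_iff)
  }
qed

context
  fixes K :: "'k ring" and V U :: "('k, 'k tens) module"
  assumes V: "fd_space K V" and U: "fd_space K U"
begin

interpretation V: module K V using V by (simp add: fd_space_def)
interpretation U: module K U using U by (simp add: fd_space_def)

private abbreviation "cls \<equiv> formal_class K V U"
private abbreviation "FS \<equiv> formal_sums V U"
private abbreviation "VU \<equiv> formal_tensor K V U"

lemma formal_value_closed:
  assumes "fd_space K W" "is_bilinear K V U W b" "xs \<in> FS"
  shows "formal_value W b xs \<in> carrier W"
proof -
  interpret W: module K W using assms by (simp add: fd_space_def)
  show ?thesis using assms(3)
    by (induction xs)
       (use assms(2) in \<open>auto simp: formal_value_def formal_sums_def is_bilinear_def is_linear_def Pi_iff\<close>)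
qed

lemma formal_value_append:
  assumes "fd_space K W" "is_bilinear K V U W b" "xs \<in> FS" "ys \<in> FS"
  shows "formal_value W b (xs @ ys) = formal_value W b xs \<oplus>\<^bsub>W\<^esub> formal_value W b ys"
proof -
  interpret W: module K W using assms by (simp add: fd_space_def)
  note ys = formal_value_closed[OF assms(1,2,4)]
  show ?thesis using assms(3)
  proof (induction xs)
    case Nil
    then show ?case using ys by (simp add: formal_value_def)
  next
    case (Cons p xs)
    obtain v u where p: "p = (v, u)" by force
    have xs: "xs \<in> FS" and vu: "v \<in> carrier V" "u \<in> carrier U"
      using Cons.prems p by (auto simp: formal_sums_def)
    have "b v u \<in> carrier W" using assms(2) vu by (auto simp: is_bilinear_def is_linear_def)
    then show ?case
      using Cons.IH[OF xs] formal_value_closed[OF assms(1,2) xs] ys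
      by (simp add: formal_value_def p W.M.a_assoc)
  qed
qed

lemma formal_value_scale:
  assumes "fd_space K W" "is_bilinear K V U W b" "xs \<in> FS" "c \<in> carrier K"
  shows "formal_value W b (formal_scale V c xs) = c \<odot>\<^bsub>W\<^esub> formal_value W b xs"
proof -
  interpret W: module K W using assms by (simp add: fd_space_def)
  show ?thesis using assms(3)
  proof (induction xs)
    case Nil
    then show ?case using assms(4) by (simp add: formal_value_def formal_scale_def)
  next
    case (Cons p xs)
    obtain v u where p: "p = (v, u)" by force
    have xs: "xs \<in> FS" and vu: "v \<in> carrier V" "u \<in> carrier U"
      using Cons.prems p by (auto simp: formal_sums_def)
    have "b v u \<in> carrier W" "b (c \<odot>\<^bsub>V\<^esub> v) u = c \<odot>\<^bsub>W\<^esub> b v u"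
      using assms(2,4) vu by (auto simp: is_bilinear_def is_linear_def)
    then show ?case
      using Cons.IH[OF xs] formal_value_closed[OF assms(1,2) xs] assms(4)
      by (simp add: formal_value_def formal_scale_def p W.smult_r_distr)
  qed
qed

lemma formal_sums_closed:
  "[] \<in> FS" "xs \<in> FS \<Longrightarrow> ys \<in> FS \<Longrightarrow> xs @ ys \<in> FS"
  "xs \<in> FS \<Longrightarrow> c \<in> carrier K \<Longrightarrow> formal_scale V c xs \<in> FS"
proof -
  show "formal_scale V c xs \<in> FS" if "xs \<in> FS" "c \<in> carrier K"
    using that(1) by (induction xs) (auto simp: formal_sums_def formal_scale_def that(2))
qed (simp_all add: formal_sums_def)

lemma summands_formal_class:
  assumes "xs \<in> FS"
  shows "summands (cls xs) \<in> FS" and "formal_eq K V U xs (summands (cls xs))"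
proof -
  have "xs \<in> FS \<and> formal_eq K V U xs xs" using assms by (simp add: formal_eq_def)
  from someI[of "\<lambda>ys. ys \<in> FS \<and> formal_eq K V U xs ys", OF this]
  show "summands (cls xs) \<in> FS" and "formal_eq K V U xs (summands (cls xs))"
    by (simp_all add: formal_class_def)
qed

lemma formal_class_eqI:
  assumes "\<And>W b. fd_space K W \<Longrightarrow> is_bilinear K V U W b \<Longrightarrow> formal_value W b xs = formal_value W b ys"
  shows "cls xs = cls ys"
proof -
  have "formal_eq K V U xs = formal_eq K V U ys"
    using assms by (auto simp: formal_eq_def fun_eq_iff)
  then show ?thesis by (simp add: formal_class_def)
qed

lemma formal_value_summands:
  assumes "fd_space K W" "is_bilinear K V U W b" "xs \<in> FS"
  shows "formal_value W b (summands (cls xs)) = formal_value W b xs"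
  using summands_formal_class(2)[OF assms(3)] assms(1,2) by (simp add: formal_eq_def)

lemma formal_tensor_carrier: "t \<in> carrier VU \<longleftrightarrow> (\<exists>xs \<in> FS. t = cls xs)"
  by (auto simp: formal_tensor_def)

lemma formal_tensor_closed: "xs \<in> FS \<Longrightarrow> cls xs \<in> carrier VU"
  by (auto simp: formal_tensor_def)

lemma formal_tensor_zero: "\<zero>\<^bsub>VU\<^esub> = cls []"
  by (simp add: formal_tensor_def)

lemma formal_tensor_add:
  assumes "xs \<in> FS" "ys \<in> FS"
  shows "cls xs \<oplus>\<^bsub>VU\<^esub> cls ys = cls (xs @ ys)"
  using assms summands_formal_class(1)
  by (auto simp: formal_tensor_def formal_value_append formal_value_summands intro!: formal_class_eqI)

lemma formal_tensor_smult:
  assumes "xs \<in> FS" "c \<in> carrier K"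
  shows "c \<odot>\<^bsub>VU\<^esub> cls xs = cls (formal_scale V c xs)"
  using assms summands_formal_class(1)
  by (auto simp: formal_tensor_def formal_value_scale formal_value_summands intro!: formal_class_eqI)

lemma formal_tensor_module: "module K VU"
proof (rule moduleI)
  note simps = formal_tensor_carrier formal_tensor_add formal_tensor_smult formal_tensor_zero
    formal_sums_closed formal_value_append formal_value_scale formal_value_closed
  show "cring K" ..
  have W: "module K W" if "fd_space K W" for W :: "('k, 'k tens) module" using that by (simp add: fd_space_def)
  show "abelian_group VU"
  proof (rule abelian_groupI)
    fix x y assume "x \<in> carrier VU" "y \<in> carrier VU"
    then show "x \<oplus>\<^bsub>VU\<^esub> y \<in> carrier VU" by (auto simp: simps)
  next
    show "\<zero>\<^bsub>VU\<^esub> \<in> carrier VU" using formal_sums_closed(1) by (auto simp: simps)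
  next
    fix x y z assume "x \<in> carrier VU" "y \<in> carrier VU" "z \<in> carrier VU"
    then show "x \<oplus>\<^bsub>VU\<^esub> y \<oplus>\<^bsub>VU\<^esub> z = x \<oplus>\<^bsub>VU\<^esub> (y \<oplus>\<^bsub>VU\<^esub> z)" by (auto simp: simps)
  next
    fix x y assume "x \<in> carrier VU" "y \<in> carrier VU"
    then obtain xs ys where xy: "xs \<in> FS" "ys \<in> FS" "x = cls xs" "y = cls ys"
      by (auto simp: formal_tensor_carrier)
    have "cls (xs @ ys) = cls (ys @ xs)"
    proof (rule formal_class_eqI)
      fix W :: "('k, 'k tens) module" and b assume *: "fd_space K W" "is_bilinear K V U W b"
      interpret W: module K W by (rule W[OF *(1)])
      show "formal_value W b (xs @ ys) = formal_value W b (ys @ xs)"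
        using xy * by (simp add: simps W.M.a_comm)
    qed
    then show "x \<oplus>\<^bsub>VU\<^esub> y = y \<oplus>\<^bsub>VU\<^esub> x"
      using xy by (simp add: formal_tensor_add)
  next
    fix x assume "x \<in> carrier VU"
    then show "\<zero>\<^bsub>VU\<^esub> \<oplus>\<^bsub>VU\<^esub> x = x" by (auto simp: simps)
  next
    fix x assume "x \<in> carrier VU"
    then obtain xs where xs: "xs \<in> FS" "x = cls xs" by (auto simp: simps)
    have "cls (formal_scale V (\<ominus>\<^bsub>K\<^esub> \<one>\<^bsub>K\<^esub>) xs) \<oplus>\<^bsub>VU\<^esub> x = \<zero>\<^bsub>VU\<^esub>"
      unfolding xs(2)
    proof (subst formal_tensor_add, goal_cases)
      case 3
      show ?case unfolding formal_tensor_zero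
      proof (rule formal_class_eqI)
        fix W :: "('k, 'k tens) module" and b assume *: "fd_space K W" "is_bilinear K V U W b"
        interpret W: module K W by (rule W[OF *(1)])
        show "formal_value W b (formal_scale V (\<ominus>\<^bsub>K\<^esub> \<one>\<^bsub>K\<^esub>) xs @ xs) = formal_value W b []"
          using xs * formal_value_closed[OF * xs(1)]
          by (simp add: simps W.smult_l_minus W.M.l_neg) (simp add: formal_value_def)
      qed
    qed (use xs in \<open>auto simp: simps\<close>)
    then show "\<exists>y\<in>carrier VU. y \<oplus>\<^bsub>VU\<^esub> x = \<zero>\<^bsub>VU\<^esub>"
      using xs by (intro bexI) (auto intro!: formal_tensor_closed simp: formal_sums_closed)
  qed
  show "c \<odot>\<^bsub>VU\<^esub> x \<in> carrier VU" if "c \<in> carrier K" "x \<in> carrier VU" for c x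
    using that by (auto simp: simps)
  show "(c \<oplus>\<^bsub>K\<^esub> d) \<odot>\<^bsub>VU\<^esub> x = c \<odot>\<^bsub>VU\<^esub> x \<oplus>\<^bsub>VU\<^esub> d \<odot>\<^bsub>VU\<^esub> x"
    if "c \<in> carrier K" "d \<in> carrier K" "x \<in> carrier VU" for c d x
    using that by (auto simp: simps module.smult_l_distr[OF W] intro!: formal_class_eqI)
  show "c \<odot>\<^bsub>VU\<^esub> (x \<oplus>\<^bsub>VU\<^esub> y) = c \<odot>\<^bsub>VU\<^esub> x \<oplus>\<^bsub>VU\<^esub> c \<odot>\<^bsub>VU\<^esub> y"
    if "c \<in> carrier K" "x \<in> carrier VU" "y \<in> carrier VU" for c x y
    using that by (auto simp: simps module.smult_r_distr[OF W] intro!: formal_class_eqI)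
  show "(c \<otimes>\<^bsub>K\<^esub> d) \<odot>\<^bsub>VU\<^esub> x = c \<odot>\<^bsub>VU\<^esub> (d \<odot>\<^bsub>VU\<^esub> x)"
    if "c \<in> carrier K" "d \<in> carrier K" "x \<in> carrier VU" for c d x
    using that by (auto simp: simps module.smult_assoc1[OF W] intro!: formal_class_eqI)
  show "\<one>\<^bsub>K\<^esub> \<odot>\<^bsub>VU\<^esub> x = x" if "x \<in> carrier VU" for x
    using that by (auto simp: simps module.smult_one[OF W] intro!: formal_class_eqI)
qed

lemma formal_tensor_bilinear: "is_bilinear K V U VU (\<lambda>v u. cls [(v, u)])"
proof -
  have FS: "[(v, u)] \<in> FS \<longleftrightarrow> v \<in> carrier V \<and> u \<in> carrier U" for v u
    by (auto simp: formal_sums_def)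
  have sc: "formal_scale V c [(v, u)] = [(c \<odot>\<^bsub>V\<^esub> v, u)]" for c v u
    by (simp add: formal_scale_def)
  have val: "formal_value W b [(v, u)] = b v u"
    if "fd_space K W" "is_bilinear K V U W b" "v \<in> carrier V" "u \<in> carrier U" for W b v u
  proof -
    interpret W: module K W using that by (simp add: fd_space_def)
    show ?thesis using that
      by (auto simp: formal_value_def is_bilinear_def is_linear_def Pi_iff)
  qed
  have app: "formal_value W b [(v, u), (v', u')] = b v u \<oplus>\<^bsub>W\<^esub> b v' u'"
    if "fd_space K W" "is_bilinear K V U W b" "v \<in> carrier V" "u \<in> carrier U"
      "v' \<in> carrier V" "u' \<in> carrier U" for W b v u v' u'
    using formal_value_append[OF that(1,2), of "[(v, u)]" "[(v', u')]"] that val by (simp add: FS)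
  show ?thesis
    unfolding is_bilinear_def is_linear_def
    apply (intro conjI ballI funcsetI formal_tensor_closed)
         apply (simp_all add: FS formal_tensor_add formal_tensor_smult sc)
    by (rule formal_class_eqI; simp add: val app; simp add: is_bilinear_def is_linear_def)+
qed

lemma formal_class_Cons:
  assumes "v \<in> carrier V" "u \<in> carrier U" "xs \<in> FS"
  shows "cls ((v, u) # xs) = cls [(v, u)] \<oplus>\<^bsub>VU\<^esub> cls xs"
  using assms formal_tensor_add[of "[(v, u)]" xs] by (simp add: formal_sums_def)

lemma formal_tensor_fd: "fd_space K VU"
proof -
  interpret VU: module K VU by (rule formal_tensor_module)
  obtain A where A: "finite A" "A \<subseteq> carrier V"
      "\<And>v. v \<in> carrier V \<Longrightarrow> \<exists>c \<in> A \<rightarrow> carrier K. v = (\<Oplus>\<^bsub>V\<^esub>a\<in>A. c a \<odot>\<^bsub>V\<^esub> a)"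
    using V unfolding fd_space_def by blast
  obtain B where B: "finite B" "B \<subseteq> carrier U"
      "\<And>u. u \<in> carrier U \<Longrightarrow> \<exists>c \<in> B \<rightarrow> carrier K. u = (\<Oplus>\<^bsub>U\<^esub>a\<in>B. c a \<odot>\<^bsub>U\<^esub> a)"
    using U unfolding fd_space_def by blast
  define S where "S = (\<lambda>(v, u). cls [(v, u)]) ` (A \<times> B)"
  have S: "finite S" "S \<subseteq> carrier VU"
    using A B by (auto simp: S_def formal_sums_def intro!: formal_tensor_closed)
  define N where "N = {\<Oplus>\<^bsub>VU\<^esub>b\<in>S. c b \<odot>\<^bsub>VU\<^esub> b | c. c \<in> S \<rightarrow> carrier K}"
  have N: "submodule N K VU"
    unfolding N_def by (rule finsum_combinations_submodule[OF formal_tensor_module S])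
  have SN: "S \<subseteq> N"
    unfolding N_def using combination_single[OF formal_tensor_module S] by blast
  note NE = VU.submoduleE[OF N]
  have lin1: "is_linear K V VU (\<lambda>v. cls [(v, u)])" if "u \<in> carrier U" for u
    using formal_tensor_bilinear that by (simp add: is_bilinear_def)
  have lin2: "is_linear K U VU (\<lambda>u. cls [(v, u)])" if "v \<in> carrier V" for v
    using formal_tensor_bilinear that by (simp add: is_bilinear_def)
  have 1: "cls [(a, u)] \<in> N" if a: "a \<in> A" and u: "u \<in> carrier U" for a u
  proof -
    have aV: "a \<in> carrier V" using a A by auto
    obtain c where c: "c \<in> B \<rightarrow> carrier K" "u = (\<Oplus>\<^bsub>U\<^esub>b\<in>B. c b \<odot>\<^bsub>U\<^esub> b)" using B(3) u by blast
    have cl: "(\<lambda>b. c b \<odot>\<^bsub>U\<^esub> b) \<in> B \<rightarrow> carrier U" using c B by auto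
    have "cls [(a, u)] = (\<Oplus>\<^bsub>VU\<^esub>b\<in>B. cls [(a, c b \<odot>\<^bsub>U\<^esub> b)])"
      using linear_finsum[OF U.module_axioms VU.module_axioms lin2[OF aV] B(1) cl] c by simp
    also have "\<dots> \<in> N"
    proof (rule submodule_finsum[OF VU.module_axioms N B(1)], intro funcsetI)
      fix b assume b: "b \<in> B"
      then have "cls [(a, c b \<odot>\<^bsub>U\<^esub> b)] = c b \<odot>\<^bsub>VU\<^esub> cls [(a, b)]"
        using lin2[OF aV] c(1) B(2) unfolding is_linear_def by blast
      moreover have "cls [(a, b)] \<in> N" using SN a b by (auto simp: S_def)
      ultimately show "cls [(a, c b \<odot>\<^bsub>U\<^esub> b)] \<in> N"
        using submodule.smult_closed[OF N] c b by auto
    qed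
    finally show ?thesis .
  qed
  have 2: "cls [(v, u)] \<in> N" if v: "v \<in> carrier V" and u: "u \<in> carrier U" for v u
  proof -
    obtain c where c: "c \<in> A \<rightarrow> carrier K" "v = (\<Oplus>\<^bsub>V\<^esub>b\<in>A. c b \<odot>\<^bsub>V\<^esub> b)" using A(3) v by blast
    have cl: "(\<lambda>b. c b \<odot>\<^bsub>V\<^esub> b) \<in> A \<rightarrow> carrier V" using c A by auto
    have "cls [(v, u)] = (\<Oplus>\<^bsub>VU\<^esub>b\<in>A. cls [(c b \<odot>\<^bsub>V\<^esub> b, u)])"
      using linear_finsum[OF V.module_axioms VU.module_axioms lin1[OF u] A(1) cl] c by simp
    also have "\<dots> \<in> N"
    proof (rule submodule_finsum[OF VU.module_axioms N A(1)], intro funcsetI)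
      fix b assume b: "b \<in> A"
      then have "cls [(c b \<odot>\<^bsub>V\<^esub> b, u)] = c b \<odot>\<^bsub>VU\<^esub> cls [(b, u)]"
        using lin1[OF u] c(1) A(2) unfolding is_linear_def by blast
      then show "cls [(c b \<odot>\<^bsub>V\<^esub> b, u)] \<in> N"
        using submodule.smult_closed[OF N] c b 1[OF b u] by auto
    qed
    finally show ?thesis .
  qed
  have 3: "cls xs \<in> N" if "xs \<in> FS" for xs
    using that
  proof (induction xs)
    case Nil
    then show ?case
      using subgroup.one_closed[OF submodule.axioms(1)[OF N]] by (simp add: formal_tensor_zero)
  next
    case (Cons p xs)
    then obtain v u where p: "p = (v, u)" "v \<in> carrier V" "u \<in> carrier U" "xs \<in> FS"
      by (auto simp: formal_sums_def)
    then show ?case using Cons.IH 2 NE(5) by (simp add: formal_class_Cons)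
  qed
  then show ?thesis
    unfolding fd_space_def N_def using S formal_tensor_module
    by (auto simp: formal_tensor_carrier N_def intro!: exI[of _ S]; blast)
qed

lemma formal_tensor_universal:
  assumes "fd_space K W" "is_bilinear K V U W b"
  shows "\<exists>!\<phi>. \<phi> \<in> Lin K VU W \<and>
    (\<forall>v \<in> carrier V. \<forall>u \<in> carrier U. \<phi> (cls [(v, u)]) = b v u)"
proof -
  interpret W: module K W using assms by (simp add: fd_space_def)
  interpret VU: module K VU by (rule formal_tensor_module)
  define \<phi> where "\<phi> = (\<lambda>t \<in> carrier VU. formal_value W b (summands t))"
  have \<phi>: "\<phi> (cls xs) = formal_value W b xs" if "xs \<in> FS" for xs
    using that assms by (simp add: \<phi>_def formal_tensor_closed formal_value_summands)
  show ?thesis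
  proof (intro ex1I[of _ \<phi>] conjI ballI)
    show "\<phi> \<in> Lin K VU W"
      unfolding Lin_def is_linear_def
    proof (intro CollectI conjI ballI funcsetI)
      show "\<phi> \<in> extensional (carrier VU)" by (simp add: \<phi>_def)
    qed (auto simp: formal_tensor_carrier \<phi> formal_value_closed[OF assms]
          formal_tensor_add formal_tensor_smult formal_sums_closed
          formal_value_append[OF assms] formal_value_scale[OF assms])
    fix v u assume "v \<in> carrier V" "u \<in> carrier U"
    then have "[(v, u)] \<in> FS" "b v u \<in> carrier W"
      using assms(2) by (auto simp: formal_sums_def is_bilinear_def is_linear_def)
    then show "\<phi> (cls [(v, u)]) = b v u" by (simp add: \<phi>) (simp add: formal_value_def)
  next
    fix \<psi> assume \<psi>: "\<psi> \<in> Lin K VU W \<and>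
      (\<forall>v \<in> carrier V. \<forall>u \<in> carrier U. \<psi> (cls [(v, u)]) = b v u)"
    have lin: "is_linear K VU W \<psi>" and ext: "\<psi> \<in> extensional (carrier VU)"
      using \<psi> by (auto simp: Lin_def)
    have "\<psi> (cls xs) = formal_value W b xs" if "xs \<in> FS" for xs
      using that
    proof (induction xs)
      case Nil
      have "\<psi> \<zero>\<^bsub>VU\<^esub> = \<zero>\<^bsub>W\<^esub>"
        using linear_finsum[OF VU.module_axioms W.module_axioms lin, of "{}"] by simp
      then show ?case by (simp add: formal_tensor_zero formal_value_def)
    next
      case (Cons p xs)
      then obtain v u where p: "p = (v, u)" "v \<in> carrier V" "u \<in> carrier U" "xs \<in> FS"
        by (auto simp: formal_sums_def)
      have "[(v, u)] \<in> FS" using p by (auto simp: formal_sums_def)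
      then show ?case
        using Cons.IH p lin \<psi> formal_tensor_closed
        by (simp add: formal_class_Cons is_linear_def) (simp add: formal_value_def)
    qed
    then have "\<psi> t = \<phi> t" if "t \<in> carrier VU" for t
      using that \<phi> by (auto simp: formal_tensor_carrier)
    then show "\<psi> = \<phi>"
      using ext by (intro extensionalityI[of _ "carrier VU"]) (auto simp: \<phi>_def)
  qed
qed

end

lemma formal_choice_tensor_products:
  fixes K :: "'k ring"
  assumes "field K"
  shows "tensor_products K (formal_choice K)"
proof -
  interpret K: field K by fact
  let ?I = "uspace (formal_choice K)"
  have I: "module K ?I"
  proof (rule moduleI)
    show "abelian_group ?I"
    proof (rule abelian_groupI)
      fix x assume "x \<in> carrier ?I"
      then obtain c where "c \<in> carrier K" "x = Scalar c" by (auto simp: formal_choice_def)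
      then show "\<exists>y\<in>carrier ?I. y \<oplus>\<^bsub>?I\<^esub> x = \<zero>\<^bsub>?I\<^esub>"
        by (intro bexI[of _ "Scalar (\<ominus>\<^bsub>K\<^esub> c)"]) (auto simp: formal_choice_def K.l_neg)
    qed (auto simp: formal_choice_def K.a_ac)
  qed (auto simp: formal_choice_def K.is_cring K.l_distr K.r_distr K.m_assoc)
  interpret I: module K ?I by (rule I)
  show ?thesis
  proof
    fix V U :: "('k, 'k tens) module" assume VU: "fd_space K V" "fd_space K U"
    show "fd_space K (tspace (formal_choice K) V U)"
      using formal_tensor_fd[OF VU] by (simp add: formal_choice_def)
    show "is_bilinear K V U (tspace (formal_choice K) V U) (tvec (formal_choice K) V U)"
      using formal_tensor_bilinear[OF VU] by (simp add: formal_choice_def)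
    fix W :: "('k, 'k tens) module" and b assume "fd_space K W" "is_bilinear K V U W b"
    then show "\<exists>!\<phi>. \<phi> \<in> Lin K (tspace (formal_choice K) V U) W \<and>
        (\<forall>v \<in> carrier V. \<forall>u \<in> carrier U. \<phi> (tvec (formal_choice K) V U v u) = b v u)"
      using formal_tensor_universal[OF VU] by (simp add: formal_choice_def)
  next
    have "\<exists>c\<in>{Scalar \<one>\<^bsub>K\<^esub>} \<rightarrow> carrier K. v = (\<Oplus>\<^bsub>?I\<^esub>b\<in>{Scalar \<one>\<^bsub>K\<^esub>}. c b \<odot>\<^bsub>?I\<^esub> b)"
      if v: "v \<in> carrier ?I" for v
    proof -
      obtain a where a: "a \<in> carrier K" "v = Scalar a" using v by (auto simp: formal_choice_def)
      have one: "Scalar \<one>\<^bsub>K\<^esub> \<in> carrier ?I" by (auto simp: formal_choice_def)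
      have "v = a \<odot>\<^bsub>?I\<^esub> Scalar \<one>\<^bsub>K\<^esub>" using a by (simp add: formal_choice_def)
      also have "\<dots> = (\<Oplus>\<^bsub>?I\<^esub>b\<in>{Scalar \<one>\<^bsub>K\<^esub>}. a \<odot>\<^bsub>?I\<^esub> b)"
        using a one by (simp add: I.M.finsum_insert)
      finally show ?thesis using a by (intro bexI[of _ "\<lambda>_. a"]) auto
    qed
    then show "fd_space K ?I"
      unfolding fd_space_def using I
      by (intro conjI exI[of _ "{Scalar \<one>\<^bsub>K\<^esub>}"]) (auto simp: formal_choice_def)
  next
    show "uvec (formal_choice K) \<in> carrier ?I" by (simp add: formal_choice_def)
  next
    fix v assume "v \<in> carrier ?I"
    then show "\<exists>!c. c \<in> carrier K \<and> v = c \<odot>\<^bsub>?I\<^esub> uvec (formal_choice K)"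
      by (auto simp: formal_choice_def)
  qed
qed

end

theory Submission
  imports Defs
begin

text \<open>Write \<open>k\<^sub>f\<close> for the field placed in degree \<open>f\<close>.  A half-braiding \<open>x\<close> on \<open>X\<close> is determined by
  its components at the spaces \<open>k\<^sub>f\<close>: if \<open>f.y\<close> is defined by \<open>1 \<otimes> y \<mapsto> f.y \<otimes> 1\<close> under the component
  at \<open>k\<^sub>f\<close>, then naturality along \<open>k\<^sub>f \<rightarrow> V\<close>, \<open>1 \<mapsto> v\<close>, forces \<open>v \<otimes> y \<mapsto> f.y \<otimes> v\<close> under the component
  at \<open>V\<close>, for every \<open>v \<in> V\<^sub>f\<close>.  The hexagon condition on \<open>v \<otimes> (u \<otimes> y)\<close> becomes
  \<open>(fg).y = \<alpha>(f,g|h) f.(g.y)\<close>, invertibility of \<open>x\<close> then gives \<open>e.y = y\<close>, and the half-braiding of a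
  tensor product on \<open>v \<otimes> (y \<otimes> z)\<close> produces the factor \<open>\<alpha>(f|g,h)\<close>; the braidings agree by
  construction.  Hence the centre and \<open>\<Z>(G,\<alpha>)\<close> have the same raw structure, and it is enough to verify
  the axioms of a braided category for \<open>\<Z>(G,\<alpha>)\<close>, where they are identities between values of
  \<open>\<alpha>\<close> on homogeneous tensors.\<close>

section \<open>Linear and bilinear maps\<close>

text \<open>The scalars have a direct origin. The hexagon on v \<otimes> (u \<otimes> y) contains
  three associativity constraints, one of them inverted; solving it for the action of fg gives
  \<alpha>(f,g|h). The tensor product of two half-braidings contains three constraints again, and
  the product of their scalars is \<alpha>(f|g,h) as it stands. Normalisation gives \<alpha>(e,e|h)
  = 1, so e acts as an idempotent, and injectivity of the component in degree e turns it into the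
  identity.

  The obstacle is that tensor products are known only through a universal property and that the
  structural maps are definite descriptions. A map prescribed degree by degree is therefore built by
  summing over homogeneous projections, shown to be unique, and from then on compared with other
  maps on homogeneous pure tensors alone. Linear maps are extensional, so these comparisons yield
  equalities of arrows; together with the extensionality of half-braidings and actions this gives
  bijections on objects and arrows, not merely an equivalence of categories.\<close>

lemma is_linear_closed: "is_linear K V W \<phi> \<Longrightarrow> v \<in> carrier V \<Longrightarrow> \<phi> v \<in> carrier W"
  by (auto simp: is_linear_def)

lemma is_linear_add:
  "is_linear K V W \<phi> \<Longrightarrow> v \<in> carrier V \<Longrightarrow> u \<in> carrier V \<Longrightarrow> \<phi> (v \<oplus>\<^bsub>V\<^esub> u) = \<phi> v \<oplus>\<^bsub>W\<^esub> \<phi> u"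
  by (auto simp: is_linear_def)

lemma is_linear_smult:
  "is_linear K V W \<phi> \<Longrightarrow> c \<in> carrier K \<Longrightarrow> v \<in> carrier V \<Longrightarrow> \<phi> (c \<odot>\<^bsub>V\<^esub> v) = c \<odot>\<^bsub>W\<^esub> \<phi> v"
  by (auto simp: is_linear_def)

lemma is_linear_zero:
  assumes "module K V" "module K W" "is_linear K V W \<phi>"
  shows "\<phi> \<zero>\<^bsub>V\<^esub> = \<zero>\<^bsub>W\<^esub>"
proof -
  interpret V: module K V by fact
  interpret W: module K W by fact
  show ?thesis using linear_finsum[OF assms, of "{}"] by simp
qed

lemma is_linear_comp:
  "is_linear K V W \<phi> \<Longrightarrow> is_linear K W Z \<psi> \<Longrightarrow> is_linear K V Z (\<lambda>v. \<psi> (\<phi> v))"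
  unfolding is_linear_def by (auto simp: Pi_iff)

text \<open>The module structure on \<open>V\<close> keeps sums and multiples of carrier elements in
  the carrier, so \<open>is_linear\<close> sees only values on which the two maps agree.\<close>

lemma is_linear_cong:
  assumes "module K V" "\<And>v. v \<in> carrier V \<Longrightarrow> \<phi> v = \<psi> v"
  shows "is_linear K V W \<phi> \<longleftrightarrow> is_linear K V W \<psi>"
proof -
  interpret V: module K V by fact
  show ?thesis
    unfolding is_linear_def using assms(2) by (auto simp: Pi_iff)
qed

lemma is_linear_restrict [simp]:
  "module K V \<Longrightarrow> is_linear K V W (restrict \<phi> (carrier V)) \<longleftrightarrow> is_linear K V W \<phi>"
  by (rule is_linear_cong) auto

lemma is_linear_id: "is_linear K V V (\<lambda>v. v)"
  by (auto simp: is_linear_def)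

lemma is_linear_null:
  assumes "module K W" shows "is_linear K V W (\<lambda>v. \<zero>\<^bsub>W\<^esub>)"
proof -
  interpret W: module K W by fact
  show ?thesis by (auto simp: is_linear_def)
qed

lemma is_linear_scale:
  assumes "module K W" "c \<in> carrier K" "is_linear K V W \<phi>"
  shows "is_linear K V W (\<lambda>v. c \<odot>\<^bsub>W\<^esub> \<phi> v)"
proof -
  interpret W: module K W by fact
  \<comment> \<open>Commutativity of \<open>K\<close> makes multiplication by \<open>c\<close> a
    linear map.\<close>
  have "c \<odot>\<^bsub>W\<^esub> (d \<odot>\<^bsub>W\<^esub> w) = d \<odot>\<^bsub>W\<^esub> (c \<odot>\<^bsub>W\<^esub> w)" if "d \<in> carrier K" "w \<in> carrier W" for d w
    using that assms(2) by (simp add: W.smult_assoc1[symmetric] W.m_comm)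
  then show ?thesis
    using assms(2,3) by (auto simp: is_linear_def W.smult_r_distr Pi_iff)
qed

text \<open>Maps prescribed degree by degree are assembled as finite sums over the group; this
  supplies their linearity.\<close>

lemma is_linear_finsum:
  assumes "module K W" "finite I" "\<And>i. i \<in> I \<Longrightarrow> is_linear K V W (\<phi> i)"
  shows "is_linear K V W (\<lambda>v. \<Oplus>\<^bsub>W\<^esub>i\<in>I. \<phi> i v)"
proof -
  interpret W: module K W by fact
  have cl: "(\<lambda>i. \<phi> i v) \<in> I \<rightarrow> carrier W" if "v \<in> carrier V" for v
    using is_linear_closed[OF assms(3) that] by auto
  show ?thesis
    unfolding is_linear_def
  proof (intro conjI ballI funcsetI)
    fix v u assume vu: "v \<in> carrier V" "u \<in> carrier V"
    have "(\<Oplus>\<^bsub>W\<^esub>i\<in>I. \<phi> i (v \<oplus>\<^bsub>V\<^esub> u)) = (\<Oplus>\<^bsub>W\<^esub>i\<in>I. \<phi> i v \<oplus>\<^bsub>W\<^esub> \<phi> i u)"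
      using vu cl assms(3)
      by (intro W.M.finsum_cong') (auto simp: is_linear_add[OF assms(3)] Pi_iff)
    then show "(\<Oplus>\<^bsub>W\<^esub>i\<in>I. \<phi> i (v \<oplus>\<^bsub>V\<^esub> u)) = (\<Oplus>\<^bsub>W\<^esub>i\<in>I. \<phi> i v) \<oplus>\<^bsub>W\<^esub> (\<Oplus>\<^bsub>W\<^esub>i\<in>I. \<phi> i u)"
      using vu cl by (simp add: W.M.finsum_addf)
  next
    fix c v assume cv: "c \<in> carrier K" "v \<in> carrier V"
    have "(\<Oplus>\<^bsub>W\<^esub>i\<in>I. \<phi> i (c \<odot>\<^bsub>V\<^esub> v)) = (\<Oplus>\<^bsub>W\<^esub>i\<in>I. c \<odot>\<^bsub>W\<^esub> \<phi> i v)"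
      using cv cl by (intro W.M.finsum_cong') (auto simp: is_linear_smult[OF assms(3)] Pi_iff)
    then show "(\<Oplus>\<^bsub>W\<^esub>i\<in>I. \<phi> i (c \<odot>\<^bsub>V\<^esub> v)) = c \<odot>\<^bsub>W\<^esub> (\<Oplus>\<^bsub>W\<^esub>i\<in>I. \<phi> i v)"
      using cv cl assms(2) by (simp add: W.finsum_smult_ldistr)
  qed (use cl in simp)
qed

text \<open>Supplies the linearity of the inverse action maps from which the inverse braiding is
  built.\<close>

lemma is_linear_inv_into:
  assumes "module K V" "is_linear K V W \<phi>" "bij_betw \<phi> (carrier V) (carrier W)"
  shows "is_linear K W V (inv_into (carrier V) \<phi>)"
proof -
  interpret V: module K V by fact
  let ?i = "inv_into (carrier V) \<phi>"
  have img: "\<phi> ` carrier V = carrier W" and inj: "inj_on \<phi> (carrier V)"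
    using assms(3) by (auto simp: bij_betw_def)
  have cl: "?i w \<in> carrier V" "\<phi> (?i w) = w" if "w \<in> carrier W" for w
    using that by (auto simp: img[symmetric] intro: inv_into_into f_inv_into_f)
  have eq: "?i w = v" if "\<phi> v = w" "v \<in> carrier V" for v w
    using that inj by auto
  show ?thesis
    unfolding is_linear_def
    using cl by (auto intro!: eq simp: is_linear_add[OF assms(2)] is_linear_smult[OF assms(2)])
qed

section \<open>Bilinear maps\<close>

lemma is_bilinear_left: "is_bilinear K V U W b \<Longrightarrow> u \<in> carrier U \<Longrightarrow> is_linear K V W (\<lambda>v. b v u)"
  and is_bilinear_right: "is_bilinear K V U W b \<Longrightarrow> v \<in> carrier V \<Longrightarrow> is_linear K U W (\<lambda>u. b v u)"
  by (auto simp: is_bilinear_def)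

lemma is_bilinear_closed:
  "is_bilinear K V U W b \<Longrightarrow> v \<in> carrier V \<Longrightarrow> u \<in> carrier U \<Longrightarrow> b v u \<in> carrier W"
  by (rule is_linear_closed[OF is_bilinear_left])

lemma is_bilinear_swap: "is_bilinear K V U W b \<Longrightarrow> is_bilinear K U V W (\<lambda>u v. b v u)"
  by (auto simp: is_bilinear_def)

lemma is_bilinear_comp:
  assumes "is_bilinear K V U W b" "is_linear K V' V \<phi>" "is_linear K U' U \<psi>" "is_linear K W W' \<chi>"
  shows "is_bilinear K V' U' W' (\<lambda>v u. \<chi> (b (\<phi> v) (\<psi> u)))"
  unfolding is_bilinear_def
proof (intro conjI ballI)
  fix v assume "v \<in> carrier V'"
  note b = is_bilinear_right[OF assms(1) is_linear_closed[OF assms(2) this]]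
  show "is_linear K U' W' (\<lambda>u. \<chi> (b (\<phi> v) (\<psi> u)))"
    using is_linear_comp[where \<psi> = "\<lambda>u. \<chi> (b (\<phi> v) u)", OF assms(3)] is_linear_comp[OF b assms(4)] by simp
next
  fix u assume "u \<in> carrier U'"
  note b = is_bilinear_left[OF assms(1) is_linear_closed[OF assms(3) this]]
  show "is_linear K V' W' (\<lambda>v. \<chi> (b (\<phi> v) (\<psi> u)))"
    using is_linear_comp[where \<psi> = "\<lambda>v. \<chi> (b v (\<psi> u))", OF assms(2)] is_linear_comp[OF b assms(4)] by simp
qed

lemma is_bilinear_comp2:
  assumes "is_bilinear K V U W b" "is_linear K V' V \<phi>" "is_linear K U' U \<psi>"
  shows "is_bilinear K V' U' W (\<lambda>v u. b (\<phi> v) (\<psi> u))"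
  using is_bilinear_comp[where \<chi> = "\<lambda>w. w" and W = W and W' = W, OF _ assms(2,3) is_linear_id] assms(1)
  by blast

lemma is_bilinear_scale:
  "module K W \<Longrightarrow> c \<in> carrier K \<Longrightarrow> is_bilinear K V U W b \<Longrightarrow> is_bilinear K V U W (\<lambda>v u. c \<odot>\<^bsub>W\<^esub> b v u)"
  unfolding is_bilinear_def by (simp add: is_linear_scale)

lemma is_bilinear_null: "module K W \<Longrightarrow> is_bilinear K V U W (\<lambda>v u. \<zero>\<^bsub>W\<^esub>)"
  unfolding is_bilinear_def by (simp add: is_linear_null)

lemma is_bilinear_finsum:
  assumes "module K W" "finite I" "\<And>i. i \<in> I \<Longrightarrow> is_bilinear K V U W (b i)"
  shows "is_bilinear K V U W (\<lambda>v u. \<Oplus>\<^bsub>W\<^esub>i\<in>I. b i v u)"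
  unfolding is_bilinear_def
  by (intro conjI ballI is_linear_finsum assms(1,2) is_bilinear_left[OF assms(3)] is_bilinear_right[OF assms(3)])

lemma Lin_iff: "\<phi> \<in> Lin K V W \<longleftrightarrow> \<phi> \<in> extensional (carrier V) \<and> is_linear K V W \<phi>"
  by (simp add: Lin_def)

lemma Lin_restrict: "module K V \<Longrightarrow> is_linear K V W \<phi> \<Longrightarrow> restrict \<phi> (carrier V) \<in> Lin K V W"
  by (simp add: Lin_iff)

text \<open>Members of \<open>Lin\<close> are extensional, so agreement on the carrier is equality
  of functions. Extensionality concerns the domain only, so the codomains may differ.\<close>

lemma Lin_eqI:
  "\<phi> \<in> Lin K V W \<Longrightarrow> \<psi> \<in> Lin K V W' \<Longrightarrow> (\<And>v. v \<in> carrier V \<Longrightarrow> \<phi> v = \<psi> v) \<Longrightarrow> \<phi> = \<psi>"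
  by (auto simp: Lin_iff intro: extensionalityI)

section \<open>Submodules, spans and equalizers\<close>

lemma submodule_zero: "submodule N K V \<Longrightarrow> \<zero>\<^bsub>V\<^esub> \<in> N"
  using subgroup.one_closed[OF submodule.axioms(1)] by force

text \<open>The basis of the spanning arguments: if a linear map sends generators into
  \<open>N\<close>, the preimage of \<open>N\<close> is a submodule containing them, hence contains
  their span.\<close>

lemma submodule_preimage:
  assumes "module K V" "module K W" "is_linear K V W \<phi>" "submodule N K W"
  shows "submodule {v \<in> carrier V. \<phi> v \<in> N} K V"
proof -
  interpret V: module K V by fact
  interpret W: module K W by fact
  note N = W.submoduleE[OF assms(4)]
  \<comment> \<open>Negation is multiplication by the scalar -1, so linearity covers it.\<close>
  have neg: "\<phi> (\<ominus>\<^bsub>V\<^esub> v) = \<ominus>\<^bsub>W\<^esub> \<phi> v" if "v \<in> carrier V" for v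
  proof -
    have "\<phi> ((\<ominus>\<^bsub>K\<^esub> \<one>\<^bsub>K\<^esub>) \<odot>\<^bsub>V\<^esub> v) = (\<ominus>\<^bsub>K\<^esub> \<one>\<^bsub>K\<^esub>) \<odot>\<^bsub>W\<^esub> \<phi> v"
      using that by (intro is_linear_smult[OF assms(3)]) auto
    then show ?thesis
      using that is_linear_closed[OF assms(3) that] by (simp add: V.smult_l_minus W.smult_l_minus)
  qed
  show ?thesis
    using N submodule_zero[OF assms(4)]
    by (intro V.submoduleI)
       (auto simp: is_linear_zero[OF assms(1,2,3)] neg is_linear_add[OF assms(3)] is_linear_smult[OF assms(3)])
qed

lemma lin_span_submodule:
  assumes "module K V" "S \<subseteq> carrier V"
  shows "submodule (lin_span K V S) K V"
proof -
  interpret V: module K V by fact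
  have sub: "lin_span K V S \<subseteq> carrier V"
    using assms(2) V.carrier_is_submodule by (auto simp: lin_span_def hull_def)
  show ?thesis
    by (rule V.submoduleI[OF sub])
       (auto simp: lin_span_def hull_def V.submoduleE submodule_zero)
qed

lemma lin_span_superset: "S \<subseteq> lin_span K V S"
  by (simp add: lin_span_def hull_subset)

lemma lin_span_minimal: "submodule N K V \<Longrightarrow> S \<subseteq> N \<Longrightarrow> lin_span K V S \<subseteq> N"
  unfolding lin_span_def by (rule hull_minimal)

lemma lin_span_image:
  assumes "module K V" "module K W" "is_linear K V W \<phi>" "submodule N K W"
    and "S \<subseteq> carrier V" "\<And>s. s \<in> S \<Longrightarrow> \<phi> s \<in> N" "v \<in> lin_span K V S"
  shows "\<phi> v \<in> N"
  using lin_span_minimal[OF submodule_preimage[OF assms(1-4)], of S] assms(5-7) by blast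
text \<open>Turns an equality of linear maps into membership in a submodule. Spanning arguments can
  then prove equations on a single homogeneous piece, about which the universal property says
  nothing.\<close>

lemma submodule_equalizer:
  assumes "module K V" "module K W" "is_linear K V W \<phi>" "is_linear K V W \<psi>"
  shows "submodule {v \<in> carrier V. \<phi> v = \<psi> v} K V"
proof -
  interpret V: module K V by fact
  interpret W: module K W by fact
  have neg: "\<chi> (\<ominus>\<^bsub>V\<^esub> v) = \<ominus>\<^bsub>W\<^esub> \<chi> v" if "is_linear K V W \<chi>" "v \<in> carrier V" for \<chi> v
  proof -
    have "\<chi> ((\<ominus>\<^bsub>K\<^esub> \<one>\<^bsub>K\<^esub>) \<odot>\<^bsub>V\<^esub> v) = (\<ominus>\<^bsub>K\<^esub> \<one>\<^bsub>K\<^esub>) \<odot>\<^bsub>W\<^esub> \<chi> v"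
      using that by (intro is_linear_smult[OF that(1)]) auto
    then show ?thesis
      using that is_linear_closed[OF that] by (simp add: V.smult_l_minus W.smult_l_minus)
  qed
  show ?thesis
    by (rule V.submoduleI)
       (auto simp: is_linear_zero[OF assms(1,2,3)] is_linear_zero[OF assms(1,2,4)] neg[OF assms(3)]
          neg[OF assms(4)] is_linear_add[OF assms(3)] is_linear_smult[OF assms(3)]
          is_linear_add[OF assms(4)] is_linear_smult[OF assms(4)])
qed

lemma fd_submodule_eq:
  assumes "module K V" "finite B" "submodule N K V" "B \<subseteq> N"
    and "\<forall>v \<in> carrier V. \<exists>c \<in> B \<rightarrow> carrier K. v = (\<Oplus>\<^bsub>V\<^esub>b\<in>B. c b \<odot>\<^bsub>V\<^esub> b)"
  shows "carrier V \<subseteq> N"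
proof
  interpret V: module K V by fact
  fix v assume "v \<in> carrier V"
  then obtain c where c: "c \<in> B \<rightarrow> carrier K" "v = (\<Oplus>\<^bsub>V\<^esub>b\<in>B. c b \<odot>\<^bsub>V\<^esub> b)" using assms(5) by blast
  have "(\<lambda>b. c b \<odot>\<^bsub>V\<^esub> b) \<in> B \<rightarrow> N"
    using c(1) assms(4) V.submoduleE(4)[OF assms(3)] by blast
  then show "v \<in> N" unfolding c(2) by (rule submodule_finsum[OF assms(1,3,2)])
qed

text \<open>The universal property only speaks about spaces in the universe, so a quotient by the span
  of the pure tensors is not available; instead, the finite dimensional span itself is used as
  the target of the universal map.\<close>

lemma (in tensor_products) tensor_generated:
  assumes V: "fd_space K V" and U: "fd_space K U" and N: "submodule N K (tspace T V U)"
    and gen: "\<And>v u. v \<in> carrier V \<Longrightarrow> u \<in> carrier U \<Longrightarrow> tvec T V U v u \<in> N"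
  shows "carrier (tspace T V U) \<subseteq> N"
proof -
  let ?VU = "tspace T V U"
  note bil = tvec_bilinear[OF V U]
  interpret V: module K V using V by (simp add: fd_space_def)
  interpret U: module K U using U by (simp add: fd_space_def)
  interpret VU: module K ?VU using tspace_fd[OF V U] by (simp add: fd_space_def)
  obtain A where A: "finite A" "A \<subseteq> carrier V"
      "\<forall>v \<in> carrier V. \<exists>c \<in> A \<rightarrow> carrier K. v = (\<Oplus>\<^bsub>V\<^esub>a\<in>A. c a \<odot>\<^bsub>V\<^esub> a)"
    using V unfolding fd_space_def by blast
  obtain B where B: "finite B" "B \<subseteq> carrier U"
      "\<forall>u \<in> carrier U. \<exists>c \<in> B \<rightarrow> carrier K. u = (\<Oplus>\<^bsub>U\<^esub>b\<in>B. c b \<odot>\<^bsub>U\<^esub> b)"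
    using U unfolding fd_space_def by blast
  \<comment> \<open>Tensors of two finite spanning sets: their span is finite dimensional, as a
    target of the universal map has to be.\<close>
  define S where "S = (\<lambda>(v, u). tvec T V U v u) ` (A \<times> B)"
  have tcl: "tvec T V U v u \<in> carrier ?VU" if "v \<in> carrier V" "u \<in> carrier U" for v u
    using is_bilinear_closed[OF bil that] .
  have S: "finite S" "S \<subseteq> carrier ?VU"
    using A B tcl by (auto simp: S_def subset_iff)
  define M where "M = {\<Oplus>\<^bsub>?VU\<^esub>b\<in>S. c b \<odot>\<^bsub>?VU\<^esub> b | c. c \<in> S \<rightarrow> carrier K}"
  have M: "submodule M K ?VU"
    unfolding M_def by (rule finsum_combinations_submodule[OF VU.module_axioms S])
  have SM: "S \<subseteq> M"
    unfolding M_def using combination_single[OF VU.module_axioms S] by blast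
  have MN: "M \<subseteq> N"
  proof
    fix t assume "t \<in> M"
    then obtain c where c: "c \<in> S \<rightarrow> carrier K" "t = (\<Oplus>\<^bsub>?VU\<^esub>b\<in>S. c b \<odot>\<^bsub>?VU\<^esub> b)" by (auto simp: M_def)
    have "S \<subseteq> N" using gen A(2) B(2) by (auto simp: S_def)
    then have "(\<lambda>b. c b \<odot>\<^bsub>?VU\<^esub> b) \<in> S \<rightarrow> N" using c(1) VU.submoduleE(4)[OF N] by blast
    then show "t \<in> N" unfolding c(2) by (rule submodule_finsum[OF VU.module_axioms N S(1)])
  qed
  have 1: "tvec T V U a u \<in> M" if a: "a \<in> A" and u: "u \<in> carrier U" for a u
  proof -
    have aV: "a \<in> carrier V" using a A by blast
    have "carrier U \<subseteq> {u \<in> carrier U. tvec T V U a u \<in> M}"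
      by (rule fd_submodule_eq[OF U.module_axioms B(1) submodule_preimage[OF U.module_axioms
            VU.module_axioms is_bilinear_right[OF bil aV] M] _ B(3)])
         (use SM a B(2) in \<open>auto simp: S_def\<close>)
    then show ?thesis using u by blast
  qed
  have 2: "tvec T V U v u \<in> M" if v: "v \<in> carrier V" and u: "u \<in> carrier U" for v u
  proof -
    have "carrier V \<subseteq> {v \<in> carrier V. tvec T V U v u \<in> M}"
      by (rule fd_submodule_eq[OF V.module_axioms A(1) submodule_preimage[OF V.module_axioms
            VU.module_axioms is_bilinear_left[OF bil u] M] _ A(3)])
         (use 1 u A(2) in auto)
    then show ?thesis using v by blast
  qed
  define W where "W = ?VU\<lparr>carrier := M\<rparr>"
  have W_simps: "carrier W = M" "add W = add ?VU" "smult W = smult ?VU" by (simp_all add: W_def)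
  have Wm: "module K W" unfolding W_def by (rule submodule.submodule_is_module[OF M VU.module_axioms])
  have MV: "M \<subseteq> carrier ?VU" by (rule VU.submoduleE(1)[OF M])
  have incl: "is_linear K W ?VU (\<lambda>w. w)"
    using MV by (auto simp: is_linear_def W_simps)
  have W: "fd_space K W"
    unfolding fd_space_def W_simps
  proof (intro conjI Wm exI[of _ S] S(1) SM ballI)
    fix w assume "w \<in> M"
    then obtain c where c: "c \<in> S \<rightarrow> carrier K" "w = (\<Oplus>\<^bsub>?VU\<^esub>b\<in>S. c b \<odot>\<^bsub>?VU\<^esub> b)" by (auto simp: M_def)
    have "(\<lambda>b. c b \<odot>\<^bsub>?VU\<^esub> b) \<in> S \<rightarrow> carrier W"
      using c(1) SM VU.submoduleE(4)[OF M] by (auto simp: W_simps Pi_iff)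
    from linear_finsum[OF Wm VU.module_axioms incl S(1) this] c
    show "\<exists>c\<in>S \<rightarrow> carrier K. w = (\<Oplus>\<^bsub>W\<^esub>b\<in>S. c b \<odot>\<^bsub>?VU\<^esub> b)"
      by (intro bexI[of _ c]) simp_all
  qed
  have "is_bilinear K V U W (tvec T V U)"
    using bil 2 by (auto simp: is_bilinear_def is_linear_def W_simps)
  then obtain \<phi> where \<phi>: "\<phi> \<in> Lin K ?VU W" "\<And>v u. v \<in> carrier V \<Longrightarrow> u \<in> carrier U \<Longrightarrow> \<phi> (tvec T V U v u) = tvec T V U v u"
    using tensor_universal[OF V U W] by blast
  \<comment> \<open>Followed by the inclusion, \<open>\<phi>\<close> fixes all pure tensors, as the
    identity does. Uniqueness makes it the identity, while its values lie in
    \<open>M\<close>.\<close>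
  have "\<phi> \<in> Lin K ?VU ?VU"
    using \<phi>(1) is_linear_comp[OF _ incl] by (auto simp: Lin_iff)
  moreover have "restrict (\<lambda>t. t) (carrier ?VU) \<in> Lin K ?VU ?VU"
    by (rule Lin_restrict[OF VU.module_axioms is_linear_id])
  ultimately have \<phi>_id: "\<phi> = restrict (\<lambda>t. t) (carrier ?VU)"
    using tensor_universal[OF V U tspace_fd[OF V U] bil] \<phi>(2) tcl
    by (metis (no_types, lifting) restrict_apply')
  show ?thesis
  proof
    fix t assume t: "t \<in> carrier ?VU"
    have "\<phi> t \<in> M" using \<phi>(1) t by (auto simp: Lin_iff W_simps dest: is_linear_closed)
    then show "t \<in> N" using t MN by (auto simp: \<phi>_id)
  qed
qed

section \<open>Maps out of tensor products of graded spaces\<close>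

locale cocycle_setting = G: group G + K: field K + tensor_products K T
  for G :: "('g, 'a) monoid_scheme" and K :: "'k ring" and T :: "('k, 'v) tensor_choice" +
  fixes \<alpha> :: "'g \<Rightarrow> 'g \<Rightarrow> 'g \<Rightarrow> 'k"
  assumes finite_G: "finite (carrier G)" and cocycle: "normalised_3_cocycle G K \<alpha>"
begin

abbreviation gs :: "('g, 'k, 'v) graded \<Rightarrow> bool" where
  "gs X \<equiv> graded_space G K X"

abbreviation car :: "('g, 'k, 'v) graded \<Rightarrow> 'v set" where
  "car X \<equiv> carrier (space X)"

abbreviation lin :: "('g, 'k, 'v) graded \<Rightarrow> ('g, 'k, 'v) graded \<Rightarrow> ('v \<Rightarrow> 'v) \<Rightarrow> bool" where
  "lin X Y \<equiv> is_linear K (space X) (space Y)"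

abbreviation gtensor ::
    "('g, 'k, 'v) graded \<Rightarrow> ('g, 'k, 'v) graded \<Rightarrow> ('g, 'k, 'v) graded"
    (infixl \<open>\<otimes>\<^sub>V\<close> 70) where
  "X \<otimes>\<^sub>V Y \<equiv> graded_tensor G K T X Y"

abbreviation tv :: "('g, 'k, 'v) graded \<Rightarrow> ('g, 'k, 'v) graded \<Rightarrow> 'v \<Rightarrow> 'v \<Rightarrow> 'v" where
  "tv X Y \<equiv> tvec T (space X) (space Y)"

lemma space_tensor: "space (X \<otimes>\<^sub>V Y) = tspace T (space X) (space Y)"
  by (simp add: graded_tensor_def)

lemma fd_module: "fd_space K V \<Longrightarrow> module K V"
  by (simp add: fd_space_def)

lemma gs_fd: "gs X \<Longrightarrow> fd_space K (space X)"
  by (simp add: graded_space_def)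

lemma gs_module: "gs X \<Longrightarrow> module K (space X)"
  by (simp add: gs_fd fd_module)

lemma piece_submodule: "gs X \<Longrightarrow> g \<in> carrier G \<Longrightarrow> submodule (piece X g) K (space X)"
  by (simp add: graded_space_def)

lemma piece_car: "gs X \<Longrightarrow> g \<in> carrier G \<Longrightarrow> x \<in> piece X g \<Longrightarrow> x \<in> car X"
  using module.submoduleE(1)[OF gs_module piece_submodule] by blast

lemma piece_zero: "gs X \<Longrightarrow> g \<in> carrier G \<Longrightarrow> \<zero>\<^bsub>space X\<^esub> \<in> piece X g"
  by (rule submodule_zero[OF piece_submodule])

lemma piece_smult:
  "gs X \<Longrightarrow> g \<in> carrier G \<Longrightarrow> c \<in> carrier K \<Longrightarrow> x \<in> piece X g \<Longrightarrow> c \<odot>\<^bsub>space X\<^esub> x \<in> piece X g"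
  using module.submoduleE(4)[OF gs_module piece_submodule] by blast

lemma gs_zero_closed: "gs X \<Longrightarrow> \<zero>\<^bsub>space X\<^esub> \<in> car X"
  by (rule piece_car[OF _ G.one_closed piece_zero]) auto

lemma gs_smult_closed: "gs X \<Longrightarrow> c \<in> carrier K \<Longrightarrow> x \<in> car X \<Longrightarrow> c \<odot>\<^bsub>space X\<^esub> x \<in> car X"
  by (rule module.smult_closed[OF gs_module])

lemma gs_smult_smult:
  "gs X \<Longrightarrow> c \<in> carrier K \<Longrightarrow> d \<in> carrier K \<Longrightarrow> x \<in> car X \<Longrightarrow>
   c \<odot>\<^bsub>space X\<^esub> (d \<odot>\<^bsub>space X\<^esub> x) = (c \<otimes>\<^bsub>K\<^esub> d) \<odot>\<^bsub>space X\<^esub> x"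
  by (simp add: module.smult_assoc1[OF gs_module])

lemma gs_smult_one: "gs X \<Longrightarrow> x \<in> car X \<Longrightarrow> \<one>\<^bsub>K\<^esub> \<odot>\<^bsub>space X\<^esub> x = x"
  by (simp add: module.smult_one[OF gs_module])

text \<open>The homogeneous component of degree \<open>g\<close>: the whole family of components is
  the unique \<open>c\<close> from the definition of a graded space, here evaluated at
  \<open>g\<close>.\<close>

definition pr :: "('g, 'k, 'v) graded \<Rightarrow> 'g \<Rightarrow> 'v \<Rightarrow> 'v" where
  "pr X g v = (THE c. c \<in> (\<Pi>\<^sub>E g \<in> carrier G. piece X g) \<and>
     v = (\<Oplus>\<^bsub>space X\<^esub>g\<in>carrier G. c g)) g"

lemma pr_decomposition:
  assumes "gs X" "v \<in> car X"
  shows "(\<lambda>g. pr X g v) \<in> (\<Pi>\<^sub>E g \<in> carrier G. piece X g)"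
    and "v = (\<Oplus>\<^bsub>space X\<^esub>g\<in>carrier G. pr X g v)"
proof -
  have "\<exists>!c. c \<in> (\<Pi>\<^sub>E g \<in> carrier G. piece X g) \<and> v = (\<Oplus>\<^bsub>space X\<^esub>g\<in>carrier G. c g)"
    using assms unfolding graded_space_def by blast
  from theI'[OF this]
  show "(\<lambda>g. pr X g v) \<in> (\<Pi>\<^sub>E g \<in> carrier G. piece X g)"
    and "v = (\<Oplus>\<^bsub>space X\<^esub>g\<in>carrier G. pr X g v)"
    unfolding pr_def by auto
qed

lemma pr_piece: "gs X \<Longrightarrow> v \<in> car X \<Longrightarrow> g \<in> carrier G \<Longrightarrow> pr X g v \<in> piece X g"
  using pr_decomposition(1) by (auto simp: PiE_iff)

lemma pr_closed: "gs X \<Longrightarrow> v \<in> car X \<Longrightarrow> g \<in> carrier G \<Longrightarrow> pr X g v \<in> car X"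
  by (rule piece_car[OF _ _ pr_piece])

text \<open>Uniqueness of the decomposition, in a form that leaves the family \<open>c\<close>
  arbitrary outside the group.\<close>

lemma pr_eqI:
  assumes "gs X" "\<And>g. g \<in> carrier G \<Longrightarrow> c g \<in> piece X g"
    and "v = (\<Oplus>\<^bsub>space X\<^esub>g\<in>carrier G. c g)" "g \<in> carrier G"
  shows "pr X g v = c g"
proof -
  interpret X: module K "space X" using assms(1) by (rule gs_module)
  have cl: "c \<in> carrier G \<rightarrow> car X" using piece_car[OF assms(1) _ assms(2)] by blast
  have v: "v \<in> car X" unfolding assms(3) using cl by simp
  then have "\<exists>!c. c \<in> (\<Pi>\<^sub>E g \<in> carrier G. piece X g) \<and> v = (\<Oplus>\<^bsub>space X\<^esub>g\<in>carrier G. c g)"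
    using assms(1) unfolding graded_space_def by blast
  \<comment> \<open>Uniqueness is stated among extensional families, hence the restriction of
    \<open>c\<close>.\<close>
  moreover have "v = (\<Oplus>\<^bsub>space X\<^esub>g\<in>carrier G. restrict c (carrier G) g)"
    unfolding assms(3) using cl by (intro X.M.finsum_cong') auto
  moreover have "restrict c (carrier G) \<in> (\<Pi>\<^sub>E g \<in> carrier G. piece X g)" using assms(2) by auto
  ultimately have "(\<lambda>g. pr X g v) = restrict c (carrier G)"
    using pr_decomposition[OF assms(1) v] by blast
  then show ?thesis using assms(4) by (metis restrict_apply')
qed

text \<open>Sums and multiples of decompositions are again decompositions, so uniqueness forces
  linearity.\<close>

lemma pr_linear:
  assumes "gs X" "g \<in> carrier G"
  shows "lin X X (pr X g)"
proof -
  interpret X: module K "space X" using assms(1) by (rule gs_module)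
  have cl: "(\<lambda>g. pr X g v) \<in> carrier G \<rightarrow> car X" if "v \<in> car X" for v
    using pr_closed[OF assms(1) that] by blast
  note sub = X.submoduleE[OF piece_submodule[OF assms(1)]]
  show ?thesis
    unfolding is_linear_def
  proof (intro conjI ballI funcsetI)
    fix v u assume vu: "v \<in> car X" "u \<in> car X"
    have "v \<oplus>\<^bsub>space X\<^esub> u = (\<Oplus>\<^bsub>space X\<^esub>g\<in>carrier G. pr X g v \<oplus>\<^bsub>space X\<^esub> pr X g u)"
      using vu cl pr_decomposition(2)[OF assms(1)] by (simp add: X.M.finsum_addf)
    then show "pr X g (v \<oplus>\<^bsub>space X\<^esub> u) = pr X g v \<oplus>\<^bsub>space X\<^esub> pr X g u"
      using vu sub(5) pr_piece[OF assms(1)] by (intro pr_eqI[OF assms(1) _ _ assms(2)]) auto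
  next
    fix c v assume cv: "c \<in> carrier K" "v \<in> car X"
    have "c \<odot>\<^bsub>space X\<^esub> v = (\<Oplus>\<^bsub>space X\<^esub>g\<in>carrier G. c \<odot>\<^bsub>space X\<^esub> pr X g v)"
      using X.finsum_smult_ldistr[OF finite_G cv(1) cl[OF cv(2)]] pr_decomposition(2)[OF assms(1) cv(2)]
      by simp
    then show "pr X g (c \<odot>\<^bsub>space X\<^esub> v) = c \<odot>\<^bsub>space X\<^esub> pr X g v"
      using cv sub(4) pr_piece[OF assms(1)] by (intro pr_eqI[OF assms(1) _ _ assms(2)]) auto
  qed (use pr_closed assms in blast)
qed

lemma finsum_delta:
  assumes "module K V" "h \<in> carrier G" "v \<in> carrier V"
  shows "(\<Oplus>\<^bsub>V\<^esub>g\<in>carrier G. if g = h then v else \<zero>\<^bsub>V\<^esub>) = v"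
proof -
  interpret V: module K V by fact
  have "(\<Oplus>\<^bsub>V\<^esub>g\<in>carrier G. if g = h then v else \<zero>\<^bsub>V\<^esub>) = (\<Oplus>\<^bsub>V\<^esub>g\<in>carrier G. if h = g then v else \<zero>\<^bsub>V\<^esub>)"
    using assms by (intro V.M.finsum_cong') auto
  then show ?thesis
    using V.M.finsum_singleton[of h "carrier G" "\<lambda>_. v"] assms finite_G by simp
qed

lemma pr_homogeneous:
  assumes "gs X" "g \<in> carrier G" "h \<in> carrier G" "v \<in> piece X h"
  shows "pr X g v = (if g = h then v else \<zero>\<^bsub>space X\<^esub>)"
proof -
  have "v = (\<Oplus>\<^bsub>space X\<^esub>g\<in>carrier G. if g = h then v else \<zero>\<^bsub>space X\<^esub>)"
    using assms by (simp add: finsum_delta[OF gs_module] piece_car)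
  then show ?thesis
    using assms piece_zero by (intro pr_eqI[where c = "\<lambda>g. if g = h then v else \<zero>\<^bsub>space X\<^esub>"]) auto
qed

text \<open>A complete system of linear projections yields a direct sum: the \<open>P g v\<close>
  decompose \<open>v\<close>, and applying \<open>P h\<close> to any other decomposition picks out
  its entry at \<open>h\<close>. Tensor products and lines are graded in this way, without
  bases.\<close>

lemma graded_spaceI:
  assumes fd: "fd_space K (space X)" and ext: "piece X \<in> extensional (carrier G)"
    and sub: "\<And>g. g \<in> carrier G \<Longrightarrow> submodule (piece X g) K (space X)"
    and P: "\<And>g. g \<in> carrier G \<Longrightarrow> lin X X (P g)"
    and P_piece: "\<And>g v. g \<in> carrier G \<Longrightarrow> v \<in> car X \<Longrightarrow> P g v \<in> piece X g"
    and P_sum: "\<And>v. v \<in> car X \<Longrightarrow> (\<Oplus>\<^bsub>space X\<^esub>g\<in>carrier G. P g v) = v"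
    and P_delta: "\<And>g h v. g \<in> carrier G \<Longrightarrow> h \<in> carrier G \<Longrightarrow> v \<in> piece X h \<Longrightarrow>
            P g v = (if g = h then v else \<zero>\<^bsub>space X\<^esub>)"
  shows "gs X"
proof -
  interpret X: module K "space X" using fd by (rule fd_module)
  have piece_car: "v \<in> car X" if "g \<in> carrier G" "v \<in> piece X g" for g v
    using X.submoduleE(1)[OF sub] that by blast
  have "\<exists>!c. c \<in> (\<Pi>\<^sub>E g \<in> carrier G. piece X g) \<and> v = (\<Oplus>\<^bsub>space X\<^esub>g\<in>carrier G. c g)"
    if v: "v \<in> car X" for v
  proof (intro ex1I conjI)
    show "restrict (\<lambda>g. P g v) (carrier G) \<in> (\<Pi>\<^sub>E g \<in> carrier G. piece X g)"
      using P_piece v by auto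
    have "(\<Oplus>\<^bsub>space X\<^esub>g\<in>carrier G. restrict (\<lambda>g. P g v) (carrier G) g) = (\<Oplus>\<^bsub>space X\<^esub>g\<in>carrier G. P g v)"
      using P_piece piece_car v by (intro X.M.finsum_cong') auto
    then show "v = (\<Oplus>\<^bsub>space X\<^esub>g\<in>carrier G. restrict (\<lambda>g. P g v) (carrier G) g)"
      using P_sum[OF v] by simp
  next
    fix c assume c: "c \<in> (\<Pi>\<^sub>E g \<in> carrier G. piece X g) \<and> v = (\<Oplus>\<^bsub>space X\<^esub>g\<in>carrier G. c g)"
    have cl: "c \<in> carrier G \<rightarrow> car X" using c piece_car by (auto simp: PiE_iff)
    have "P h v = c h" if h: "h \<in> carrier G" for h
    proof -
      have "P h v = (\<Oplus>\<^bsub>space X\<^esub>g\<in>carrier G. P h (c g))"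
        using linear_finsum[OF X.module_axioms X.module_axioms P[OF h] finite_G cl] c by simp
      also have "\<dots> = (\<Oplus>\<^bsub>space X\<^esub>g\<in>carrier G. if g = h then c h else \<zero>\<^bsub>space X\<^esub>)"
        using cl h c by (intro X.M.finsum_cong') (auto simp: P_delta PiE_iff)
      also have "\<dots> = c h"
        using cl h by (intro finsum_delta[OF X.module_axioms]) auto
      finally show ?thesis .
    qed
    then show "c = restrict (\<lambda>g. P g v) (carrier G)"
      using c by (intro extensionalityI[of _ "carrier G"]) (auto simp: PiE_iff)
  qed
  then show ?thesis using fd ext sub by (simp add: graded_space_def)
qed

lemma linear_eq_on_pieces:
  assumes "gs X" "module K W" "is_linear K (space X) W \<phi>" "is_linear K (space X) W \<psi>"
    and "\<And>g x. g \<in> carrier G \<Longrightarrow> x \<in> piece X g \<Longrightarrow> x \<in> car X \<Longrightarrow> \<phi> x = \<psi> x" and "v \<in> car X"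
  shows "\<phi> v = \<psi> v"
proof -
  interpret X: module K "space X" using assms(1) by (rule gs_module)
  interpret W: module K W by fact
  have cl: "(\<lambda>g. pr X g v) \<in> carrier G \<rightarrow> car X"
    using pr_closed[OF assms(1,6)] by blast
  have eq: "\<And>g. g \<in> carrier G \<Longrightarrow> \<phi> (pr X g v) = \<psi> (pr X g v)"
    using assms(5) pr_piece[OF assms(1,6)] pr_closed[OF assms(1,6)] by blast
  have "\<phi> v = (\<Oplus>\<^bsub>W\<^esub>g\<in>carrier G. \<phi> (pr X g v))"
    by (subst pr_decomposition(2)[OF assms(1,6)],
        rule linear_finsum[OF X.module_axioms W.module_axioms assms(3) finite_G cl])
  also have "\<dots> = (\<Oplus>\<^bsub>W\<^esub>g\<in>carrier G. \<psi> (pr X g v))"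
    using cl is_linear_closed[OF assms(4)] by (intro W.M.finsum_cong') (auto simp: eq)
  also have "\<dots> = \<psi> v"
    by (subst (2) pr_decomposition(2)[OF assms(1,6)],
        rule linear_finsum[OF X.module_axioms W.module_axioms assms(4) finite_G cl, symmetric])
  finally show ?thesis .
qed

section \<open>Linear maps on a tensor product, tested on homogeneous pure tensors\<close>

lemma tv_bilinear: "gs X \<Longrightarrow> gs Y \<Longrightarrow> is_bilinear K (space X) (space Y) (space (X \<otimes>\<^sub>V Y)) (tv X Y)"
  unfolding space_tensor by (rule tvec_bilinear[OF gs_fd gs_fd])

lemma fd_tensor: "gs X \<Longrightarrow> gs Y \<Longrightarrow> fd_space K (space (X \<otimes>\<^sub>V Y))"
  unfolding space_tensor by (rule tspace_fd[OF gs_fd gs_fd])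

lemma tv_closed: "gs X \<Longrightarrow> gs Y \<Longrightarrow> x \<in> car X \<Longrightarrow> y \<in> car Y \<Longrightarrow> tv X Y x y \<in> car (X \<otimes>\<^sub>V Y)"
  by (rule is_bilinear_closed[OF tv_bilinear])

lemma tv_smult_left:
  "gs X \<Longrightarrow> gs Y \<Longrightarrow> c \<in> carrier K \<Longrightarrow> x \<in> car X \<Longrightarrow> y \<in> car Y \<Longrightarrow>
   tv X Y (c \<odot>\<^bsub>space X\<^esub> x) y = c \<odot>\<^bsub>space (X \<otimes>\<^sub>V Y)\<^esub> tv X Y x y"
  using is_linear_smult[OF is_bilinear_left[OF tv_bilinear]] by metis

lemma tv_smult_right:
  "gs X \<Longrightarrow> gs Y \<Longrightarrow> c \<in> carrier K \<Longrightarrow> x \<in> car X \<Longrightarrow> y \<in> car Y \<Longrightarrow>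
   tv X Y x (c \<odot>\<^bsub>space Y\<^esub> y) = c \<odot>\<^bsub>space (X \<otimes>\<^sub>V Y)\<^esub> tv X Y x y"
  using is_linear_smult[OF is_bilinear_right[OF tv_bilinear]] by metis

lemma linear_tv_left: "gs X \<Longrightarrow> gs Y \<Longrightarrow> y \<in> car Y \<Longrightarrow> lin X (X \<otimes>\<^sub>V Y) (\<lambda>x. tv X Y x y)"
  by (rule is_bilinear_left[OF tv_bilinear])

lemma linear_tv_right: "gs X \<Longrightarrow> gs Y \<Longrightarrow> x \<in> car X \<Longrightarrow> lin Y (X \<otimes>\<^sub>V Y) (tv X Y x)"
  by (rule is_bilinear_right[OF tv_bilinear])

text \<open>Agreement spreads from homogeneous \<open>y\<close> to all \<open>y\<close>, then from
  homogeneous \<open>x\<close> to all \<open>x\<close>. Both maps then solve the same universal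
  problem, the one for the bilinear map induced by \<open>\<psi>\<close>, and so coincide.\<close>

lemma tensor_linear_eqI:
  assumes X: "gs X" and Y: "gs Y" and W: "fd_space K W"
    and \<phi>: "is_linear K (space (X \<otimes>\<^sub>V Y)) W \<phi>" and \<psi>: "is_linear K (space (X \<otimes>\<^sub>V Y)) W \<psi>"
    and eq: "\<And>g h x y. \<lbrakk>g \<in> carrier G; h \<in> carrier G; x \<in> piece X g; y \<in> piece Y h;
           x \<in> car X; y \<in> car Y\<rbrakk> \<Longrightarrow> \<phi> (tv X Y x y) = \<psi> (tv X Y x y)"
    and t: "t \<in> car (X \<otimes>\<^sub>V Y)"
  shows "\<phi> t = \<psi> t"
proof -
  let ?XY = "space (X \<otimes>\<^sub>V Y)"
  have XY: "module K ?XY" by (rule fd_module[OF fd_tensor[OF X Y]])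
  have bil: "is_bilinear K (space X) (space Y) W (\<lambda>x y. \<phi> (tv X Y x y))"
    if "is_linear K ?XY W \<phi>" for \<phi>
    using is_bilinear_comp[OF tv_bilinear[OF X Y] is_linear_id is_linear_id that] .
  note bil = bil[OF \<phi>] bil[OF \<psi>]
  have 1: "\<phi> (tv X Y x y) = \<psi> (tv X Y x y)" if g: "g \<in> carrier G" "x \<in> piece X g" and y: "y \<in> car Y" for g x y
  proof (rule linear_eq_on_pieces[OF Y fd_module[OF W] _ _ _ y])
    have x: "x \<in> car X" using g X by (simp add: piece_car)
    show "is_linear K (space Y) W (\<lambda>y. \<phi> (tv X Y x y))" "is_linear K (space Y) W (\<lambda>y. \<psi> (tv X Y x y))"
      using bil x by (auto intro: is_bilinear_right)
  qed (use g eq X in \<open>auto simp: piece_car\<close>)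
  have 2: "\<phi> (tv X Y x y) = \<psi> (tv X Y x y)" if x: "x \<in> car X" and y: "y \<in> car Y" for x y
    by (rule linear_eq_on_pieces[OF X fd_module[OF W] _ _ _ x])
       (use 1 y is_bilinear_left[OF bil(1) y] is_bilinear_left[OF bil(2) y] in auto)
  have "\<exists>!\<chi>. \<chi> \<in> Lin K ?XY W \<and> (\<forall>x \<in> car X. \<forall>y \<in> car Y. \<chi> (tv X Y x y) = \<psi> (tv X Y x y))"
    unfolding space_tensor by (rule tensor_universal[OF gs_fd[OF X] gs_fd[OF Y] W bil(2)])
  moreover have "restrict \<phi> (carrier ?XY) \<in> Lin K ?XY W" "restrict \<psi> (carrier ?XY) \<in> Lin K ?XY W"
    by (rule Lin_restrict[OF XY \<phi>], rule Lin_restrict[OF XY \<psi>])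
  moreover have "\<forall>x \<in> car X. \<forall>y \<in> car Y. restrict \<phi> (carrier ?XY) (tv X Y x y) = \<psi> (tv X Y x y)"
      "\<forall>x \<in> car X. \<forall>y \<in> car Y. restrict \<psi> (carrier ?XY) (tv X Y x y) = \<psi> (tv X Y x y)"
    using 2 tv_closed[OF X Y] by auto
  ultimately have "restrict \<phi> (carrier ?XY) = restrict \<psi> (carrier ?XY)" by blast
  then show ?thesis using t by (metis restrict_apply')
qed

lemma bilinear_extension:
  assumes "gs X" "gs Y" "fd_space K W" "is_bilinear K (space X) (space Y) W b"
  obtains \<phi> where "\<phi> \<in> Lin K (space (X \<otimes>\<^sub>V Y)) W"
    and "\<And>x y. x \<in> car X \<Longrightarrow> y \<in> car Y \<Longrightarrow> \<phi> (tv X Y x y) = b x y"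
  using tensor_universal[OF gs_fd[OF assms(1)] gs_fd[OF assms(2)] assms(3,4)]
  unfolding space_tensor by blast

text \<open>The family \<open>b\<close> may prescribe a different bilinear map for each pair of
  degrees. Precomposing with projections and summing gives one bilinear map \<open>B\<close>, to
  which the universal property applies; uniqueness on homogeneous tensors identifies its extension
  with the description in \<open>tensor_lift\<close>.\<close>

lemma
  assumes X: "gs X" and Y: "gs Y" and W: "fd_space K W"
    and b: "\<And>g h. g \<in> carrier G \<Longrightarrow> h \<in> carrier G \<Longrightarrow> is_bilinear K (space X) (space Y) W (b g h)"
  shows tensor_lift_Lin: "tensor_lift G K T X Y W b \<in> Lin K (space (X \<otimes>\<^sub>V Y)) W"
    and tensor_lift_tv: "\<And>g h x y. \<lbrakk>g \<in> carrier G; h \<in> carrier G; x \<in> piece X g; y \<in> piece Y h\<rbrakk>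
           \<Longrightarrow> tensor_lift G K T X Y W b (tv X Y x y) = b g h x y"
proof -
  interpret W: module K W by (rule fd_module[OF W])
  \<comment> \<open>On homogeneous arguments of degrees \<open>g\<close> and \<open>h\<close> only
    the term \<open>b g h\<close> of the double sum survives.\<close>
  define B where "B = (\<lambda>x y. \<Oplus>\<^bsub>W\<^esub>g\<in>carrier G. \<Oplus>\<^bsub>W\<^esub>h\<in>carrier G. b g h (pr X g x) (pr Y h y))"
  have "is_bilinear K (space X) (space Y) W B"
    unfolding B_def
    by (intro is_bilinear_finsum W.module_axioms finite_G is_bilinear_comp2[OF b] pr_linear X Y)
  then obtain \<phi> where \<phi>: "\<phi> \<in> Lin K (space (X \<otimes>\<^sub>V Y)) W"
    "\<And>x y. x \<in> car X \<Longrightarrow> y \<in> car Y \<Longrightarrow> \<phi> (tv X Y x y) = B x y"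
    using bilinear_extension[OF X Y W] by blast
  have B: "B x y = b g h x y"
    if gh: "g \<in> carrier G" "h \<in> carrier G" "x \<in> piece X g" "y \<in> piece Y h" for g h x y
  proof -
    have xy: "x \<in> car X" "y \<in> car Y" using gh X Y by (auto simp: piece_car)
    have b0: "b g' h' x' y' \<in> carrier W" if "g' \<in> carrier G" "h' \<in> carrier G" "x' \<in> car X" "y' \<in> car Y"
      for g' h' x' y' using is_bilinear_closed[OF b] that by blast
    have z1: "b g' h' \<zero>\<^bsub>space X\<^esub> y' = \<zero>\<^bsub>W\<^esub>" if "g' \<in> carrier G" "h' \<in> carrier G" "y' \<in> car Y" for g' h' y'
      using is_linear_zero[OF gs_module[OF X] W.module_axioms is_bilinear_left[OF b]] that by blast
    have z2: "b g' h' x' \<zero>\<^bsub>space Y\<^esub> = \<zero>\<^bsub>W\<^esub>" if "g' \<in> carrier G" "h' \<in> carrier G" "x' \<in> car X" for g' h' x'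
      using is_linear_zero[OF gs_module[OF Y] W.module_axioms is_bilinear_right[OF b]] that by blast
    have inner: "(\<Oplus>\<^bsub>W\<^esub>h'\<in>carrier G. b g' h' (pr X g' x) (pr Y h' y)) =
        (if g' = g then b g h x y else \<zero>\<^bsub>W\<^esub>)" if g': "g' \<in> carrier G" for g'
    proof -
      have "(\<Oplus>\<^bsub>W\<^esub>h'\<in>carrier G. b g' h' (pr X g' x) (pr Y h' y)) =
          (\<Oplus>\<^bsub>W\<^esub>h'\<in>carrier G. if h' = h then (if g' = g then b g h x y else \<zero>\<^bsub>W\<^esub>) else \<zero>\<^bsub>W\<^esub>)"
        using g' gh xy X Y
        by (intro W.M.finsum_cong')
           (auto simp: pr_homogeneous[OF X g' gh(1,3)] pr_homogeneous[OF Y _ gh(2,4)] b0 z1 z2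
              gs_zero_closed)
      also have "\<dots> = (if g' = g then b g h x y else \<zero>\<^bsub>W\<^esub>)"
        using gh xy b0 by (intro finsum_delta[OF W.module_axioms]) auto
      finally show ?thesis .
    qed
    have "B x y = (\<Oplus>\<^bsub>W\<^esub>g'\<in>carrier G. if g' = g then b g h x y else \<zero>\<^bsub>W\<^esub>)"
      unfolding B_def using gh xy b0 by (intro W.M.finsum_cong') (auto simp: inner)
    also have "\<dots> = b g h x y"
      using gh xy b0 by (intro finsum_delta[OF W.module_axioms]) auto
    finally show ?thesis .
  qed
  have val: "\<phi> (tv X Y x y) = b g h x y"
    if "g \<in> carrier G" "h \<in> carrier G" "x \<in> piece X g" "y \<in> piece Y h" for g h x y
    using that \<phi>(2) B X Y by (simp add: piece_car)
  have "tensor_lift G K T X Y W b = \<phi>"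
    unfolding tensor_lift_def space_tensor[symmetric]
  proof (rule the_equality)
    fix \<psi> assume \<psi>: "\<psi> \<in> Lin K (space (X \<otimes>\<^sub>V Y)) W \<and>
      (\<forall>g \<in> carrier G. \<forall>h \<in> carrier G. \<forall>x \<in> piece X g. \<forall>y \<in> piece Y h. \<psi> (tv X Y x y) = b g h x y)"
    show "\<psi> = \<phi>"
    proof (rule Lin_eqI[of _ K "space (X \<otimes>\<^sub>V Y)" W _ W])
      show "\<psi> v = \<phi> v" if "v \<in> car (X \<otimes>\<^sub>V Y)" for v
        by (rule tensor_linear_eqI[OF X Y W _ _ _ that]) (use \<psi> \<phi>(1) val in \<open>auto simp: Lin_iff\<close>)
    qed (use \<psi> \<phi> in auto)
  qed (use \<phi> val in auto)
  then show "tensor_lift G K T X Y W b \<in> Lin K (space (X \<otimes>\<^sub>V Y)) W"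
    and "\<And>g h x y. \<lbrakk>g \<in> carrier G; h \<in> carrier G; x \<in> piece X g; y \<in> piece Y h\<rbrakk>
           \<Longrightarrow> tensor_lift G K T X Y W b (tv X Y x y) = b g h x y"
    using \<phi> val by auto
qed

lemma tv_piece:
  assumes "gs X" "gs Y" "f \<in> carrier G" "h \<in> carrier G" "x \<in> piece X f" "y \<in> piece Y h"
  shows "tv X Y x y \<in> piece (X \<otimes>\<^sub>V Y) (f \<otimes>\<^bsub>G\<^esub> h)"
  unfolding graded_tensor_def using assms by (auto intro!: subsetD[OF lin_span_superset])

text \<open>Uniqueness in the universal property only compares two maps. Containment in a submodule
  needs that pure tensors span, which is \<open>tensor_generated\<close>; homogeneous ones suffice
  because each factor is the sum of its pieces.\<close>

lemma tensor_image:
  assumes X: "gs X" and Y: "gs Y" and W: "module K W" and \<phi>: "is_linear K (space (X \<otimes>\<^sub>V Y)) W \<phi>"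
    and N: "submodule N K W"
    and img: "\<And>f h x y. \<lbrakk>f \<in> carrier G; h \<in> carrier G; x \<in> piece X f; y \<in> piece Y h;
           x \<in> car X; y \<in> car Y\<rbrakk> \<Longrightarrow> \<phi> (tv X Y x y) \<in> N"
    and t: "t \<in> car (X \<otimes>\<^sub>V Y)"
  shows "\<phi> t \<in> N"
proof -
  let ?M = "{v \<in> car (X \<otimes>\<^sub>V Y). \<phi> v \<in> N}"
  have M: "submodule ?M K (space (X \<otimes>\<^sub>V Y))"
    by (rule submodule_preimage[OF fd_module[OF fd_tensor[OF X Y]] W \<phi> N])
  have generated: "car Z \<subseteq> P" if "gs Z" "submodule P K (space Z)" "\<And>g z. g \<in> carrier G \<Longrightarrow> z \<in> piece Z g \<Longrightarrow> z \<in> P" for Z P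
  proof
    fix z assume z: "z \<in> car Z"
    then have "(\<lambda>g. pr Z g z) \<in> carrier G \<rightarrow> P" using that pr_piece by blast
    from submodule_finsum[OF gs_module[OF that(1)] that(2) finite_G this]
    show "z \<in> P" using pr_decomposition(2)[OF that(1) z] by simp
  qed
  have 1: "tv X Y x y \<in> ?M" if "g \<in> carrier G" "x \<in> piece X g" "y \<in> car Y" for g x y
  proof -
    have "x \<in> car X" using that X by (simp add: piece_car)
    note lin = linear_tv_right[OF X Y this]
    have "car Y \<subseteq> {y \<in> car Y. tv X Y x y \<in> ?M}"
      by (rule generated[OF Y submodule_preimage[OF gs_module[OF Y] fd_module[OF fd_tensor[OF X Y]] lin M]])
         (use that X Y img in \<open>auto simp: piece_car tv_closed\<close>)
    then show ?thesis using that by blast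
  qed
  have 2: "tv X Y x y \<in> ?M" if "x \<in> car X" "y \<in> car Y" for x y
  proof -
    note lin = linear_tv_left[OF X Y that(2)]
    have "car X \<subseteq> {x \<in> car X. tv X Y x y \<in> ?M}"
      by (rule generated[OF X submodule_preimage[OF gs_module[OF X] fd_module[OF fd_tensor[OF X Y]] lin M]])
         (use 1 that X in \<open>auto simp: piece_car\<close>)
    then show ?thesis using that by blast
  qed
  have "car (X \<otimes>\<^sub>V Y) \<subseteq> ?M"
    using M 2 unfolding space_tensor by (intro tensor_generated gs_fd X Y) auto
  then show ?thesis using t by blast
qed

text \<open>By definition the piece of degree \<open>k\<close> is a span of pure tensors, so its
  generators suffice.\<close>

lemma tensor_piece_image:
  assumes X: "gs X" and Y: "gs Y" and "module K W" "is_linear K (space (X \<otimes>\<^sub>V Y)) W \<phi>"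
    and "submodule N K W" "k \<in> carrier G" "t \<in> piece (X \<otimes>\<^sub>V Y) k"
    and img: "\<And>f h x y. \<lbrakk>f \<in> carrier G; h \<in> carrier G; f \<otimes>\<^bsub>G\<^esub> h = k; x \<in> piece X f; y \<in> piece Y h;
           x \<in> car X; y \<in> car Y\<rbrakk> \<Longrightarrow> \<phi> (tv X Y x y) \<in> N"
  shows "\<phi> t \<in> N"
proof (rule lin_span_image[OF fd_module[OF fd_tensor[OF X Y]] assms(3-5)])
  let ?S = "{tv X Y x y | x y f h. f \<in> carrier G \<and> h \<in> carrier G \<and> f \<otimes>\<^bsub>G\<^esub> h = k \<and> x \<in> piece X f \<and> y \<in> piece Y h}"
  show "?S \<subseteq> car (X \<otimes>\<^sub>V Y)" using X Y by (auto simp: tv_closed piece_car)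
  show "\<phi> s \<in> N" if "s \<in> ?S" for s using that img X Y piece_car by blast
  show "t \<in> lin_span K (space (X \<otimes>\<^sub>V Y)) ?S"
    using assms(6,7) by (simp add: graded_tensor_def)
qed

lemma gs_tensor:
  assumes X: "gs X" and Y: "gs Y"
  shows "gs (X \<otimes>\<^sub>V Y)"
proof -
  let ?V = "space (X \<otimes>\<^sub>V Y)"
  \<comment> \<open>The projection onto degree \<open>k\<close>: it keeps homogeneous pure tensors
    of total degree \<open>k\<close> and kills the others.\<close>
  define P where "P = (\<lambda>k. tensor_lift G K T X Y ?V (\<lambda>g h x y. if g \<otimes>\<^bsub>G\<^esub> h = k then tv X Y x y else \<zero>\<^bsub>?V\<^esub>))"
  note fd = fd_tensor[OF X Y]
  interpret V: module K ?V by (rule fd_module[OF fd])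
  have bil: "is_bilinear K (space X) (space Y) ?V
      (\<lambda>x y. if g \<otimes>\<^bsub>G\<^esub> h = k then tv X Y x y else \<zero>\<^bsub>?V\<^esub>)" for g h k
    using tv_bilinear[OF X Y] is_bilinear_null[OF V.module_axioms] by (cases "g \<otimes>\<^bsub>G\<^esub> h = k") auto
  have P: "is_linear K ?V ?V (P k)" for k
    using tensor_lift_Lin[OF X Y fd bil] by (simp add: P_def Lin_iff)
  have P_tv: "P k (tv X Y x y) = (if g \<otimes>\<^bsub>G\<^esub> h = k then tv X Y x y else \<zero>\<^bsub>?V\<^esub>)"
    if "g \<in> carrier G" "h \<in> carrier G" "x \<in> piece X g" "y \<in> piece Y h" for g h x y k
    unfolding P_def by (rule tensor_lift_tv[OF X Y fd bil that])
  have sub: "submodule (piece (X \<otimes>\<^sub>V Y) k) K ?V" if "k \<in> carrier G" for k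
  proof -
    let ?S = "{tv X Y x y | x y f h. f \<in> carrier G \<and> h \<in> carrier G \<and> f \<otimes>\<^bsub>G\<^esub> h = k \<and> x \<in> piece X f \<and> y \<in> piece Y h}"
    have "?S \<subseteq> carrier ?V" using X Y by (auto simp: tv_closed piece_car)
    from lin_span_submodule[OF V.module_axioms this] show ?thesis
      using that by (simp add: graded_tensor_def)
  qed
  show ?thesis
  proof (rule graded_spaceI[where P = P])
    fix k v assume k: "k \<in> carrier G" and v: "v \<in> car (X \<otimes>\<^sub>V Y)"
    show "P k v \<in> piece (X \<otimes>\<^sub>V Y) k"
      by (rule tensor_image[OF X Y V.module_axioms P sub[OF k] _ v])
         (use k X Y submodule_zero[OF sub[OF k]] in \<open>auto simp: P_tv intro: tv_piece\<close>)
  next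
    fix v assume v: "v \<in> car (X \<otimes>\<^sub>V Y)"
    show "(\<Oplus>\<^bsub>?V\<^esub>k\<in>carrier G. P k v) = v"
    proof (rule tensor_linear_eqI[OF X Y fd _ _ _ v])
      show "is_linear K ?V ?V (\<lambda>v. \<Oplus>\<^bsub>?V\<^esub>k\<in>carrier G. P k v)"
        by (intro is_linear_finsum V.module_axioms finite_G P)
      fix g h x y assume *: "g \<in> carrier G" "h \<in> carrier G" "x \<in> piece X g" "y \<in> piece Y h"
        "x \<in> car X" "y \<in> car Y"
      have "(\<Oplus>\<^bsub>?V\<^esub>k\<in>carrier G. P k (tv X Y x y)) =
          (\<Oplus>\<^bsub>?V\<^esub>k\<in>carrier G. if k = g \<otimes>\<^bsub>G\<^esub> h then tv X Y x y else \<zero>\<^bsub>?V\<^esub>)"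
        using * tv_closed[OF X Y] by (intro V.M.finsum_cong') (auto simp: P_tv)
      also have "\<dots> = tv X Y x y"
        using * tv_closed[OF X Y] by (intro finsum_delta[OF V.module_axioms]) auto
      finally show "(\<Oplus>\<^bsub>?V\<^esub>k\<in>carrier G. P k (tv X Y x y)) = tv X Y x y" .
    qed (rule is_linear_id)
  next
    fix k l v assume *: "k \<in> carrier G" "l \<in> carrier G" "v \<in> piece (X \<otimes>\<^sub>V Y) l"
    show "P k v = (if k = l then v else \<zero>\<^bsub>?V\<^esub>)"
    proof -
      have Q: "is_linear K ?V ?V (\<lambda>v. if k = l then v else \<zero>\<^bsub>?V\<^esub>)"
        using is_linear_id is_linear_null[OF V.module_axioms] by (cases "k = l") auto
      \<comment> \<open>With the identity as the map and an equalizer as the target submodule,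
        \<open>tensor_piece_image\<close> becomes an equality principle.\<close>
      have "id v \<in> {v \<in> carrier ?V. P k v = (if k = l then v else \<zero>\<^bsub>?V\<^esub>)}"
        by (rule tensor_piece_image[OF X Y V.module_axioms _
              submodule_equalizer[OF V.module_axioms V.module_axioms P Q] *(2,3)])
           (use X Y in \<open>auto simp: P_tv tv_closed is_linear_id id_def\<close>)
      then show ?thesis by simp
    qed
  qed (use fd sub P in \<open>auto simp: graded_tensor_def\<close>)
qed
end

section \<open>The structural maps\<close>

context cocycle_setting
begin

text \<open>The underlying maps of the arrows from \<open>X\<close> to \<open>Y\<close> in
  \<open>VCat\<close>, without the recorded domain and codomain.\<close>

definition gm :: "('g, 'k, 'v) graded \<Rightarrow> ('g, 'k, 'v) graded \<Rightarrow> ('v \<Rightarrow> 'v) set" where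
  "gm X Y = {\<phi> \<in> Lin K (space X) (space Y). \<forall>g \<in> carrier G. \<phi> ` piece X g \<subseteq> piece Y g}"

lemma gm_Lin: "\<phi> \<in> gm X Y \<Longrightarrow> \<phi> \<in> Lin K (space X) (space Y)"
  by (simp add: gm_def)

lemma gm_lin: "\<phi> \<in> gm X Y \<Longrightarrow> lin X Y \<phi>"
  by (simp add: gm_def Lin_iff)

lemma gm_closed: "\<phi> \<in> gm X Y \<Longrightarrow> x \<in> car X \<Longrightarrow> \<phi> x \<in> car Y"
  by (rule is_linear_closed[OF gm_lin])

lemma gm_piece: "\<phi> \<in> gm X Y \<Longrightarrow> g \<in> carrier G \<Longrightarrow> x \<in> piece X g \<Longrightarrow> \<phi> x \<in> piece Y g"
  by (auto simp: gm_def)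

lemma gm_smult:
  "\<phi> \<in> gm X Y \<Longrightarrow> c \<in> carrier K \<Longrightarrow> x \<in> car X \<Longrightarrow> \<phi> (c \<odot>\<^bsub>space X\<^esub> x) = c \<odot>\<^bsub>space Y\<^esub> \<phi> x"
  by (rule is_linear_smult[OF gm_lin])

lemma gmI:
  assumes "gs X" "lin X Y \<phi>" "\<phi> \<in> extensional (car X)"
    and "\<And>g x. g \<in> carrier G \<Longrightarrow> x \<in> piece X g \<Longrightarrow> x \<in> car X \<Longrightarrow> \<phi> x \<in> piece Y g"
  shows "\<phi> \<in> gm X Y"
  using assms by (auto simp: gm_def Lin_iff piece_car)

lemma gm_restrictI:
  assumes "gs X" "lin X Y \<phi>"
    and "\<And>g x. g \<in> carrier G \<Longrightarrow> x \<in> piece X g \<Longrightarrow> x \<in> car X \<Longrightarrow> \<phi> x \<in> piece Y g"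
  shows "restrict \<phi> (car X) \<in> gm X Y"
  using assms by (intro gmI) (auto simp: gs_module)

lemma gm_eqI:
  "\<phi> \<in> gm X Y \<Longrightarrow> \<psi> \<in> gm X Y' \<Longrightarrow> (\<And>x. x \<in> car X \<Longrightarrow> \<phi> x = \<psi> x) \<Longrightarrow> \<phi> = \<psi>"
  by (rule Lin_eqI[OF gm_Lin gm_Lin])

lemma gm_id: "gs X \<Longrightarrow> (\<lambda>x \<in> car X. x) \<in> gm X X"
  by (rule gm_restrictI) (auto intro: is_linear_id)

lemma gm_compose:
  assumes "gs X" "\<phi> \<in> gm X Y" "\<psi> \<in> gm Y Z"
  shows "compose (car X) \<psi> \<phi> \<in> gm X Z"
  using gm_restrictI[OF assms(1) is_linear_comp[OF gm_lin[OF assms(2)] gm_lin[OF assms(3)]]]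
    gm_piece[OF assms(2)] gm_piece[OF assms(3)]
  by (simp add: compose_def)

lemma tensor_lift_gm:
  assumes X: "gs X" and Y: "gs Y" and Z: "gs Z"
    and b: "\<And>g h. g \<in> carrier G \<Longrightarrow> h \<in> carrier G \<Longrightarrow> is_bilinear K (space X) (space Y) (space Z) (b g h)"
    and deg: "\<And>g h x y. \<lbrakk>g \<in> carrier G; h \<in> carrier G; x \<in> piece X g; y \<in> piece Y h;
      x \<in> car X; y \<in> car Y\<rbrakk> \<Longrightarrow> b g h x y \<in> piece Z (g \<otimes>\<^bsub>G\<^esub> h)"
  shows "tensor_lift G K T X Y (space Z) b \<in> gm (X \<otimes>\<^sub>V Y) Z"
proof -
  note L = tensor_lift_Lin[OF X Y gs_fd[OF Z] b]
  note V = tensor_lift_tv[OF X Y gs_fd[OF Z] b]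
  have lin: "lin (X \<otimes>\<^sub>V Y) Z (tensor_lift G K T X Y (space Z) b)" using L by (simp add: Lin_iff)
  show ?thesis
  proof (rule gmI[OF gs_tensor[OF X Y] lin])
    fix k t assume k: "k \<in> carrier G" and t: "t \<in> piece (X \<otimes>\<^sub>V Y) k"
    show "tensor_lift G K T X Y (space Z) b t \<in> piece Z k"
      by (rule tensor_piece_image[OF X Y gs_module[OF Z] lin piece_submodule[OF Z k] k t])
         (use V deg in auto)
  qed (use L in \<open>simp add: Lin_iff\<close>)
qed

text \<open>For a family that does not depend on the degrees the lift is the ordinary extension of
  \<open>b\<close>, so its value is known on inhomogeneous tensors as well.\<close>

lemma tensor_lift_bilinear:
  assumes "gs X" "gs Y" "fd_space K W" "is_bilinear K (space X) (space Y) W b" "x \<in> car X" "y \<in> car Y"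
  shows "tensor_lift G K T X Y W (\<lambda>g h. b) (tv X Y x y) = b x y"
proof -
  obtain \<phi> where \<phi>: "\<phi> \<in> Lin K (space (X \<otimes>\<^sub>V Y)) W"
    "\<And>x y. x \<in> car X \<Longrightarrow> y \<in> car Y \<Longrightarrow> \<phi> (tv X Y x y) = b x y"
    using bilinear_extension[OF assms(1-4)] by blast
  have "tensor_lift G K T X Y W (\<lambda>g h. b) (tv X Y x y) = \<phi> (tv X Y x y)"
    by (rule tensor_linear_eqI[OF assms(1-3) _ _ _ tv_closed[OF assms(1,2,5,6)]])
       (use tensor_lift_Lin[OF assms(1-4)] tensor_lift_tv[OF assms(1-4)] \<phi> in \<open>auto simp: Lin_iff\<close>)
  then show ?thesis using \<phi>(2) assms by simp
qed

abbreviation tm where "tm \<equiv> tensor_map G K T"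

lemma tm_bilinear:
  assumes "gs Y" "gs Y'" "\<phi> \<in> gm X Y" "\<phi>' \<in> gm X' Y'"
  shows "is_bilinear K (space X) (space X') (space (Y \<otimes>\<^sub>V Y')) (\<lambda>x x'. tv Y Y' (\<phi> x) (\<phi>' x'))"
  by (rule is_bilinear_comp2[OF tv_bilinear[OF assms(1,2)] gm_lin[OF assms(3)] gm_lin[OF assms(4)]])

lemma tm_gm:
  assumes "gs X" "gs X'" "gs Y" "gs Y'" "\<phi> \<in> gm X Y" "\<phi>' \<in> gm X' Y'"
  shows "tm X Y \<phi> X' Y' \<phi>' \<in> gm (X \<otimes>\<^sub>V X') (Y \<otimes>\<^sub>V Y')"
  unfolding tensor_map_def space_tensor[symmetric]
  by (rule tensor_lift_gm[OF assms(1,2) gs_tensor[OF assms(3,4)] tm_bilinear[OF assms(3-6)]])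
     (simp add: assms tv_piece gm_piece[OF assms(5)] gm_piece[OF assms(6)])

lemma tm_tv:
  assumes "gs X" "gs X'" "gs Y" "gs Y'" "\<phi> \<in> gm X Y" "\<phi>' \<in> gm X' Y'" "x \<in> car X" "x' \<in> car X'"
  shows "tm X Y \<phi> X' Y' \<phi>' (tv X X' x x') = tv Y Y' (\<phi> x) (\<phi>' x')"
  unfolding tensor_map_def space_tensor[symmetric]
  by (rule tensor_lift_bilinear[OF assms(1,2) gs_fd[OF gs_tensor[OF assms(3,4)]] tm_bilinear[OF assms(3-6)] assms(7,8)])

text \<open>Maps on threefold tensors are lifts of lifts. For the outer lift to exist, the inner one
  must depend linearly on the outer variable, which is checked here on homogeneous tensors.\<close>

lemma tensor_lift_parameter:
  assumes X: "gs X" and Y: "gs Y" and W: "fd_space K W" and V: "module K V"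
    and b: "\<And>v g h. v \<in> carrier V \<Longrightarrow> g \<in> carrier G \<Longrightarrow> h \<in> carrier G \<Longrightarrow>
          is_bilinear K (space X) (space Y) W (b v g h)"
    and lin: "\<And>g h x y. g \<in> carrier G \<Longrightarrow> h \<in> carrier G \<Longrightarrow> x \<in> car X \<Longrightarrow> y \<in> car Y \<Longrightarrow>
          is_linear K V W (\<lambda>v. b v g h x y)"
    and t: "t \<in> car (X \<otimes>\<^sub>V Y)"
  shows "is_linear K V W (\<lambda>v. tensor_lift G K T X Y W (b v) t)"
proof -
  interpret V: module K V by fact
  interpret W: module K W by (rule fd_module[OF W])
  let ?L = "\<lambda>v. tensor_lift G K T X Y W (b v)"
  have L: "is_linear K (space (X \<otimes>\<^sub>V Y)) W (?L v)" if "v \<in> carrier V" for v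
    using tensor_lift_Lin[OF X Y W b[OF that]] by (simp add: Lin_iff)
  note tv = tensor_lift_tv[OF X Y W b]
  have plus: "is_linear K (space (X \<otimes>\<^sub>V Y)) W (\<lambda>t. \<phi> t \<oplus>\<^bsub>W\<^esub> \<psi> t)"
    if "is_linear K (space (X \<otimes>\<^sub>V Y)) W \<phi>" "is_linear K (space (X \<otimes>\<^sub>V Y)) W \<psi>" for \<phi> \<psi>
    using that by (auto simp: is_linear_def Pi_iff W.smult_r_distr W.M.a_ac)
  show ?thesis
    unfolding is_linear_def
  proof (intro conjI ballI funcsetI)
    fix v assume v: "v \<in> carrier V"
    show "?L v t \<in> carrier W" by (rule is_linear_closed[OF L[OF v] t])
    fix u assume u: "u \<in> carrier V"
    show "?L (v \<oplus>\<^bsub>V\<^esub> u) t = ?L v t \<oplus>\<^bsub>W\<^esub> ?L u t"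
      by (rule tensor_linear_eqI[OF X Y W L plus[OF L L] _ t])
         (use u v is_linear_add[OF lin] in \<open>auto simp: tv\<close>)
  next
    fix c v assume cv: "c \<in> carrier K" "v \<in> carrier V"
    show "?L (c \<odot>\<^bsub>V\<^esub> v) t = c \<odot>\<^bsub>W\<^esub> ?L v t"
      by (rule tensor_linear_eqI[OF X Y W L is_linear_scale[OF W.module_axioms cv(1) L] _ t])
         (use cv is_linear_smult[OF lin] in \<open>auto simp: tv\<close>)
  qed
qed

text \<open>With the outer factor fixed, both maps become linear in the inner tensor, so the
  criterion for two factors applies twice.\<close>

lemma tensor3_right_eqI:
  assumes X: "gs X" and Y: "gs Y" and Z: "gs Z" and W: "fd_space K W"
    and \<phi>: "is_linear K (space (X \<otimes>\<^sub>V (Y \<otimes>\<^sub>V Z))) W \<phi>" and \<psi>: "is_linear K (space (X \<otimes>\<^sub>V (Y \<otimes>\<^sub>V Z))) W \<psi>"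
    and eq: "\<And>f g h x y z. \<lbrakk>f \<in> carrier G; g \<in> carrier G; h \<in> carrier G; x \<in> piece X f; y \<in> piece Y g;
           z \<in> piece Z h; x \<in> car X; y \<in> car Y; z \<in> car Z\<rbrakk>
           \<Longrightarrow> \<phi> (tv X (Y \<otimes>\<^sub>V Z) x (tv Y Z y z)) = \<psi> (tv X (Y \<otimes>\<^sub>V Z) x (tv Y Z y z))"
    and t: "t \<in> car (X \<otimes>\<^sub>V (Y \<otimes>\<^sub>V Z))"
  shows "\<phi> t = \<psi> t"
proof (rule tensor_linear_eqI[OF X gs_tensor[OF Y Z] W \<phi> \<psi> _ t])
  fix f k x s assume *: "f \<in> carrier G" "x \<in> piece X f" "x \<in> car X" "s \<in> car (Y \<otimes>\<^sub>V Z)"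
  note lin = is_linear_comp[OF linear_tv_right[OF X gs_tensor[OF Y Z] *(3)]]
  show "\<phi> (tv X (Y \<otimes>\<^sub>V Z) x s) = \<psi> (tv X (Y \<otimes>\<^sub>V Z) x s)"
    by (rule tensor_linear_eqI[OF Y Z W lin[OF \<phi>] lin[OF \<psi>] _ *(4)]) (use * eq in auto)
qed

lemma tensor3_left_eqI:
  assumes X: "gs X" and Y: "gs Y" and Z: "gs Z" and W: "fd_space K W"
    and \<phi>: "is_linear K (space ((X \<otimes>\<^sub>V Y) \<otimes>\<^sub>V Z)) W \<phi>" and \<psi>: "is_linear K (space ((X \<otimes>\<^sub>V Y) \<otimes>\<^sub>V Z)) W \<psi>"
    and eq: "\<And>f g h x y z. \<lbrakk>f \<in> carrier G; g \<in> carrier G; h \<in> carrier G; x \<in> piece X f; y \<in> piece Y g;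
           z \<in> piece Z h; x \<in> car X; y \<in> car Y; z \<in> car Z\<rbrakk>
           \<Longrightarrow> \<phi> (tv (X \<otimes>\<^sub>V Y) Z (tv X Y x y) z) = \<psi> (tv (X \<otimes>\<^sub>V Y) Z (tv X Y x y) z)"
    and t: "t \<in> car ((X \<otimes>\<^sub>V Y) \<otimes>\<^sub>V Z)"
  shows "\<phi> t = \<psi> t"
proof (rule tensor_linear_eqI[OF gs_tensor[OF X Y] Z W \<phi> \<psi> _ t])
  fix h k z s assume *: "h \<in> carrier G" "z \<in> piece Z h" "z \<in> car Z" "s \<in> car (X \<otimes>\<^sub>V Y)"
  note lin = is_linear_comp[OF linear_tv_left[OF gs_tensor[OF X Y] Z *(3)]]
  show "\<phi> (tv (X \<otimes>\<^sub>V Y) Z s z) = \<psi> (tv (X \<otimes>\<^sub>V Y) Z s z)"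
    by (rule tensor_linear_eqI[OF X Y W lin[OF \<phi>] lin[OF \<psi>] _ *(4)]) (use * eq in auto)
qed

lemma tensor4_right_eqI:
  assumes X: "gs X" and Y: "gs Y" and Z: "gs Z" and U: "gs U" and W: "fd_space K W"
    and \<phi>: "is_linear K (space (X \<otimes>\<^sub>V (Y \<otimes>\<^sub>V (Z \<otimes>\<^sub>V U)))) W \<phi>"
    and \<psi>: "is_linear K (space (X \<otimes>\<^sub>V (Y \<otimes>\<^sub>V (Z \<otimes>\<^sub>V U)))) W \<psi>"
    and eq: "\<And>f g h l x y z u. \<lbrakk>f \<in> carrier G; g \<in> carrier G; h \<in> carrier G; l \<in> carrier G;
           x \<in> piece X f; y \<in> piece Y g; z \<in> piece Z h; u \<in> piece U l;
           x \<in> car X; y \<in> car Y; z \<in> car Z; u \<in> car U\<rbrakk>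
           \<Longrightarrow> \<phi> (tv X (Y \<otimes>\<^sub>V (Z \<otimes>\<^sub>V U)) x (tv Y (Z \<otimes>\<^sub>V U) y (tv Z U z u))) =
               \<psi> (tv X (Y \<otimes>\<^sub>V (Z \<otimes>\<^sub>V U)) x (tv Y (Z \<otimes>\<^sub>V U) y (tv Z U z u)))"
    and t: "t \<in> car (X \<otimes>\<^sub>V (Y \<otimes>\<^sub>V (Z \<otimes>\<^sub>V U)))"
  shows "\<phi> t = \<psi> t"
proof (rule tensor_linear_eqI[OF X gs_tensor[OF Y gs_tensor[OF Z U]] W \<phi> \<psi> _ t])
  fix f k x s assume *: "f \<in> carrier G" "x \<in> piece X f" "x \<in> car X" "s \<in> car (Y \<otimes>\<^sub>V (Z \<otimes>\<^sub>V U))"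
  note lin = is_linear_comp[OF linear_tv_right[OF X gs_tensor[OF Y gs_tensor[OF Z U]] *(3)]]
  show "\<phi> (tv X (Y \<otimes>\<^sub>V (Z \<otimes>\<^sub>V U)) x s) = \<psi> (tv X (Y \<otimes>\<^sub>V (Z \<otimes>\<^sub>V U)) x s)"
    by (rule tensor3_right_eqI[OF Y Z U W lin[OF \<phi>] lin[OF \<psi>] _ *(4)]) (use * eq in auto)
qed

section \<open>The associativity constraint and its inverse\<close>

lemma \<alpha>_Units [simp]: "f \<in> carrier G \<Longrightarrow> g \<in> carrier G \<Longrightarrow> h \<in> carrier G \<Longrightarrow> \<alpha> f g h \<in> Units K"
  using cocycle by (simp add: normalised_3_cocycle_def)

lemma \<alpha>_closed [simp]: "f \<in> carrier G \<Longrightarrow> g \<in> carrier G \<Longrightarrow> h \<in> carrier G \<Longrightarrow> \<alpha> f g h \<in> carrier K"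
  by (simp add: K.Units_closed)

lemma \<alpha>_cocycle:
  "\<lbrakk>f \<in> carrier G; g \<in> carrier G; h \<in> carrier G; l \<in> carrier G\<rbrakk> \<Longrightarrow>
   \<alpha> g h l \<otimes>\<^bsub>K\<^esub> \<alpha> f (g \<otimes>\<^bsub>G\<^esub> h) l \<otimes>\<^bsub>K\<^esub> \<alpha> f g h = \<alpha> (f \<otimes>\<^bsub>G\<^esub> g) h l \<otimes>\<^bsub>K\<^esub> \<alpha> f g (h \<otimes>\<^bsub>G\<^esub> l)"
  using cocycle by (simp add: normalised_3_cocycle_def)

lemma \<alpha>_normalised [simp]:
  "g \<in> carrier G \<Longrightarrow> h \<in> carrier G \<Longrightarrow> \<alpha> \<one>\<^bsub>G\<^esub> g h = \<one>\<^bsub>K\<^esub>"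
  "g \<in> carrier G \<Longrightarrow> h \<in> carrier G \<Longrightarrow> \<alpha> g \<one>\<^bsub>G\<^esub> h = \<one>\<^bsub>K\<^esub>"
  "g \<in> carrier G \<Longrightarrow> h \<in> carrier G \<Longrightarrow> \<alpha> g h \<one>\<^bsub>G\<^esub> = \<one>\<^bsub>K\<^esub>"
  using cocycle G.one_closed unfolding normalised_3_cocycle_def by blast+

abbreviation am where "am \<equiv> assoc_map G K T \<alpha>"

text \<open>The inverse constraint as an explicit nested lift: the outer lift supplies the degree
  \<open>h\<close>, and the inner lift splits the tensor \<open>s\<close> into the degrees
  \<open>f\<close> and \<open>g\<close> on which the scalar depends.\<close>

definition am_inv :: "('g, 'k, 'v) graded \<Rightarrow> ('g, 'k, 'v) graded \<Rightarrow> ('g, 'k, 'v) graded \<Rightarrow> 'v \<Rightarrow> 'v" where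
  "am_inv X Y Z = tensor_lift G K T (X \<otimes>\<^sub>V Y) Z (space (X \<otimes>\<^sub>V (Y \<otimes>\<^sub>V Z)))
     (\<lambda>k h s z. tensor_lift G K T X Y (space (X \<otimes>\<^sub>V (Y \<otimes>\<^sub>V Z)))
       (\<lambda>f g x y. inv\<^bsub>K\<^esub> (\<alpha> f g h) \<odot>\<^bsub>space (X \<otimes>\<^sub>V (Y \<otimes>\<^sub>V Z))\<^esub> tv X (Y \<otimes>\<^sub>V Z) x (tv Y Z y z)) s)"

context
  fixes X Y Z :: "('g, 'k, 'v) graded"
  assumes X: "gs X" and Y: "gs Y" and Z: "gs Z"
begin

private abbreviation "S \<equiv> X \<otimes>\<^sub>V (Y \<otimes>\<^sub>V Z)"
private abbreviation "R \<equiv> (X \<otimes>\<^sub>V Y) \<otimes>\<^sub>V Z"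

text \<open>The description in \<open>assoc_map\<close> fixes values on homogeneous threefold
  tensors. Existence comes from the nested lift \<open>\<phi>\<close>, uniqueness from
  \<open>tensor3_right_eqI\<close>.\<close>

lemma am_facts:
  shows am_gm: "am X Y Z \<in> gm S R"
    and am_tv: "\<And>f g h x y z. \<lbrakk>f \<in> carrier G; g \<in> carrier G; h \<in> carrier G;
          x \<in> piece X f; y \<in> piece Y g; z \<in> piece Z h\<rbrakk> \<Longrightarrow>
          am X Y Z (tv X (Y \<otimes>\<^sub>V Z) x (tv Y Z y z)) = \<alpha> f g h \<odot>\<^bsub>space R\<^esub> tv (X \<otimes>\<^sub>V Y) Z (tv X Y x y) z"
proof -
  note YZ = gs_tensor[OF Y Z] and XY = gs_tensor[OF X Y]
  note R = gs_tensor[OF XY Z]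
  define b where "b = (\<lambda>f g h x y z. \<alpha> f g h \<odot>\<^bsub>space R\<^esub> tv (X \<otimes>\<^sub>V Y) Z (tv X Y x y) z)"
  have b1: "is_bilinear K (space Y) (space Z) (space R) (b f g h x)"
    if "f \<in> carrier G" "g \<in> carrier G" "h \<in> carrier G" "x \<in> car X" for f g h x
    unfolding b_def using that
    by (intro is_bilinear_scale gs_module R is_bilinear_comp2[OF tv_bilinear[OF XY Z] linear_tv_right[OF X Y] is_linear_id]) auto
  have b2: "lin X R (\<lambda>x. b f g h x y z)"
    if "f \<in> carrier G" "g \<in> carrier G" "h \<in> carrier G" "y \<in> car Y" "z \<in> car Z" for f g h y z
    unfolding b_def using that
    by (intro is_linear_scale gs_module R is_linear_comp[OF linear_tv_left[OF X Y] linear_tv_left[OF XY Z]]) auto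
  \<comment> \<open>The degree \<open>k\<close> of the inner tensor does not determine the scalar,
    which depends on \<open>g\<close> and \<open>h\<close> separately; the inner lift recovers
    them.\<close>
  define c where "c = (\<lambda>f (k :: 'g) x. tensor_lift G K T Y Z (space R) (\<lambda>g h. b f g h x))"
  have c_tv: "c f k x (tv Y Z y z) = b f g h x y z"
    if "f \<in> carrier G" "g \<in> carrier G" "h \<in> carrier G" "x \<in> car X" "y \<in> piece Y g" "z \<in> piece Z h"
    for f g h k x y z
    unfolding c_def by (rule tensor_lift_tv[OF Y Z gs_fd[OF R] b1]) (use that in auto)
  have c_Lin: "c f k x \<in> Lin K (space (Y \<otimes>\<^sub>V Z)) (space R)" if "f \<in> carrier G" "x \<in> car X" for f k x
    unfolding c_def by (rule tensor_lift_Lin[OF Y Z gs_fd[OF R] b1]) (use that in auto)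
  have c_bil: "is_bilinear K (space X) (space (Y \<otimes>\<^sub>V Z)) (space R) (c f k)" if "f \<in> carrier G" for f k
    unfolding is_bilinear_def
  proof (intro conjI ballI)
    fix x assume "x \<in> car X" then show "lin (Y \<otimes>\<^sub>V Z) R (\<lambda>t. c f k x t)"
      using c_Lin[OF that] by (simp add: Lin_iff)
  next
    fix t assume "t \<in> car (Y \<otimes>\<^sub>V Z)" then show "lin X R (\<lambda>x. c f k x t)"
      unfolding c_def
      by (intro tensor_lift_parameter[OF Y Z gs_fd[OF R] gs_module[OF X] b1 b2]) (use that in auto)
  qed
  define \<phi> where "\<phi> = tensor_lift G K T X (Y \<otimes>\<^sub>V Z) (space R) c"
  have \<phi>_tv1: "\<phi> (tv X (Y \<otimes>\<^sub>V Z) x t) = c f k x t"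
    if "f \<in> carrier G" "k \<in> carrier G" "x \<in> piece X f" "t \<in> piece (Y \<otimes>\<^sub>V Z) k" for f k x t
    unfolding \<phi>_def by (rule tensor_lift_tv[OF X YZ gs_fd[OF R] c_bil]) (use that in auto)
  have \<phi>: "\<phi> (tv X (Y \<otimes>\<^sub>V Z) x (tv Y Z y z)) = b f g h x y z"
    if "f \<in> carrier G" "g \<in> carrier G" "h \<in> carrier G" "x \<in> piece X f" "y \<in> piece Y g" "z \<in> piece Z h"
    for f g h x y z
    using that \<phi>_tv1[OF that(1) _ that(4) tv_piece[OF Y Z that(2,3,5,6)]] c_tv[OF that(1-3) piece_car[OF X that(1,4)] that(5,6)]
    by simp
  have gm: "\<phi> \<in> gm S R"
    unfolding \<phi>_def
  proof (rule tensor_lift_gm[OF X YZ R c_bil])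
    fix f k x t assume *: "f \<in> carrier G" "k \<in> carrier G" "x \<in> piece X f" "t \<in> piece (Y \<otimes>\<^sub>V Z) k" "x \<in> car X"
    have fk: "f \<otimes>\<^bsub>G\<^esub> k \<in> carrier G" using * by simp
    have lin: "is_linear K (space (Y \<otimes>\<^sub>V Z)) (space R) (c f k x)" using c_Lin * by (simp add: Lin_iff)
    show "c f k x t \<in> piece R (f \<otimes>\<^bsub>G\<^esub> k)"
    proof (rule tensor_piece_image[OF Y Z gs_module[OF R] lin piece_submodule[OF R fk] *(2,4)])
      fix g h y z assume **: "g \<in> carrier G" "h \<in> carrier G" "g \<otimes>\<^bsub>G\<^esub> h = k" "y \<in> piece Y g" "z \<in> piece Z h"
      have "tv (X \<otimes>\<^sub>V Y) Z (tv X Y x y) z \<in> piece R (f \<otimes>\<^bsub>G\<^esub> g \<otimes>\<^bsub>G\<^esub> h)"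
        by (intro tv_piece XY Z X Y G.m_closed * **)
      then show "c f k x (tv Y Z y z) \<in> piece R (f \<otimes>\<^bsub>G\<^esub> k)"
        using * ** by (auto simp: c_tv b_def G.m_assoc intro!: piece_smult R)
    qed
  qed
  have "am X Y Z = \<phi>"
    unfolding assoc_map_def Let_def space_tensor[symmetric]
  proof (rule the_equality)
    show "\<phi> \<in> Lin K (space S) (space R) \<and>
       (\<forall>f\<in>carrier G. \<forall>g\<in>carrier G. \<forall>h\<in>carrier G. \<forall>v\<in>piece X f. \<forall>u\<in>piece Y g. \<forall>w\<in>piece Z h.
         \<phi> (tv X (Y \<otimes>\<^sub>V Z) v (tv Y Z u w)) = \<alpha> f g h \<odot>\<^bsub>space R\<^esub> tv (X \<otimes>\<^sub>V Y) Z (tv X Y v u) w)"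
      using \<phi> gm_Lin[OF gm] by (simp add: b_def)
  next
    fix \<psi> assume \<psi>: "\<psi> \<in> Lin K (space S) (space R) \<and>
       (\<forall>f\<in>carrier G. \<forall>g\<in>carrier G. \<forall>h\<in>carrier G. \<forall>v\<in>piece X f. \<forall>u\<in>piece Y g. \<forall>w\<in>piece Z h.
         \<psi> (tv X (Y \<otimes>\<^sub>V Z) v (tv Y Z u w)) = \<alpha> f g h \<odot>\<^bsub>space R\<^esub> tv (X \<otimes>\<^sub>V Y) Z (tv X Y v u) w)"
    show "\<psi> = \<phi>"
    proof (rule Lin_eqI[of _ K "space S" "space R" _ "space R"])
      show "\<psi> v = \<phi> v" if "v \<in> car S" for v
        by (rule tensor3_right_eqI[OF X Y Z gs_fd[OF R] _ gm_lin[OF gm] _ that])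
           (use \<psi> \<phi> in \<open>auto simp: Lin_iff b_def\<close>)
    qed (use \<psi> gm_Lin[OF gm] in auto)
  qed
  then show "am X Y Z \<in> gm S R"
    and "\<And>f g h x y z. \<lbrakk>f \<in> carrier G; g \<in> carrier G; h \<in> carrier G;
          x \<in> piece X f; y \<in> piece Y g; z \<in> piece Z h\<rbrakk> \<Longrightarrow>
          am X Y Z (tv X (Y \<otimes>\<^sub>V Z) x (tv Y Z y z)) = \<alpha> f g h \<odot>\<^bsub>space R\<^esub> tv (X \<otimes>\<^sub>V Y) Z (tv X Y x y) z"
    using gm \<phi> by (auto simp: b_def)
qed

lemma am_inv_facts:
  shows am_inv_gm: "am_inv X Y Z \<in> gm R S"
    and am_inv_tv: "\<And>f g h x y z. \<lbrakk>f \<in> carrier G; g \<in> carrier G; h \<in> carrier G;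
          x \<in> piece X f; y \<in> piece Y g; z \<in> piece Z h\<rbrakk> \<Longrightarrow>
          am_inv X Y Z (tv (X \<otimes>\<^sub>V Y) Z (tv X Y x y) z) = inv\<^bsub>K\<^esub> (\<alpha> f g h) \<odot>\<^bsub>space S\<^esub> tv X (Y \<otimes>\<^sub>V Z) x (tv Y Z y z)"
proof -
  note YZ = gs_tensor[OF Y Z] and XY = gs_tensor[OF X Y]
  note S = gs_tensor[OF X YZ]
  define b where "b = (\<lambda>f g h x y z. inv\<^bsub>K\<^esub> (\<alpha> f g h) \<odot>\<^bsub>space S\<^esub> tv X (Y \<otimes>\<^sub>V Z) x (tv Y Z y z))"
  have b1: "is_bilinear K (space X) (space Y) (space S) (\<lambda>x y. b f g h x y z)"
    if "f \<in> carrier G" "g \<in> carrier G" "h \<in> carrier G" "z \<in> car Z" for f g h z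
    unfolding b_def using that
    by (intro is_bilinear_scale gs_module S is_bilinear_comp2[OF tv_bilinear[OF X YZ] is_linear_id linear_tv_left[OF Y Z]]) auto
  have b2: "lin Z S (\<lambda>z. b f g h x y z)"
    if "f \<in> carrier G" "g \<in> carrier G" "h \<in> carrier G" "x \<in> car X" "y \<in> car Y" for f g h x y
    unfolding b_def using that
    by (intro is_linear_scale gs_module S is_linear_comp[OF linear_tv_right[OF Y Z] linear_tv_right[OF X YZ]]) auto
  define c where "c = (\<lambda>(k :: 'g) h t z. tensor_lift G K T X Y (space S) (\<lambda>f g x y. b f g h x y z) t)"
  have c_tv: "c k h (tv X Y x y) z = b f g h x y z"
    if "f \<in> carrier G" "g \<in> carrier G" "h \<in> carrier G" "z \<in> car Z" "x \<in> piece X f" "y \<in> piece Y g"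
    for f g h k x y z
    unfolding c_def by (rule tensor_lift_tv[OF X Y gs_fd[OF S] b1]) (use that in auto)
  have c_Lin: "lin (X \<otimes>\<^sub>V Y) S (\<lambda>t. c k h t z)" if "h \<in> carrier G" "z \<in> car Z" for h k z
    unfolding c_def using tensor_lift_Lin[OF X Y gs_fd[OF S] b1] that by (auto simp: Lin_iff)
  have c_bil: "is_bilinear K (space (X \<otimes>\<^sub>V Y)) (space Z) (space S) (c k h)" if "h \<in> carrier G" for h k
    unfolding is_bilinear_def
  proof (intro conjI ballI c_Lin that)
    fix t assume "t \<in> car (X \<otimes>\<^sub>V Y)" then show "lin Z S (\<lambda>z. c k h t z)"
      unfolding c_def
      by (intro tensor_lift_parameter[OF X Y gs_fd[OF S] gs_module[OF Z] b1 b2]) (use that in auto)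
  qed
  have \<phi>_tv1: "am_inv X Y Z (tv (X \<otimes>\<^sub>V Y) Z t z) = c k h t z"
    if "k \<in> carrier G" "h \<in> carrier G" "t \<in> piece (X \<otimes>\<^sub>V Y) k" "z \<in> piece Z h" for h k z t
    using tensor_lift_tv[OF XY Z gs_fd[OF S] c_bil] that by (simp add: am_inv_def c_def b_def)
  show "am_inv X Y Z (tv (X \<otimes>\<^sub>V Y) Z (tv X Y x y) z) = inv\<^bsub>K\<^esub> (\<alpha> f g h) \<odot>\<^bsub>space S\<^esub> tv X (Y \<otimes>\<^sub>V Z) x (tv Y Z y z)"
    if "f \<in> carrier G" "g \<in> carrier G" "h \<in> carrier G" "x \<in> piece X f" "y \<in> piece Y g" "z \<in> piece Z h"
    for f g h x y z
    using that \<phi>_tv1[OF _ that(3) tv_piece[OF X Y that(1,2,4,5)] that(6)] c_tv[OF that(1-3) piece_car[OF Z that(3,6)] that(4,5)]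
    by (simp add: b_def)
  have "tensor_lift G K T (X \<otimes>\<^sub>V Y) Z (space S) c \<in> gm R S"
  proof (rule tensor_lift_gm[OF XY Z S c_bil])
    fix k h t z assume *: "k \<in> carrier G" "h \<in> carrier G" "t \<in> piece (X \<otimes>\<^sub>V Y) k" "z \<in> piece Z h" "z \<in> car Z"
    have kh: "k \<otimes>\<^bsub>G\<^esub> h \<in> carrier G" using * by simp
    show "c k h t z \<in> piece S (k \<otimes>\<^bsub>G\<^esub> h)"
    proof (rule tensor_piece_image[OF X Y gs_module[OF S] c_Lin piece_submodule[OF S kh] *(1,3)])
      fix f g x y assume **: "f \<in> carrier G" "g \<in> carrier G" "f \<otimes>\<^bsub>G\<^esub> g = k" "x \<in> piece X f" "y \<in> piece Y g"
      have "tv X (Y \<otimes>\<^sub>V Z) x (tv Y Z y z) \<in> piece S (f \<otimes>\<^bsub>G\<^esub> (g \<otimes>\<^bsub>G\<^esub> h))"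
        by (intro tv_piece YZ Z X Y G.m_closed * **)
      then show "c k h (tv X Y x y) z \<in> piece S (k \<otimes>\<^bsub>G\<^esub> h)"
        using * ** by (auto simp: c_tv b_def G.m_assoc intro!: piece_smult S)
    qed (use * in auto)
  qed
  then show "am_inv X Y Z \<in> gm R S" by (simp add: am_inv_def c_def b_def)
qed

lemma am_inv_am: "t \<in> car S \<Longrightarrow> am_inv X Y Z (am X Y Z t) = t"
  by (rule tensor3_right_eqI[OF X Y Z gs_fd is_linear_comp[OF gm_lin[OF am_gm] gm_lin[OF am_inv_gm]] is_linear_id])
     (auto simp: am_tv am_inv_tv X Y Z gs_tensor tv_closed gs_smult_smult gs_smult_one gm_smult[OF am_inv_gm])

lemma am_am_inv: "t \<in> car R \<Longrightarrow> am X Y Z (am_inv X Y Z t) = t"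
  by (rule tensor3_left_eqI[OF X Y Z gs_fd is_linear_comp[OF gm_lin[OF am_inv_gm] gm_lin[OF am_gm]] is_linear_id])
     (auto simp: am_tv am_inv_tv X Y Z gs_tensor tv_closed gs_smult_smult gs_smult_one gm_smult[OF am_gm])

end
end

section \<open>One-dimensional spaces\<close>

context cocycle_setting
begin

text \<open>The graded maps from the space below to \<open>V\<close> are the elements of \<open>V\<^sub>f\<close>, so naturality
  reduces every half-braiding to its components at these spaces.\<close>

definition line :: "'g \<Rightarrow> ('g, 'k, 'v) graded" where
  "line f = \<lparr> space = uspace T,
     piece = (\<lambda>g \<in> carrier G. if g = f then carrier (uspace T) else {\<zero>\<^bsub>uspace T\<^esub>}) \<rparr>"

abbreviation u :: 'v where "u \<equiv> uvec T"

lemma unit_line: "graded_unit G T = line \<one>\<^bsub>G\<^esub>"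
  by (simp add: graded_unit_def line_def)

lemma space_line: "space (line f) = uspace T"
  by (simp add: line_def)

lemma piece_line:
  "g \<in> carrier G \<Longrightarrow> piece (line f) g = (if g = f then car (line f) else {\<zero>\<^bsub>space (line f)\<^esub>})"
  by (simp add: line_def)

lemma gs_line:
  assumes "f \<in> carrier G"
  shows "gs (line f)"
proof -
  interpret U: module K "space (line f)"
    unfolding space_line by (rule fd_module[OF uspace_fd])
  have zero: "submodule {\<zero>\<^bsub>space (line f)\<^esub>} K (space (line f))"
    by (rule U.submoduleI) auto
  show ?thesis
  proof (rule graded_spaceI[where P = "\<lambda>g v. if g = f then v else \<zero>\<^bsub>space (line f)\<^esub>"])
    show "fd_space K (space (line f))" by (simp add: space_line uspace_fd)
    show "piece (line f) \<in> extensional (carrier G)" by (simp add: line_def)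
    show "lin (line f) (line f) (\<lambda>v. if g = f then v else \<zero>\<^bsub>space (line f)\<^esub>)" for g
      using is_linear_id is_linear_null[OF U.module_axioms] by (cases "g = f") auto
    show "(\<Oplus>\<^bsub>space (line f)\<^esub>g\<in>carrier G. if g = f then v else \<zero>\<^bsub>space (line f)\<^esub>) = v"
      if "v \<in> car (line f)" for v
      using finsum_delta[OF U.module_axioms assms that] by simp
  qed (use zero U.carrier_is_submodule in \<open>auto simp: piece_line split: if_splits\<close>)
qed

lemma u_closed: "u \<in> car (line f)"
  by (simp add: space_line uvec_closed)

lemma u_piece: "f \<in> carrier G \<Longrightarrow> u \<in> piece (line f) f"
  by (simp add: piece_line u_closed)

text \<open>The coordinate of \<open>t\<close> with respect to the generator. All lines share one
  underlying space, so no degree enters.\<close>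

definition coef :: "'v \<Rightarrow> 'k" where
  "coef t = (THE c. c \<in> carrier K \<and> t = c \<odot>\<^bsub>uspace T\<^esub> u)"

lemma coef:
  assumes "t \<in> car (line f)"
  shows "coef t \<in> carrier K" and "t = coef t \<odot>\<^bsub>space (line f)\<^esub> u"
  using theI'[OF uvec_generator[of t]] assms by (auto simp: coef_def space_line)

lemma coef_eqI:
  assumes "f \<in> carrier G" "c \<in> carrier K" "t = c \<odot>\<^bsub>space (line f)\<^esub> u"
  shows "coef t = c"
proof -
  have "t \<in> carrier (uspace T)"
    using gs_smult_closed[OF gs_line[OF assms(1)] assms(2) u_closed] assms(3) by (simp add: space_line)
  from uvec_generator[OF this] show ?thesis
    unfolding coef_def using assms by (intro the1_equality) (auto simp: space_line)
qed

lemma coef_u: "coef u = \<one>\<^bsub>K\<^esub>"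
  by (rule coef_eqI[OF G.one_closed]) (auto simp: gs_smult_one gs_line u_closed)

text \<open>The bilinear map behind both unit constraints, available for a line in any degree
  \<open>f\<close>.\<close>

lemma coef_bilinear:
  assumes X: "gs X" and f: "f \<in> carrier G"
  shows "is_bilinear K (space X) (space (line f)) (space X) (\<lambda>x t. coef t \<odot>\<^bsub>space X\<^esub> x)"
proof -
  interpret X: module K "space X" by (rule gs_module[OF X])
  interpret U: module K "space (line f)" by (rule gs_module[OF gs_line[OF f]])
  have add: "coef (t \<oplus>\<^bsub>space (line f)\<^esub> s) = coef t \<oplus>\<^bsub>K\<^esub> coef s" if "t \<in> car (line f)" "s \<in> car (line f)" for t s
    using coef[OF that(1)] coef[OF that(2)]
    by (intro coef_eqI[OF f]) (auto simp: U.smult_l_distr u_closed)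
  have smult: "coef (c \<odot>\<^bsub>space (line f)\<^esub> t) = c \<otimes>\<^bsub>K\<^esub> coef t" if "t \<in> car (line f)" "c \<in> carrier K" for c t
    using coef[OF that(1)] that
    by (intro coef_eqI[OF f]) (auto simp: U.smult_assoc1 u_closed)
  have "coef t \<otimes>\<^bsub>K\<^esub> c = c \<otimes>\<^bsub>K\<^esub> coef t" if "t \<in> car (line f)" "c \<in> carrier K" for c t
    using coef[OF that(1)] that by (simp add: K.m_comm)
  then show ?thesis
    using coef(1)[of _ f]
    by (auto simp: is_bilinear_def is_linear_def add smult X.smult_l_distr X.smult_r_distr
        X.smult_assoc1[symmetric])
qed

text \<open>Sends \<open>u\<close> to \<open>x\<close>. For \<open>x\<close> of degree
  \<open>f\<close> it is graded, and naturality along it carries statements about \<open>u\<close>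
  over to \<open>x\<close>.\<close>

definition point :: "'g \<Rightarrow> ('g, 'k, 'v) graded \<Rightarrow> 'v \<Rightarrow> 'v \<Rightarrow> 'v" where
  "point f X x = (\<lambda>t \<in> car (line f). coef t \<odot>\<^bsub>space X\<^esub> x)"

lemma point_gm:
  assumes "gs X" "f \<in> carrier G" "x \<in> piece X f"
  shows "point f X x \<in> gm (line f) X"
  unfolding point_def
proof (rule gm_restrictI[OF gs_line[OF assms(2)]])
  have x: "x \<in> car X" using piece_car[OF assms] .
  show "lin (line f) X (\<lambda>t. coef t \<odot>\<^bsub>space X\<^esub> x)"
    by (rule is_bilinear_right[OF coef_bilinear[OF assms(1,2)] x])
  fix g t assume *: "g \<in> carrier G" "t \<in> piece (line f) g" "t \<in> car (line f)"
  show "coef t \<odot>\<^bsub>space X\<^esub> x \<in> piece X g"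
  proof (cases "g = f")
    case True
    then show ?thesis using assms coef(1)[OF *(3)] by (simp add: piece_smult)
  next
    case False
    then have "t = \<zero>\<^bsub>space (line f)\<^esub>" using * by (simp add: piece_line)
    then have "coef t \<odot>\<^bsub>space X\<^esub> x = \<zero>\<^bsub>space X\<^esub>"
      using is_linear_zero[OF gs_module[OF gs_line[OF assms(2)]] gs_module[OF assms(1)]
          is_bilinear_right[OF coef_bilinear[OF assms(1,2)] x]] by simp
    then show ?thesis using piece_zero[OF assms(1) *(1)] by simp
  qed
qed

lemma point_u: "gs X \<Longrightarrow> x \<in> car X \<Longrightarrow> point f X x u = x"
  by (simp add: point_def u_closed coef_u gs_smult_one)

text \<open>Every element of the line is a multiple of \<open>u\<close>, so the second factor can be
  fixed.\<close>

lemma line_right_eqI: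
  assumes X: "gs X" and f: "f \<in> carrier G" and W: "fd_space K W"
    and \<phi>: "is_linear K (space (X \<otimes>\<^sub>V line f)) W \<phi>" and \<psi>: "is_linear K (space (X \<otimes>\<^sub>V line f)) W \<psi>"
    and eq: "\<And>g x. g \<in> carrier G \<Longrightarrow> x \<in> piece X g \<Longrightarrow> x \<in> car X \<Longrightarrow>
       \<phi> (tv X (line f) x u) = \<psi> (tv X (line f) x u)"
    and t: "t \<in> car (X \<otimes>\<^sub>V line f)"
  shows "\<phi> t = \<psi> t"
proof (rule tensor_linear_eqI[OF X gs_line[OF f] W \<phi> \<psi> _ t])
  fix g x y assume *: "g \<in> carrier G" "x \<in> piece X g" "x \<in> car X" "y \<in> car (line f)"
  note y = coef[OF *(4)]
  have "tv X (line f) x y = coef y \<odot>\<^bsub>space (X \<otimes>\<^sub>V line f)\<^esub> tv X (line f) x u"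
    using * y(1) by (subst y(2)) (simp add: tv_smult_right X gs_line f u_closed)
  then show "\<phi> (tv X (line f) x y) = \<psi> (tv X (line f) x y)"
    using is_linear_smult[OF \<phi> y(1) tv_closed[OF X gs_line[OF f] *(3) u_closed]]
      is_linear_smult[OF \<psi> y(1) tv_closed[OF X gs_line[OF f] *(3) u_closed]] eq[OF *(1-3)] by simp
qed

lemma line_left_eqI:
  assumes X: "gs X" and f: "f \<in> carrier G" and W: "fd_space K W"
    and \<phi>: "is_linear K (space (line f \<otimes>\<^sub>V X)) W \<phi>" and \<psi>: "is_linear K (space (line f \<otimes>\<^sub>V X)) W \<psi>"
    and eq: "\<And>g x. g \<in> carrier G \<Longrightarrow> x \<in> piece X g \<Longrightarrow> x \<in> car X \<Longrightarrow>
       \<phi> (tv (line f) X u x) = \<psi> (tv (line f) X u x)"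
    and t: "t \<in> car (line f \<otimes>\<^sub>V X)"
  shows "\<phi> t = \<psi> t"
proof (rule tensor_linear_eqI[OF gs_line[OF f] X W \<phi> \<psi> _ t])
  fix g x y assume *: "g \<in> carrier G" "x \<in> piece X g" "x \<in> car X" "y \<in> car (line f)"
  note y = coef[OF *(4)]
  have "tv (line f) X y x = coef y \<odot>\<^bsub>space (line f \<otimes>\<^sub>V X)\<^esub> tv (line f) X u x"
    using * y(1) by (subst y(2)) (simp add: tv_smult_left X gs_line f u_closed)
  then show "\<phi> (tv (line f) X y x) = \<psi> (tv (line f) X y x)"
    using is_linear_smult[OF \<phi> y(1) tv_closed[OF gs_line[OF f] X u_closed *(3)]]
      is_linear_smult[OF \<psi> y(1) tv_closed[OF gs_line[OF f] X u_closed *(3)]] eq[OF *(1-3)] by simp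
qed

text \<open>\<open>runit_map\<close> knows only the underlying space, which all lines share. It
  therefore strips \<open>u\<close> from \<open>X \<otimes>\<^sub>V line f\<close> for every
  \<open>f\<close>, shifting degrees by \<open>f\<close>: at the identity this is the unit
  constraint, in other degrees it is how an action is read off from a half-braiding.\<close>

lemma runit_facts:
  assumes X: "gs X" and f: "f \<in> carrier G"
  shows runit_Lin: "runit_map K T X \<in> Lin K (space (X \<otimes>\<^sub>V line f)) (space X)"
    and runit_tv: "\<And>x. x \<in> car X \<Longrightarrow> runit_map K T X (tv X (line f) x u) = x"
    and runit_piece: "\<And>k t. k \<in> carrier G \<Longrightarrow> t \<in> piece (X \<otimes>\<^sub>V line f) (k \<otimes>\<^bsub>G\<^esub> f) \<Longrightarrow> runit_map K T X t \<in> piece X k"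
proof -
  obtain \<phi> where \<phi>: "\<phi> \<in> Lin K (space (X \<otimes>\<^sub>V line f)) (space X)"
    "\<And>x t. x \<in> car X \<Longrightarrow> t \<in> car (line f) \<Longrightarrow> \<phi> (tv X (line f) x t) = coef t \<odot>\<^bsub>space X\<^esub> x"
    using bilinear_extension[OF X gs_line[OF f] gs_fd[OF X] coef_bilinear[OF X f]] by blast
  have \<phi>_u: "\<phi> (tv X (line f) x u) = x" if "x \<in> car X" for x
    using that by (simp add: \<phi>(2) u_closed coef_u gs_smult_one X)
  have eq: "runit_map K T X = \<phi>"
    unfolding runit_map_def space_line[symmetric, of f] space_tensor[symmetric]
  proof (rule the_equality)
    fix \<psi> assume \<psi>: "\<psi> \<in> Lin K (space (X \<otimes>\<^sub>V line f)) (space X) \<and> (\<forall>x \<in> car X. \<psi> (tv X (line f) x u) = x)"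
    show "\<psi> = \<phi>"
    proof (rule Lin_eqI[of _ K "space (X \<otimes>\<^sub>V line f)" "space X" _ "space X"])
      show "\<psi> v = \<phi> v" if "v \<in> car (X \<otimes>\<^sub>V line f)" for v
        by (rule line_right_eqI[OF X f gs_fd[OF X] _ _ _ that]) (use \<psi> \<phi>(1) \<phi>_u in \<open>auto simp: Lin_iff\<close>)
    qed (use \<psi> \<phi> in auto)
  qed (use \<phi>(1) \<phi>_u in auto)
  show "runit_map K T X \<in> Lin K (space (X \<otimes>\<^sub>V line f)) (space X)"
    and "\<And>x. x \<in> car X \<Longrightarrow> runit_map K T X (tv X (line f) x u) = x"
    using eq \<phi>(1) \<phi>_u by auto
  have lin: "lin (X \<otimes>\<^sub>V line f) X \<phi>" using \<phi>(1) by (simp add: Lin_iff)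
  fix k t assume k: "k \<in> carrier G" and t: "t \<in> piece (X \<otimes>\<^sub>V line f) (k \<otimes>\<^bsub>G\<^esub> f)"
  show "runit_map K T X t \<in> piece X k"
    unfolding eq
  proof (rule tensor_piece_image[OF X gs_line[OF f] gs_module[OF X] lin piece_submodule[OF X k] _ t])
    fix g h x y assume *: "g \<in> carrier G" "h \<in> carrier G" "g \<otimes>\<^bsub>G\<^esub> h = k \<otimes>\<^bsub>G\<^esub> f"
      "x \<in> piece X g" "y \<in> piece (line f) h" "x \<in> car X" "y \<in> car (line f)"
    have "coef y \<odot>\<^bsub>space X\<^esub> x \<in> piece X k"
    proof (cases "h = f")
      case True
      then have "g = k" using * k f by simp
      then show ?thesis using * coef(1)[OF *(7)] by (simp add: piece_smult X)
    next
      case False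
      \<comment> \<open>Outside degree \<open>f\<close> the line is zero, so only the degree
        \<open>f\<close> component of the second factor contributes.\<close>
      then have y: "y = \<zero>\<^bsub>space (line f)\<^esub>" using * by (simp add: piece_line)
      have "coef y \<odot>\<^bsub>space X\<^esub> x = \<zero>\<^bsub>space X\<^esub>"
        unfolding y using is_linear_zero[OF gs_module[OF gs_line[OF f]] gs_module[OF X]
          is_bilinear_right[OF coef_bilinear[OF X f] *(6)]] .
      then show ?thesis using piece_zero[OF X k] by simp
    qed
    then show "\<phi> (tv X (line f) x y) \<in> piece X k" using * by (simp add: \<phi>(2))
  qed (use k f in simp)
qed

text \<open>The mirror image; in arbitrary degrees it makes tensoring with \<open>u\<close> on the
  left injective, which \<open>act_inj\<close> uses.\<close>

lemma lunit_facts: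
  assumes X: "gs X" and f: "f \<in> carrier G"
  shows lunit_Lin: "lunit_map K T X \<in> Lin K (space (line f \<otimes>\<^sub>V X)) (space X)"
    and lunit_tv: "\<And>x. x \<in> car X \<Longrightarrow> lunit_map K T X (tv (line f) X u x) = x"
    and lunit_piece: "\<And>k t. k \<in> carrier G \<Longrightarrow> t \<in> piece (line f \<otimes>\<^sub>V X) (f \<otimes>\<^bsub>G\<^esub> k) \<Longrightarrow> lunit_map K T X t \<in> piece X k"
proof -
  obtain \<phi> where \<phi>: "\<phi> \<in> Lin K (space (line f \<otimes>\<^sub>V X)) (space X)"
    "\<And>t x. t \<in> car (line f) \<Longrightarrow> x \<in> car X \<Longrightarrow> \<phi> (tv (line f) X t x) = coef t \<odot>\<^bsub>space X\<^esub> x"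
    using bilinear_extension[OF gs_line[OF f] X gs_fd[OF X] is_bilinear_swap[OF coef_bilinear[OF X f]]] by blast
  have \<phi>_u: "\<phi> (tv (line f) X u x) = x" if "x \<in> car X" for x
    using that by (simp add: \<phi>(2) u_closed coef_u gs_smult_one X)
  have eq: "lunit_map K T X = \<phi>"
    unfolding lunit_map_def space_line[symmetric, of f] space_tensor[symmetric]
  proof (rule the_equality)
    fix \<psi> assume \<psi>: "\<psi> \<in> Lin K (space (line f \<otimes>\<^sub>V X)) (space X) \<and> (\<forall>x \<in> car X. \<psi> (tv (line f) X u x) = x)"
    show "\<psi> = \<phi>"
    proof (rule Lin_eqI[of _ K "space (line f \<otimes>\<^sub>V X)" "space X" _ "space X"])
      show "\<psi> v = \<phi> v" if "v \<in> car (line f \<otimes>\<^sub>V X)" for v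
        by (rule line_left_eqI[OF X f gs_fd[OF X] _ _ _ that]) (use \<psi> \<phi>(1) \<phi>_u in \<open>auto simp: Lin_iff\<close>)
    qed (use \<psi> \<phi> in auto)
  qed (use \<phi>(1) \<phi>_u in auto)
  show "lunit_map K T X \<in> Lin K (space (line f \<otimes>\<^sub>V X)) (space X)"
    and "\<And>x. x \<in> car X \<Longrightarrow> lunit_map K T X (tv (line f) X u x) = x"
    using eq \<phi>(1) \<phi>_u by auto
  have lin: "lin (line f \<otimes>\<^sub>V X) X \<phi>" using \<phi>(1) by (simp add: Lin_iff)
  fix k t assume k: "k \<in> carrier G" and t: "t \<in> piece (line f \<otimes>\<^sub>V X) (f \<otimes>\<^bsub>G\<^esub> k)"
  show "lunit_map K T X t \<in> piece X k"
    unfolding eq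
  proof (rule tensor_piece_image[OF gs_line[OF f] X gs_module[OF X] lin piece_submodule[OF X k] _ t])
    fix h g y x assume *: "h \<in> carrier G" "g \<in> carrier G" "h \<otimes>\<^bsub>G\<^esub> g = f \<otimes>\<^bsub>G\<^esub> k"
      "y \<in> piece (line f) h" "x \<in> piece X g" "y \<in> car (line f)" "x \<in> car X"
    have "coef y \<odot>\<^bsub>space X\<^esub> x \<in> piece X k"
    proof (cases "h = f")
      case True
      then have "g = k" using * k f by simp
      then show ?thesis using * coef(1)[OF *(6)] by (simp add: piece_smult X)
    next
      case False
      then have y: "y = \<zero>\<^bsub>space (line f)\<^esub>" using * by (simp add: piece_line)
      have "coef y \<odot>\<^bsub>space X\<^esub> x = \<zero>\<^bsub>space X\<^esub>"
        unfolding y using is_linear_zero[OF gs_module[OF gs_line[OF f]] gs_module[OF X]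
          is_bilinear_right[OF coef_bilinear[OF X f] *(7)]] .
      then show ?thesis using piece_zero[OF X k] by simp
    qed
    then show "\<phi> (tv (line f) X y x) \<in> piece X k" using * by (simp add: \<phi>(2))
  qed (use k f in simp)
qed

section \<open>The unit object and its constraints\<close>

abbreviation unit where "unit \<equiv> line \<one>\<^bsub>G\<^esub>"

definition linv :: "('g, 'k, 'v) graded \<Rightarrow> 'v \<Rightarrow> 'v" where
  "linv X = (\<lambda>x \<in> car X. tv unit X u x)"

definition rinv :: "('g, 'k, 'v) graded \<Rightarrow> 'v \<Rightarrow> 'v" where
  "rinv X = (\<lambda>x \<in> car X. tv X unit x u)"

lemma gs_unit: "gs unit" by (simp add: gs_line)

lemma runit_gm: "gs X \<Longrightarrow> runit_map K T X \<in> gm (X \<otimes>\<^sub>V unit) X"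
  using runit_Lin[OF _ G.one_closed] runit_piece[OF _ G.one_closed] by (auto simp: gm_def)

lemma lunit_gm: "gs X \<Longrightarrow> lunit_map K T X \<in> gm (unit \<otimes>\<^sub>V X) X"
  using lunit_Lin[OF _ G.one_closed] lunit_piece[OF _ G.one_closed] by (auto simp: gm_def)

lemma linv_gm: "gs X \<Longrightarrow> linv X \<in> gm X (unit \<otimes>\<^sub>V X)"
  unfolding linv_def
  using tv_piece[OF gs_unit _ G.one_closed _ u_piece[OF G.one_closed]]
  by (intro gm_restrictI linear_tv_right gs_unit u_closed) fastforce+

lemma rinv_gm: "gs X \<Longrightarrow> rinv X \<in> gm X (X \<otimes>\<^sub>V unit)"
  unfolding rinv_def
  using tv_piece[OF _ gs_unit _ G.one_closed _ u_piece[OF G.one_closed]]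
  by (intro gm_restrictI linear_tv_left gs_unit u_closed) fastforce+

lemma lunit_linv: "gs X \<Longrightarrow> x \<in> car X \<Longrightarrow> lunit_map K T X (linv X x) = x"
  by (simp add: linv_def lunit_tv)

lemma runit_rinv: "gs X \<Longrightarrow> x \<in> car X \<Longrightarrow> runit_map K T X (rinv X x) = x"
  by (simp add: rinv_def runit_tv)

lemma linv_lunit: "gs X \<Longrightarrow> t \<in> car (unit \<otimes>\<^sub>V X) \<Longrightarrow> linv X (lunit_map K T X t) = t"
  by (rule line_left_eqI[OF _ G.one_closed gs_fd[OF gs_tensor[OF gs_unit]]
        is_linear_comp[OF gm_lin[OF lunit_gm] gm_lin[OF linv_gm]] is_linear_id])
     (auto simp: lunit_tv linv_def)

lemma rinv_runit: "gs X \<Longrightarrow> t \<in> car (X \<otimes>\<^sub>V unit) \<Longrightarrow> rinv X (runit_map K T X t) = t"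
  by (rule line_right_eqI[OF _ G.one_closed gs_fd[OF gs_tensor[OF _ gs_unit]]
        is_linear_comp[OF gm_lin[OF runit_gm] gm_lin[OF rinv_gm]] is_linear_id])
     (auto simp: runit_tv rinv_def)

end

section \<open>Cocycle identities\<close>

context cocycle_setting
begin

abbreviation cj where "cj \<equiv> conj_by G"
abbreviation ac where "ac \<equiv> action_cocycle G K \<alpha>"
abbreviation tc where "tc \<equiv> tensor_cocycle G K \<alpha>"

lemma cj_closed [simp]: "f \<in> carrier G \<Longrightarrow> g \<in> carrier G \<Longrightarrow> cj f g \<in> carrier G"
  by (simp add: conj_by_def)

lemma cj_mult:
  "f \<in> carrier G \<Longrightarrow> g \<in> carrier G \<Longrightarrow> h \<in> carrier G \<Longrightarrow> cj (f \<otimes>\<^bsub>G\<^esub> g) h = cj f (cj g h)"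
  by (simp add: conj_by_def G.inv_mult_group G.m_assoc)

text \<open>The shuffle rule: moving \<open>f\<close> to the right of \<open>g\<close> conjugates
  \<open>g\<close>. It matches the arguments of the different cocycle equations and shows that the
  braiding preserves degrees.\<close>

lemma cj_swap: "f \<in> carrier G \<Longrightarrow> g \<in> carrier G \<Longrightarrow> cj f g \<otimes>\<^bsub>G\<^esub> f = f \<otimes>\<^bsub>G\<^esub> g"
  by (simp add: conj_by_def G.m_assoc)

lemma cj_hom:
  assumes "f \<in> carrier G" "g \<in> carrier G" "h \<in> carrier G"
  shows "cj f (g \<otimes>\<^bsub>G\<^esub> h) = cj f g \<otimes>\<^bsub>G\<^esub> cj f h"
proof -
  have "cj f g \<otimes>\<^bsub>G\<^esub> cj f h \<otimes>\<^bsub>G\<^esub> f = cj f (g \<otimes>\<^bsub>G\<^esub> h) \<otimes>\<^bsub>G\<^esub> f"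
    using assms by (simp add: cj_swap G.m_assoc) (simp add: cj_swap G.m_assoc[symmetric])
  then show ?thesis using assms by simp
qed

lemma cj_one [simp]: "f \<in> carrier G \<Longrightarrow> cj f \<one>\<^bsub>G\<^esub> = \<one>\<^bsub>G\<^esub>" "g \<in> carrier G \<Longrightarrow> cj \<one>\<^bsub>G\<^esub> g = g"
  by (simp_all add: conj_by_def)

lemma cj_inv:
  assumes "f \<in> carrier G" "g \<in> carrier G"
  shows "cj f (cj (inv\<^bsub>G\<^esub> f) g) = g" "cj (inv\<^bsub>G\<^esub> f) (cj f g) = g"
  using assms cj_mult[of f "inv\<^bsub>G\<^esub> f" g] cj_mult[of "inv\<^bsub>G\<^esub> f" f g] by simp_all

lemma ac_Units [simp]:
  "f \<in> carrier G \<Longrightarrow> g \<in> carrier G \<Longrightarrow> h \<in> carrier G \<Longrightarrow> ac f g h \<in> Units K"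
  by (simp add: action_cocycle_def)

lemma tc_Units [simp]:
  "f \<in> carrier G \<Longrightarrow> g \<in> carrier G \<Longrightarrow> h \<in> carrier G \<Longrightarrow> tc f g h \<in> Units K"
  by (simp add: tensor_cocycle_def)

lemma ac_closed [simp]:
  "f \<in> carrier G \<Longrightarrow> g \<in> carrier G \<Longrightarrow> h \<in> carrier G \<Longrightarrow> ac f g h \<in> carrier K"
  by (simp add: K.Units_closed)

lemma tc_closed [simp]:
  "f \<in> carrier G \<Longrightarrow> g \<in> carrier G \<Longrightarrow> h \<in> carrier G \<Longrightarrow> tc f g h \<in> carrier K"
  by (simp add: K.Units_closed)

lemma Units_cancel:
  assumes "x \<in> Units K" "a \<in> carrier K" "b \<in> carrier K" "a \<otimes>\<^bsub>K\<^esub> x = b \<otimes>\<^bsub>K\<^esub> x"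
  shows "a = b"
  using assms K.Units_l_cancel[of x a b] by (simp add: K.m_comm K.Units_closed)

text \<open>\<open>ac\<close> and \<open>tc\<close> contain inverses. Cleared of denominators, their
  defining formulas combine with the cocycle equations by commutative rewriting alone.\<close>

lemma ac_mult:
  assumes "f \<in> carrier G" "g \<in> carrier G" "h \<in> carrier G"
  shows "ac f g h \<otimes>\<^bsub>K\<^esub> (\<alpha> f g h \<otimes>\<^bsub>K\<^esub> \<alpha> (cj f (cj g h)) f g) = \<alpha> f (cj g h) g"
proof -
  \<comment> \<open>Each inverse is regrouped with the value that it cancels.\<close>
  have "(i \<otimes>\<^bsub>K\<^esub> b \<otimes>\<^bsub>K\<^esub> j) \<otimes>\<^bsub>K\<^esub> (a \<otimes>\<^bsub>K\<^esub> c) = (i \<otimes>\<^bsub>K\<^esub> a) \<otimes>\<^bsub>K\<^esub> ((j \<otimes>\<^bsub>K\<^esub> c) \<otimes>\<^bsub>K\<^esub> b)"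
    if "i \<in> carrier K" "b \<in> carrier K" "j \<in> carrier K" "a \<in> carrier K" "c \<in> carrier K" for i b j a c
    using that by (simp add: K.m_ac)
  then show ?thesis
    using assms by (simp add: action_cocycle_def cj_mult)
qed

lemma tc_mult:
  assumes "f \<in> carrier G" "g \<in> carrier G" "h \<in> carrier G"
  shows "tc f g h \<otimes>\<^bsub>K\<^esub> \<alpha> (cj f g) f h = \<alpha> f g h \<otimes>\<^bsub>K\<^esub> \<alpha> (cj f g) (cj f h) f"
proof -
  have "(a \<otimes>\<^bsub>K\<^esub> j \<otimes>\<^bsub>K\<^esub> b) \<otimes>\<^bsub>K\<^esub> c = (j \<otimes>\<^bsub>K\<^esub> c) \<otimes>\<^bsub>K\<^esub> (a \<otimes>\<^bsub>K\<^esub> b)"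
    if "b \<in> carrier K" "j \<in> carrier K" "a \<in> carrier K" "c \<in> carrier K" for b j a c
    using that by (simp add: K.m_ac)
  then show ?thesis
    using assms by (simp add: tensor_cocycle_def)
qed

lemma tc_one [simp]:
  "g \<in> carrier G \<Longrightarrow> h \<in> carrier G \<Longrightarrow> tc \<one>\<^bsub>G\<^esub> g h = \<one>\<^bsub>K\<^esub>"
  "f \<in> carrier G \<Longrightarrow> h \<in> carrier G \<Longrightarrow> tc f \<one>\<^bsub>G\<^esub> h = \<one>\<^bsub>K\<^esub>"
  "f \<in> carrier G \<Longrightarrow> g \<in> carrier G \<Longrightarrow> tc f g \<one>\<^bsub>G\<^esub> = \<one>\<^bsub>K\<^esub>"
  by (simp_all add: tensor_cocycle_def)

lemma ac_one [simp]: "h \<in> carrier G \<Longrightarrow> ac \<one>\<^bsub>G\<^esub> \<one>\<^bsub>G\<^esub> h = \<one>\<^bsub>K\<^esub>"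
  by (simp add: action_cocycle_def)

lemma ac_unit [simp]: "f \<in> carrier G \<Longrightarrow> g \<in> carrier G \<Longrightarrow> ac f g \<one>\<^bsub>G\<^esub> = \<one>\<^bsub>K\<^esub>"
  by (simp add: action_cocycle_def)

text \<open>In each of the two lemmas below, the cocycle equations come from the shuffles of the acting
  elements with the degrees, the sign of a shuffle deciding which side of its equation is used.\<close>

lemma ac_tc:
  assumes f: "f \<in> carrier G" and g: "g \<in> carrier G" and h: "h \<in> carrier G" and l: "l \<in> carrier G"
  shows "ac f g (h \<otimes>\<^bsub>G\<^esub> l) \<otimes>\<^bsub>K\<^esub> tc g h l \<otimes>\<^bsub>K\<^esub> tc f (cj g h) (cj g l) =
    tc (f \<otimes>\<^bsub>G\<^esub> g) h l \<otimes>\<^bsub>K\<^esub> ac f g h \<otimes>\<^bsub>K\<^esub> ac f g l"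
proof -
  define h' h'' l' l'' where defs: "h' = cj g h" "h'' = cj f h'" "l' = cj g l" "l'' = cj f l'"
  have G: "h' \<in> carrier G" "h'' \<in> carrier G" "l' \<in> carrier G" "l'' \<in> carrier G"
    using assms by (auto simp: defs)
  note cl = f g h l G
  have swap: "h' \<otimes>\<^bsub>G\<^esub> g = g \<otimes>\<^bsub>G\<^esub> h" "l' \<otimes>\<^bsub>G\<^esub> g = g \<otimes>\<^bsub>G\<^esub> l"
      "h'' \<otimes>\<^bsub>G\<^esub> f = f \<otimes>\<^bsub>G\<^esub> h'" "l'' \<otimes>\<^bsub>G\<^esub> f = f \<otimes>\<^bsub>G\<^esub> l'"
    using cl by (auto simp: defs cj_swap)
  \<comment> \<open>The values of \<open>\<alpha>\<close> become atoms, so that commutative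
    rewriting acts on products of variables and leaves the group elements alone.\<close>
  define t1 t2 t3 t4 t5 where t1: "t1 = \<alpha> g h l" "t2 = \<alpha> f (g \<otimes>\<^bsub>G\<^esub> h) l" "t3 = \<alpha> f g h"
    "t4 = \<alpha> (f \<otimes>\<^bsub>G\<^esub> g) h l" "t5 = \<alpha> f g (h \<otimes>\<^bsub>G\<^esub> l)"
  define t6 t7 t8 t9 where t2: "t6 = \<alpha> h' g l" "t7 = \<alpha> f h' g" "t8 = \<alpha> (f \<otimes>\<^bsub>G\<^esub> h') g l"
    "t9 = \<alpha> f h' (g \<otimes>\<^bsub>G\<^esub> l)"
  define t10 t11 t12 t13 where t3: "t10 = \<alpha> h' l' g" "t11 = \<alpha> f (h' \<otimes>\<^bsub>G\<^esub> l') g" "t12 = \<alpha> f h' l'"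
    "t13 = \<alpha> (f \<otimes>\<^bsub>G\<^esub> h') l' g"
  define t14 t15 t16 t17 where t4: "t14 = \<alpha> f g l" "t15 = \<alpha> h'' (f \<otimes>\<^bsub>G\<^esub> g) l" "t16 = \<alpha> h'' f g"
    "t17 = \<alpha> h'' f (g \<otimes>\<^bsub>G\<^esub> l)"
  define t18 t19 t20 where t5: "t18 = \<alpha> f l' g" "t19 = \<alpha> h'' (f \<otimes>\<^bsub>G\<^esub> l') g" "t20 = \<alpha> h'' f l'"
  define t21 t22 t23 t24 where t6: "t21 = \<alpha> l'' f g" "t22 = \<alpha> h'' l'' f"
    "t23 = \<alpha> (h'' \<otimes>\<^bsub>G\<^esub> l'') f g" "t24 = \<alpha> h'' l'' (f \<otimes>\<^bsub>G\<^esub> g)"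
  note t = t1 t2 t3 t4 t5 t6
  define a1 b1 b2 b3 a2 a3 where p: "a1 = ac f g (h \<otimes>\<^bsub>G\<^esub> l)" "b1 = tc g h l" "b2 = tc f h' l'"
    "b3 = tc (f \<otimes>\<^bsub>G\<^esub> g) h l" "a2 = ac f g h" "a3 = ac f g l"
  \<comment> \<open>One cocycle equation for each of the six orders in which \<open>f\<close>,
    \<open>g\<close> can be interleaved with \<open>h\<close>, \<open>l\<close>; a degree is
    conjugated whenever an acting element passes from its left to its right.\<close>
  have d: "t1 \<otimes>\<^bsub>K\<^esub> t2 \<otimes>\<^bsub>K\<^esub> t3 = t4 \<otimes>\<^bsub>K\<^esub> t5" "t6 \<otimes>\<^bsub>K\<^esub> t2 \<otimes>\<^bsub>K\<^esub> t7 = t8 \<otimes>\<^bsub>K\<^esub> t9"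
    "t10 \<otimes>\<^bsub>K\<^esub> t11 \<otimes>\<^bsub>K\<^esub> t12 = t13 \<otimes>\<^bsub>K\<^esub> t9" "t14 \<otimes>\<^bsub>K\<^esub> t15 \<otimes>\<^bsub>K\<^esub> t16 = t8 \<otimes>\<^bsub>K\<^esub> t17"
    "t18 \<otimes>\<^bsub>K\<^esub> t19 \<otimes>\<^bsub>K\<^esub> t20 = t13 \<otimes>\<^bsub>K\<^esub> t17" "t21 \<otimes>\<^bsub>K\<^esub> t19 \<otimes>\<^bsub>K\<^esub> t22 = t23 \<otimes>\<^bsub>K\<^esub> t24"
    using \<alpha>_cocycle[of f g h l] \<alpha>_cocycle[of f h' g l] \<alpha>_cocycle[of f h' l' g]
      \<alpha>_cocycle[of h'' f g l] \<alpha>_cocycle[of h'' f l' g] \<alpha>_cocycle[of h'' l'' f g] cl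
    by (simp_all add: t swap)
  have q: "a1 \<otimes>\<^bsub>K\<^esub> (t5 \<otimes>\<^bsub>K\<^esub> t23) = t11" "b1 \<otimes>\<^bsub>K\<^esub> t6 = t1 \<otimes>\<^bsub>K\<^esub> t10" "b2 \<otimes>\<^bsub>K\<^esub> t20 = t12 \<otimes>\<^bsub>K\<^esub> t22"
    "b3 \<otimes>\<^bsub>K\<^esub> t15 = t4 \<otimes>\<^bsub>K\<^esub> t24" "a2 \<otimes>\<^bsub>K\<^esub> (t3 \<otimes>\<^bsub>K\<^esub> t16) = t7" "a3 \<otimes>\<^bsub>K\<^esub> (t14 \<otimes>\<^bsub>K\<^esub> t21) = t18"
    using ac_mult[of f g "h \<otimes>\<^bsub>G\<^esub> l"] tc_mult[of g h l] tc_mult[of f h' l'] tc_mult[of "f \<otimes>\<^bsub>G\<^esub> g" h l]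
      ac_mult[of f g h] ac_mult[of f g l] cl
    by (simp_all add: t p defs cj_hom cj_mult)
  have U: "t1 \<in> Units K" "t2 \<in> Units K" "t3 \<in> Units K" "t4 \<in> Units K" "t5 \<in> Units K" "t6 \<in> Units K"
    "t7 \<in> Units K" "t8 \<in> Units K" "t9 \<in> Units K" "t10 \<in> Units K" "t11 \<in> Units K" "t12 \<in> Units K"
    "t13 \<in> Units K" "t14 \<in> Units K" "t15 \<in> Units K" "t16 \<in> Units K" "t17 \<in> Units K" "t18 \<in> Units K"
    "t19 \<in> Units K" "t20 \<in> Units K" "t21 \<in> Units K" "t22 \<in> Units K" "t23 \<in> Units K" "t24 \<in> Units K"
    using cl by (simp_all add: t)
  have P: "a1 \<in> carrier K" "a2 \<in> carrier K" "a3 \<in> carrier K" "b1 \<in> carrier K" "b2 \<in> carrier K" "b3 \<in> carrier K"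
    using cl by (simp_all add: p)
  note C = U[THEN K.Units_closed] P
  \<comment> \<open>\<open>D\<close> collects the denominators of the six factors. \<open>E\<close>
    collects the values that occur in none of these factors; each of them occurs in two of the
    cocycle equations.\<close>
  define D where "D = t5 \<otimes>\<^bsub>K\<^esub> t23 \<otimes>\<^bsub>K\<^esub> t6 \<otimes>\<^bsub>K\<^esub> t20 \<otimes>\<^bsub>K\<^esub> (t15 \<otimes>\<^bsub>K\<^esub> t3 \<otimes>\<^bsub>K\<^esub> t16 \<otimes>\<^bsub>K\<^esub> t14 \<otimes>\<^bsub>K\<^esub> t21)"
  define E where "E = t2 \<otimes>\<^bsub>K\<^esub> t8 \<otimes>\<^bsub>K\<^esub> t9 \<otimes>\<^bsub>K\<^esub> t13 \<otimes>\<^bsub>K\<^esub> t17 \<otimes>\<^bsub>K\<^esub> t19"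
  have "(a1 \<otimes>\<^bsub>K\<^esub> b1 \<otimes>\<^bsub>K\<^esub> b2) \<otimes>\<^bsub>K\<^esub> D =
    (a1 \<otimes>\<^bsub>K\<^esub> (t5 \<otimes>\<^bsub>K\<^esub> t23)) \<otimes>\<^bsub>K\<^esub> (b1 \<otimes>\<^bsub>K\<^esub> t6) \<otimes>\<^bsub>K\<^esub> (b2 \<otimes>\<^bsub>K\<^esub> t20) \<otimes>\<^bsub>K\<^esub> (t15 \<otimes>\<^bsub>K\<^esub> t3 \<otimes>\<^bsub>K\<^esub> t16 \<otimes>\<^bsub>K\<^esub> t14 \<otimes>\<^bsub>K\<^esub> t21)"
    unfolding D_def using C by (simp add: K.m_ac)
  then have L: "(a1 \<otimes>\<^bsub>K\<^esub> b1 \<otimes>\<^bsub>K\<^esub> b2) \<otimes>\<^bsub>K\<^esub> D \<otimes>\<^bsub>K\<^esub> E =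
    (t1 \<otimes>\<^bsub>K\<^esub> t2 \<otimes>\<^bsub>K\<^esub> t3) \<otimes>\<^bsub>K\<^esub> (t10 \<otimes>\<^bsub>K\<^esub> t11 \<otimes>\<^bsub>K\<^esub> t12) \<otimes>\<^bsub>K\<^esub> (t14 \<otimes>\<^bsub>K\<^esub> t15 \<otimes>\<^bsub>K\<^esub> t16) \<otimes>\<^bsub>K\<^esub>
    (t21 \<otimes>\<^bsub>K\<^esub> t19 \<otimes>\<^bsub>K\<^esub> t22) \<otimes>\<^bsub>K\<^esub> (t8 \<otimes>\<^bsub>K\<^esub> t9) \<otimes>\<^bsub>K\<^esub> (t13 \<otimes>\<^bsub>K\<^esub> t17)"
    unfolding q E_def using C by (simp add: K.m_ac)
  have "(b3 \<otimes>\<^bsub>K\<^esub> a2 \<otimes>\<^bsub>K\<^esub> a3) \<otimes>\<^bsub>K\<^esub> D =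
    (b3 \<otimes>\<^bsub>K\<^esub> t15) \<otimes>\<^bsub>K\<^esub> (a2 \<otimes>\<^bsub>K\<^esub> (t3 \<otimes>\<^bsub>K\<^esub> t16)) \<otimes>\<^bsub>K\<^esub> (a3 \<otimes>\<^bsub>K\<^esub> (t14 \<otimes>\<^bsub>K\<^esub> t21)) \<otimes>\<^bsub>K\<^esub> (t5 \<otimes>\<^bsub>K\<^esub> t23 \<otimes>\<^bsub>K\<^esub> t6 \<otimes>\<^bsub>K\<^esub> t20)"
    unfolding D_def using C by (simp add: K.m_ac)
  then have R: "(b3 \<otimes>\<^bsub>K\<^esub> a2 \<otimes>\<^bsub>K\<^esub> a3) \<otimes>\<^bsub>K\<^esub> D \<otimes>\<^bsub>K\<^esub> E =
    (t4 \<otimes>\<^bsub>K\<^esub> t5) \<otimes>\<^bsub>K\<^esub> (t13 \<otimes>\<^bsub>K\<^esub> t9) \<otimes>\<^bsub>K\<^esub> (t8 \<otimes>\<^bsub>K\<^esub> t17) \<otimes>\<^bsub>K\<^esub> (t23 \<otimes>\<^bsub>K\<^esub> t24) \<otimes>\<^bsub>K\<^esub>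
    (t6 \<otimes>\<^bsub>K\<^esub> t2 \<otimes>\<^bsub>K\<^esub> t7) \<otimes>\<^bsub>K\<^esub> (t18 \<otimes>\<^bsub>K\<^esub> t19 \<otimes>\<^bsub>K\<^esub> t20)"
    unfolding q E_def using C by (simp add: K.m_ac)
  have DE: "D \<in> Units K" "E \<in> Units K" unfolding D_def E_def using U by simp_all
  have "(a1 \<otimes>\<^bsub>K\<^esub> b1 \<otimes>\<^bsub>K\<^esub> b2) \<otimes>\<^bsub>K\<^esub> D \<otimes>\<^bsub>K\<^esub> E = (b3 \<otimes>\<^bsub>K\<^esub> a2 \<otimes>\<^bsub>K\<^esub> a3) \<otimes>\<^bsub>K\<^esub> D \<otimes>\<^bsub>K\<^esub> E"
    unfolding L R d ..
  from Units_cancel[OF DE(2) _ _ this] have "(a1 \<otimes>\<^bsub>K\<^esub> b1 \<otimes>\<^bsub>K\<^esub> b2) \<otimes>\<^bsub>K\<^esub> D = (b3 \<otimes>\<^bsub>K\<^esub> a2 \<otimes>\<^bsub>K\<^esub> a3) \<otimes>\<^bsub>K\<^esub> D"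
    using C DE[THEN K.Units_closed] by simp
  from Units_cancel[OF DE(1) _ _ this] have "a1 \<otimes>\<^bsub>K\<^esub> b1 \<otimes>\<^bsub>K\<^esub> b2 = b3 \<otimes>\<^bsub>K\<^esub> a2 \<otimes>\<^bsub>K\<^esub> a3"
    using C by simp
  then show ?thesis by (simp add: p defs)
qed

lemma tc_assoc:
  assumes f: "f \<in> carrier G" and g: "g \<in> carrier G" and h: "h \<in> carrier G" and l: "l \<in> carrier G"
  shows "tc f g (h \<otimes>\<^bsub>G\<^esub> l) \<otimes>\<^bsub>K\<^esub> tc f h l \<otimes>\<^bsub>K\<^esub> \<alpha> (cj f g) (cj f h) (cj f l) =
    \<alpha> g h l \<otimes>\<^bsub>K\<^esub> tc f (g \<otimes>\<^bsub>G\<^esub> h) l \<otimes>\<^bsub>K\<^esub> tc f g h"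
proof -
  define g' h' l' where defs: "g' = cj f g" "h' = cj f h" "l' = cj f l"
  have G: "h' \<in> carrier G" "g' \<in> carrier G" "l' \<in> carrier G"
    using assms by (auto simp: defs)
  note cl = f g h l G
  have swap: "g' \<otimes>\<^bsub>G\<^esub> f = f \<otimes>\<^bsub>G\<^esub> g" "h' \<otimes>\<^bsub>G\<^esub> f = f \<otimes>\<^bsub>G\<^esub> h" "l' \<otimes>\<^bsub>G\<^esub> f = f \<otimes>\<^bsub>G\<^esub> l"
    using cl by (auto simp: defs cj_swap)
  define t1 t2 t3 t4 t5 where t1: "t1 = \<alpha> g h l" "t2 = \<alpha> f (g \<otimes>\<^bsub>G\<^esub> h) l" "t3 = \<alpha> f g h"
    "t4 = \<alpha> (f \<otimes>\<^bsub>G\<^esub> g) h l" "t5 = \<alpha> f g (h \<otimes>\<^bsub>G\<^esub> l)"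
  define t6 t7 t8 t9 where t2: "t6 = \<alpha> f h l" "t7 = \<alpha> g' (f \<otimes>\<^bsub>G\<^esub> h) l" "t8 = \<alpha> g' f h"
    "t9 = \<alpha> g' f (h \<otimes>\<^bsub>G\<^esub> l)"
  define t10 t11 t12 t13 where t3: "t10 = \<alpha> h' f l" "t11 = \<alpha> g' h' f" "t12 = \<alpha> (g' \<otimes>\<^bsub>G\<^esub> h') f l"
    "t13 = \<alpha> g' h' (f \<otimes>\<^bsub>G\<^esub> l)"
  define t14 t15 t16 t17 where t4: "t14 = \<alpha> h' l' f" "t15 = \<alpha> g' (h' \<otimes>\<^bsub>G\<^esub> l') f" "t16 = \<alpha> g' h' l'"
    "t17 = \<alpha> (g' \<otimes>\<^bsub>G\<^esub> h') l' f"
  note t = t1 t2 t3 t4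
  define b1 b2 b3 b4 where p: "b1 = tc f g (h \<otimes>\<^bsub>G\<^esub> l)" "b2 = tc f h l" "b3 = tc f (g \<otimes>\<^bsub>G\<^esub> h) l" "b4 = tc f g h"
  \<comment> \<open>Only \<open>f\<close> acts here, so there are four interleavings:
    \<open>f\<close> before \<open>g\<close>, between two neighbouring degrees, or after
    \<open>l\<close>.\<close>
  have d: "t1 \<otimes>\<^bsub>K\<^esub> t2 \<otimes>\<^bsub>K\<^esub> t3 = t4 \<otimes>\<^bsub>K\<^esub> t5" "t6 \<otimes>\<^bsub>K\<^esub> t7 \<otimes>\<^bsub>K\<^esub> t8 = t4 \<otimes>\<^bsub>K\<^esub> t9"
    "t10 \<otimes>\<^bsub>K\<^esub> t7 \<otimes>\<^bsub>K\<^esub> t11 = t12 \<otimes>\<^bsub>K\<^esub> t13" "t14 \<otimes>\<^bsub>K\<^esub> t15 \<otimes>\<^bsub>K\<^esub> t16 = t17 \<otimes>\<^bsub>K\<^esub> t13"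
    using \<alpha>_cocycle[of f g h l] \<alpha>_cocycle[of g' f h l] \<alpha>_cocycle[of g' h' f l] \<alpha>_cocycle[of g' h' l' f] cl
    by (simp_all add: t swap)
  have q: "b1 \<otimes>\<^bsub>K\<^esub> t9 = t5 \<otimes>\<^bsub>K\<^esub> t15" "b2 \<otimes>\<^bsub>K\<^esub> t10 = t6 \<otimes>\<^bsub>K\<^esub> t14" "b3 \<otimes>\<^bsub>K\<^esub> t12 = t2 \<otimes>\<^bsub>K\<^esub> t17"
    "b4 \<otimes>\<^bsub>K\<^esub> t8 = t3 \<otimes>\<^bsub>K\<^esub> t11"
    using tc_mult[of f g "h \<otimes>\<^bsub>G\<^esub> l"] tc_mult[of f h l] tc_mult[of f "g \<otimes>\<^bsub>G\<^esub> h" l] tc_mult[of f g h] cl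
    by (simp_all add: t p defs cj_hom)
  have U: "t1 \<in> Units K" "t2 \<in> Units K" "t3 \<in> Units K" "t4 \<in> Units K" "t5 \<in> Units K" "t6 \<in> Units K"
    "t7 \<in> Units K" "t8 \<in> Units K" "t9 \<in> Units K" "t10 \<in> Units K" "t11 \<in> Units K" "t12 \<in> Units K"
    "t13 \<in> Units K" "t14 \<in> Units K" "t15 \<in> Units K" "t16 \<in> Units K" "t17 \<in> Units K"
    using cl by (simp_all add: t)
  have P: "b1 \<in> carrier K" "b2 \<in> carrier K" "b3 \<in> carrier K" "b4 \<in> carrier K"
    using cl by (simp_all add: p)
  note C = U[THEN K.Units_closed] P
  \<comment> \<open>As before, \<open>D\<close> clears denominators, and \<open>E\<close> holds the
    values shared by two consecutive cocycle equations.\<close>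
  define D where "D = t9 \<otimes>\<^bsub>K\<^esub> t10 \<otimes>\<^bsub>K\<^esub> (t12 \<otimes>\<^bsub>K\<^esub> t8)"
  define E where "E = t4 \<otimes>\<^bsub>K\<^esub> t7 \<otimes>\<^bsub>K\<^esub> t13"
  have "(b1 \<otimes>\<^bsub>K\<^esub> b2 \<otimes>\<^bsub>K\<^esub> t16) \<otimes>\<^bsub>K\<^esub> D = (b1 \<otimes>\<^bsub>K\<^esub> t9) \<otimes>\<^bsub>K\<^esub> (b2 \<otimes>\<^bsub>K\<^esub> t10) \<otimes>\<^bsub>K\<^esub> t16 \<otimes>\<^bsub>K\<^esub> (t12 \<otimes>\<^bsub>K\<^esub> t8)"
    unfolding D_def using C by (simp add: K.m_ac)
  then have L: "(b1 \<otimes>\<^bsub>K\<^esub> b2 \<otimes>\<^bsub>K\<^esub> t16) \<otimes>\<^bsub>K\<^esub> D \<otimes>\<^bsub>K\<^esub> E =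
    (t6 \<otimes>\<^bsub>K\<^esub> t7 \<otimes>\<^bsub>K\<^esub> t8) \<otimes>\<^bsub>K\<^esub> (t14 \<otimes>\<^bsub>K\<^esub> t15 \<otimes>\<^bsub>K\<^esub> t16) \<otimes>\<^bsub>K\<^esub> (t4 \<otimes>\<^bsub>K\<^esub> t5) \<otimes>\<^bsub>K\<^esub> (t12 \<otimes>\<^bsub>K\<^esub> t13)"
    unfolding q E_def using C by (simp add: K.m_ac)
  have "(t1 \<otimes>\<^bsub>K\<^esub> b3 \<otimes>\<^bsub>K\<^esub> b4) \<otimes>\<^bsub>K\<^esub> D = t1 \<otimes>\<^bsub>K\<^esub> (b3 \<otimes>\<^bsub>K\<^esub> t12) \<otimes>\<^bsub>K\<^esub> (b4 \<otimes>\<^bsub>K\<^esub> t8) \<otimes>\<^bsub>K\<^esub> (t9 \<otimes>\<^bsub>K\<^esub> t10)"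
    unfolding D_def using C by (simp add: K.m_ac)
  then have R: "(t1 \<otimes>\<^bsub>K\<^esub> b3 \<otimes>\<^bsub>K\<^esub> b4) \<otimes>\<^bsub>K\<^esub> D \<otimes>\<^bsub>K\<^esub> E =
    (t4 \<otimes>\<^bsub>K\<^esub> t9) \<otimes>\<^bsub>K\<^esub> (t17 \<otimes>\<^bsub>K\<^esub> t13) \<otimes>\<^bsub>K\<^esub> (t1 \<otimes>\<^bsub>K\<^esub> t2 \<otimes>\<^bsub>K\<^esub> t3) \<otimes>\<^bsub>K\<^esub> (t10 \<otimes>\<^bsub>K\<^esub> t7 \<otimes>\<^bsub>K\<^esub> t11)"
    unfolding q E_def using C by (simp add: K.m_ac)
  have DE: "D \<in> Units K" "E \<in> Units K" unfolding D_def E_def using U by simp_all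
  have "(b1 \<otimes>\<^bsub>K\<^esub> b2 \<otimes>\<^bsub>K\<^esub> t16) \<otimes>\<^bsub>K\<^esub> D \<otimes>\<^bsub>K\<^esub> E = (t1 \<otimes>\<^bsub>K\<^esub> b3 \<otimes>\<^bsub>K\<^esub> b4) \<otimes>\<^bsub>K\<^esub> D \<otimes>\<^bsub>K\<^esub> E"
    unfolding L R d ..
  from Units_cancel[OF DE(2) _ _ this] have "(b1 \<otimes>\<^bsub>K\<^esub> b2 \<otimes>\<^bsub>K\<^esub> t16) \<otimes>\<^bsub>K\<^esub> D = (t1 \<otimes>\<^bsub>K\<^esub> b3 \<otimes>\<^bsub>K\<^esub> b4) \<otimes>\<^bsub>K\<^esub> D"
    using C DE[THEN K.Units_closed] by simp
  from Units_cancel[OF DE(1) _ _ this] have "b1 \<otimes>\<^bsub>K\<^esub> b2 \<otimes>\<^bsub>K\<^esub> t16 = t1 \<otimes>\<^bsub>K\<^esub> b3 \<otimes>\<^bsub>K\<^esub> b4"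
    using C by simp
  then show ?thesis by (simp add: p defs t)
qed

text \<open>The scalar identity behind the equivariance of the braiding. Cleared of denominators,
  both sides consist of the same values of \<open>\<alpha>\<close>, once the two iterated conjugates
  of \<open>g\<close> that come from the two factorisations of hf are identified.\<close>

lemma tc_braid:
  assumes f: "f \<in> carrier G" and g: "g \<in> carrier G" and h: "h \<in> carrier G"
  shows "tc h f g \<otimes>\<^bsub>K\<^esub> ac h f g = tc h (cj f g) f \<otimes>\<^bsub>K\<^esub> ac (cj h f) h g"
proof -
  define f' g1 g' g'' where defs: "f' = cj h f" "g1 = cj f g" "g' = cj h g" "g'' = cj h g1"
  have g'': "g'' = cj f' g'"
    using assms cj_mult[of f' h g] cj_mult[of h f g] by (simp add: defs cj_swap)
  have G: "f' \<in> carrier G" "g1 \<in> carrier G" "g' \<in> carrier G" "g'' \<in> carrier G"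
    using assms by (auto simp: defs)
  note cl = f g h G
  define t1 t2 t3 t4 t5 t6 where t: "t1 = \<alpha> f' h g" "t2 = \<alpha> h f g" "t3 = \<alpha> f' g' h" "t4 = \<alpha> g'' h f"
    "t5 = \<alpha> h g1 f" "t6 = \<alpha> g'' f' h"
  define b1 a1 b2 a2 where p: "b1 = tc h f g" "a1 = ac h f g" "b2 = tc h g1 f" "a2 = ac f' h g"
  have q: "b1 \<otimes>\<^bsub>K\<^esub> t1 = t2 \<otimes>\<^bsub>K\<^esub> t3" "a1 \<otimes>\<^bsub>K\<^esub> (t2 \<otimes>\<^bsub>K\<^esub> t4) = t5" "b2 \<otimes>\<^bsub>K\<^esub> t4 = t5 \<otimes>\<^bsub>K\<^esub> t6"
    "a2 \<otimes>\<^bsub>K\<^esub> (t1 \<otimes>\<^bsub>K\<^esub> t6) = t3"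
    using tc_mult[of h f g] ac_mult[of h f g] tc_mult[of h g1 f] ac_mult[of f' h g] cl g''[symmetric]
    by (simp_all add: t p defs)
  have U: "t1 \<in> Units K" "t2 \<in> Units K" "t3 \<in> Units K" "t4 \<in> Units K" "t5 \<in> Units K" "t6 \<in> Units K"
    using cl by (simp_all add: t)
  have P: "b1 \<in> carrier K" "b2 \<in> carrier K" "a1 \<in> carrier K" "a2 \<in> carrier K"
    using cl by (simp_all add: p)
  note C = U[THEN K.Units_closed] P
  define D where "D = t1 \<otimes>\<^bsub>K\<^esub> t2 \<otimes>\<^bsub>K\<^esub> t4 \<otimes>\<^bsub>K\<^esub> t6"
  have "(b1 \<otimes>\<^bsub>K\<^esub> a1) \<otimes>\<^bsub>K\<^esub> D = (b1 \<otimes>\<^bsub>K\<^esub> t1) \<otimes>\<^bsub>K\<^esub> (a1 \<otimes>\<^bsub>K\<^esub> (t2 \<otimes>\<^bsub>K\<^esub> t4)) \<otimes>\<^bsub>K\<^esub> t6"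
    unfolding D_def using C by (simp add: K.m_ac)
  also have "\<dots> = (b2 \<otimes>\<^bsub>K\<^esub> t4) \<otimes>\<^bsub>K\<^esub> (a2 \<otimes>\<^bsub>K\<^esub> (t1 \<otimes>\<^bsub>K\<^esub> t6)) \<otimes>\<^bsub>K\<^esub> t2"
    unfolding q using C by (simp add: K.m_ac)
  also have "\<dots> = (b2 \<otimes>\<^bsub>K\<^esub> a2) \<otimes>\<^bsub>K\<^esub> D"
    unfolding D_def using C by (simp add: K.m_ac)
  finally have eq: "(b1 \<otimes>\<^bsub>K\<^esub> a1) \<otimes>\<^bsub>K\<^esub> D = (b2 \<otimes>\<^bsub>K\<^esub> a2) \<otimes>\<^bsub>K\<^esub> D" .
  have "D \<in> Units K" using U by (simp add: D_def)
  from Units_cancel[OF this _ _ eq] have "b1 \<otimes>\<^bsub>K\<^esub> a1 = b2 \<otimes>\<^bsub>K\<^esub> a2" using C by simp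
  then show ?thesis by (simp add: p defs)
qed

end

section \<open>Projective actions and the braiding\<close>

context cocycle_setting
begin

abbreviation pa :: "('g, 'k, 'v) graded \<Rightarrow> ('g \<Rightarrow> 'v \<Rightarrow> 'v) \<Rightarrow> bool" where
  "pa X \<rho> \<equiv> projective_action G K \<alpha> X \<rho>"

lemma pa_Lin: "pa X \<rho> \<Longrightarrow> f \<in> carrier G \<Longrightarrow> \<rho> f \<in> Lin K (space X) (space X)"
  by (simp add: projective_action_def)

lemma pa_lin: "pa X \<rho> \<Longrightarrow> f \<in> carrier G \<Longrightarrow> lin X X (\<rho> f)"
  using pa_Lin by (simp add: Lin_iff)

lemma pa_closed: "pa X \<rho> \<Longrightarrow> f \<in> carrier G \<Longrightarrow> x \<in> car X \<Longrightarrow> \<rho> f x \<in> car X"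
  by (rule is_linear_closed[OF pa_lin])

lemma pa_bij: "pa X \<rho> \<Longrightarrow> f \<in> carrier G \<Longrightarrow> bij_betw (\<rho> f) (car X) (car X)"
  by (simp add: projective_action_def)

lemma pa_image: "pa X \<rho> \<Longrightarrow> f \<in> carrier G \<Longrightarrow> g \<in> carrier G \<Longrightarrow> \<rho> f ` piece X g = piece X (cj f g)"
  by (simp add: projective_action_def)

lemma pa_piece:
  "pa X \<rho> \<Longrightarrow> f \<in> carrier G \<Longrightarrow> g \<in> carrier G \<Longrightarrow> x \<in> piece X g \<Longrightarrow> \<rho> f x \<in> piece X (cj f g)"
  using pa_image by blast

lemma pa_mult:
  "pa X \<rho> \<Longrightarrow> f \<in> carrier G \<Longrightarrow> g \<in> carrier G \<Longrightarrow> h \<in> carrier G \<Longrightarrow> x \<in> piece X h \<Longrightarrow>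
   \<rho> (f \<otimes>\<^bsub>G\<^esub> g) x = ac f g h \<odot>\<^bsub>space X\<^esub> \<rho> f (\<rho> g x)"
  by (simp add: projective_action_def)

text \<open>\<open>ac\<close> is trivial at two identities, so the operator at the identity is
  idempotent on every piece, and injectivity makes it the identity map. The lemma concerns a bare
  family of maps, because the action extracted from a half-braiding needs it before it is known to
  be projective.\<close>

lemma action_one:
  assumes X: "gs X" and lin: "lin X X (\<rho> \<one>\<^bsub>G\<^esub>)" and inj: "inj_on (\<rho> \<one>\<^bsub>G\<^esub>) (car X)"
    and mult: "\<And>h x. h \<in> carrier G \<Longrightarrow> x \<in> piece X h \<Longrightarrow>
      \<rho> (\<one>\<^bsub>G\<^esub> \<otimes>\<^bsub>G\<^esub> \<one>\<^bsub>G\<^esub>) x = ac \<one>\<^bsub>G\<^esub> \<one>\<^bsub>G\<^esub> h \<odot>\<^bsub>space X\<^esub> \<rho> \<one>\<^bsub>G\<^esub> (\<rho> \<one>\<^bsub>G\<^esub> x)"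
    and x: "x \<in> car X"
  shows "\<rho> \<one>\<^bsub>G\<^esub> x = x"
proof (rule linear_eq_on_pieces[OF X gs_module[OF X] lin is_linear_id _ x])
  fix h x assume h: "h \<in> carrier G" "x \<in> piece X h" and x: "x \<in> car X"
  have cl: "\<rho> \<one>\<^bsub>G\<^esub> x \<in> car X" "\<rho> \<one>\<^bsub>G\<^esub> (\<rho> \<one>\<^bsub>G\<^esub> x) \<in> car X"
    using is_linear_closed[OF lin] x by auto
  then have "\<rho> \<one>\<^bsub>G\<^esub> (\<rho> \<one>\<^bsub>G\<^esub> x) = \<rho> \<one>\<^bsub>G\<^esub> x"
    using mult[OF h] h by (simp add: gs_smult_one[OF X])
  then show "\<rho> \<one>\<^bsub>G\<^esub> x = x" using inj cl x by (auto dest: inj_onD)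
qed

lemma pa_one: "gs X \<Longrightarrow> pa X \<rho> \<Longrightarrow> x \<in> car X \<Longrightarrow> \<rho> \<one>\<^bsub>G\<^esub> x = x"
  by (rule action_one[OF _ pa_lin bij_betw_imp_inj_on[OF pa_bij] pa_mult]) simp_all

text \<open>A graded inverse of \<open>\<rho> f\<close> is \<open>\<rho> (inv f)\<close>, rescaled on every homogeneous component.\<close>

lemma projective_actionI:
  assumes X: "gs X" and ext: "\<rho> \<in> extensional (carrier G)"
    and Lin: "\<And>f. f \<in> carrier G \<Longrightarrow> \<rho> f \<in> Lin K (space X) (space X)"
    and piece: "\<And>f g x. f \<in> carrier G \<Longrightarrow> g \<in> carrier G \<Longrightarrow> x \<in> piece X g \<Longrightarrow> \<rho> f x \<in> piece X (cj f g)"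
    and mult: "\<And>f g h x. f \<in> carrier G \<Longrightarrow> g \<in> carrier G \<Longrightarrow> h \<in> carrier G \<Longrightarrow> x \<in> piece X h \<Longrightarrow>
      \<rho> (f \<otimes>\<^bsub>G\<^esub> g) x = ac f g h \<odot>\<^bsub>space X\<^esub> \<rho> f (\<rho> g x)"
    and one: "\<And>x. x \<in> car X \<Longrightarrow> \<rho> \<one>\<^bsub>G\<^esub> x = x"
  shows "pa X \<rho>"
proof -
  have lin: "lin X X (\<rho> f)" if "f \<in> carrier G" for f using Lin[OF that] by (simp add: Lin_iff)
  note cl = is_linear_closed[OF lin]
  \<comment> \<open>When \<open>f\<close> and \<open>g\<close> are inverse to each other, the
    composite of their operators is a scalar on each piece.\<close>
  have inv_mult: "x = ac f g h \<odot>\<^bsub>space X\<^esub> \<rho> f (\<rho> g x)"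
    if "f \<in> carrier G" "g \<in> carrier G" "h \<in> carrier G" "x \<in> piece X h" "f \<otimes>\<^bsub>G\<^esub> g = \<one>\<^bsub>G\<^esub>" for f g h x
    using mult[OF that(1-4)] one piece_car[OF X that(3,4)] that(5) by simp
  have "bij_betw (\<rho> f) (car X) (car X) \<and> (\<forall>g \<in> carrier G. \<rho> f ` piece X g = piece X (cj f g))"
    if f: "f \<in> carrier G" for f
  proof -
    let ?i = "inv\<^bsub>G\<^esub> f"
    have i: "?i \<in> carrier G" using f by simp
    have surj: "\<exists>x \<in> piece X (cj ?i g). y = \<rho> f x" if g: "g \<in> carrier G" "y \<in> piece X g" for g y
    proof
      have y: "y \<in> car X" using piece_car[OF X g] .
      have "\<rho> ?i y \<in> piece X (cj ?i g)" using piece[OF i g] .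
      then show "ac f ?i g \<odot>\<^bsub>space X\<^esub> \<rho> ?i y \<in> piece X (cj ?i g)"
        using f g by (simp add: piece_smult X)
      show "y = \<rho> f (ac f ?i g \<odot>\<^bsub>space X\<^esub> \<rho> ?i y)"
        using inv_mult[OF f i g] f g by (simp add: is_linear_smult[OF lin] cl y)
    qed
    have img: "\<rho> f ` piece X g = piece X (cj f g)" if g: "g \<in> carrier G" for g
    proof
      show "\<rho> f ` piece X g \<subseteq> piece X (cj f g)" using piece f g by blast
      show "piece X (cj f g) \<subseteq> \<rho> f ` piece X g"
        using surj[of "cj f g"] f g by (auto simp: cj_inv)
    qed
    define s where "s = (\<lambda>x. \<Oplus>\<^bsub>space X\<^esub>g\<in>carrier G. ac ?i f g \<odot>\<^bsub>space X\<^esub> \<rho> ?i (\<rho> f (pr X g x)))"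
    \<comment> \<open>A left inverse. A vector of degree \<open>g\<close> in the image comes from
      degree \<open>cj ?i g\<close>, which is where the scalar is evaluated.\<close>
    define l where "l = (\<lambda>x. \<Oplus>\<^bsub>space X\<^esub>g\<in>carrier G. ac ?i f (cj ?i g) \<odot>\<^bsub>space X\<^esub> \<rho> ?i (pr X g x))"
    have l_lin: "lin X X l"
      unfolding l_def using f
      by (intro is_linear_finsum gs_module X finite_G is_linear_scale is_linear_comp[OF pr_linear lin]) auto
    have l_inv: "l (\<rho> f x) = x" if "x \<in> car X" for x
    proof (rule linear_eq_on_pieces[OF X gs_module[OF X] is_linear_comp[OF lin[OF f] l_lin] is_linear_id _ that])
      fix g x assume g: "g \<in> carrier G" "x \<in> piece X g" "x \<in> car X"
      interpret X: module K "space X" by (rule gs_module[OF X])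
      have cg: "cj f g \<in> carrier G" using f g by simp
      have "l (\<rho> f x) = (\<Oplus>\<^bsub>space X\<^esub>h\<in>carrier G. if h = cj f g then x else \<zero>\<^bsub>space X\<^esub>)"
        unfolding l_def
      proof (rule X.M.finsum_cong')
        fix h assume h: "h \<in> carrier G"
        show "ac ?i f (cj ?i h) \<odot>\<^bsub>space X\<^esub> \<rho> ?i (pr X h (\<rho> f x)) = (if h = cj f g then x else \<zero>\<^bsub>space X\<^esub>)"
          using inv_mult[OF i f g(1,2)] f g h
          by (auto simp: pr_homogeneous[OF X h cg piece[OF f g(1,2)]] cj_inv
              is_linear_zero[OF X.module_axioms X.module_axioms lin[OF i]])
      qed (use g in auto)
      then show "l (\<rho> f x) = x" using finsum_delta[OF X.module_axioms cg g(3)] by simp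
    qed
    have inj: "inj_on (\<rho> f) (car X)" by (rule inj_on_inverseI[where g = l]) (rule l_inv)
    have "car X \<subseteq> \<rho> f ` car X"
    proof
      fix y assume y: "y \<in> car X"
      \<comment> \<open>A right inverse: this time the inverse element acts first, on a vector of
        degree \<open>g\<close>, so the scalar is read off in degree \<open>g\<close>
        itself.\<close>
      define l' where "l' = (\<lambda>x. \<Oplus>\<^bsub>space X\<^esub>g\<in>carrier G. ac f ?i g \<odot>\<^bsub>space X\<^esub> \<rho> ?i (pr X g x))"
      have l'_lin: "lin X X l'"
        unfolding l'_def using f
        by (intro is_linear_finsum gs_module X finite_G is_linear_scale is_linear_comp[OF pr_linear lin]) auto
      have "\<rho> f (l' y) = y"
      proof (rule linear_eq_on_pieces[OF X gs_module[OF X] is_linear_comp[OF l'_lin lin[OF f]] is_linear_id _ y])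
        fix g x assume g: "g \<in> carrier G" "x \<in> piece X g" "x \<in> car X"
        interpret X: module K "space X" by (rule gs_module[OF X])
        let ?v = "ac f ?i g \<odot>\<^bsub>space X\<^esub> \<rho> ?i x"
        have v: "?v \<in> car X" using f g cl[OF i g(3)] by simp
        have "l' x = (\<Oplus>\<^bsub>space X\<^esub>h\<in>carrier G. if h = g then ?v else \<zero>\<^bsub>space X\<^esub>)"
          unfolding l'_def
        proof (rule X.M.finsum_cong')
          fix h assume h: "h \<in> carrier G"
          show "ac f ?i h \<odot>\<^bsub>space X\<^esub> \<rho> ?i (pr X h x) = (if h = g then ?v else \<zero>\<^bsub>space X\<^esub>)"
            using f h by (auto simp: pr_homogeneous[OF X h g(1,2)]
                is_linear_zero[OF X.module_axioms X.module_axioms lin[OF i]])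
        qed (use v in auto)
        then have "l' x = ?v" using finsum_delta[OF X.module_axioms g(1) v] by simp
        then show "\<rho> f (l' x) = x"
          using inv_mult[OF f i g(1,2)] f g by (simp add: is_linear_smult[OF lin] cl)
      qed
      then show "y \<in> \<rho> f ` car X" using is_linear_closed[OF l'_lin y] by (metis imageI)
    qed
    then show ?thesis using inj img cl[OF f] by (auto simp: bij_betw_def)
  qed
  then show ?thesis
    unfolding projective_action_def using ext Lin mult by blast
qed

text \<open>Scalars such as \<open>ac\<close> depend on the total degree, so maps have to be
  compared on one piece at a time. The comparison runs through the equalizer of the two
  maps.\<close>

lemma tensor_piece_eqI:
  assumes X: "gs X" and Y: "gs Y" and W: "module K W"
    and \<phi>: "is_linear K (space (X \<otimes>\<^sub>V Y)) W \<phi>" and \<psi>: "is_linear K (space (X \<otimes>\<^sub>V Y)) W \<psi>"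
    and k: "k \<in> carrier G" and t: "t \<in> piece (X \<otimes>\<^sub>V Y) k"
    and eq: "\<And>f h x y. \<lbrakk>f \<in> carrier G; h \<in> carrier G; f \<otimes>\<^bsub>G\<^esub> h = k; x \<in> piece X f; y \<in> piece Y h;
           x \<in> car X; y \<in> car Y\<rbrakk> \<Longrightarrow> \<phi> (tv X Y x y) = \<psi> (tv X Y x y)"
  shows "\<phi> t = \<psi> t"
proof -
  note XY = gs_module[OF gs_tensor[OF X Y]]
  have "id t \<in> {t \<in> car (X \<otimes>\<^sub>V Y). \<phi> t = \<psi> t}"
    by (rule tensor_piece_image[OF X Y XY _ submodule_equalizer[OF XY W \<phi> \<psi>] k t])
       (use eq X Y in \<open>auto simp: tv_closed is_linear_id id_def\<close>)
  then show ?thesis by simp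
qed

section \<open>Tensor products of actions\<close>

definition ta :: "('g, 'k, 'v) graded \<Rightarrow> ('g \<Rightarrow> 'v \<Rightarrow> 'v) \<Rightarrow> ('g, 'k, 'v) graded \<Rightarrow> ('g \<Rightarrow> 'v \<Rightarrow> 'v) \<Rightarrow>
    'g \<Rightarrow> 'v \<Rightarrow> 'v" where
  "ta X \<rho> Y \<sigma> = (\<lambda>f \<in> carrier G. tensor_lift G K T X Y (space (X \<otimes>\<^sub>V Y))
     (\<lambda>g h x y. tc f g h \<odot>\<^bsub>space (X \<otimes>\<^sub>V Y)\<^esub> tv X Y (\<rho> f x) (\<sigma> f y)))"

lemma action_tensor_eq: "action_tensor G K T \<alpha> (X, \<rho>) (Y, \<sigma>) = (X \<otimes>\<^sub>V Y, ta X \<rho> Y \<sigma>)"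
  by (simp add: action_tensor_def ta_def space_tensor Let_def)

context
  fixes X \<rho> Y \<sigma>
  assumes X: "gs X" "pa X \<rho>" and Y: "gs Y" "pa Y \<sigma>"
begin

lemma ta_bilinear:
  assumes "f \<in> carrier G" "g \<in> carrier G" "h \<in> carrier G"
  shows "is_bilinear K (space X) (space Y) (space (X \<otimes>\<^sub>V Y))
     (\<lambda>x y. tc f g h \<odot>\<^bsub>space (X \<otimes>\<^sub>V Y)\<^esub> tv X Y (\<rho> f x) (\<sigma> f y))"
  using assms
  by (intro is_bilinear_scale gs_module gs_tensor X Y
        is_bilinear_comp2[OF tv_bilinear[OF X(1) Y(1)] pa_lin[OF X(2)] pa_lin[OF Y(2)]]) auto

lemma ta_tv:
  assumes "f \<in> carrier G" "g \<in> carrier G" "h \<in> carrier G" "x \<in> piece X g" "y \<in> piece Y h"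
  shows "ta X \<rho> Y \<sigma> f (tv X Y x y) = tc f g h \<odot>\<^bsub>space (X \<otimes>\<^sub>V Y)\<^esub> tv X Y (\<rho> f x) (\<sigma> f y)"
  using tensor_lift_tv[OF X(1) Y(1) gs_fd[OF gs_tensor[OF X(1) Y(1)]] ta_bilinear] assms
  by (simp add: ta_def)

lemma ta_Lin: "f \<in> carrier G \<Longrightarrow> ta X \<rho> Y \<sigma> f \<in> Lin K (space (X \<otimes>\<^sub>V Y)) (space (X \<otimes>\<^sub>V Y))"
  using tensor_lift_Lin[OF X(1) Y(1) gs_fd[OF gs_tensor[OF X(1) Y(1)]] ta_bilinear]
  by (simp add: ta_def)

lemma ta_lin: "f \<in> carrier G \<Longrightarrow> lin (X \<otimes>\<^sub>V Y) (X \<otimes>\<^sub>V Y) (ta X \<rho> Y \<sigma> f)"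
  using ta_Lin by (simp add: Lin_iff)

text \<open>On a pure tensor of degrees \<open>h\<close> and \<open>l\<close> projectivity reduces
  to the scalar identity \<open>ac_tc\<close>; bijectivity is left to
  \<open>projective_actionI\<close>.\<close>

lemma pa_tensor: "pa (X \<otimes>\<^sub>V Y) (ta X \<rho> Y \<sigma>)"
proof -
  note XY = gs_tensor[OF X(1) Y(1)]
  note tvp = tv_piece[OF X(1) Y(1)]
  show ?thesis
  proof (rule projective_actionI[OF XY])
    fix f k t assume *: "f \<in> carrier G" "k \<in> carrier G" "t \<in> piece (X \<otimes>\<^sub>V Y) k"
    have fk: "cj f k \<in> carrier G" using * by simp
    show "ta X \<rho> Y \<sigma> f t \<in> piece (X \<otimes>\<^sub>V Y) (cj f k)"
    proof (rule tensor_piece_image[OF X(1) Y(1) gs_module[OF XY] ta_lin[OF *(1)] piece_submodule[OF XY fk] *(2,3)])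
      fix g h x y assume **: "g \<in> carrier G" "h \<in> carrier G" "g \<otimes>\<^bsub>G\<^esub> h = k" "x \<in> piece X g" "y \<in> piece Y h"
      have "tv X Y (\<rho> f x) (\<sigma> f y) \<in> piece (X \<otimes>\<^sub>V Y) (cj f g \<otimes>\<^bsub>G\<^esub> cj f h)"
        using * ** by (intro tvp cj_closed pa_piece[OF X(2)] pa_piece[OF Y(2)])
      moreover have "cj f k = cj f g \<otimes>\<^bsub>G\<^esub> cj f h" using * ** cj_hom by blast
      ultimately show "ta X \<rho> Y \<sigma> f (tv X Y x y) \<in> piece (X \<otimes>\<^sub>V Y) (cj f k)"
        using * ** by (simp add: ta_tv piece_smult XY)
    qed
  next
    fix f g k t assume *: "f \<in> carrier G" "g \<in> carrier G" "k \<in> carrier G" "t \<in> piece (X \<otimes>\<^sub>V Y) k"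
    show "ta X \<rho> Y \<sigma> (f \<otimes>\<^bsub>G\<^esub> g) t = ac f g k \<odot>\<^bsub>space (X \<otimes>\<^sub>V Y)\<^esub> ta X \<rho> Y \<sigma> f (ta X \<rho> Y \<sigma> g t)"
    proof (rule tensor_piece_eqI[OF X(1) Y(1) gs_module[OF XY] ta_lin
          is_linear_scale[OF gs_module[OF XY] _ is_linear_comp[OF ta_lin ta_lin]] *(3,4)])
      fix h l x y assume **: "h \<in> carrier G" "l \<in> carrier G" "h \<otimes>\<^bsub>G\<^esub> l = k"
        "x \<in> piece X h" "y \<in> piece Y l" "x \<in> car X" "y \<in> car Y"
      note p = pa_piece[OF X(2) *(2) **(1,4)] pa_piece[OF Y(2) *(2) **(2,5)]
      note c = pa_closed[OF X(2) *(2) **(6)] pa_closed[OF Y(2) *(2) **(7)]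
      note cc = pa_closed[OF X(2) *(1) c(1)] pa_closed[OF Y(2) *(1) c(2)]
      let ?t = "tv X Y (\<rho> f (\<rho> g x)) (\<sigma> f (\<sigma> g y))"
      have t: "?t \<in> car (X \<otimes>\<^sub>V Y)" using cc X Y by (simp add: tv_closed)
      have "ta X \<rho> Y \<sigma> (f \<otimes>\<^bsub>G\<^esub> g) (tv X Y x y) =
          (tc (f \<otimes>\<^bsub>G\<^esub> g) h l \<otimes>\<^bsub>K\<^esub> ac f g h \<otimes>\<^bsub>K\<^esub> ac f g l) \<odot>\<^bsub>space (X \<otimes>\<^sub>V Y)\<^esub> ?t"
        using * ** cc t X Y
        by (simp add: ta_tv[OF _ **(1,2,4,5)] pa_mult[OF X(2) *(1,2) **(1,4)] pa_mult[OF Y(2) *(1,2) **(2,5)]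
            tv_smult_left tv_smult_right gs_smult_closed gs_smult_smult XY K.m_ac)
      also have "\<dots> = (ac f g (h \<otimes>\<^bsub>G\<^esub> l) \<otimes>\<^bsub>K\<^esub> tc g h l \<otimes>\<^bsub>K\<^esub> tc f (cj g h) (cj g l)) \<odot>\<^bsub>space (X \<otimes>\<^sub>V Y)\<^esub> ?t"
        by (simp only: ac_tc[OF *(1,2) **(1,2)])
      also have "\<dots> = ac f g k \<odot>\<^bsub>space (X \<otimes>\<^sub>V Y)\<^esub> ta X \<rho> Y \<sigma> f (ta X \<rho> Y \<sigma> g (tv X Y x y))"
        using * ** c t X Y
        by (simp add: ta_tv[OF *(2) **(1,2,4,5)] ta_tv[OF *(1) _ _ p] is_linear_smult[OF ta_lin[OF *(1)]]
            tv_closed gs_smult_closed gs_smult_smult XY K.m_assoc)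
      finally show "ta X \<rho> Y \<sigma> (f \<otimes>\<^bsub>G\<^esub> g) (tv X Y x y) =
          ac f g k \<odot>\<^bsub>space (X \<otimes>\<^sub>V Y)\<^esub> ta X \<rho> Y \<sigma> f (ta X \<rho> Y \<sigma> g (tv X Y x y))" .
    qed (use * in auto)
  next
    fix t assume t: "t \<in> car (X \<otimes>\<^sub>V Y)"
    show "ta X \<rho> Y \<sigma> \<one>\<^bsub>G\<^esub> t = t"
      by (rule tensor_linear_eqI[OF X(1) Y(1) gs_fd[OF XY] ta_lin is_linear_id _ t])
         (simp_all add: ta_tv pa_one[OF X] pa_one[OF Y] X Y tv_closed gs_smult_one XY)
  qed (use ta_Lin in \<open>auto simp: ta_def\<close>)
qed

end

definition ua :: "'g \<Rightarrow> 'v \<Rightarrow> 'v" where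
  "ua = (\<lambda>f \<in> carrier G. \<lambda>v \<in> car unit. v)"

lemma action_unit_eq: "action_unit G T = (unit, ua)"
  by (simp add: action_unit_def ua_def unit_line space_line)

text \<open>The pieces away from the identity vanish, and at the identity the scalar is trivial by
  \<open>ac_unit\<close>.\<close>

lemma pa_unit: "pa unit ua"
proof (rule projective_actionI[OF gs_unit])
  interpret U: module K "space unit" by (rule gs_module[OF gs_unit])
  show "ua f \<in> Lin K (space unit) (space unit)" if "f \<in> carrier G" for f
    using that by (simp add: ua_def Lin_restrict U.module_axioms is_linear_id)
  show "ua f x \<in> piece unit (cj f g)" if "f \<in> carrier G" "g \<in> carrier G" "x \<in> piece unit g" for f g x
    using that by (auto simp: ua_def piece_line split: if_splits)
  show "ua (f \<otimes>\<^bsub>G\<^esub> g) x = ac f g h \<odot>\<^bsub>space unit\<^esub> ua f (ua g x)"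
    if "f \<in> carrier G" "g \<in> carrier G" "h \<in> carrier G" "x \<in> piece unit h" for f g h x
    using that by (auto simp: ua_def piece_line split: if_splits)
qed (auto simp: ua_def)

text \<open>Only \<open>X\<close> carries an action. The same map is therefore the component at
  \<open>V\<close> of the half-braiding attached to \<open>\<rho>\<close> and, when \<open>V\<close>
  also carries an action, the braiding of \<open>ZCat\<close>.\<close>

definition br :: "('g, 'k, 'v) graded \<Rightarrow> ('g, 'k, 'v) graded \<Rightarrow> ('g \<Rightarrow> 'v \<Rightarrow> 'v) \<Rightarrow> 'v \<Rightarrow> 'v" where
  "br V X \<rho> = tensor_lift G K T V X (space (X \<otimes>\<^sub>V V)) (\<lambda>f g v x. tv X V (\<rho> f x) v)"

definition br_inv :: "('g, 'k, 'v) graded \<Rightarrow> ('g, 'k, 'v) graded \<Rightarrow> ('g \<Rightarrow> 'v \<Rightarrow> 'v) \<Rightarrow> 'v \<Rightarrow> 'v" where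
  "br_inv V X \<rho> = tensor_lift G K T X V (space (V \<otimes>\<^sub>V X)) (\<lambda>g f x v. tv V X v (inv_into (car X) (\<rho> f) x))"

context
  fixes V X \<rho>
  assumes V: "gs V" and X: "gs X" "pa X \<rho>"
begin

lemma br_bilinear:
  "f \<in> carrier G \<Longrightarrow> is_bilinear K (space V) (space X) (space (X \<otimes>\<^sub>V V)) (\<lambda>v x. tv X V (\<rho> f x) v)"
  by (rule is_bilinear_comp2[OF is_bilinear_swap[OF tv_bilinear[OF X(1) V]] is_linear_id pa_lin[OF X(2)]])

lemma br_gm: "br V X \<rho> \<in> gm (V \<otimes>\<^sub>V X) (X \<otimes>\<^sub>V V)"
  unfolding br_def
proof (rule tensor_lift_gm[OF V X(1) gs_tensor[OF X(1) V] br_bilinear])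
  fix f g v x assume *: "f \<in> carrier G" "g \<in> carrier G" "v \<in> piece V f" "x \<in> piece X g"
  have "tv X V (\<rho> f x) v \<in> piece (X \<otimes>\<^sub>V V) (cj f g \<otimes>\<^bsub>G\<^esub> f)"
    using * by (intro tv_piece X V pa_piece[OF X(2)]) auto
  then show "tv X V (\<rho> f x) v \<in> piece (X \<otimes>\<^sub>V V) (f \<otimes>\<^bsub>G\<^esub> g)" using * by (simp add: cj_swap)
qed

text \<open>The prescription depends on the degree of \<open>v\<close> alone, so \<open>x\<close>
  may be inhomogeneous.\<close>

lemma br_tv:
  assumes "f \<in> carrier G" "v \<in> piece V f" "x \<in> car X"
  shows "br V X \<rho> (tv V X v x) = tv X V (\<rho> f x) v"
proof -
  have v: "v \<in> car V" using piece_car[OF V assms(1,2)] .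
  show ?thesis
    by (rule linear_eq_on_pieces[OF X(1) gs_module[OF gs_tensor[OF X(1) V]]
          is_linear_comp[OF linear_tv_right[OF V X(1) v] gm_lin[OF br_gm]]
          is_linear_comp[OF pa_lin[OF X(2) assms(1)] linear_tv_left[OF X(1) V v]] _ assms(3)])
       (use assms tensor_lift_tv[OF V X(1) gs_fd[OF gs_tensor[OF X(1) V]] br_bilinear] in \<open>auto simp: br_def\<close>)
qed

lemma
  assumes "f \<in> carrier G"
  shows pa_inv_lin: "lin X X (inv_into (car X) (\<rho> f))"
    and pa_inv_left: "x \<in> car X \<Longrightarrow> inv_into (car X) (\<rho> f) (\<rho> f x) = x"
    and pa_inv_right: "x \<in> car X \<Longrightarrow> \<rho> f (inv_into (car X) (\<rho> f) x) = x"
    and pa_inv_piece: "g \<in> carrier G \<Longrightarrow> x \<in> piece X g \<Longrightarrow>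
          inv_into (car X) (\<rho> f) x \<in> piece X (cj (inv\<^bsub>G\<^esub> f) g)"
proof -
  note bij = pa_bij[OF X(2) assms]
  show "lin X X (inv_into (car X) (\<rho> f))"
    by (rule is_linear_inv_into[OF gs_module[OF X(1)] pa_lin[OF X(2) assms] bij])
  show left: "inv_into (car X) (\<rho> f) (\<rho> f x) = x" if "x \<in> car X" for x
    using bij that by (rule bij_betw_inv_into_left)
  show "\<rho> f (inv_into (car X) (\<rho> f) x) = x" if "x \<in> car X"
    using bij that by (rule bij_betw_inv_into_right)
  assume g: "g \<in> carrier G" "x \<in> piece X g"
  have ig: "cj (inv\<^bsub>G\<^esub> f) g \<in> carrier G" using assms g by simp
  have "x \<in> \<rho> f ` piece X (cj (inv\<^bsub>G\<^esub> f) g)"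
    using pa_image[OF X(2) assms ig] g assms by (simp add: cj_inv)
  then show "inv_into (car X) (\<rho> f) x \<in> piece X (cj (inv\<^bsub>G\<^esub> f) g)"
    using left piece_car[OF X(1) ig] by auto
qed

lemma br_inv_bilinear:
  "f \<in> carrier G \<Longrightarrow>
   is_bilinear K (space X) (space V) (space (V \<otimes>\<^sub>V X)) (\<lambda>x v. tv V X v (inv_into (car X) (\<rho> f) x))"
  by (rule is_bilinear_comp2[OF is_bilinear_swap[OF tv_bilinear[OF V X(1)]] pa_inv_lin is_linear_id])

lemma br_inv_gm: "br_inv V X \<rho> \<in> gm (X \<otimes>\<^sub>V V) (V \<otimes>\<^sub>V X)"
  unfolding br_inv_def
proof (rule tensor_lift_gm[OF X(1) V gs_tensor[OF V X(1)] br_inv_bilinear])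
  fix g f x v assume *: "g \<in> carrier G" "f \<in> carrier G" "x \<in> piece X g" "v \<in> piece V f"
  have "tv V X v (inv_into (car X) (\<rho> f) x) \<in> piece (V \<otimes>\<^sub>V X) (f \<otimes>\<^bsub>G\<^esub> cj (inv\<^bsub>G\<^esub> f) g)"
    using * by (intro tv_piece X V pa_inv_piece) auto
  moreover have "f \<otimes>\<^bsub>G\<^esub> cj (inv\<^bsub>G\<^esub> f) g = g \<otimes>\<^bsub>G\<^esub> f"
    using * cj_swap[of f "cj (inv\<^bsub>G\<^esub> f) g"] by (simp add: cj_inv)
  ultimately show "tv V X v (inv_into (car X) (\<rho> f) x) \<in> piece (V \<otimes>\<^sub>V X) (g \<otimes>\<^bsub>G\<^esub> f)" by simp
qed

lemma br_inv_tv: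
  assumes "f \<in> carrier G" "v \<in> piece V f" "x \<in> car X"
  shows "br_inv V X \<rho> (tv X V x v) = tv V X v (inv_into (car X) (\<rho> f) x)"
proof -
  have v: "v \<in> car V" using piece_car[OF V assms(1,2)] .
  show ?thesis
    by (rule linear_eq_on_pieces[OF X(1) gs_module[OF gs_tensor[OF V X(1)]]
          is_linear_comp[OF linear_tv_left[OF X(1) V v] gm_lin[OF br_inv_gm]]
          is_linear_comp[OF pa_inv_lin[OF assms(1)] linear_tv_right[OF V X(1) v]] _ assms(3)])
       (use assms tensor_lift_tv[OF X(1) V gs_fd[OF gs_tensor[OF V X(1)]] br_inv_bilinear] in \<open>auto simp: br_inv_def\<close>)
qed

lemma br_inv_br: "t \<in> car (V \<otimes>\<^sub>V X) \<Longrightarrow> br_inv V X \<rho> (br V X \<rho> t) = t"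
  by (rule tensor_linear_eqI[OF V X(1) gs_fd[OF gs_tensor[OF V X(1)]]
        is_linear_comp[OF gm_lin[OF br_gm] gm_lin[OF br_inv_gm]] is_linear_id])
     (simp_all add: br_tv br_inv_tv pa_closed[OF X(2)] pa_inv_left)

lemma br_br_inv: "t \<in> car (X \<otimes>\<^sub>V V) \<Longrightarrow> br V X \<rho> (br_inv V X \<rho> t) = t"
  by (rule tensor_linear_eqI[OF X(1) V gs_fd[OF gs_tensor[OF X(1) V]]
        is_linear_comp[OF gm_lin[OF br_inv_gm] gm_lin[OF br_gm]] is_linear_id])
     (simp_all add: br_tv br_inv_tv is_linear_closed[OF pa_inv_lin] pa_inv_right)

end
end

section \<open>Coherence on elements\<close>

context cocycle_setting
begin

abbreviation idm :: "('g, 'k, 'v) graded \<Rightarrow> 'v \<Rightarrow> 'v" where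
  "idm X \<equiv> \<lambda>x \<in> car X. x"

lemma tensor_gm_eqI:
  assumes "gs X" "gs Y" "gs W" "\<phi> \<in> gm (X \<otimes>\<^sub>V Y) W" "\<psi> \<in> gm (X \<otimes>\<^sub>V Y) W"
    and "\<And>f g x y. \<lbrakk>f \<in> carrier G; g \<in> carrier G; x \<in> piece X f; y \<in> piece Y g; x \<in> car X; y \<in> car Y\<rbrakk>
      \<Longrightarrow> \<phi> (tv X Y x y) = \<psi> (tv X Y x y)"
  shows "\<phi> = \<psi>"
  by (rule gm_eqI[OF assms(4,5)], rule tensor_linear_eqI[OF assms(1,2) gs_fd[OF assms(3)]
        gm_lin[OF assms(4)] gm_lin[OF assms(5)] assms(6)])

lemma tensor3_gm_eqI:
  assumes "gs X" "gs Y" "gs Z" "gs W"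
    and "\<phi> \<in> gm (X \<otimes>\<^sub>V (Y \<otimes>\<^sub>V Z)) W" "\<psi> \<in> gm (X \<otimes>\<^sub>V (Y \<otimes>\<^sub>V Z)) W"
    and "\<And>f g h x y z. \<lbrakk>f \<in> carrier G; g \<in> carrier G; h \<in> carrier G; x \<in> piece X f; y \<in> piece Y g;
           z \<in> piece Z h; x \<in> car X; y \<in> car Y; z \<in> car Z\<rbrakk>
      \<Longrightarrow> \<phi> (tv X (Y \<otimes>\<^sub>V Z) x (tv Y Z y z)) = \<psi> (tv X (Y \<otimes>\<^sub>V Z) x (tv Y Z y z))"
  shows "\<phi> = \<psi>"
  by (rule gm_eqI[OF assms(5,6)], rule tensor3_right_eqI[OF assms(1-3) gs_fd[OF assms(4)]
        gm_lin[OF assms(5)] gm_lin[OF assms(6)] assms(7)])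

lemma tensor4_gm_eqI:
  assumes "gs X" "gs Y" "gs Z" "gs U" "gs W"
    and "\<phi> \<in> gm (X \<otimes>\<^sub>V (Y \<otimes>\<^sub>V (Z \<otimes>\<^sub>V U))) W" "\<psi> \<in> gm (X \<otimes>\<^sub>V (Y \<otimes>\<^sub>V (Z \<otimes>\<^sub>V U))) W"
    and "\<And>f g h l x y z u. \<lbrakk>f \<in> carrier G; g \<in> carrier G; h \<in> carrier G; l \<in> carrier G;
           x \<in> piece X f; y \<in> piece Y g; z \<in> piece Z h; u \<in> piece U l;
           x \<in> car X; y \<in> car Y; z \<in> car Z; u \<in> car U\<rbrakk>
           \<Longrightarrow> \<phi> (tv X (Y \<otimes>\<^sub>V (Z \<otimes>\<^sub>V U)) x (tv Y (Z \<otimes>\<^sub>V U) y (tv Z U z u))) =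
               \<psi> (tv X (Y \<otimes>\<^sub>V (Z \<otimes>\<^sub>V U)) x (tv Y (Z \<otimes>\<^sub>V U) y (tv Z U z u)))"
  shows "\<phi> = \<psi>"
  by (rule gm_eqI[OF assms(6,7)], rule tensor4_right_eqI[OF assms(1-4) gs_fd[OF assms(5)]
        gm_lin[OF assms(6)] gm_lin[OF assms(7)] assms(8)])

lemmas gm_intros = gm_compose gm_id tm_gm am_gm am_inv_gm br_gm br_inv_gm lunit_gm runit_gm
  linv_gm rinv_gm gs_tensor gs_unit pa_tensor pa_unit

section \<open>Functoriality of the tensor product and coherence of the constraints\<close>

lemma tm_id: "gs X \<Longrightarrow> gs Y \<Longrightarrow> tm X X (idm X) Y Y (idm Y) = idm (X \<otimes>\<^sub>V Y)"
  by (rule tensor_gm_eqI[of X Y "X \<otimes>\<^sub>V Y"]) (simp_all add: gm_intros tm_tv tv_closed)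

lemma tm_compose:
  assumes "gs X" "gs X'" "gs X''" "gs Y" "gs Y'" "gs Y''"
    and "\<phi> \<in> gm X X'" "\<phi>' \<in> gm X' X''" "\<psi> \<in> gm Y Y'" "\<psi>' \<in> gm Y' Y''"
  shows "tm X X'' (compose (car X) \<phi>' \<phi>) Y Y'' (compose (car Y) \<psi>' \<psi>) =
    compose (car (X \<otimes>\<^sub>V Y)) (tm X' X'' \<phi>' Y' Y'' \<psi>') (tm X X' \<phi> Y Y' \<psi>)"
proof (rule tensor_gm_eqI[OF assms(1,4) gs_tensor[OF assms(3,6)]])
  show "tm X X'' (compose (car X) \<phi>' \<phi>) Y Y'' (compose (car Y) \<psi>' \<psi>) \<in> gm (X \<otimes>\<^sub>V Y) (X'' \<otimes>\<^sub>V Y'')"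
    by (intro gm_intros assms gm_compose[OF assms(1,7,8)] gm_compose[OF assms(4,9,10)])
  show "compose (car (X \<otimes>\<^sub>V Y)) (tm X' X'' \<phi>' Y' Y'' \<psi>') (tm X X' \<phi> Y Y' \<psi>) \<in> gm (X \<otimes>\<^sub>V Y) (X'' \<otimes>\<^sub>V Y'')"
    by (intro gm_compose[OF _ tm_gm tm_gm] assms gs_tensor)
  fix x y assume xy: "x \<in> car X" "y \<in> car Y"
  have c: "\<phi> x \<in> car X'" "\<psi> y \<in> car Y'" using gm_closed[OF assms(7) xy(1)] gm_closed[OF assms(9) xy(2)] .
  show "tm X X'' (compose (car X) \<phi>' \<phi>) Y Y'' (compose (car Y) \<psi>' \<psi>) (tv X Y x y) =
    compose (car (X \<otimes>\<^sub>V Y)) (tm X' X'' \<phi>' Y' Y'' \<psi>') (tm X X' \<phi> Y Y' \<psi>) (tv X Y x y)"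
    using xy c
    by (simp add: compose_eq tv_closed assms(1,4) tm_tv[OF assms(1,4,2,5,7,9)] tm_tv[OF assms(2,5,3,6,8,10)]
        tm_tv[OF assms(1,4,3,6) gm_compose[OF assms(1,7,8)] gm_compose[OF assms(4,9,10)]])
qed

text \<open>The three maps preserve degrees, so the scalar \<alpha>(f,g,h) is the same before and
  after they are applied.\<close>

lemma am_natural:
  assumes gs: "gs X" "gs X'" "gs Y" "gs Y'" "gs Z" "gs Z'"
    and \<phi>: "\<phi> \<in> gm X X'" and \<psi>: "\<psi> \<in> gm Y Y'" and \<chi>: "\<chi> \<in> gm Z Z'"
  shows "compose (car (X \<otimes>\<^sub>V (Y \<otimes>\<^sub>V Z))) (am X' Y' Z') (tm X X' \<phi> (Y \<otimes>\<^sub>V Z) (Y' \<otimes>\<^sub>V Z') (tm Y Y' \<psi> Z Z' \<chi>)) =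
    compose (car (X \<otimes>\<^sub>V (Y \<otimes>\<^sub>V Z))) (tm (X \<otimes>\<^sub>V Y) (X' \<otimes>\<^sub>V Y') (tm X X' \<phi> Y Y' \<psi>) Z Z' \<chi>) (am X Y Z)"
    (is "?l = ?r")
proof (rule tensor3_gm_eqI[OF gs(1,3,5)])
  let ?W = "(X' \<otimes>\<^sub>V Y') \<otimes>\<^sub>V Z'"
  show "gs ?W" by (intro gs gs_tensor)
  show "?l \<in> gm (X \<otimes>\<^sub>V (Y \<otimes>\<^sub>V Z)) ?W" "?r \<in> gm (X \<otimes>\<^sub>V (Y \<otimes>\<^sub>V Z)) ?W"
    by (intro gm_compose[OF _ tm_gm am_gm] gm_compose[OF _ am_gm tm_gm] tm_gm gs gs_tensor \<phi> \<psi> \<chi>)+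
  fix f g h x y z assume *: "f \<in> carrier G" "g \<in> carrier G" "h \<in> carrier G" "x \<in> piece X f" "y \<in> piece Y g"
    "z \<in> piece Z h" "x \<in> car X" "y \<in> car Y" "z \<in> car Z"
  note c = gm_closed[OF \<phi> *(7)] gm_closed[OF \<psi> *(8)] gm_closed[OF \<chi> *(9)]
  note p = gm_piece[OF \<phi> *(1,4)] gm_piece[OF \<psi> *(2,5)] gm_piece[OF \<chi> *(3,6)]
  note t1 = tm_gm[OF gs(3,5,4,6) \<psi> \<chi>] and t2 = tm_gm[OF gs(1,3,2,4) \<phi> \<psi>]
  show "?l (tv X (Y \<otimes>\<^sub>V Z) x (tv Y Z y z)) = ?r (tv X (Y \<otimes>\<^sub>V Z) x (tv Y Z y z))"
    using * c
    by (simp add: compose_eq tv_closed gs gs_tensor am_tv[OF gs(1,3,5) *(1-6)] am_tv[OF gs(2,4,6) *(1-3) p]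
        tm_tv[OF gs(3,5,4,6) \<psi> \<chi>] tm_tv[OF gs(1,3,2,4) \<phi> \<psi>]
        tm_tv[OF gs(1) gs_tensor[OF gs(3,5)] gs(2) gs_tensor[OF gs(4,6)] \<phi> t1]
        tm_tv[OF gs_tensor[OF gs(1,3)] gs(5) gs_tensor[OF gs(2,4)] gs(6) t2 \<chi>]
        gm_smult[OF tm_gm[OF gs_tensor[OF gs(1,3)] gs(5) gs_tensor[OF gs(2,4)] gs(6) t2 \<chi>]])
qed

text \<open>On homogeneous fourfold tensors both composites are multiples of one and the same
  tensor, and the equality of their scalars is the cocycle equation.\<close>

lemma pentagon_map:
  assumes gs: "gs X" "gs Y" "gs Z" "gs U"
  shows "compose (car (X \<otimes>\<^sub>V (Y \<otimes>\<^sub>V (Z \<otimes>\<^sub>V U)))) (am (X \<otimes>\<^sub>V Y) Z U) (am X Y (Z \<otimes>\<^sub>V U)) =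
    compose (car (X \<otimes>\<^sub>V (Y \<otimes>\<^sub>V (Z \<otimes>\<^sub>V U)))) (tm (X \<otimes>\<^sub>V (Y \<otimes>\<^sub>V Z)) ((X \<otimes>\<^sub>V Y) \<otimes>\<^sub>V Z) (am X Y Z) U U (idm U))
      (compose (car (X \<otimes>\<^sub>V (Y \<otimes>\<^sub>V (Z \<otimes>\<^sub>V U)))) (am X (Y \<otimes>\<^sub>V Z) U)
        (tm X X (idm X) (Y \<otimes>\<^sub>V (Z \<otimes>\<^sub>V U)) ((Y \<otimes>\<^sub>V Z) \<otimes>\<^sub>V U) (am Y Z U)))" (is "?l = ?r")
proof (rule tensor4_gm_eqI[OF gs])
  let ?S = "X \<otimes>\<^sub>V (Y \<otimes>\<^sub>V (Z \<otimes>\<^sub>V U))" and ?W = "((X \<otimes>\<^sub>V Y) \<otimes>\<^sub>V Z) \<otimes>\<^sub>V U"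
  note g2 = gs_tensor[OF gs(1,2)] gs_tensor[OF gs(2,3)] gs_tensor[OF gs(3,4)]
  note g3 = gs_tensor[OF gs(1) g2(2)] gs_tensor[OF g2(2) gs(4)] gs_tensor[OF gs(2) g2(3)] gs_tensor[OF g2(1) gs(3)]
  note g4 = gs_tensor[OF gs(1) g3(3)] gs_tensor[OF g3(4) gs(4)] gs_tensor[OF g3(1) gs(4)] gs_tensor[OF gs(1) g3(2)]
  note g = gs g2 g3 g4
  show "gs ?W" by (rule g4)
  note tma = tm_gm[OF g3(1) gs(4) g3(4) gs(4) am_gm[OF gs(1-3)] gm_id[OF gs(4)]]
  note tmb = tm_gm[OF gs(1) g3(3) gs(1) g3(2) gm_id[OF gs(1)] am_gm[OF gs(2-4)]]
  show "?l \<in> gm ?S ?W" by (rule gm_compose[OF g4(1) am_gm[OF gs(1,2) g2(3)] am_gm[OF g2(1) gs(3,4)]])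
  show "?r \<in> gm ?S ?W"
    by (rule gm_compose[OF g4(1) gm_compose[OF g4(1) tmb am_gm[OF gs(1) g2(2) gs(4)]] tma])
  fix e f h l x y z w assume *: "e \<in> carrier G" "f \<in> carrier G" "h \<in> carrier G" "l \<in> carrier G"
    "x \<in> piece X e" "y \<in> piece Y f" "z \<in> piece Z h" "w \<in> piece U l"
    "x \<in> car X" "y \<in> car Y" "z \<in> car Z" "w \<in> car U"
  have m: "e \<otimes>\<^bsub>G\<^esub> f \<in> carrier G" "f \<otimes>\<^bsub>G\<^esub> h \<in> carrier G" "h \<otimes>\<^bsub>G\<^esub> l \<in> carrier G" using * by auto
  note p = tv_piece[OF gs(1,2) *(1,2,5,6)] tv_piece[OF gs(2,3) *(2,3,6,7)] tv_piece[OF gs(3,4) *(3,4,7,8)]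
  note am = am_tv[OF gs(1,2) g2(3) *(1,2) m(3) *(5,6) p(3)] am_tv[OF g2(1) gs(3,4) m(1) *(3,4) p(1) *(7,8)]
    am_tv[OF gs(2-4) *(2-4,6-8)] am_tv[OF gs(1) g2(2) gs(4) *(1) m(2) *(4,5) p(2) *(8)] am_tv[OF gs(1-3) *(1-3,5-7)]
  have "?r (tv X (Y \<otimes>\<^sub>V (Z \<otimes>\<^sub>V U)) x (tv Y (Z \<otimes>\<^sub>V U) y (tv Z U z w))) =
    (\<alpha> f h l \<otimes>\<^bsub>K\<^esub> \<alpha> e (f \<otimes>\<^bsub>G\<^esub> h) l \<otimes>\<^bsub>K\<^esub> \<alpha> e f h) \<odot>\<^bsub>space ?W\<^esub>
      tv ((X \<otimes>\<^sub>V Y) \<otimes>\<^sub>V Z) U (tv (X \<otimes>\<^sub>V Y) Z (tv X Y x y) z) w"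
    using *
    by (simp add: compose_eq tv_closed g am tm_tv[OF gs(1) g3(3) gs(1) g3(2) gm_id[OF gs(1)] am_gm[OF gs(2-4)]]
        tm_tv[OF g3(1) gs(4) g3(4) gs(4) am_gm[OF gs(1-3)] gm_id[OF gs(4)]]
        tv_smult_right tv_smult_left gm_smult[OF am_gm[OF gs(1) g2(2) gs(4)]] gm_smult[OF tma]
        gs_smult_closed gs_smult_smult K.m_assoc)
  also have "\<dots> = ?l (tv X (Y \<otimes>\<^sub>V (Z \<otimes>\<^sub>V U)) x (tv Y (Z \<otimes>\<^sub>V U) y (tv Z U z w)))"
    using *
    unfolding \<alpha>_cocycle[OF *(1-4)]
    by (simp add: compose_eq tv_closed g am gm_smult[OF am_gm[OF g2(1) gs(3,4)]] gs_smult_smult K.m_comm)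
  finally show "?l (tv X (Y \<otimes>\<^sub>V (Z \<otimes>\<^sub>V U)) x (tv Y (Z \<otimes>\<^sub>V U) y (tv Z U z w))) =
    ?r (tv X (Y \<otimes>\<^sub>V (Z \<otimes>\<^sub>V U)) x (tv Y (Z \<otimes>\<^sub>V U) y (tv Z U z w)))" ..
qed

lemma triangle_map:
  assumes gs: "gs X" "gs Y"
  shows "compose (car (X \<otimes>\<^sub>V (unit \<otimes>\<^sub>V Y))) (tm (X \<otimes>\<^sub>V unit) X (runit_map K T X) Y Y (idm Y)) (am X unit Y) =
    tm X X (idm X) (unit \<otimes>\<^sub>V Y) Y (lunit_map K T Y)" (is "?l = ?r")
proof -
  note g = gs_tensor[OF gs] gs_tensor[OF gs(1) gs_unit] gs_tensor[OF gs_unit gs(2)] gs_tensor[OF gs(1) gs_tensor[OF gs_unit gs(2)]]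
  have l: "?l \<in> gm (X \<otimes>\<^sub>V (unit \<otimes>\<^sub>V Y)) (X \<otimes>\<^sub>V Y)"
    by (rule gm_compose[OF g(4) am_gm[OF gs(1) gs_unit gs(2)] tm_gm[OF g(2) gs(2) gs runit_gm[OF gs(1)] gm_id[OF gs(2)]]])
  have r: "?r \<in> gm (X \<otimes>\<^sub>V (unit \<otimes>\<^sub>V Y)) (X \<otimes>\<^sub>V Y)"
    by (rule tm_gm[OF gs(1) g(3) gs gm_id[OF gs(1)] lunit_gm[OF gs(2)]])
  show ?thesis
  proof (rule tensor_gm_eqI[OF gs(1) g(3) g(1) l r])
    fix f k x t assume *: "f \<in> carrier G" "x \<in> piece X f" "x \<in> car X" "t \<in> car (unit \<otimes>\<^sub>V Y)"
    show "?l (tv X (unit \<otimes>\<^sub>V Y) x t) = ?r (tv X (unit \<otimes>\<^sub>V Y) x t)"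
    proof (rule line_left_eqI[OF gs(2) G.one_closed gs_fd[OF g(1)]
          is_linear_comp[OF linear_tv_right[OF gs(1) g(3) *(3)] gm_lin[OF l]]
          is_linear_comp[OF linear_tv_right[OF gs(1) g(3) *(3)] gm_lin[OF r]] _ *(4)])
      fix h y assume **: "h \<in> carrier G" "y \<in> piece Y h" "y \<in> car Y"
      show "?l (tv X (unit \<otimes>\<^sub>V Y) x (tv unit Y u y)) = ?r (tv X (unit \<otimes>\<^sub>V Y) x (tv unit Y u y))"
        using * **
        by (simp add: compose_eq tv_closed g gs gs_unit u_closed am_tv[OF gs(1) gs_unit gs(2) *(1) G.one_closed **(1) *(2) u_piece **(2)]
            gs_tensor gs_smult_one tm_tv[OF g(2) gs(2) gs runit_gm[OF gs(1)] gm_id[OF gs(2)]]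
            tm_tv[OF gs(1) g(3) gs gm_id[OF gs(1)] lunit_gm[OF gs(2)]] runit_tv lunit_tv)
    qed
  qed
qed

lemma lunit_natural_map:
  assumes gs: "gs X" "gs Y" and \<phi>: "\<phi> \<in> gm X Y"
  shows "compose (car (unit \<otimes>\<^sub>V X)) (lunit_map K T Y) (tm unit unit (idm unit) X Y \<phi>) =
    compose (car (unit \<otimes>\<^sub>V X)) \<phi> (lunit_map K T X)" (is "?l = ?r")
proof -
  note g = gs_tensor[OF gs_unit gs(1)]
  note t = gs_unit gs(1) gs_unit gs(2) gm_id[OF gs_unit] \<phi>
  have l: "?l \<in> gm (unit \<otimes>\<^sub>V X) Y" by (rule gm_compose[OF g tm_gm[OF t] lunit_gm[OF gs(2)]])
  have r: "?r \<in> gm (unit \<otimes>\<^sub>V X) Y" by (rule gm_compose[OF g lunit_gm[OF gs(1)] \<phi>])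
  show ?thesis
    by (rule gm_eqI[OF l r], rule line_left_eqI[OF gs(1) G.one_closed gs_fd[OF gs(2)] gm_lin[OF l] gm_lin[OF r]])
       (simp_all add: compose_eq tv_closed gs gs_unit u_closed tm_tv[OF t] lunit_tv gm_closed[OF \<phi>])
qed

lemma runit_natural_map:
  assumes gs: "gs X" "gs Y" and \<phi>: "\<phi> \<in> gm X Y"
  shows "compose (car (X \<otimes>\<^sub>V unit)) (runit_map K T Y) (tm X Y \<phi> unit unit (idm unit)) =
    compose (car (X \<otimes>\<^sub>V unit)) \<phi> (runit_map K T X)" (is "?l = ?r")
proof -
  note g = gs_tensor[OF gs(1) gs_unit]
  note t = gs(1) gs_unit gs(2) gs_unit \<phi> gm_id[OF gs_unit]
  have l: "?l \<in> gm (X \<otimes>\<^sub>V unit) Y" by (rule gm_compose[OF g tm_gm[OF t] runit_gm[OF gs(2)]])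
  have r: "?r \<in> gm (X \<otimes>\<^sub>V unit) Y" by (rule gm_compose[OF g runit_gm[OF gs(1)] \<phi>])
  show ?thesis
    by (rule gm_eqI[OF l r], rule line_right_eqI[OF gs(1) G.one_closed gs_fd[OF gs(2)] gm_lin[OF l] gm_lin[OF r]])
       (simp_all add: compose_eq tv_closed gs gs_unit u_closed tm_tv[OF t] runit_tv gm_closed[OF \<phi>])
qed

text \<open>The acting element is the degree of the first factor, so \<open>\<phi>\<close> has to
  preserve degrees and \<open>\<psi>\<close> has to be equivariant. The case of an identity
  \<open>\<psi>\<close> is the naturality of a half-braiding; the case of an identity
  \<open>\<phi>\<close> is the condition on arrows of the centre.\<close>

lemma br_natural:
  assumes gs: "gs V" "gs V'" "gs X" "gs X'" and pa: "pa X \<rho>" "pa X' \<rho>'"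
    and \<phi>: "\<phi> \<in> gm V V'" and \<psi>: "\<psi> \<in> gm X X'"
    and eqv: "\<And>f x. f \<in> carrier G \<Longrightarrow> x \<in> car X \<Longrightarrow> \<psi> (\<rho> f x) = \<rho>' f (\<psi> x)"
  shows "compose (car (V \<otimes>\<^sub>V X)) (br V' X' \<rho>') (tm V V' \<phi> X X' \<psi>) =
    compose (car (V \<otimes>\<^sub>V X)) (tm X X' \<psi> V V' \<phi>) (br V X \<rho>)" (is "?l = ?r")
proof (rule tensor_gm_eqI[OF gs(1,3) gs_tensor[OF gs(4,2)]])
  note t = gs(1,3,2,4) \<phi> \<psi> and t' = gs(3,1,4,2) \<psi> \<phi>
  show "?l \<in> gm (V \<otimes>\<^sub>V X) (X' \<otimes>\<^sub>V V')"
    by (rule gm_compose[OF gs_tensor[OF gs(1,3)] tm_gm[OF t] br_gm[OF gs(2,4) pa(2)]])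
  show "?r \<in> gm (V \<otimes>\<^sub>V X) (X' \<otimes>\<^sub>V V')"
    by (rule gm_compose[OF gs_tensor[OF gs(1,3)] br_gm[OF gs(1,3) pa(1)] tm_gm[OF t']])
  fix f g v x assume *: "f \<in> carrier G" "g \<in> carrier G" "v \<in> piece V f" "x \<in> piece X g" "v \<in> car V" "x \<in> car X"
  show "?l (tv V X v x) = ?r (tv V X v x)"
    using *
    by (simp add: compose_eq tv_closed gs tm_tv[OF t] tm_tv[OF t'] br_tv[OF gs(1,3) pa(1) *(1,3,6)]
        br_tv[OF gs(2,4) pa(2) *(1) gm_piece[OF \<phi> *(1,3)] gm_closed[OF \<psi> *(6)]] pa_closed[OF pa(1)] eqv)
qed

text \<open>The constraint on the left of the hexagon contributes \<alpha>(f,g,h), the two on the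
  right contribute the right side here. Solving for the remaining factor is how \<open>ac\<close>
  arises.\<close>

lemma ac_\<alpha>:
  assumes "f \<in> carrier G" "g \<in> carrier G" "h \<in> carrier G"
  shows "\<alpha> f g h \<otimes>\<^bsub>K\<^esub> ac f g h = inv\<^bsub>K\<^esub> (\<alpha> (cj f (cj g h)) f g) \<otimes>\<^bsub>K\<^esub> \<alpha> f (cj g h) g"
proof -
  have "a \<otimes>\<^bsub>K\<^esub> (i \<otimes>\<^bsub>K\<^esub> b \<otimes>\<^bsub>K\<^esub> j) = (a \<otimes>\<^bsub>K\<^esub> i) \<otimes>\<^bsub>K\<^esub> (j \<otimes>\<^bsub>K\<^esub> b)"
    if "i \<in> carrier K" "b \<in> carrier K" "j \<in> carrier K" "a \<in> carrier K" for i b j a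
    using that by (simp add: K.m_ac)
  then show ?thesis using assms by (simp add: action_cocycle_def cj_mult)
qed

text \<open>The compatibility of a half-braiding with the tensor product is the projectivity of the action.\<close>

lemma br_tensor_left:
  assumes gs: "gs V" "gs U" "gs X" and pa: "pa X \<rho>"
  shows "compose (car (V \<otimes>\<^sub>V (U \<otimes>\<^sub>V X))) (br (V \<otimes>\<^sub>V U) X \<rho>) (am V U X) =
    compose (car (V \<otimes>\<^sub>V (U \<otimes>\<^sub>V X))) (am_inv X V U)
     (compose (car (V \<otimes>\<^sub>V (U \<otimes>\<^sub>V X))) (tm (V \<otimes>\<^sub>V X) (X \<otimes>\<^sub>V V) (br V X \<rho>) U U (idm U))
      (compose (car (V \<otimes>\<^sub>V (U \<otimes>\<^sub>V X))) (am V X U)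
        (tm V V (idm V) (U \<otimes>\<^sub>V X) (X \<otimes>\<^sub>V U) (br U X \<rho>))))" (is "?l = ?r")
proof (rule tensor3_gm_eqI[OF gs])
  let ?S = "V \<otimes>\<^sub>V (U \<otimes>\<^sub>V X)" and ?W = "X \<otimes>\<^sub>V (V \<otimes>\<^sub>V U)"
  note g2 = gs_tensor[OF gs(1,2)] gs_tensor[OF gs(1,3)] gs_tensor[OF gs(3,1)] gs_tensor[OF gs(2,3)] gs_tensor[OF gs(3,2)]
  note g3 = gs_tensor[OF gs(1) g2(4)] gs_tensor[OF gs(3) g2(1)] gs_tensor[OF g2(1) gs(3)] gs_tensor[OF gs(1) g2(5)]
    gs_tensor[OF g2(2) gs(2)] gs_tensor[OF g2(3) gs(2)]
  note g = gs g2 g3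
  note ta = gs(1) g2(4) gs(1) g2(5) gm_id[OF gs(1)] br_gm[OF gs(2,3) pa]
  note tb = g2(2) gs(2) g2(3) gs(2) br_gm[OF gs(1,3) pa] gm_id[OF gs(2)]
  show "gs ?W" by (rule g3)
  show "?l \<in> gm ?S ?W" by (rule gm_compose[OF g3(1) am_gm[OF gs] br_gm[OF g2(1) gs(3) pa]])
  show "?r \<in> gm ?S ?W"
    by (rule gm_compose[OF g3(1) gm_compose[OF g3(1) gm_compose[OF g3(1) tm_gm[OF ta] am_gm[OF gs(1,3,2)]] tm_gm[OF tb]] am_inv_gm[OF gs(3,1,2)]])
  fix e f h v w x assume *: "e \<in> carrier G" "f \<in> carrier G" "h \<in> carrier G" "v \<in> piece V e" "w \<in> piece U f"
    "x \<in> piece X h" "v \<in> car V" "w \<in> car U" "x \<in> car X"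
  have ef: "e \<otimes>\<^bsub>G\<^esub> f \<in> carrier G" and cj: "cj f h \<in> carrier G" "cj e (cj f h) \<in> carrier G" using * by auto
  note c1 = pa_closed[OF pa *(2,9)] note c2 = pa_closed[OF pa *(1) c1]
  note p1 = pa_piece[OF pa *(2,3,6)] note p2 = pa_piece[OF pa *(1) cj(1) p1]
  let ?t = "tv X (V \<otimes>\<^sub>V U) (\<rho> e (\<rho> f x)) (tv V U v w)"
  have t: "?t \<in> car ?W" using * c2 g by (simp add: tv_closed)
  have "?l (tv V (U \<otimes>\<^sub>V X) v (tv U X w x)) = (\<alpha> e f h \<otimes>\<^bsub>K\<^esub> ac e f h) \<odot>\<^bsub>space ?W\<^esub> ?t"
    using * c1 c2 t
    by (simp add: compose_eq tv_closed g am_tv[OF gs *(1-6)] gm_smult[OF br_gm[OF g2(1) gs(3) pa]]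
        br_tv[OF g2(1) gs(3) pa ef tv_piece[OF gs(1,2) *(1,2,4,5)] *(9)] pa_mult[OF pa *(1-3,6)]
        tv_smult_left gs_smult_smult)
  also have "\<dots> = ?r (tv V (U \<otimes>\<^sub>V X) v (tv U X w x))"
    using * c1 c2 t cj
    by (simp add: ac_\<alpha> compose_eq tv_closed g tm_tv[OF ta] br_tv[OF gs(2,3) pa *(2,5,9)]
        am_tv[OF gs(1,3,2) *(1) cj(1) *(2,4) p1 *(5)] gm_smult[OF tm_gm[OF tb]] tm_tv[OF tb]
        br_tv[OF gs(1,3) pa *(1,4) c1] gm_smult[OF am_inv_gm[OF gs(3,1,2)]]
        am_inv_tv[OF gs(3,1,2) cj(2) *(1,2) p2 *(4,5)] gs_smult_smult K.m_comm)
  finally show "?l (tv V (U \<otimes>\<^sub>V X) v (tv U X w x)) = ?r (tv V (U \<otimes>\<^sub>V X) v (tv U X w x))" .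
qed

text \<open>The three associativity constraints contribute exactly the three factors in the
  definition of \<open>tc\<close>. The right side is both the half-braiding of a tensor product in
  the centre and one side of the first hexagon of \<open>ZCat\<close>.\<close>

lemma br_tensor_right:
  assumes gs: "gs V" "gs X" "gs Y" and pa: "pa X \<rho>" "pa Y \<sigma>"
  shows "br V (X \<otimes>\<^sub>V Y) (ta X \<rho> Y \<sigma>) =
    compose (car (V \<otimes>\<^sub>V (X \<otimes>\<^sub>V Y))) (am X Y V)
     (compose (car (V \<otimes>\<^sub>V (X \<otimes>\<^sub>V Y))) (tm X X (idm X) (V \<otimes>\<^sub>V Y) (Y \<otimes>\<^sub>V V) (br V Y \<sigma>))
      (compose (car (V \<otimes>\<^sub>V (X \<otimes>\<^sub>V Y))) (am_inv X V Y)
       (compose (car (V \<otimes>\<^sub>V (X \<otimes>\<^sub>V Y))) (tm (V \<otimes>\<^sub>V X) (X \<otimes>\<^sub>V V) (br V X \<rho>) Y Y (idm Y))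
         (am V X Y))))" (is "?l = ?r")
proof (rule tensor3_gm_eqI[OF gs])
  let ?S = "V \<otimes>\<^sub>V (X \<otimes>\<^sub>V Y)" and ?W = "(X \<otimes>\<^sub>V Y) \<otimes>\<^sub>V V"
  note g2 = gs_tensor[OF gs(1,2)] gs_tensor[OF gs(1,3)] gs_tensor[OF gs(3,1)] gs_tensor[OF gs(2,3)] gs_tensor[OF gs(2,1)]
  note g3 = gs_tensor[OF gs(1) g2(4)] gs_tensor[OF g2(4) gs(1)] gs_tensor[OF g2(1) gs(3)] gs_tensor[OF g2(5) gs(3)]
    gs_tensor[OF gs(2) g2(2)] gs_tensor[OF gs(2) g2(3)]
  note g = gs g2 g3
  note ta = g2(1) gs(3) g2(5) gs(3) br_gm[OF gs(1,2) pa(1)] gm_id[OF gs(3)]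
  note tb = gs(2) g2(2) gs(2) g2(3) gm_id[OF gs(2)] br_gm[OF gs(1,3) pa(2)]
  note paXY = pa_tensor[OF gs(2) pa(1) gs(3) pa(2)]
  show "gs ?W" by (rule g3)
  show "?l \<in> gm ?S ?W" by (rule br_gm[OF gs(1) g2(4) paXY])
  show "?r \<in> gm ?S ?W"
    by (rule gm_compose[OF g3(1) gm_compose[OF g3(1) gm_compose[OF g3(1) gm_compose[OF g3(1) am_gm[OF gs] tm_gm[OF ta]]
            am_inv_gm[OF gs(2,1,3)]] tm_gm[OF tb]] am_gm[OF gs(2,3,1)]])
  fix e f h v x y assume *: "e \<in> carrier G" "f \<in> carrier G" "h \<in> carrier G" "v \<in> piece V e" "x \<in> piece X f"
    "y \<in> piece Y h" "v \<in> car V" "x \<in> car X" "y \<in> car Y"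
  have cj: "cj e f \<in> carrier G" "cj e h \<in> carrier G" using * by auto
  note c = pa_closed[OF pa(1) *(1,8)] pa_closed[OF pa(2) *(1,9)]
  note p = pa_piece[OF pa(1) *(1,2,5)] pa_piece[OF pa(2) *(1,3,6)]
  let ?t = "tv (X \<otimes>\<^sub>V Y) V (tv X Y (\<rho> e x) (\<sigma> e y)) v"
  have t: "?t \<in> car ?W" using * c g by (simp add: tv_closed)
  have "?l (tv V (X \<otimes>\<^sub>V Y) v (tv X Y x y)) = tc e f h \<odot>\<^bsub>space ?W\<^esub> ?t"
    using * c t
    by (simp add: tv_closed g br_tv[OF gs(1) g2(4) paXY *(1,4)] ta_tv[OF gs(2) pa(1) gs(3) pa(2) *(1-3,5,6)]
        tv_smult_left)
  also have "\<dots> = ?r (tv V (X \<otimes>\<^sub>V Y) v (tv X Y x y))"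
    using * c t cj
    by (simp add: compose_eq tv_closed g am_tv[OF gs *(1-6)] gm_smult[OF tm_gm[OF ta]] tm_tv[OF ta]
        br_tv[OF gs(1,2) pa(1) *(1,4,8)] gm_smult[OF am_inv_gm[OF gs(2,1,3)]]
        am_inv_tv[OF gs(2,1,3) cj(1) *(1,3) p(1) *(4,6)] gm_smult[OF tm_gm[OF tb]] tm_tv[OF tb]
        br_tv[OF gs(1,3) pa(2) *(1,4,9)] gm_smult[OF am_gm[OF gs(2,3,1)]]
        am_tv[OF gs(2,3,1) cj *(1) p *(4)] gs_smult_smult tensor_cocycle_def)
  finally show "?l (tv V (X \<otimes>\<^sub>V Y) v (tv X Y x y)) = ?r (tv V (X \<otimes>\<^sub>V Y) v (tv X Y x y))" .
qed

lemma ua_apply: "f \<in> carrier G \<Longrightarrow> v \<in> car unit \<Longrightarrow> ua f v = v"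
  by (simp add: ua_def)

text \<open>For the trivial action the map only exchanges \<open>u\<close> with the other factor,
  which is also what the composite of unit constraints in \<open>centre_unit\<close> does.\<close>

lemma br_unit: "gs V \<Longrightarrow> br V unit ua = compose (car (V \<otimes>\<^sub>V unit)) (linv V) (runit_map K T V)" (is "_ \<Longrightarrow> ?l = ?r")
proof -
  assume V: "gs V"
  note g = gs_tensor[OF V gs_unit]
  have l: "?l \<in> gm (V \<otimes>\<^sub>V unit) (unit \<otimes>\<^sub>V V)" by (rule br_gm[OF V gs_unit pa_unit])
  have r: "?r \<in> gm (V \<otimes>\<^sub>V unit) (unit \<otimes>\<^sub>V V)" by (rule gm_compose[OF g runit_gm[OF V] linv_gm[OF V]])
  show "?l = ?r"
    by (rule gm_eqI[OF l r], rule line_right_eqI[OF V G.one_closed gs_fd[OF gs_tensor[OF gs_unit V]] gm_lin[OF l] gm_lin[OF r]])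
       (simp_all add: compose_eq tv_closed V gs_unit u_closed br_tv[OF V gs_unit pa_unit] runit_tv linv_def ua_apply)
qed

end

section \<open>Transport of a braided structure along a bijection\<close>

text \<open>Inverses are unique, so the description in \<open>Inv\<close> may be replaced by any
  explicit inverse.\<close>

lemma (in category) Inv_eqI:
  assumes "inverse_arrows C f g"
  shows "Inv C f = g"
  unfolding Inv_def
proof (rule the_equality)
  fix g' assume g': "inverse_arrows C f g'"
  let ?A = "Dom C f" and ?B = "Cod C f"
  have f: "f \<in> Hom C ?A ?B" "g \<in> Hom C ?B ?A" "g' \<in> Hom C ?B ?A"
    using assms g' by (auto simp: inverse_arrows_def Hom_def)
  have "g' = (g' \<bullet> f) \<bullet> g"
    using assms g' cmp_assoc[OF f(2,1,3)] idn_right[OF f(3)] by (simp add: inverse_arrows_def)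
  then show "g' = g"
    using g' idn_left[OF f(2)] by (simp add: inverse_arrows_def)
qed (rule assms)

lemma (in category) idn_arr:
  assumes "A \<in> Obj C"
  shows "Idn C A \<in> Arr C" "Dom C (Idn C A) = A" "Cod C (Idn C A) = A"
  using idn[OF assms] by (auto simp: Hom_def)

lemma (in category) cmp_arr:
  assumes "f \<in> Arr C" "g \<in> Arr C" "Cod C f = Dom C g"
  shows "g \<bullet> f \<in> Arr C" "Dom C (g \<bullet> f) = Dom C f" "Cod C (g \<bullet> f) = Cod C g"
  using cmp[of f "Dom C f" "Cod C f" g "Cod C g"] assms by (auto simp: Hom_def)

lemma (in monoidal_category) tensor_arr_closed:
  assumes "f \<in> Arr C" "g \<in> Arr C"
  shows "f \<star> g \<in> Arr C" "Dom C (f \<star> g) = Dom C f \<boxtimes> Dom C g" "Cod C (f \<star> g) = Cod C f \<boxtimes> Cod C g"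
  using tensor_arr[of f "Dom C f" "Cod C f" g "Dom C g" "Cod C g"] assms by (auto simp: Hom_def)

lemma (in monoidal_category) assoc_arr:
  assumes "A \<in> Obj C" "B \<in> Obj C" "D \<in> Obj C"
  shows "Assoc C A B D \<in> Arr C" "Dom C (Assoc C A B D) = A \<boxtimes> (B \<boxtimes> D)" "Cod C (Assoc C A B D) = (A \<boxtimes> B) \<boxtimes> D"
  using assoc_iso[OF assms] by (auto simp: Iso_def Hom_def)

lemma (in monoidal_category) unitor_arr:
  assumes "A \<in> Obj C"
  shows "LUnit C A \<in> Arr C" "Dom C (LUnit C A) = Unit C \<boxtimes> A" "Cod C (LUnit C A) = A"
    and "RUnit C A \<in> Arr C" "Dom C (RUnit C A) = A \<boxtimes> Unit C" "Cod C (RUnit C A) = A"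
  using lunit_iso[OF assms] runit_iso[OF assms] by (auto simp: Iso_def Hom_def)

lemma (in braided_category) braid_arr:
  assumes "A \<in> Obj C" "B \<in> Obj C"
  shows "Braid C A B \<in> Arr C" "Dom C (Braid C A B) = A \<boxtimes> B" "Cod C (Braid C A B) = B \<boxtimes> A"
  using braid_iso[OF assms] by (auto simp: Iso_def Hom_def)

text \<open>\<open>C\<close> is not assumed to be a category. It is bare structure that matches the
  braided category \<open>D\<close> along the bijections \<open>Ho\<close> and \<open>Ha\<close>,
  and its axioms are deduced from those of \<open>D\<close>. In the application \<open>C\<close> is
  the centre.\<close>

locale braided_transport = D: braided_category D
  for D :: "('p, 'n, 'y) braided_category_scheme" +
  fixes C :: "('o, 'm, 'x) braided_category_scheme" and Ho :: "'p \<Rightarrow> 'o" and Ha :: "'n \<Rightarrow> 'm"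
  assumes bij_Ho: "bij_betw Ho (Obj D) (Obj C)"
    and bij_Ha: "bij_betw Ha (Arr D) (Arr C)"
    and Ha_dom: "f \<in> Arr D \<Longrightarrow> Dom C (Ha f) = Ho (Dom D f)"
    and Ha_cod: "f \<in> Arr D \<Longrightarrow> Cod C (Ha f) = Ho (Cod D f)"
    and Ha_idn: "A \<in> Obj D \<Longrightarrow> Idn C (Ho A) = Ha (Idn D A)"
    and Ha_cmp: "\<lbrakk>f \<in> Arr D; g \<in> Arr D; Cod D f = Dom D g\<rbrakk> \<Longrightarrow> Ha g \<bullet>\<^bsub>C\<^esub> Ha f = Ha (g \<bullet>\<^bsub>D\<^esub> f)"
    and Ho_tensor: "\<lbrakk>A \<in> Obj D; B \<in> Obj D\<rbrakk> \<Longrightarrow> Ho A \<boxtimes>\<^bsub>C\<^esub> Ho B = Ho (A \<boxtimes>\<^bsub>D\<^esub> B)"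
    and Ha_tensor: "\<lbrakk>f \<in> Arr D; g \<in> Arr D\<rbrakk> \<Longrightarrow> Ha f \<star>\<^bsub>C\<^esub> Ha g = Ha (f \<star>\<^bsub>D\<^esub> g)"
    and Ho_unit: "Unit C = Ho (Unit D)"
    and Ha_assoc: "\<lbrakk>A \<in> Obj D; B \<in> Obj D; E \<in> Obj D\<rbrakk> \<Longrightarrow> Assoc C (Ho A) (Ho B) (Ho E) = Ha (Assoc D A B E)"
    and Ha_lunit: "A \<in> Obj D \<Longrightarrow> LUnit C (Ho A) = Ha (LUnit D A)"
    and Ha_runit: "A \<in> Obj D \<Longrightarrow> RUnit C (Ho A) = Ha (RUnit D A)"
    and Ha_braid: "\<lbrakk>A \<in> Obj D; B \<in> Obj D\<rbrakk> \<Longrightarrow> Braid C (Ho A) (Ho B) = Ha (Braid D A B)"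
begin

text \<open>The structure is compared from \<open>D\<close> to \<open>C\<close>, but the isomorphism
  wanted goes from \<open>C\<close> to \<open>D\<close>, hence the inverses of \<open>Ho\<close> and
  \<open>Ha\<close>.\<close>

definition Fo :: "'o \<Rightarrow> 'p" where "Fo = inv_into (Obj D) Ho"
definition Fa :: "'m \<Rightarrow> 'n" where "Fa = inv_into (Arr D) Ha"

lemma Fo [simp]: "X \<in> Obj C \<Longrightarrow> Fo X \<in> Obj D" "X \<in> Obj C \<Longrightarrow> Ho (Fo X) = X"
  using bij_Ho by (auto simp: Fo_def bij_betw_def f_inv_into_f intro: inv_into_into)

lemma Fa [simp]: "f \<in> Arr C \<Longrightarrow> Fa f \<in> Arr D" "f \<in> Arr C \<Longrightarrow> Ha (Fa f) = f"
  using bij_Ha by (auto simp: Fa_def bij_betw_def f_inv_into_f intro: inv_into_into)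

lemma Ho [simp]: "A \<in> Obj D \<Longrightarrow> Ho A \<in> Obj C" "A \<in> Obj D \<Longrightarrow> Fo (Ho A) = A"
  using bij_Ho by (auto simp: Fo_def bij_betw_def)

lemma Ha [simp]: "f \<in> Arr D \<Longrightarrow> Ha f \<in> Arr C" "f \<in> Arr D \<Longrightarrow> Fa (Ha f) = f"
  using bij_Ha by (auto simp: Fa_def bij_betw_def)

text \<open>Reduces an equation between arrows of \<open>C\<close> to its image in \<open>D\<close>;
  the simplification rules below push \<open>Fa\<close> through all operations until the
  corresponding axiom of \<open>D\<close> appears.\<close>

lemma Fa_eqI: "f \<in> Arr C \<Longrightarrow> g \<in> Arr C \<Longrightarrow> Fa f = Fa g \<Longrightarrow> f = g"
  by (metis Fa(2))

lemma dom_Fa [simp]: "f \<in> Arr C \<Longrightarrow> Dom D (Fa f) = Fo (Dom C f)" "f \<in> Arr C \<Longrightarrow> Cod D (Fa f) = Fo (Cod C f)"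
  using Ha_dom[of "Fa f"] Ha_cod[of "Fa f"] D.dom_cod[of "Fa f"] by auto

lemma dom_closed [simp]: "f \<in> Arr C \<Longrightarrow> Dom C f \<in> Obj C" "f \<in> Arr C \<Longrightarrow> Cod C f \<in> Obj C"
  using Ha_dom[of "Fa f"] Ha_cod[of "Fa f"] D.dom_cod[of "Fa f"] by (auto simp del: dom_Fa)

lemma idn_C [simp]:
  assumes "X \<in> Obj C"
  shows "Idn C X \<in> Arr C" "Dom C (Idn C X) = X" "Cod C (Idn C X) = X" "Fa (Idn C X) = Idn D (Fo X)"
  using Ha_idn[of "Fo X"] assms by (auto simp: D.idn_arr Ha_dom Ha_cod)

lemma cmp_C [simp]:
  assumes "f \<in> Arr C" "g \<in> Arr C" "Cod C f = Dom C g"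
  shows "g \<bullet>\<^bsub>C\<^esub> f \<in> Arr C" "Dom C (g \<bullet>\<^bsub>C\<^esub> f) = Dom C f" "Cod C (g \<bullet>\<^bsub>C\<^esub> f) = Cod C g"
    "Fa (g \<bullet>\<^bsub>C\<^esub> f) = Fa g \<bullet>\<^bsub>D\<^esub> Fa f"
  using Ha_cmp[of "Fa f" "Fa g"] assms by (auto simp: D.cmp_arr Ha_dom Ha_cod)

lemma tensor_obj_C [simp]:
  assumes "X \<in> Obj C" "Y \<in> Obj C"
  shows "X \<boxtimes>\<^bsub>C\<^esub> Y \<in> Obj C" "Fo (X \<boxtimes>\<^bsub>C\<^esub> Y) = Fo X \<boxtimes>\<^bsub>D\<^esub> Fo Y"
  using Ho_tensor[of "Fo X" "Fo Y"] assms by (auto simp: D.tensor_obj)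

lemma unit_C [simp]: "Unit C \<in> Obj C" "Fo (Unit C) = Unit D"
  by (auto simp: Ho_unit D.unit_obj)

lemma tensor_arr_C [simp]:
  assumes "f \<in> Arr C" "g \<in> Arr C"
  shows "f \<star>\<^bsub>C\<^esub> g \<in> Arr C" "Dom C (f \<star>\<^bsub>C\<^esub> g) = Dom C f \<boxtimes>\<^bsub>C\<^esub> Dom C g"
    "Cod C (f \<star>\<^bsub>C\<^esub> g) = Cod C f \<boxtimes>\<^bsub>C\<^esub> Cod C g" "Fa (f \<star>\<^bsub>C\<^esub> g) = Fa f \<star>\<^bsub>D\<^esub> Fa g"
  using Ha_tensor[of "Fa f" "Fa g"] assms
  by (auto simp: D.tensor_arr_closed Ha_dom Ha_cod Ho_tensor[symmetric])

lemma assoc_C [simp]: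
  assumes "X \<in> Obj C" "Y \<in> Obj C" "Z \<in> Obj C"
  shows "Assoc C X Y Z \<in> Arr C" "Dom C (Assoc C X Y Z) = X \<boxtimes>\<^bsub>C\<^esub> (Y \<boxtimes>\<^bsub>C\<^esub> Z)"
    "Cod C (Assoc C X Y Z) = (X \<boxtimes>\<^bsub>C\<^esub> Y) \<boxtimes>\<^bsub>C\<^esub> Z" "Fa (Assoc C X Y Z) = Assoc D (Fo X) (Fo Y) (Fo Z)"
  using Ha_assoc[of "Fo X" "Fo Y" "Fo Z"] assms
  by (auto simp: D.assoc_arr Ha_dom Ha_cod Ho_tensor[symmetric] D.tensor_obj)

lemma unitor_C [simp]:
  assumes "X \<in> Obj C"
  shows "LUnit C X \<in> Arr C" "Dom C (LUnit C X) = Unit C \<boxtimes>\<^bsub>C\<^esub> X" "Cod C (LUnit C X) = X"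
    "Fa (LUnit C X) = LUnit D (Fo X)" "RUnit C X \<in> Arr C" "Dom C (RUnit C X) = X \<boxtimes>\<^bsub>C\<^esub> Unit C"
    "Cod C (RUnit C X) = X" "Fa (RUnit C X) = RUnit D (Fo X)"
  using Ha_lunit[of "Fo X"] Ha_runit[of "Fo X"] assms
  by (auto simp: D.unitor_arr Ha_dom Ha_cod Ho_tensor[symmetric] Ho_unit D.unit_obj)

lemma braid_C [simp]:
  assumes "X \<in> Obj C" "Y \<in> Obj C"
  shows "Braid C X Y \<in> Arr C" "Dom C (Braid C X Y) = X \<boxtimes>\<^bsub>C\<^esub> Y"
    "Cod C (Braid C X Y) = Y \<boxtimes>\<^bsub>C\<^esub> X" "Fa (Braid C X Y) = Braid D (Fo X) (Fo Y)"
  using Ha_braid[of "Fo X" "Fo Y"] assms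
  by (auto simp: D.braid_arr Ha_dom Ha_cod Ho_tensor[symmetric])

lemma Fa_Hom: "f \<in> Hom C X Y \<Longrightarrow> Fa f \<in> Hom D (Fo X) (Fo Y)"
  by (auto simp: Hom_def)

section \<open>The axioms carried over to \<open>C\<close>\<close>

lemma category_C: "category C"
proof
  fix f X Y assume f: "f \<in> Hom C X Y"
  then show "Idn C Y \<bullet>\<^bsub>C\<^esub> f = f" "f \<bullet>\<^bsub>C\<^esub> Idn C X = f"
    using D.idn_left[OF Fa_Hom[OF f]] D.idn_right[OF Fa_Hom[OF f]]
    by (auto simp: Hom_def intro!: Fa_eqI)
next
  fix f g h X Y Z W assume *: "f \<in> Hom C X Y" "g \<in> Hom C Y Z" "h \<in> Hom C Z W"
  then show "(h \<bullet>\<^bsub>C\<^esub> g) \<bullet>\<^bsub>C\<^esub> f = h \<bullet>\<^bsub>C\<^esub> (g \<bullet>\<^bsub>C\<^esub> f)"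
    using D.cmp_assoc[OF *[THEN Fa_Hom]] by (auto simp: Hom_def intro!: Fa_eqI)
qed (auto simp: Hom_def)

interpretation C: category C by (rule category_C)

lemma inverse_arrows_C:
  assumes "f \<in> Arr C" "inverse_arrows D (Fa f) g"
  shows "inverse_arrows C f (Ha g)"
proof -
  have g: "g \<in> Arr D" "Dom D g = Fo (Cod C f)" "Cod D g = Fo (Dom C f)"
    using assms by (auto simp: inverse_arrows_def Hom_def)
  then have "Dom C (Ha g) = Cod C f" "Cod C (Ha g) = Dom C f"
    using assms(1) by (auto simp: Ha_dom Ha_cod)
  then show ?thesis
    using assms g by (auto simp: inverse_arrows_def Hom_def intro!: Fa_eqI)
qed

lemma Iso_C:
  assumes "f \<in> Arr C" "Fa f \<in> Iso D A B"
  shows "f \<in> Iso C (Dom C f) (Cod C f)"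
  using assms inverse_arrows_C by (auto simp: Iso_def Hom_def)

text \<open>\<open>Inv\<close> is a description and not a field of the record, so its compatibility
  with \<open>Fa\<close> is not among the assumptions. It follows from uniqueness of inverses and is
  needed for the hexagons.\<close>

lemma Inv_C:
  assumes "f \<in> Arr C" "Fa f \<in> Iso D A B"
  shows "Inv C f \<in> Arr C" "Dom C (Inv C f) = Cod C f" "Cod C (Inv C f) = Dom C f"
    "Fa (Inv C f) = Inv D (Fa f)"
proof -
  obtain g where g: "inverse_arrows D (Fa f) g" using assms(2) by (auto simp: Iso_def)
  have "Inv C f = Ha g" by (rule C.Inv_eqI[OF inverse_arrows_C[OF assms(1) g]])
  moreover have "Inv D (Fa f) = g" by (rule D.Inv_eqI[OF g])
  ultimately show "Inv C f \<in> Arr C" "Dom C (Inv C f) = Cod C f" "Cod C (Inv C f) = Dom C f"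
    "Fa (Inv C f) = Inv D (Fa f)"
    using g assms(1) by (auto simp: inverse_arrows_def Hom_def Ha_dom Ha_cod)
qed

lemma Inv_assoc_C [simp]:
  assumes "X \<in> Obj C" "Y \<in> Obj C" "Z \<in> Obj C"
  shows "Inv C (Assoc C X Y Z) \<in> Arr C" "Dom C (Inv C (Assoc C X Y Z)) = (X \<boxtimes>\<^bsub>C\<^esub> Y) \<boxtimes>\<^bsub>C\<^esub> Z"
    "Cod C (Inv C (Assoc C X Y Z)) = X \<boxtimes>\<^bsub>C\<^esub> (Y \<boxtimes>\<^bsub>C\<^esub> Z)"
    "Fa (Inv C (Assoc C X Y Z)) = Inv D (Assoc D (Fo X) (Fo Y) (Fo Z))"
  using Inv_C[of "Assoc C X Y Z"] D.assoc_iso[of "Fo X" "Fo Y" "Fo Z"] assms by auto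

lemma monoidal_C: "monoidal_category C"
proof (intro monoidal_category.intro category_C monoidal_category_axioms.intro)
  fix f f' g g' X X' X'' Y Y' Y''
  assume *: "f \<in> Hom C X X'" "f' \<in> Hom C X' X''" "g \<in> Hom C Y Y'" "g' \<in> Hom C Y' Y''"
  then show "(f' \<bullet>\<^bsub>C\<^esub> f) \<star>\<^bsub>C\<^esub> (g' \<bullet>\<^bsub>C\<^esub> g) = (f' \<star>\<^bsub>C\<^esub> g') \<bullet>\<^bsub>C\<^esub> (f \<star>\<^bsub>C\<^esub> g)"
    using D.tensor_cmp[OF *[THEN Fa_Hom]] by (auto simp: Hom_def intro!: Fa_eqI)
next
  fix X Y assume "X \<in> Obj C" "Y \<in> Obj C"
  then show "Idn C X \<star>\<^bsub>C\<^esub> Idn C Y = Idn C (X \<boxtimes>\<^bsub>C\<^esub> Y)"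
    "(RUnit C X \<star>\<^bsub>C\<^esub> Idn C Y) \<bullet>\<^bsub>C\<^esub> Assoc C X (Unit C) Y = Idn C X \<star>\<^bsub>C\<^esub> LUnit C Y"
    using D.tensor_idn[of "Fo X" "Fo Y"] D.triangle[of "Fo X" "Fo Y"] by (auto intro!: Fa_eqI)
next
  fix X Y Z assume "X \<in> Obj C" "Y \<in> Obj C" "Z \<in> Obj C"
  then show "Assoc C X Y Z \<in> Iso C (X \<boxtimes>\<^bsub>C\<^esub> (Y \<boxtimes>\<^bsub>C\<^esub> Z)) ((X \<boxtimes>\<^bsub>C\<^esub> Y) \<boxtimes>\<^bsub>C\<^esub> Z)"
    using Iso_C[of "Assoc C X Y Z"] D.assoc_iso[of "Fo X" "Fo Y" "Fo Z"] by auto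
next
  fix X assume "X \<in> Obj C"
  then show "LUnit C X \<in> Iso C (Unit C \<boxtimes>\<^bsub>C\<^esub> X) X" "RUnit C X \<in> Iso C (X \<boxtimes>\<^bsub>C\<^esub> Unit C) X"
    using Iso_C[of "LUnit C X"] D.lunit_iso[of "Fo X"] Iso_C[of "RUnit C X"] D.runit_iso[of "Fo X"] by auto
next
  fix f g h X X' Y Y' Z Z' assume *: "f \<in> Hom C X X'" "g \<in> Hom C Y Y'" "h \<in> Hom C Z Z'"
  then show "Assoc C X' Y' Z' \<bullet>\<^bsub>C\<^esub> (f \<star>\<^bsub>C\<^esub> (g \<star>\<^bsub>C\<^esub> h)) = ((f \<star>\<^bsub>C\<^esub> g) \<star>\<^bsub>C\<^esub> h) \<bullet>\<^bsub>C\<^esub> Assoc C X Y Z"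
    using D.assoc_natural[OF *[THEN Fa_Hom]] by (auto simp: Hom_def intro!: Fa_eqI)
next
  fix f X X' assume *: "f \<in> Hom C X X'"
  then show "LUnit C X' \<bullet>\<^bsub>C\<^esub> (Idn C (Unit C) \<star>\<^bsub>C\<^esub> f) = f \<bullet>\<^bsub>C\<^esub> LUnit C X"
    "RUnit C X' \<bullet>\<^bsub>C\<^esub> (f \<star>\<^bsub>C\<^esub> Idn C (Unit C)) = f \<bullet>\<^bsub>C\<^esub> RUnit C X"
    using D.lunit_natural[OF *[THEN Fa_Hom]] D.runit_natural[OF *[THEN Fa_Hom]]
    by (auto simp: Hom_def intro!: Fa_eqI)
next
  fix X Y Z W assume "X \<in> Obj C" "Y \<in> Obj C" "Z \<in> Obj C" "W \<in> Obj C"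
  then show "Assoc C (X \<boxtimes>\<^bsub>C\<^esub> Y) Z W \<bullet>\<^bsub>C\<^esub> Assoc C X Y (Z \<boxtimes>\<^bsub>C\<^esub> W) =
      (Assoc C X Y Z \<star>\<^bsub>C\<^esub> Idn C W) \<bullet>\<^bsub>C\<^esub> Assoc C X (Y \<boxtimes>\<^bsub>C\<^esub> Z) W \<bullet>\<^bsub>C\<^esub> (Idn C X \<star>\<^bsub>C\<^esub> Assoc C Y Z W)"
    using D.pentagon[of "Fo X" "Fo Y" "Fo Z" "Fo W"] by (auto intro!: Fa_eqI)
qed (auto simp: Hom_def)

lemma braided_C: "braided_category C"
proof (intro braided_category.intro monoidal_C braided_category_axioms.intro)
  fix X Y assume "X \<in> Obj C" "Y \<in> Obj C"
  then show "Braid C X Y \<in> Iso C (X \<boxtimes>\<^bsub>C\<^esub> Y) (Y \<boxtimes>\<^bsub>C\<^esub> X)"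
    using Iso_C[of "Braid C X Y"] D.braid_iso[of "Fo X" "Fo Y"] by auto
next
  fix f g X X' Y Y' assume *: "f \<in> Hom C X X'" "g \<in> Hom C Y Y'"
  then show "Braid C X' Y' \<bullet>\<^bsub>C\<^esub> (f \<star>\<^bsub>C\<^esub> g) = (g \<star>\<^bsub>C\<^esub> f) \<bullet>\<^bsub>C\<^esub> Braid C X Y"
    using D.braid_natural[OF *[THEN Fa_Hom]] by (auto simp: Hom_def intro!: Fa_eqI)
next
  fix X Y Z assume "X \<in> Obj C" "Y \<in> Obj C" "Z \<in> Obj C"
  then show "Braid C X (Y \<boxtimes>\<^bsub>C\<^esub> Z) = Assoc C Y Z X \<bullet>\<^bsub>C\<^esub> (Idn C Y \<star>\<^bsub>C\<^esub> Braid C X Z) \<bullet>\<^bsub>C\<^esub>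
      Inv C (Assoc C Y X Z) \<bullet>\<^bsub>C\<^esub> (Braid C X Y \<star>\<^bsub>C\<^esub> Idn C Z) \<bullet>\<^bsub>C\<^esub> Assoc C X Y Z"
    "Braid C (X \<boxtimes>\<^bsub>C\<^esub> Y) Z \<bullet>\<^bsub>C\<^esub> Assoc C X Y Z = Inv C (Assoc C Z X Y) \<bullet>\<^bsub>C\<^esub>
      (Braid C X Z \<star>\<^bsub>C\<^esub> Idn C Y) \<bullet>\<^bsub>C\<^esub> Assoc C X Z Y \<bullet>\<^bsub>C\<^esub> (Idn C X \<star>\<^bsub>C\<^esub> Braid C Y Z)"
    using D.hexagon1[of "Fo X" "Fo Y" "Fo Z"] D.hexagon2[of "Fo X" "Fo Y" "Fo Z"]
    by (auto intro!: Fa_eqI)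
qed

lemma braided_isomorphism_C: "braided_isomorphism C D Fo Fa"
proof (intro braided_isomorphism.intro cat_functor.intro category_C D.category_axioms braided_C
    D.braided_category_axioms cat_functor_axioms.intro braided_isomorphism_axioms.intro)
  show "bij_betw Fo (Obj C) (Obj D)" "bij_betw Fa (Arr C) (Arr D)"
    unfolding Fo_def Fa_def by (rule bij_betw_inv_into[OF bij_Ho], rule bij_betw_inv_into[OF bij_Ha])
qed (auto simp: Hom_def)

end

section \<open>The braided category of projective actions\<close>

context cocycle_setting
begin

abbreviation Zc where "Zc \<equiv> ZCat G K T \<alpha>"
abbreviation zt where "zt \<equiv> action_tensor G K T \<alpha>"
abbreviation zunit :: "('g, 'k, 'v) action_obj" where "zunit \<equiv> (unit, ua)"

definition zobj :: "('g, 'k, 'v) action_obj \<Rightarrow> bool" where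
  "zobj A \<longleftrightarrow> gs (fst A) \<and> pa (fst A) (snd A)"

definition zm :: "('g, 'k, 'v) action_obj \<Rightarrow> ('g, 'k, 'v) action_obj \<Rightarrow> ('v \<Rightarrow> 'v) set" where
  "zm A B = {\<phi> \<in> gm (fst A) (fst B).
     \<forall>f \<in> carrier G. \<forall>x \<in> car (fst A). \<phi> (snd A f x) = snd B f (\<phi> x)}"

lemma zobj_gs: "zobj A \<Longrightarrow> gs (fst A)" and zobj_pa: "zobj A \<Longrightarrow> pa (fst A) (snd A)"
  by (auto simp: zobj_def)

lemma zt_eq: "zt A B = (fst A \<otimes>\<^sub>V fst B, ta (fst A) (snd A) (fst B) (snd B))"
  by (cases A; cases B) (simp add: action_tensor_eq)

lemma fst_zt [simp]: "fst (zt A B) = fst A \<otimes>\<^sub>V fst B"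
  by (simp add: zt_eq)

lemma zobj_zt: "zobj A \<Longrightarrow> zobj B \<Longrightarrow> zobj (zt A B)"
  by (simp add: zobj_def zt_eq gs_tensor pa_tensor)

lemma zobj_unit: "zobj zunit"
  by (simp add: zobj_def gs_unit pa_unit)

lemma Zc_simps:
  "Obj Zc = {A. zobj A}"
  "Arr Zc = {(A, \<phi>, B). zobj A \<and> zobj B \<and> \<phi> \<in> zm A B}"
  "Dom Zc (A, \<phi>, B) = A"
  "Cod Zc (A, \<phi>, B) = B"
  "Idn Zc A = (A, idm (fst A), A)"
  "Cmp Zc (B', \<psi>, D) (A, \<phi>, B) = (A, compose (car (fst A)) \<psi> \<phi>, D)"
  "TObj Zc = zt"
  "TArr Zc (A, \<phi>, B) (A', \<phi>', B') = (zt A A', tm (fst A) (fst B) \<phi> (fst A') (fst B') \<phi>', zt B B')"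
  "Unit Zc = zunit"
  "Assoc Zc A B D = (zt A (zt B D), am (fst A) (fst B) (fst D), zt (zt A B) D)"
  "LUnit Zc A = (zt zunit A, lunit_map K T (fst A), A)"
  "RUnit Zc A = (zt A zunit, runit_map K T (fst A), A)"
  "Braid Zc A B = (zt A B, br (fst A) (fst B) (snd B), zt B A)"
  by (auto simp: ZCat_def zobj_def zm_def gm_def br_def space_tensor action_unit_eq image_subset_iff split: prod.splits)

lemma Hom_Zc: "F \<in> Hom Zc A B \<longleftrightarrow> zobj A \<and> zobj B \<and> (\<exists>\<phi> \<in> zm A B. F = (A, \<phi>, B))"
  by (auto simp: Hom_def Zc_simps)

lemma zm_gm: "\<phi> \<in> zm A B \<Longrightarrow> \<phi> \<in> gm (fst A) (fst B)"
  by (simp add: zm_def)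

lemma zm_equivariant:
  "\<phi> \<in> zm A B \<Longrightarrow> f \<in> carrier G \<Longrightarrow> x \<in> car (fst A) \<Longrightarrow> \<phi> (snd A f x) = snd B f (\<phi> x)"
  by (simp add: zm_def)

section \<open>Equivariance of the structural maps\<close>

lemma zm_id: "zobj A \<Longrightarrow> idm (fst A) \<in> zm A A"
  by (simp add: zm_def gm_id zobj_gs pa_closed[OF zobj_pa])

lemma zm_compose:
  "zobj A \<Longrightarrow> \<phi> \<in> zm A B \<Longrightarrow> \<psi> \<in> zm B D \<Longrightarrow> compose (car (fst A)) \<psi> \<phi> \<in> zm A D"
  by (auto simp: zm_def compose_eq pa_closed[OF zobj_pa] gm_closed intro: gm_compose[OF zobj_gs])

text \<open>A graded inverse of an equivariant map is automatically equivariant, so isomorphisms in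
  \<open>ZCat\<close> only require inverses in \<open>gm\<close>.\<close>

lemma zm_inverse:
  assumes A: "zobj A" and B: "zobj B" and \<phi>: "\<phi> \<in> zm A B" and \<psi>: "\<psi> \<in> gm (fst B) (fst A)"
    and inv: "\<And>x. x \<in> car (fst A) \<Longrightarrow> \<psi> (\<phi> x) = x" "\<And>y. y \<in> car (fst B) \<Longrightarrow> \<phi> (\<psi> y) = y"
  shows "\<psi> \<in> zm B A"
proof -
  have "\<psi> (snd B f y) = snd A f (\<psi> y)" if "f \<in> carrier G" "y \<in> car (fst B)" for f y
  proof -
    have c: "\<psi> y \<in> car (fst A)" using gm_closed[OF \<psi> that(2)] .
    have "\<psi> (snd B f y) = \<psi> (\<phi> (snd A f (\<psi> y)))"
      using zm_equivariant[OF \<phi> that(1) c] inv(2)[OF that(2)] by simp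
    then show ?thesis using inv(1) pa_closed[OF zobj_pa[OF A] that(1) c] by simp
  qed
  then show ?thesis using \<psi> by (simp add: zm_def)
qed

lemma zm_tm:
  assumes obj: "zobj A" "zobj A'" "zobj B" "zobj B'" and \<phi>: "\<phi> \<in> zm A B" and \<phi>': "\<phi>' \<in> zm A' B'"
  shows "tm (fst A) (fst B) \<phi> (fst A') (fst B') \<phi>' \<in> zm (zt A A') (zt B B')"
proof -
  note gs = obj[THEN zobj_gs] and pa = obj[THEN zobj_pa]
  note t = gs zm_gm[OF \<phi>] zm_gm[OF \<phi>']
  note ta = ta_tv[OF gs(1) pa(1) gs(2) pa(2)] ta_tv[OF gs(3) pa(3) gs(4) pa(4)]
  note lin = ta_lin[OF gs(1) pa(1) gs(2) pa(2)] ta_lin[OF gs(3) pa(3) gs(4) pa(4)]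
  show ?thesis
    unfolding zm_def
  proof (intro CollectI conjI ballI)
    fix f s assume f: "f \<in> carrier G" and "s \<in> car (fst (zt A A'))"
    then have s: "s \<in> car (fst A \<otimes>\<^sub>V fst A')" by simp
    show "tm (fst A) (fst B) \<phi> (fst A') (fst B') \<phi>' (snd (zt A A') f s) =
        snd (zt B B') f (tm (fst A) (fst B) \<phi> (fst A') (fst B') \<phi>' s)"
      unfolding zt_eq snd_conv
    proof (rule tensor_linear_eqI[OF gs(1,2) gs_fd[OF gs_tensor[OF gs(3,4)]]
          is_linear_comp[OF lin(1)[OF f] gm_lin[OF tm_gm[OF t]]]
          is_linear_comp[OF gm_lin[OF tm_gm[OF t]] lin(2)[OF f]] _ s])
      fix g h x y assume *: "g \<in> carrier G" "h \<in> carrier G" "x \<in> piece (fst A) g" "y \<in> piece (fst A') h"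
        "x \<in> car (fst A)" "y \<in> car (fst A')"
      show "tm (fst A) (fst B) \<phi> (fst A') (fst B') \<phi>' (ta (fst A) (snd A) (fst A') (snd A') f (tv (fst A) (fst A') x y)) =
        ta (fst B) (snd B) (fst B') (snd B') f (tm (fst A) (fst B) \<phi> (fst A') (fst B') \<phi>' (tv (fst A) (fst A') x y))"
        using * f
        by (simp add: ta(1)[OF f *(1-4)] ta(2)[OF f *(1,2) gm_piece[OF t(5) *(1,3)] gm_piece[OF t(6) *(2,4)]]
            tm_tv[OF t] gm_smult[OF tm_gm[OF t]] tv_closed gs pa_closed[OF pa(1)] pa_closed[OF pa(2)]
            zm_equivariant[OF \<phi>] zm_equivariant[OF \<phi>'])
    qed
  qed (use tm_gm[OF t] in simp)
qed

text \<open>Acting before or after the constraint gives multiples of the same tensor; the two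
  scalars agree by \<open>tc_assoc\<close>.\<close>

lemma zm_am:
  assumes obj: "zobj A" "zobj B" "zobj D"
  shows "am (fst A) (fst B) (fst D) \<in> zm (zt A (zt B D)) (zt (zt A B) D)"
proof -
  note gs = obj[THEN zobj_gs] and pa = obj[THEN zobj_pa]
  note AB = gs_tensor[OF gs(1,2)] pa_tensor[OF gs(1) pa(1) gs(2) pa(2)]
  note BD = gs_tensor[OF gs(2,3)] pa_tensor[OF gs(2) pa(2) gs(3) pa(3)]
  note g = gs AB(1) BD(1) gs_tensor[OF AB(1) gs(3)] gs_tensor[OF gs(1) BD(1)]
  note am = am_gm[OF gs]
  note ta_AB = ta_tv[OF gs(1) pa(1) gs(2) pa(2)] and ta_BD = ta_tv[OF gs(2) pa(2) gs(3) pa(3)]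
  note ta_l = ta_tv[OF AB gs(3) pa(3)] and ta_r = ta_tv[OF gs(1) pa(1) BD]
  note lin_l = ta_lin[OF AB gs(3) pa(3)] and lin_r = ta_lin[OF gs(1) pa(1) BD]
  let ?X = "fst A" and ?Y = "fst B" and ?Z = "fst D"
  let ?\<rho> = "snd A" and ?\<sigma> = "snd B" and ?\<tau> = "snd D"
  let ?a = "am ?X ?Y ?Z"
  show ?thesis
    unfolding zm_def
  proof (intro CollectI conjI ballI)
    fix f s assume f: "f \<in> carrier G" and "s \<in> car (fst (zt A (zt B D)))"
    then have s: "s \<in> car (?X \<otimes>\<^sub>V (?Y \<otimes>\<^sub>V ?Z))" by simp
    show "?a (snd (zt A (zt B D)) f s) = snd (zt (zt A B) D) f (?a s)"
      unfolding zt_eq fst_conv snd_conv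
    proof (rule tensor3_right_eqI[OF gs gs_fd[OF g(6)]
          is_linear_comp[OF lin_r[OF f] gm_lin[OF am]] is_linear_comp[OF gm_lin[OF am] lin_l[OF f]] _ s])
      fix e h l x y z assume *: "e \<in> carrier G" "h \<in> carrier G" "l \<in> carrier G"
        "x \<in> piece ?X e" "y \<in> piece ?Y h" "z \<in> piece ?Z l" "x \<in> car ?X" "y \<in> car ?Y" "z \<in> car ?Z"
      have m: "e \<otimes>\<^bsub>G\<^esub> h \<in> carrier G" "h \<otimes>\<^bsub>G\<^esub> l \<in> carrier G" "cj f e \<in> carrier G" "cj f h \<in> carrier G"
        "cj f l \<in> carrier G" using * f by auto
      note p = pa_piece[OF pa(1) f *(1,4)] pa_piece[OF pa(2) f *(2,5)] pa_piece[OF pa(3) f *(3,6)]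
      note c = pa_closed[OF pa(1) f *(7)] pa_closed[OF pa(2) f *(8)] pa_closed[OF pa(3) f *(9)]
      note q = tv_piece[OF gs(1,2) *(1,2,4,5)] tv_piece[OF gs(2,3) *(2,3,5,6)]
      let ?t = "tv (?X \<otimes>\<^sub>V ?Y) ?Z (tv ?X ?Y (?\<rho> f x) (?\<sigma> f y)) (?\<tau> f z)"
      have t: "?t \<in> car ((?X \<otimes>\<^sub>V ?Y) \<otimes>\<^sub>V ?Z)" using c g by (simp add: tv_closed)
      have "?a (ta ?X ?\<rho> (?Y \<otimes>\<^sub>V ?Z) (ta ?Y ?\<sigma> ?Z ?\<tau>) f (tv ?X (?Y \<otimes>\<^sub>V ?Z) x (tv ?Y ?Z y z))) =
         (tc f e (h \<otimes>\<^bsub>G\<^esub> l) \<otimes>\<^bsub>K\<^esub> tc f h l \<otimes>\<^bsub>K\<^esub> \<alpha> (cj f e) (cj f h) (cj f l)) \<odot>\<^bsub>space ((?X \<otimes>\<^sub>V ?Y) \<otimes>\<^sub>V ?Z)\<^esub> ?t"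
        using f * m c t
        by (simp add: ta_r[OF f *(1) m(2) *(4) q(2)] ta_BD[OF f *(2,3,5,6)] tv_closed g tv_smult_right
            gm_smult[OF am] am_tv[OF gs m(3-5) p] gs_smult_closed gs_smult_smult K.m_assoc)
      also have "\<dots> = (\<alpha> e h l \<otimes>\<^bsub>K\<^esub> tc f (e \<otimes>\<^bsub>G\<^esub> h) l \<otimes>\<^bsub>K\<^esub> tc f e h) \<odot>\<^bsub>space ((?X \<otimes>\<^sub>V ?Y) \<otimes>\<^sub>V ?Z)\<^esub> ?t"
        by (simp only: tc_assoc[OF f *(1-3)])
      also have "\<dots> = ta (?X \<otimes>\<^sub>V ?Y) (ta ?X ?\<rho> ?Y ?\<sigma>) ?Z ?\<tau> f (?a (tv ?X (?Y \<otimes>\<^sub>V ?Z) x (tv ?Y ?Z y z)))"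
        using f * m c t
        by (simp add: am_tv[OF gs *(1-6)] is_linear_smult[OF lin_l[OF f]] tv_closed g
            ta_l[OF f m(1) *(3) q(1) *(6)] ta_AB[OF f *(1,2,4,5)] tv_smult_left gs_smult_smult K.m_assoc)
      finally show "?a (ta ?X ?\<rho> (?Y \<otimes>\<^sub>V ?Z) (ta ?Y ?\<sigma> ?Z ?\<tau>) f (tv ?X (?Y \<otimes>\<^sub>V ?Z) x (tv ?Y ?Z y z))) =
        ta (?X \<otimes>\<^sub>V ?Y) (ta ?X ?\<rho> ?Y ?\<sigma>) ?Z ?\<tau> f (?a (tv ?X (?Y \<otimes>\<^sub>V ?Z) x (tv ?Y ?Z y z)))" .
    qed
  qed (use am in simp)
qed

lemma zm_lunit:
  assumes A: "zobj A"
  shows "lunit_map K T (fst A) \<in> zm (zt zunit A) A"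
proof -
  note gs = zobj_gs[OF A] and pa = zobj_pa[OF A]
  note l = lunit_gm[OF gs]
  show ?thesis
    unfolding zm_def
  proof (intro CollectI conjI ballI)
    fix f s assume f: "f \<in> carrier G" and "s \<in> car (fst (zt zunit A))"
    then have s: "s \<in> car (unit \<otimes>\<^sub>V fst A)" by simp
    show "lunit_map K T (fst A) (snd (zt zunit A) f s) = snd A f (lunit_map K T (fst A) s)"
      unfolding zt_eq fst_conv snd_conv
      by (rule line_left_eqI[OF gs G.one_closed gs_fd[OF gs]
            is_linear_comp[OF ta_lin[OF gs_unit pa_unit gs pa f] gm_lin[OF l]]
            is_linear_comp[OF gm_lin[OF l] pa_lin[OF pa f]] _ s])
         (simp add: ta_tv[OF gs_unit pa_unit gs pa f G.one_closed _ u_piece] f gs_smult_one gs_tensor gs_unit gs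
            tv_closed u_closed pa_closed[OF pa] ua_apply lunit_tv)
  qed (use l in simp)
qed

lemma zm_runit:
  assumes A: "zobj A"
  shows "runit_map K T (fst A) \<in> zm (zt A zunit) A"
proof -
  note gs = zobj_gs[OF A] and pa = zobj_pa[OF A]
  note l = runit_gm[OF gs]
  show ?thesis
    unfolding zm_def
  proof (intro CollectI conjI ballI)
    fix f s assume f: "f \<in> carrier G" and "s \<in> car (fst (zt A zunit))"
    then have s: "s \<in> car (fst A \<otimes>\<^sub>V unit)" by simp
    show "runit_map K T (fst A) (snd (zt A zunit) f s) = snd A f (runit_map K T (fst A) s)"
      unfolding zt_eq fst_conv snd_conv
      by (rule line_right_eqI[OF gs G.one_closed gs_fd[OF gs]
            is_linear_comp[OF ta_lin[OF gs pa gs_unit pa_unit f] gm_lin[OF l]]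
            is_linear_comp[OF gm_lin[OF l] pa_lin[OF pa f]] _ s])
         (simp add: ta_tv[OF gs pa gs_unit pa_unit f _ G.one_closed _ u_piece] f gs_smult_one gs_tensor gs_unit gs
            tv_closed u_closed pa_closed[OF pa] ua_apply runit_tv)
  qed (use l in simp)
qed

lemma smult_cancel:
  assumes "gs X" "c \<in> Units K" "x \<in> car X" "y \<in> car X" "c \<odot>\<^bsub>space X\<^esub> x = c \<odot>\<^bsub>space X\<^esub> y"
  shows "x = y"
proof -
  have "inv\<^bsub>K\<^esub> c \<odot>\<^bsub>space X\<^esub> (c \<odot>\<^bsub>space X\<^esub> z) = z" if "z \<in> car X" for z
    using assms(1,2) that by (simp add: gs_smult_smult gs_smult_one K.Units_closed)
  then show ?thesis using assms(3-5) by metis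
qed

text \<open>On x \<otimes> y the two composites involve the vectors \<open>?y1\<close> and
  \<open>?y2\<close>, obtained by letting \<open>h\<close> act before or after the braiding. Each
  is, up to a scalar, the action of hf on \<open>y\<close>, and \<open>tc_braid\<close> matches the
  scalars.\<close>

lemma zm_br:
  assumes obj: "zobj A" "zobj B"
  shows "br (fst A) (fst B) (snd B) \<in> zm (zt A B) (zt B A)"
proof -
  note gs = obj[THEN zobj_gs] and pa = obj[THEN zobj_pa]
  note g = gs gs_tensor[OF gs] gs_tensor[OF gs(2,1)]
  let ?X = "fst A" and ?Y = "fst B"
  let ?\<rho> = "snd A" and ?\<sigma> = "snd B"
  note b = br_gm[OF gs pa(2)]
  note lin_l = ta_lin[OF gs(1) pa(1) gs(2) pa(2)] and lin_r = ta_lin[OF gs(2) pa(2) gs(1) pa(1)]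
  show ?thesis
    unfolding zm_def
  proof (intro CollectI conjI ballI)
    fix h s assume h: "h \<in> carrier G" and "s \<in> car (fst (zt A B))"
    then have s: "s \<in> car (?X \<otimes>\<^sub>V ?Y)" by simp
    show "br ?X ?Y ?\<sigma> (snd (zt A B) h s) = snd (zt B A) h (br ?X ?Y ?\<sigma> s)"
      unfolding zt_eq fst_conv snd_conv
    proof (rule tensor_linear_eqI[OF gs gs_fd[OF g(4)]
          is_linear_comp[OF lin_l[OF h] gm_lin[OF b]] is_linear_comp[OF gm_lin[OF b] lin_r[OF h]] _ s])
      fix f k x y assume *: "f \<in> carrier G" "k \<in> carrier G" "x \<in> piece ?X f" "y \<in> piece ?Y k"
        "x \<in> car ?X" "y \<in> car ?Y"
      have m: "cj h f \<in> carrier G" "cj f k \<in> carrier G" using h * by auto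
      note p = pa_piece[OF pa(1) h *(1,3)] pa_piece[OF pa(2) *(1,2,4)]
      note c = pa_closed[OF pa(1) h *(5)] pa_closed[OF pa(2) h *(6)] pa_closed[OF pa(2) *(1,6)]
      have acc: "ac (cj h f) h k \<in> carrier K" "ac h f k \<in> carrier K"
        and tcc: "tc h f k \<in> carrier K" "tc h (cj f k) f \<in> carrier K" using h * m by simp_all
      note cc = pa_closed[OF pa(2) m(1) c(2)] pa_closed[OF pa(2) h c(3)]
      let ?y1 = "?\<sigma> (cj h f) (?\<sigma> h y)" and ?y2 = "?\<sigma> h (?\<sigma> f y)"
      \<comment> \<open>Both sides are the action of hf on \<open>y\<close>; the right one uses the
        factorisation of hf as \<open>cj h f\<close> times \<open>h\<close>.\<close>
      have "ac h f k \<odot>\<^bsub>space ?Y\<^esub> ?y2 = ac (cj h f) h k \<odot>\<^bsub>space ?Y\<^esub> ?y1"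
        using pa_mult[OF pa(2) h *(1,2,4)] pa_mult[OF pa(2) m(1) h *(2,4)] h * by (simp add: cj_swap)
      then have "(ac (cj h f) h k \<otimes>\<^bsub>K\<^esub> tc h f k) \<odot>\<^bsub>space ?Y\<^esub> ?y1 = (tc h f k \<otimes>\<^bsub>K\<^esub> ac h f k) \<odot>\<^bsub>space ?Y\<^esub> ?y2"
        using h * m cc g by (simp add: gs_smult_smult[symmetric] K.m_comm[of "ac (cj h f) h k"])
      moreover have "tc h f k \<otimes>\<^bsub>K\<^esub> ac h f k = ac (cj h f) h k \<otimes>\<^bsub>K\<^esub> tc h (cj f k) f"
        using tc_braid[OF *(1,2) h] K.m_comm[of "ac (cj h f) h k" "tc h (cj f k) f"] acc(1) tcc(2) by simp
      \<comment> \<open>The unit \<open>ac (cj h f) h k\<close> occurs on both sides and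
        cancels.\<close>
      ultimately have "tc h f k \<odot>\<^bsub>space ?Y\<^esub> ?y1 = tc h (cj f k) f \<odot>\<^bsub>space ?Y\<^esub> ?y2"
        using h * m cc g
        by - (rule smult_cancel[of ?Y "ac (cj h f) h k"], simp_all add: gs_smult_smult gs_smult_closed)
      then have "tv ?Y ?X (tc h f k \<odot>\<^bsub>space ?Y\<^esub> ?y1) (?\<rho> h x) = tv ?Y ?X (tc h (cj f k) f \<odot>\<^bsub>space ?Y\<^esub> ?y2) (?\<rho> h x)"
        by simp
      then show "br ?X ?Y ?\<sigma> (ta ?X ?\<rho> ?Y ?\<sigma> h (tv ?X ?Y x y)) = ta ?Y ?\<sigma> ?X ?\<rho> h (br ?X ?Y ?\<sigma> (tv ?X ?Y x y))"
        using h * m c cc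
        by (simp add: ta_tv[OF gs(1) pa(1) gs(2) pa(2) h *(1-4)] gm_smult[OF b] tv_closed g br_tv[OF gs pa(2)  m(1) p(1) c(2)]
            br_tv[OF gs pa(2) *(1,3,6)] ta_tv[OF gs(2) pa(2) gs(1) pa(1) h m(2) *(1) p(2) *(3)] tv_smult_left)
    qed
  qed (use b in simp)
qed

section \<open>The axioms of a braided category for \<open>ZCat\<close>\<close>

lemma category_Zc: "category Zc"
proof
  fix F assume "F \<in> Arr Zc" then show "Dom Zc F \<in> Obj Zc \<and> Cod Zc F \<in> Obj Zc"
    by (auto simp: Zc_simps)
next
  fix A assume "A \<in> Obj Zc" then show "Idn Zc A \<in> Hom Zc A A"
    by (auto simp: Hom_Zc Zc_simps zm_id)
next
  fix F H A B D assume "F \<in> Hom Zc A B" "H \<in> Hom Zc B D"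
  then show "H \<bullet>\<^bsub>Zc\<^esub> F \<in> Hom Zc A D" by (auto simp: Hom_Zc Zc_simps zm_compose)
next
  fix F A B assume "F \<in> Hom Zc A B"
  then obtain \<phi> where F: "zobj A" "zobj B" "\<phi> \<in> zm A B" "F = (A, \<phi>, B)" by (auto simp: Hom_Zc)
  have "compose (car (fst A)) (idm (fst B)) \<phi> = \<phi>" "compose (car (fst A)) \<phi> (idm (fst A)) = \<phi>"
    using gm_closed[OF zm_gm[OF F(3)]]
    by (auto intro: gm_eqI[OF gm_compose[OF zobj_gs[OF F(1)] zm_gm[OF F(3)] gm_id[OF zobj_gs[OF F(2)]]] zm_gm[OF F(3)]]
        gm_eqI[OF gm_compose[OF zobj_gs[OF F(1)] gm_id[OF zobj_gs[OF F(1)]] zm_gm[OF F(3)]] zm_gm[OF F(3)]]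
        simp: compose_eq)
  then show "Idn Zc B \<bullet>\<^bsub>Zc\<^esub> F = F" "F \<bullet>\<^bsub>Zc\<^esub> Idn Zc A = F" by (simp_all add: F(4) Zc_simps)
next
  fix F H L A B D E assume "F \<in> Hom Zc A B" "H \<in> Hom Zc B D" "L \<in> Hom Zc D E"
  then obtain \<phi> \<psi> \<chi> where *: "\<phi> \<in> zm A B" "F = (A, \<phi>, B)" "H = (B, \<psi>, D)" "L = (D, \<chi>, E)"
    by (auto simp: Hom_Zc)
  have "\<phi> \<in> car (fst A) \<rightarrow> car (fst B)" using gm_closed[OF zm_gm[OF *(1)]] by auto
  then show "(L \<bullet>\<^bsub>Zc\<^esub> H) \<bullet>\<^bsub>Zc\<^esub> F = L \<bullet>\<^bsub>Zc\<^esub> (H \<bullet>\<^bsub>Zc\<^esub> F)"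
    by (simp add: * Zc_simps compose_assoc)
qed

interpretation Z: category Zc by (rule category_Zc)

lemma Zc_inverse_arrows:
  assumes A: "zobj A" and B: "zobj B" and \<phi>: "\<phi> \<in> zm A B" and \<psi>: "\<psi> \<in> gm (fst B) (fst A)"
    and inv: "\<And>x. x \<in> car (fst A) \<Longrightarrow> \<psi> (\<phi> x) = x" "\<And>y. y \<in> car (fst B) \<Longrightarrow> \<phi> (\<psi> y) = y"
  shows "inverse_arrows Zc (A, \<phi>, B) (B, \<psi>, A)"
proof -
  have "compose (car (fst A)) \<psi> \<phi> = idm (fst A)" "compose (car (fst B)) \<phi> \<psi> = idm (fst B)"
    using inv by (auto simp: compose_def fun_eq_iff)
  then show ?thesis
    using zm_inverse[OF assms] A B \<phi> by (simp add: inverse_arrows_def Hom_Zc Zc_simps)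
qed

lemma Zc_Iso:
  assumes "zobj A" "zobj B" "\<phi> \<in> zm A B" "\<psi> \<in> gm (fst B) (fst A)"
    and "\<And>x. x \<in> car (fst A) \<Longrightarrow> \<psi> (\<phi> x) = x" "\<And>y. y \<in> car (fst B) \<Longrightarrow> \<phi> (\<psi> y) = y"
  shows "(A, \<phi>, B) \<in> Iso Zc A B"
proof -
  have "(A, \<phi>, B) \<in> Hom Zc A B" using assms(1-3) by (auto simp: Hom_Zc)
  then show ?thesis unfolding Iso_def using Zc_inverse_arrows[OF assms] by blast
qed

lemma Zc_Inv_Assoc:
  assumes "zobj A" "zobj B" "zobj D"
  shows "Inv Zc (Assoc Zc A B D) = (zt (zt A B) D, am_inv (fst A) (fst B) (fst D), zt A (zt B D))"
  unfolding Zc_simps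
  by (rule Z.Inv_eqI[OF Zc_inverse_arrows])
     (use assms in \<open>auto simp: zobj_zt zm_am am_inv_gm zobj_gs am_inv_am am_am_inv\<close>)

lemma monoidal_Zc: "monoidal_category Zc"
proof (intro monoidal_category.intro category_Zc monoidal_category_axioms.intro)
  fix F H A A' B B' assume "F \<in> Hom Zc A A'" "H \<in> Hom Zc B B'"
  then show "F \<star>\<^bsub>Zc\<^esub> H \<in> Hom Zc (A \<boxtimes>\<^bsub>Zc\<^esub> B) (A' \<boxtimes>\<^bsub>Zc\<^esub> B')"
    by (auto simp: Hom_Zc Zc_simps zobj_zt zm_tm)
next
  fix F F' H H' A A' A'' B B' B''
  assume "F \<in> Hom Zc A A'" "F' \<in> Hom Zc A' A''" "H \<in> Hom Zc B B'" "H' \<in> Hom Zc B' B''"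
  then show "(F' \<bullet>\<^bsub>Zc\<^esub> F) \<star>\<^bsub>Zc\<^esub> (H' \<bullet>\<^bsub>Zc\<^esub> H) = (F' \<star>\<^bsub>Zc\<^esub> H') \<bullet>\<^bsub>Zc\<^esub> (F \<star>\<^bsub>Zc\<^esub> H)"
    using tm_compose by (auto simp: Hom_Zc Zc_simps zobj_gs zm_gm)
next
  fix F A A' assume "F \<in> Hom Zc A A'"
  then show "LUnit Zc A' \<bullet>\<^bsub>Zc\<^esub> (Idn Zc (Unit Zc) \<star>\<^bsub>Zc\<^esub> F) = F \<bullet>\<^bsub>Zc\<^esub> LUnit Zc A"
    "RUnit Zc A' \<bullet>\<^bsub>Zc\<^esub> (F \<star>\<^bsub>Zc\<^esub> Idn Zc (Unit Zc)) = F \<bullet>\<^bsub>Zc\<^esub> RUnit Zc A"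
    by (auto simp: Hom_Zc Zc_simps zobj_gs zm_gm lunit_natural_map runit_natural_map)
next
  fix F H L A A' B B' D D' assume "F \<in> Hom Zc A A'" "H \<in> Hom Zc B B'" "L \<in> Hom Zc D D'"
  then show "Assoc Zc A' B' D' \<bullet>\<^bsub>Zc\<^esub> (F \<star>\<^bsub>Zc\<^esub> (H \<star>\<^bsub>Zc\<^esub> L)) = ((F \<star>\<^bsub>Zc\<^esub> H) \<star>\<^bsub>Zc\<^esub> L) \<bullet>\<^bsub>Zc\<^esub> Assoc Zc A B D"
    by (auto simp: Hom_Zc Zc_simps zobj_gs zm_gm am_natural)
next
  fix A assume "A \<in> Obj Zc"
  then have A: "zobj A" by (simp add: Zc_simps)
  show "LUnit Zc A \<in> Iso Zc (Unit Zc \<boxtimes>\<^bsub>Zc\<^esub> A) A"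
    unfolding Zc_simps
    by (rule Zc_Iso[where \<psi> = "linv (fst A)"])
       (use A in \<open>auto simp: zobj_zt zobj_unit zm_lunit linv_gm zobj_gs linv_lunit lunit_linv\<close>)
  show "RUnit Zc A \<in> Iso Zc (A \<boxtimes>\<^bsub>Zc\<^esub> Unit Zc) A"
    unfolding Zc_simps
    by (rule Zc_Iso[where \<psi> = "rinv (fst A)"])
       (use A in \<open>auto simp: zobj_zt zobj_unit zm_runit rinv_gm zobj_gs rinv_runit runit_rinv\<close>)
next
  fix A B D assume "A \<in> Obj Zc" "B \<in> Obj Zc" "D \<in> Obj Zc"
  then have *: "zobj A" "zobj B" "zobj D" by (auto simp: Zc_simps)
  show "Assoc Zc A B D \<in> Iso Zc (A \<boxtimes>\<^bsub>Zc\<^esub> (B \<boxtimes>\<^bsub>Zc\<^esub> D)) ((A \<boxtimes>\<^bsub>Zc\<^esub> B) \<boxtimes>\<^bsub>Zc\<^esub> D)"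
    unfolding Zc_simps
    by (rule Zc_Iso[where \<psi> = "am_inv (fst A) (fst B) (fst D)"])
       (use * in \<open>auto simp: zobj_zt zm_am am_inv_gm zobj_gs am_inv_am am_am_inv\<close>)
qed (auto simp: Zc_simps zobj_zt zobj_unit tm_id zobj_gs pentagon_map triangle_map)

lemma braided_Zc: "braided_category Zc"
proof (intro braided_category.intro monoidal_Zc braided_category_axioms.intro)
  fix A B assume "A \<in> Obj Zc" "B \<in> Obj Zc"
  then have *: "zobj A" "zobj B" by (auto simp: Zc_simps)
  show "Braid Zc A B \<in> Iso Zc (A \<boxtimes>\<^bsub>Zc\<^esub> B) (B \<boxtimes>\<^bsub>Zc\<^esub> A)"
    unfolding Zc_simps
    by (rule Zc_Iso[where \<psi> = "br_inv (fst A) (fst B) (snd B)"])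
       (use * in \<open>auto simp: zobj_zt zm_br br_inv_gm zobj_gs zobj_pa br_inv_br br_br_inv\<close>)
next
  fix F H A A' B B' assume "F \<in> Hom Zc A A'" "H \<in> Hom Zc B B'"
  then show "Braid Zc A' B' \<bullet>\<^bsub>Zc\<^esub> (F \<star>\<^bsub>Zc\<^esub> H) = (H \<star>\<^bsub>Zc\<^esub> F) \<bullet>\<^bsub>Zc\<^esub> Braid Zc A B"
    by (auto simp: Hom_Zc Zc_simps zobj_gs zobj_pa zm_gm zm_equivariant intro!: br_natural)
next
  fix A B D assume "A \<in> Obj Zc" "B \<in> Obj Zc" "D \<in> Obj Zc"
  then have *: "zobj A" "zobj B" "zobj D" by (auto simp: Zc_simps)
  show "Braid Zc A (B \<boxtimes>\<^bsub>Zc\<^esub> D) = Assoc Zc B D A \<bullet>\<^bsub>Zc\<^esub> (Idn Zc B \<star>\<^bsub>Zc\<^esub> Braid Zc A D) \<bullet>\<^bsub>Zc\<^esub>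
      Inv Zc (Assoc Zc B A D) \<bullet>\<^bsub>Zc\<^esub> (Braid Zc A B \<star>\<^bsub>Zc\<^esub> Idn Zc D) \<bullet>\<^bsub>Zc\<^esub> Assoc Zc A B D"
    unfolding Zc_Inv_Assoc[OF *(2,1,3)]
    using * br_tensor_right[of "fst A" "fst B" "fst D" "snd B" "snd D"]
    by (simp add: Zc_simps zobj_gs zobj_pa) (simp add: zt_eq)
  show "Braid Zc (A \<boxtimes>\<^bsub>Zc\<^esub> B) D \<bullet>\<^bsub>Zc\<^esub> Assoc Zc A B D = Inv Zc (Assoc Zc D A B) \<bullet>\<^bsub>Zc\<^esub>
      (Braid Zc A D \<star>\<^bsub>Zc\<^esub> Idn Zc B) \<bullet>\<^bsub>Zc\<^esub> Assoc Zc A D B \<bullet>\<^bsub>Zc\<^esub> (Idn Zc A \<star>\<^bsub>Zc\<^esub> Braid Zc B D)"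
    unfolding Zc_Inv_Assoc[OF *(3,1,2)]
    using * by (simp add: Zc_simps zobj_gs zobj_pa br_tensor_left)
qed

end

section \<open>Half-braidings are projective actions\<close>

context cocycle_setting
begin

abbreviation Vc where "Vc \<equiv> VCat G K T \<alpha>"

lemma Vc_simps:
  "Obj Vc = {X. gs X}"
  "Arr Vc = {(X, \<phi>, Y). gs X \<and> gs Y \<and> \<phi> \<in> gm X Y}"
  "Dom Vc (X, \<phi>, Y) = X"
  "Cod Vc (X, \<phi>, Y) = Y"
  "Idn Vc X = (X, idm X, X)"
  "Cmp Vc (Y', \<psi>, Z) (X, \<phi>, Y) = (X, compose (car X) \<psi> \<phi>, Z)"
  "TObj Vc X Y = X \<otimes>\<^sub>V Y"
  "TArr Vc (X, \<phi>, Y) (X', \<phi>', Y') = (X \<otimes>\<^sub>V X', tm X Y \<phi> X' Y' \<phi>', Y \<otimes>\<^sub>V Y')"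
  "Unit Vc = unit"
  "Assoc Vc X Y Z = (X \<otimes>\<^sub>V (Y \<otimes>\<^sub>V Z), am X Y Z, (X \<otimes>\<^sub>V Y) \<otimes>\<^sub>V Z)"
  "LUnit Vc X = (unit \<otimes>\<^sub>V X, lunit_map K T X, X)"
  "RUnit Vc X = (X \<otimes>\<^sub>V unit, runit_map K T X, X)"
  by (auto simp: VCat_def gm_def unit_line image_subset_iff)

lemma Hom_Vc: "F \<in> Hom Vc X Y \<longleftrightarrow> gs X \<and> gs Y \<and> (\<exists>\<phi> \<in> gm X Y. F = (X, \<phi>, Y))"
  by (auto simp: Hom_def Vc_simps)

lemma category_Vc: "category Vc"
proof
  fix F assume "F \<in> Arr Vc" then show "Dom Vc F \<in> Obj Vc \<and> Cod Vc F \<in> Obj Vc"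
    by (auto simp: Vc_simps)
next
  fix X assume "X \<in> Obj Vc" then show "Idn Vc X \<in> Hom Vc X X"
    by (auto simp: Hom_Vc Vc_simps gm_id)
next
  fix F H X Y Z assume "F \<in> Hom Vc X Y" "H \<in> Hom Vc Y Z"
  then show "H \<bullet>\<^bsub>Vc\<^esub> F \<in> Hom Vc X Z" by (auto simp: Hom_Vc Vc_simps gm_compose)
next
  fix F X Y assume "F \<in> Hom Vc X Y"
  then obtain \<phi> where F: "gs X" "gs Y" "\<phi> \<in> gm X Y" "F = (X, \<phi>, Y)" by (auto simp: Hom_Vc)
  have "compose (car X) (idm Y) \<phi> = \<phi>" "compose (car X) \<phi> (idm X) = \<phi>"
    using gm_closed[OF F(3)]
    by (auto intro: gm_eqI[OF gm_compose[OF F(1,3) gm_id[OF F(2)]] F(3)]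
        gm_eqI[OF gm_compose[OF F(1) gm_id[OF F(1)] F(3)] F(3)] simp: compose_eq)
  then show "Idn Vc Y \<bullet>\<^bsub>Vc\<^esub> F = F" "F \<bullet>\<^bsub>Vc\<^esub> Idn Vc X = F" by (simp_all add: F(4) Vc_simps)
next
  fix F H L X Y Z W assume "F \<in> Hom Vc X Y" "H \<in> Hom Vc Y Z" "L \<in> Hom Vc Z W"
  then obtain \<phi> \<psi> \<chi> where *: "\<phi> \<in> gm X Y" "F = (X, \<phi>, Y)" "H = (Y, \<psi>, Z)" "L = (Z, \<chi>, W)"
    by (auto simp: Hom_Vc)
  have "\<phi> \<in> car X \<rightarrow> car Y" using gm_closed[OF *(1)] by auto
  then show "(L \<bullet>\<^bsub>Vc\<^esub> H) \<bullet>\<^bsub>Vc\<^esub> F = L \<bullet>\<^bsub>Vc\<^esub> (H \<bullet>\<^bsub>Vc\<^esub> F)"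
    by (simp add: * Vc_simps compose_assoc)
qed

interpretation V: category Vc by (rule category_Vc)

lemma Vc_inverse_arrows:
  assumes "gs X" "gs Y" "\<phi> \<in> gm X Y" "\<psi> \<in> gm Y X"
    and "\<And>x. x \<in> car X \<Longrightarrow> \<psi> (\<phi> x) = x" "\<And>y. y \<in> car Y \<Longrightarrow> \<phi> (\<psi> y) = y"
  shows "inverse_arrows Vc (X, \<phi>, Y) (Y, \<psi>, X)"
proof -
  have "compose (car X) \<psi> \<phi> = idm X" "compose (car Y) \<phi> \<psi> = idm Y"
    using assms(5,6) by (auto simp: compose_def fun_eq_iff)
  then show ?thesis using assms(1-4) by (simp add: inverse_arrows_def Hom_Vc Vc_simps)
qed

text \<open>Half-braidings and their tensor products are defined through \<open>Inv\<close>;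
  uniqueness of inverses replaces it by the computable \<open>am_inv\<close>.\<close>

lemma Vc_Inv_Assoc:
  "gs X \<Longrightarrow> gs Y \<Longrightarrow> gs Z \<Longrightarrow>
   Inv Vc (X \<otimes>\<^sub>V (Y \<otimes>\<^sub>V Z), am X Y Z, (X \<otimes>\<^sub>V Y) \<otimes>\<^sub>V Z) = ((X \<otimes>\<^sub>V Y) \<otimes>\<^sub>V Z, am_inv X Y Z, X \<otimes>\<^sub>V (Y \<otimes>\<^sub>V Z))"
  by (rule V.Inv_eqI[OF Vc_inverse_arrows]) (auto simp: gm_intros am_inv_am am_am_inv)

lemma Vc_Inv_LUnit:
  "gs X \<Longrightarrow> Inv Vc (unit \<otimes>\<^sub>V X, lunit_map K T X, X) = (X, linv X, unit \<otimes>\<^sub>V X)"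
  by (rule V.Inv_eqI[OF Vc_inverse_arrows]) (auto simp: gm_intros linv_lunit lunit_linv)

definition hb :: "('g, 'k, 'v) graded \<Rightarrow> ('g \<Rightarrow> 'v \<Rightarrow> 'v) \<Rightarrow> ('g, 'k, 'v) graded \<Rightarrow> ('g, 'k, 'v) graded_arr" where
  "hb X \<rho> = (\<lambda>V \<in> Obj Vc. (V \<otimes>\<^sub>V X, br V X \<rho>, X \<otimes>\<^sub>V V))"

lemma hb_apply: "gs V \<Longrightarrow> hb X \<rho> V = (V \<otimes>\<^sub>V X, br V X \<rho>, X \<otimes>\<^sub>V V)"
  by (simp add: hb_def Vc_simps)

lemma half_braiding_hb:
  assumes X: "gs X" "pa X \<rho>"
  shows "half_braiding Vc X (hb X \<rho>)"
  unfolding half_braiding_def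
proof (intro conjI ballI)
  show "hb X \<rho> \<in> extensional (Obj Vc)" by (simp add: hb_def)
next
  fix V assume "V \<in> Obj Vc"
  then have V: "gs V" by (simp add: Vc_simps)
  have "inverse_arrows Vc (V \<otimes>\<^sub>V X, br V X \<rho>, X \<otimes>\<^sub>V V) (X \<otimes>\<^sub>V V, br_inv V X \<rho>, V \<otimes>\<^sub>V X)"
    by (rule Vc_inverse_arrows) (auto simp: gm_intros V X br_inv_br br_br_inv)
  moreover have "(V \<otimes>\<^sub>V X, br V X \<rho>, X \<otimes>\<^sub>V V) \<in> Hom Vc (V \<otimes>\<^sub>V X) (X \<otimes>\<^sub>V V)"
    by (simp add: Hom_Vc gm_intros V X)
  ultimately show "hb X \<rho> V \<in> Iso Vc (V \<boxtimes>\<^bsub>Vc\<^esub> X) (X \<boxtimes>\<^bsub>Vc\<^esub> V)"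
    by (auto simp: Iso_def hb_apply V Vc_simps)
next
  fix V U F assume "V \<in> Obj Vc" "U \<in> Obj Vc" "F \<in> Hom Vc V U"
  then obtain \<phi> where \<phi>: "gs V" "gs U" "\<phi> \<in> gm V U" "F = (V, \<phi>, U)" by (auto simp: Hom_Vc Vc_simps)
  show "(Idn Vc X \<star>\<^bsub>Vc\<^esub> F) \<bullet>\<^bsub>Vc\<^esub> hb X \<rho> V = hb X \<rho> U \<bullet>\<^bsub>Vc\<^esub> (F \<star>\<^bsub>Vc\<^esub> Idn Vc X)"
    using br_natural[OF \<phi>(1,2) X(1) X(1) X(2) X(2) \<phi>(3) gm_id[OF X(1)]] \<phi>(1,2)
    by (simp add: \<phi>(4) hb_apply Vc_simps pa_closed[OF X(2)])
next
  fix V U assume "V \<in> Obj Vc" "U \<in> Obj Vc"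
  then show "hb X \<rho> (V \<boxtimes>\<^bsub>Vc\<^esub> U) \<bullet>\<^bsub>Vc\<^esub> Assoc Vc V U X = Inv Vc (Assoc Vc X V U) \<bullet>\<^bsub>Vc\<^esub> (hb X \<rho> V \<star>\<^bsub>Vc\<^esub> Idn Vc U)
     \<bullet>\<^bsub>Vc\<^esub> Assoc Vc V X U \<bullet>\<^bsub>Vc\<^esub> (Idn Vc V \<star>\<^bsub>Vc\<^esub> hb X \<rho> U)"
    by (simp add: Vc_simps hb_apply gs_tensor Vc_Inv_Assoc X br_tensor_left)
qed

section \<open>From a half-braiding to a projective action\<close>

context
  fixes X x
  assumes X: "gs X" and x: "half_braiding Vc X x"
begin

definition comp :: "('g, 'k, 'v) graded \<Rightarrow> 'v \<Rightarrow> 'v" where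
  "comp V = fst (snd (x V))"

text \<open>The component at the line sends u \<otimes> y to f.y \<otimes> u, and
  \<open>runit_map\<close>, used here in degree \<open>f\<close>, strips the trailing
  \<open>u\<close>.\<close>

definition act :: "'g \<Rightarrow> 'v \<Rightarrow> 'v" where
  "act = (\<lambda>f \<in> carrier G. \<lambda>y \<in> car X. runit_map K T X (comp (line f) (tv (line f) X u y)))"

text \<open>From invertibility only injectivity is kept: it yields the identity axiom of the action,
  from which \<open>projective_actionI\<close> recovers bijectivity.\<close>

lemma comp_facts:
  assumes V: "gs V"
  shows x_eq: "x V = (V \<otimes>\<^sub>V X, comp V, X \<otimes>\<^sub>V V)"
    and comp_gm: "comp V \<in> gm (V \<otimes>\<^sub>V X) (X \<otimes>\<^sub>V V)"
    and comp_inj: "inj_on (comp V) (car (V \<otimes>\<^sub>V X))"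
proof -
  have "x V \<in> Iso Vc (V \<otimes>\<^sub>V X) (X \<otimes>\<^sub>V V)"
    using x V by (auto simp: half_braiding_def Vc_simps)
  then obtain \<phi> F where \<phi>: "\<phi> \<in> gm (V \<otimes>\<^sub>V X) (X \<otimes>\<^sub>V V)" "x V = (V \<otimes>\<^sub>V X, \<phi>, X \<otimes>\<^sub>V V)"
    and F: "inverse_arrows Vc (x V) F"
    by (auto simp: Iso_def Hom_Vc)
  then obtain \<psi> where "F = (X \<otimes>\<^sub>V V, \<psi>, V \<otimes>\<^sub>V X)" "compose (car (V \<otimes>\<^sub>V X)) \<psi> \<phi> = idm (V \<otimes>\<^sub>V X)"
    by (auto simp: inverse_arrows_def Hom_Vc Vc_simps)
  then have "inj_on \<phi> (car (V \<otimes>\<^sub>V X))"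
    by (intro inj_on_inverseI[where g = \<psi>]) (metis compose_eq restrict_apply')
  then show "x V = (V \<otimes>\<^sub>V X, comp V, X \<otimes>\<^sub>V V)" "comp V \<in> gm (V \<otimes>\<^sub>V X) (X \<otimes>\<^sub>V V)"
    "inj_on (comp V) (car (V \<otimes>\<^sub>V X))"
    using \<phi> by (simp_all add: comp_def)
qed

lemma x_natural:
  "gs V \<Longrightarrow> gs U \<Longrightarrow> F \<in> Hom Vc V U \<Longrightarrow>
   (Idn Vc X \<star>\<^bsub>Vc\<^esub> F) \<bullet>\<^bsub>Vc\<^esub> x V = x U \<bullet>\<^bsub>Vc\<^esub> (F \<star>\<^bsub>Vc\<^esub> Idn Vc X)"
  and x_hexagon: "gs V \<Longrightarrow> gs U \<Longrightarrow> x (V \<boxtimes>\<^bsub>Vc\<^esub> U) \<bullet>\<^bsub>Vc\<^esub> Assoc Vc V U X =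
     Inv Vc (Assoc Vc X V U) \<bullet>\<^bsub>Vc\<^esub> (x V \<star>\<^bsub>Vc\<^esub> Idn Vc U) \<bullet>\<^bsub>Vc\<^esub> Assoc Vc V X U
       \<bullet>\<^bsub>Vc\<^esub> (Idn Vc V \<star>\<^bsub>Vc\<^esub> x U)"
  using x unfolding half_braiding_def Vc_simps(1) by blast+

lemma act_line:
  assumes f: "f \<in> carrier G" and y: "y \<in> car X"
  shows "comp (line f) (tv (line f) X u y) = tv X (line f) (act f y) u"
proof -
  \<comment> \<open>Every element of \<open>X \<otimes>\<^sub>V line f\<close> has the form x
    \<otimes> u, with x recovered by \<open>runit_map\<close>.\<close>
  have "tv X (line f) (runit_map K T X t) u = t" if "t \<in> car (X \<otimes>\<^sub>V line f)" for t
  proof (rule line_right_eqI[OF X f gs_fd[OF gs_tensor[OF X gs_line[OF f]]] _ is_linear_id _ that])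
    show "lin (X \<otimes>\<^sub>V line f) (X \<otimes>\<^sub>V line f) (\<lambda>t. tv X (line f) (runit_map K T X t) u)"
      using is_linear_comp[OF _ linear_tv_left[OF X gs_line[OF f] u_closed]] runit_Lin[OF X f]
      by (simp add: Lin_iff)
  qed (simp add: runit_tv[OF X f])
  then show ?thesis
    using f y gm_closed[OF comp_gm[OF gs_line[OF f]] tv_closed[OF gs_line[OF f] X u_closed y]] by (simp add: act_def)
qed

text \<open>Naturality along the map from the line in degree \<open>f\<close> that picks out \<open>v\<close>.\<close>

lemma comp_tv:
  assumes V: "gs V" and f: "f \<in> carrier G" and v: "v \<in> piece V f" and y: "y \<in> car X"
  shows "comp V (tv V X v y) = tv X V (act f y) v"
proof -
  let ?p = "point f V v"
  note L = gs_line[OF f]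
  note p = point_gm[OF V f v] and vc = piece_car[OF V f v]
  have "(line f, ?p, V) \<in> Hom Vc (line f) V" using L V p by (simp add: Hom_Vc)
  from x_natural[OF L V this]
  have eq: "compose (car (line f \<otimes>\<^sub>V X)) (tm X X (idm X) (line f) V ?p) (comp (line f)) =
     compose (car (line f \<otimes>\<^sub>V X)) (comp V) (tm (line f) V ?p X X (idm X))"
    using L V by (simp add: x_eq Vc_simps)
  have t: "tv (line f) X u y \<in> car (line f \<otimes>\<^sub>V X)" using L X u_closed y by (simp add: tv_closed)
  have a: "act f y \<in> car X"
    using y f is_linear_closed[of K "space (X \<otimes>\<^sub>V line f)" "space X"] runit_Lin[OF X f] gm_closed[OF comp_gm[OF L] t]
    by (simp add: act_def Lin_iff)
  show ?thesis
    using fun_cong[OF eq, of "tv (line f) X u y"] t a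
    by (simp add: compose_eq act_line[OF f y] tm_tv[OF X L X V gm_id[OF X] p a u_closed]
        tm_tv[OF L X V X p gm_id[OF X] u_closed y] point_u V vc y)
qed

lemma act_Lin:
  assumes f: "f \<in> carrier G"
  shows "act f \<in> Lin K (space X) (space X)"
proof -
  note L = gs_line[OF f]
  have "lin X X (\<lambda>y. runit_map K T X (comp (line f) (tv (line f) X u y)))"
    using is_linear_comp[OF is_linear_comp[OF linear_tv_right[OF L X u_closed] gm_lin[OF comp_gm[OF L]]]]
      runit_Lin[OF X f] by (simp add: Lin_iff)
  then show ?thesis using f by (simp add: act_def Lin_restrict gs_module X)
qed

lemma act_closed: "f \<in> carrier G \<Longrightarrow> y \<in> car X \<Longrightarrow> act f y \<in> car X"
  by (rule is_linear_closed[OF conjunct2[OF act_Lin[unfolded Lin_iff]]])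

text \<open>The component preserves the degree fg, which is \<open>cj f g\<close> times
  \<open>f\<close>; stripping \<open>u\<close> removes the factor \<open>f\<close>.\<close>

lemma act_piece:
  assumes f: "f \<in> carrier G" and g: "g \<in> carrier G" and y: "y \<in> piece X g"
  shows "act f y \<in> piece X (cj f g)"
proof -
  note L = gs_line[OF f]
  have "tv (line f) X u y \<in> piece (line f \<otimes>\<^sub>V X) (cj f g \<otimes>\<^bsub>G\<^esub> f)"
    using tv_piece[OF L X f g u_piece[OF f] y] f g by (simp add: cj_swap)
  from runit_piece[OF X f _ gm_piece[OF comp_gm[OF L] _ this]]
  show ?thesis using f g y piece_car[OF X g y] by (simp add: act_def)
qed

text \<open>The associativity constraint followed by stripping \<open>u\<close> twice returns the
  first factor times a value of \<open>\<alpha>\<close>, which is a unit. That value is known for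
  homogeneous vectors, hence the common degree \<open>k\<close>.\<close>

lemma tv_u_u_cancel:
  assumes "f \<in> carrier G" "g \<in> carrier G" "k \<in> carrier G" "y \<in> piece X k" "z \<in> piece X k"
    and "tv X (line f \<otimes>\<^sub>V line g) y (tv (line f) (line g) u u) = tv X (line f \<otimes>\<^sub>V line g) z (tv (line f) (line g) u u)"
  shows "y = z"
proof -
  note L = gs_line[OF assms(1)] gs_line[OF assms(2)]
  note XL = gs_tensor[OF X L(1)]
  have r: "runit_map K T X (runit_map K T (X \<otimes>\<^sub>V line f) (am X (line f) (line g)
       (tv X (line f \<otimes>\<^sub>V line g) w (tv (line f) (line g) u u)))) = \<alpha> k f g \<odot>\<^bsub>space X\<^esub> w"
    if w: "w \<in> piece X k" for w
  proof -
    have wc: "w \<in> car X" by (rule piece_car[OF X assms(3) w])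
    have lin1: "lin ((X \<otimes>\<^sub>V line f) \<otimes>\<^sub>V line g) (X \<otimes>\<^sub>V line f) (runit_map K T (X \<otimes>\<^sub>V line f))"
      and lin2: "lin (X \<otimes>\<^sub>V line f) X (runit_map K T X)"
      using runit_Lin[OF XL assms(2)] runit_Lin[OF X assms(1)] by (simp_all add: Lin_iff)
    have c: "tv X (line f) w u \<in> car (X \<otimes>\<^sub>V line f)" by (rule tv_closed[OF X L(1) wc u_closed])
    show ?thesis
      using assms(1-3) wc c
      by (simp add: am_tv[OF X L assms(3,1,2) w u_piece[OF assms(1)] u_piece[OF assms(2)]]
          is_linear_smult[OF lin1] is_linear_smult[OF lin2] tv_closed[OF XL L(2) c u_closed]
          runit_tv[OF XL assms(2)] runit_tv[OF X assms(1)])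
  qed
  show ?thesis
    using r[OF assms(4)] r[OF assms(5)] assms(1-5) piece_car[OF X assms(3)]
    by - (rule smult_cancel[OF X, of "\<alpha> k f g"], simp_all add: assms(6))
qed

text \<open>The hexagon for two lines, evaluated on u \<otimes> (u \<otimes> y). Its left side
  involves the component at \<open>line f \<otimes>\<^sub>V line g\<close>, which is not given by
  the definition of \<open>act\<close>; naturality, through \<open>comp_tv\<close>, computes it on u
  \<otimes> u, an element of degree fg.\<close>

lemma act_mult:
  assumes f: "f \<in> carrier G" and g: "g \<in> carrier G" and h: "h \<in> carrier G" and y: "y \<in> piece X h"
  shows "act (f \<otimes>\<^bsub>G\<^esub> g) y = ac f g h \<odot>\<^bsub>space X\<^esub> act f (act g y)"
proof -
  let ?V = "line f" and ?U = "line g"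
  note V = gs_line[OF f] and U = gs_line[OF g]
  note VU = gs_tensor[OF V U] and UX = gs_tensor[OF U X] and VX = gs_tensor[OF V X]
    and XV = gs_tensor[OF X V] and XU = gs_tensor[OF X U]
  let ?S = "?V \<otimes>\<^sub>V (?U \<otimes>\<^sub>V X)" and ?W = "X \<otimes>\<^sub>V (?V \<otimes>\<^sub>V ?U)"
  note gss = V U VU UX VX XV XU X gs_tensor[OF V UX] gs_tensor[OF X VU] gs_tensor[OF V XU] gs_tensor[OF VX U]
    gs_tensor[OF XV U] gs_tensor[OF VU X]
  have fg: "f \<otimes>\<^bsub>G\<^esub> g \<in> carrier G" and cj: "cj g h \<in> carrier G" "cj f (cj g h) \<in> carrier G"
    and cj': "cj (f \<otimes>\<^bsub>G\<^esub> g) h = cj f (cj g h)" using f g h by (auto simp: cj_mult)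
  have yc: "y \<in> car X" by (rule piece_car[OF X h y])
  note c1 = act_closed[OF g yc] note c2 = act_closed[OF f c1]
  note p1 = act_piece[OF g h y] note p2 = act_piece[OF f cj(1) p1]
  note p0 = act_piece[OF fg h y, unfolded cj']
  note c0 = act_closed[OF fg yc]
  note ta = V UX V XU gm_id[OF V] comp_gm[OF U]
  note tb = VX U XV U comp_gm[OF V] gm_id[OF U]
  let ?uu = "tv ?V ?U u u"
  have uu: "?uu \<in> piece (?V \<otimes>\<^sub>V ?U) (f \<otimes>\<^bsub>G\<^esub> g)" "?uu \<in> car (?V \<otimes>\<^sub>V ?U)"
    by (rule tv_piece[OF V U f g u_piece[OF f] u_piece[OF g]]) (rule tv_closed[OF V U u_closed u_closed])
  have eq: "compose (car ?S) (comp (?V \<otimes>\<^sub>V ?U)) (am ?V ?U X) =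
     compose (car ?S) (am_inv X ?V ?U) (compose (car ?S) (tm (?V \<otimes>\<^sub>V X) (X \<otimes>\<^sub>V ?V) (comp ?V) ?U ?U (idm ?U))
       (compose (car ?S) (am ?V X ?U) (tm ?V ?V (idm ?V) (?U \<otimes>\<^sub>V X) (X \<otimes>\<^sub>V ?U) (comp ?U))))"
    using x_hexagon[OF V U] V U VU by (simp add: Vc_simps x_eq Vc_Inv_Assoc X)
  let ?t = "tv ?V (?U \<otimes>\<^sub>V X) u (tv ?U X u y)"
  have t: "?t \<in> car ?S" using yc u_closed by (simp add: tv_closed gss)
  have t2: "tv X (?V \<otimes>\<^sub>V ?U) (act f (act g y)) ?uu \<in> car ?W"
    using c2 uu by (auto simp: tv_closed gss)
  have am_l: "am ?V ?U X ?t = \<alpha> f g h \<odot>\<^bsub>space ((?V \<otimes>\<^sub>V ?U) \<otimes>\<^sub>V X)\<^esub> tv (?V \<otimes>\<^sub>V ?U) X ?uu y"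
    by (rule am_tv[OF V U X f g h u_piece[OF f] u_piece[OF g] y])
  have "\<alpha> f g h \<odot>\<^bsub>space ?W\<^esub> tv X (?V \<otimes>\<^sub>V ?U) (act (f \<otimes>\<^bsub>G\<^esub> g) y) ?uu =
      compose (car ?S) (comp (?V \<otimes>\<^sub>V ?U)) (am ?V ?U X) ?t"
    using t f g h yc uu
    by (simp add: compose_eq am_l gm_smult[OF comp_gm[OF VU]] tv_closed gss comp_tv[OF VU fg uu(1) yc])
  \<comment> \<open>The two constraints on the right of the hexagon contribute the right side of
    \<open>ac_\<alpha>\<close>.\<close>
  also have "\<dots> = (\<alpha> f g h \<otimes>\<^bsub>K\<^esub> ac f g h) \<odot>\<^bsub>space ?W\<^esub> tv X (?V \<otimes>\<^sub>V ?U) (act f (act g y)) ?uu"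
    unfolding eq using t f g h yc c1 c2 cj u_closed t2
    by (simp add: compose_eq tv_closed gss tm_tv[OF ta] act_line
        am_tv[OF V X U f cj(1) g u_piece[OF f] p1 u_piece[OF g]] gm_smult[OF tm_gm[OF tb]] tm_tv[OF tb]
        gm_smult[OF am_inv_gm[OF X V U]] am_inv_tv[OF X V U cj(2) f g p2 u_piece[OF f] u_piece[OF g]]
        gs_smult_smult ac_\<alpha> K.m_comm)
  also have "\<dots> = \<alpha> f g h \<odot>\<^bsub>space ?W\<^esub> tv X (?V \<otimes>\<^sub>V ?U) (ac f g h \<odot>\<^bsub>space X\<^esub> act f (act g y)) ?uu"
    using f g h c2 uu t2 by (simp add: tv_smult_left gss gs_smult_smult)
  finally have "tv X (?V \<otimes>\<^sub>V ?U) (act (f \<otimes>\<^bsub>G\<^esub> g) y) ?uu =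
      tv X (?V \<otimes>\<^sub>V ?U) (ac f g h \<odot>\<^bsub>space X\<^esub> act f (act g y)) ?uu"
    by (rule smult_cancel[OF gs_tensor[OF X VU], rotated 3])
       (use f g h c0 c2 uu in \<open>simp_all add: tv_closed gss gs_smult_closed\<close>)
  from tv_u_u_cancel[OF f g cj(2) p0 _ this] show ?thesis
    using f g h p2 cj by (simp add: piece_smult X)
qed

text \<open>The component at the line is injective, and \<open>lunit_map\<close> at that line
  recovers \<open>y\<close> from u \<otimes> y.\<close>

lemma act_inj:
  assumes f: "f \<in> carrier G"
  shows "inj_on (act f) (car X)"
proof (rule inj_onI)
  fix y z assume yz: "y \<in> car X" "z \<in> car X" "act f y = act f z"
  note L = gs_line[OF f]
  have "comp (line f) (tv (line f) X u y) = comp (line f) (tv (line f) X u z)"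
    using yz f by (simp add: act_line)
  then have "tv (line f) X u y = tv (line f) X u z"
    using comp_inj[OF L] yz L X u_closed by (auto simp: tv_closed dest: inj_onD)
  then show "y = z" using lunit_tv[OF X f yz(1)] lunit_tv[OF X f yz(2)] by metis
qed

lemma pa_act: "pa X act"
proof (rule projective_actionI[OF X _ act_Lin act_piece act_mult])
  show "act \<one>\<^bsub>G\<^esub> y = y" if "y \<in> car X" for y
    \<comment> \<open>\<open>act\<close> is not yet known to be projective; injectivity and the
      multiplication rule are all that is available at this point.\<close>
    by (rule action_one[where \<rho> = act, OF X _ act_inj[OF G.one_closed] _ that])
       (use act_Lin[OF G.one_closed] act_mult[OF G.one_closed G.one_closed] in \<open>auto simp: Lin_iff\<close>)
  show "act \<in> extensional (carrier G)" by (simp add: act_def)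
qed

lemma hb_act: "hb X act = x"
proof (rule extensionalityI[of _ "Obj Vc"])
  show "x \<in> extensional (Obj Vc)" using x by (simp add: half_braiding_def)
  fix V assume "V \<in> Obj Vc"
  then have V: "gs V" by (simp add: Vc_simps)
  have "br V X act = comp V"
    by (rule tensor_gm_eqI[OF V X gs_tensor[OF X V] br_gm[OF V X pa_act] comp_gm[OF V]])
       (simp add: br_tv[OF V X pa_act] comp_tv[OF V])
  then show "hb X act V = x V" by (simp add: hb_apply V x_eq)
qed (simp add: hb_def)

end

section \<open>The bijection on objects\<close>

lemma half_braiding_obtain:
  assumes "gs X" "half_braiding Vc X x"
  obtains \<rho> where "pa X \<rho>" "x = hb X \<rho>"
  using pa_act[OF assms] hb_act[OF assms] by metis

text \<open>The components at the lines already determine the action: removing \<open>u\<close> from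
  the image of u \<otimes> x leaves the value at x.\<close>

lemma hb_inj:
  assumes X: "gs X" and \<rho>: "pa X \<rho>" and \<rho>': "pa X \<rho>'" and eq: "hb X \<rho> = hb X \<rho>'"
  shows "\<rho> = \<rho>'"
proof (rule extensionalityI[of _ "carrier G"])
  show "\<rho> \<in> extensional (carrier G)" "\<rho>' \<in> extensional (carrier G)"
    using \<rho> \<rho>' by (auto simp: projective_action_def)
  fix f assume f: "f \<in> carrier G"
  note L = gs_line[OF f]
  have "br (line f) X \<rho> = br (line f) X \<rho>'"
    using fun_cong[OF eq, of "line f"] L by (simp add: hb_apply)
  then have "tv X (line f) (\<rho> f x) u = tv X (line f) (\<rho>' f x) u" if "x \<in> car X" for x
    using br_tv[OF L X \<rho> f u_piece[OF f] that] br_tv[OF L X \<rho>' f u_piece[OF f] that] by simp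
  then have "\<rho> f x = \<rho>' f x" if "x \<in> car X" for x
    using runit_tv[OF X f] pa_closed[OF \<rho> f that] pa_closed[OF \<rho>' f that] that by metis
  then show "\<rho> f = \<rho>' f" by (rule Lin_eqI[OF pa_Lin[OF \<rho> f] pa_Lin[OF \<rho>' f]])
qed

definition Zo :: "('g, 'k, 'v) action_obj \<Rightarrow> (('g, 'k, 'v) graded, ('g, 'k, 'v) graded_arr) centre_obj" where
  "Zo A = (fst A, hb (fst A) (snd A))"

definition Za :: "('g, 'k, 'v) action_arr \<Rightarrow> (('g, 'k, 'v) graded, ('g, 'k, 'v) graded_arr) centre_arr" where
  "Za = (\<lambda>(A, \<phi>, B). (Zo A, (fst A, \<phi>, fst B), Zo B))"

lemma fst_Zo [simp]: "fst (Zo A) = fst A" and snd_Zo [simp]: "snd (Zo A) = hb (fst A) (snd A)"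
  by (simp_all add: Zo_def)

lemma Za_apply: "Za (A, \<phi>, B) = (Zo A, (fst A, \<phi>, fst B), Zo B)"
  by (simp add: Za_def)

lemma Zo_bij: "bij_betw Zo {A. zobj A} {(X, x). gs X \<and> half_braiding Vc X x}"
proof (rule bij_betw_imageI)
  show "inj_on Zo {A. zobj A}"
    by (rule inj_onI) (auto simp: Zo_def zobj_def intro: hb_inj)
  show "Zo ` {A. zobj A} = {(X, x). gs X \<and> half_braiding Vc X x}"
  proof (intro equalityI subsetI)
    fix P assume "P \<in> {(X, x). gs X \<and> half_braiding Vc X x}"
    then obtain X x where P: "P = (X, x)" "gs X" "half_braiding Vc X x" by auto
    obtain \<rho> where "pa X \<rho>" "x = hb X \<rho>" by (rule half_braiding_obtain[OF P(2,3)])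
    then show "P \<in> Zo ` {A. zobj A}"
      using P by (intro image_eqI[of _ _ "(X, \<rho>)"]) (auto simp: Zo_def zobj_def)
  qed (auto simp: Zo_def zobj_def half_braiding_hb)
qed

text \<open>For the forward direction the components at the lines suffice.\<close>

lemma centre_arrow_iff:
  assumes A: "zobj A" and B: "zobj B" and \<phi>: "\<phi> \<in> gm (fst A) (fst B)"
  shows "(\<forall>V \<in> Obj Vc. ((fst A, \<phi>, fst B) \<star>\<^bsub>Vc\<^esub> Idn Vc V) \<bullet>\<^bsub>Vc\<^esub> hb (fst A) (snd A) V =
      hb (fst B) (snd B) V \<bullet>\<^bsub>Vc\<^esub> (Idn Vc V \<star>\<^bsub>Vc\<^esub> (fst A, \<phi>, fst B))) \<longleftrightarrow> \<phi> \<in> zm A B" (is "?l \<longleftrightarrow> _")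
proof
  note gs = zobj_gs[OF A] zobj_gs[OF B] and pa = zobj_pa[OF A] zobj_pa[OF B]
  {
    assume l: ?l
    have "\<phi> (snd A f x) = snd B f (\<phi> x)" if f: "f \<in> carrier G" and x: "x \<in> car (fst A)" for f x
    proof -
      note L = gs_line[OF f]
      note t = gs(1) L gs(2) L \<phi> gm_id[OF L] and t' = L gs(1) L gs(2) gm_id[OF L] \<phi>
      have "compose (car (line f \<otimes>\<^sub>V fst A)) (tm (fst A) (fst B) \<phi> (line f) (line f) (idm (line f))) (br (line f) (fst A) (snd A)) =
          compose (car (line f \<otimes>\<^sub>V fst A)) (br (line f) (fst B) (snd B)) (tm (line f) (line f) (idm (line f)) (fst A) (fst B) \<phi>)"
        using l L by (auto simp: Vc_simps hb_apply)
      from fun_cong[OF this, of "tv (line f) (fst A) u x"]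
      have "tv (fst B) (line f) (\<phi> (snd A f x)) u = tv (fst B) (line f) (snd B f (\<phi> x)) u"
        using f x
        by (simp add: compose_eq tv_closed gs L u_closed br_tv[OF L gs(1) pa(1) f u_piece[OF f]]
            br_tv[OF L gs(2) pa(2) f u_piece[OF f]] tm_tv[OF t] tm_tv[OF t'] pa_closed[OF pa(1)] gm_closed[OF \<phi>])
      then show ?thesis
        using runit_tv[OF gs(2) f] gm_closed[OF \<phi> pa_closed[OF pa(1) f x]] pa_closed[OF pa(2) f gm_closed[OF \<phi> x]]
        by metis
    qed
    then show "\<phi> \<in> zm A B" using \<phi> by (simp add: zm_def)
  next
    assume zm: "\<phi> \<in> zm A B"
    show ?l
    proof
      fix V assume "V \<in> Obj Vc"
      then have V: "gs V" by (simp add: Vc_simps)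
      have "compose (car (V \<otimes>\<^sub>V fst A)) (br V (fst B) (snd B)) (tm V V (idm V) (fst A) (fst B) \<phi>) =
          compose (car (V \<otimes>\<^sub>V fst A)) (tm (fst A) (fst B) \<phi> V V (idm V)) (br V (fst A) (snd A))"
        by (rule br_natural[OF V V gs pa gm_id[OF V] \<phi>]) (simp add: zm_equivariant[OF zm])
      then show "((fst A, \<phi>, fst B) \<star>\<^bsub>Vc\<^esub> Idn Vc V) \<bullet>\<^bsub>Vc\<^esub> hb (fst A) (snd A) V =
          hb (fst B) (snd B) V \<bullet>\<^bsub>Vc\<^esub> (Idn Vc V \<star>\<^bsub>Vc\<^esub> (fst A, \<phi>, fst B))"
        by (simp add: Vc_simps hb_apply V)
    qed
  }
qed

section \<open>Matching the structure of the centre with that of \<open>ZCat\<close>\<close>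

lemma centre_simps:
  "Obj (centre Vc) = {(X, x). gs X \<and> half_braiding Vc X x}"
  "Dom (centre Vc) (P, F, Q) = P"
  "Cod (centre Vc) (P, F, Q) = Q"
  "Idn (centre Vc) P = (P, Idn Vc (fst P), P)"
  "Cmp (centre Vc) (Q', H, R) (P, F, Q) = (P, H \<bullet>\<^bsub>Vc\<^esub> F, R)"
  "TObj (centre Vc) = centre_tensor Vc"
  "TArr (centre Vc) (P, F, Q) (P', F', Q') = (centre_tensor Vc P P', F \<star>\<^bsub>Vc\<^esub> F', centre_tensor Vc Q Q')"
  "Unit (centre Vc) = centre_unit Vc"
  "Assoc (centre Vc) P Q R = (centre_tensor Vc P (centre_tensor Vc Q R), Assoc Vc (fst P) (fst Q) (fst R),
     centre_tensor Vc (centre_tensor Vc P Q) R)"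
  "LUnit (centre Vc) P = (centre_tensor Vc (centre_unit Vc) P, LUnit Vc (fst P), P)"
  "RUnit (centre Vc) P = (centre_tensor Vc P (centre_unit Vc), RUnit Vc (fst P), P)"
  "Braid (centre Vc) P Q = (centre_tensor Vc P Q, snd Q (fst P), centre_tensor Vc Q P)"
  by (auto simp: centre_def Vc_simps split: prod.splits)

text \<open>With \<open>Inv\<close> made explicit, the half-braiding of a tensor product is the
  right side of \<open>br_tensor_right\<close>.\<close>

lemma Zo_tensor:
  assumes A: "zobj A" and B: "zobj B"
  shows "centre_tensor Vc (Zo A) (Zo B) = Zo (zt A B)"
proof -
  note gs = zobj_gs[OF A] zobj_gs[OF B] and pa = zobj_pa[OF A] zobj_pa[OF B]
  have "tensor_half_braiding Vc (Zo A) (Zo B) = hb (fst A \<otimes>\<^sub>V fst B) (ta (fst A) (snd A) (fst B) (snd B))"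
    unfolding tensor_half_braiding_def Zo_def hb_def split
    by (rule restrict_ext) (simp add: Vc_simps Vc_Inv_Assoc gs br_tensor_right[OF _ gs pa])
  then show ?thesis by (simp add: centre_tensor_def zt_eq Vc_simps Zo_def)
qed

lemma Zo_unit: "centre_unit Vc = Zo zunit"
proof -
  have "(\<lambda>V \<in> Obj Vc. Inv Vc (LUnit Vc V) \<bullet>\<^bsub>Vc\<^esub> RUnit Vc V) = hb unit ua"
    unfolding hb_def by (rule restrict_ext) (simp add: Vc_simps Vc_Inv_LUnit br_unit)
  then show ?thesis by (simp add: centre_unit_def Zo_def Vc_simps)
qed

text \<open>Arrows of the centre carry their endpoints. Once both half-braidings are written as
  \<open>hb\<close> of an action, \<open>centre_arrow_iff\<close> turns the condition on the map
  into equivariance.\<close>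

lemma Arr_centre: "Arr (centre Vc) = Za ` Arr Zc"
proof (intro equalityI subsetI)
  fix H assume "H \<in> Arr (centre Vc)"
  then obtain X x F Y y where H: "H = ((X, x), F, (Y, y))" "gs X" "half_braiding Vc X x" "gs Y"
      "half_braiding Vc Y y" "F \<in> Hom Vc X Y"
      "\<forall>V \<in> Obj Vc. (F \<star>\<^bsub>Vc\<^esub> Idn Vc V) \<bullet>\<^bsub>Vc\<^esub> x V = y V \<bullet>\<^bsub>Vc\<^esub> (Idn Vc V \<star>\<^bsub>Vc\<^esub> F)"
    unfolding centre_def by (auto simp: Vc_simps)
  obtain \<rho> where \<rho>: "pa X \<rho>" "x = hb X \<rho>" by (rule half_braiding_obtain[OF H(2,3)])
  obtain \<sigma> where \<sigma>: "pa Y \<sigma>" "y = hb Y \<sigma>" by (rule half_braiding_obtain[OF H(4,5)])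
  obtain \<phi> where \<phi>: "\<phi> \<in> gm X Y" "F = (X, \<phi>, Y)" using H(6) by (auto simp: Hom_Vc)
  have obj: "zobj (X, \<rho>)" "zobj (Y, \<sigma>)" using H \<rho> \<sigma> by (auto simp: zobj_def)
  have "\<phi> \<in> zm (X, \<rho>) (Y, \<sigma>)"
    using centre_arrow_iff[OF obj] H(7) \<phi> \<rho>(2) \<sigma>(2) by simp
  then show "H \<in> Za ` Arr Zc"
    using H(1) \<rho>(2) \<sigma>(2) \<phi>(2) obj by (intro image_eqI[of _ _ "((X, \<rho>), \<phi>, (Y, \<sigma>))"]) (auto simp: Za_def Zo_def Zc_simps)
next
  fix H assume "H \<in> Za ` Arr Zc"
  then obtain A \<phi> B where H: "H = Za (A, \<phi>, B)" "zobj A" "zobj B" "\<phi> \<in> zm A B" by (auto simp: Zc_simps)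
  then show "H \<in> Arr (centre Vc)"
    using centre_arrow_iff[OF H(2,3) zm_gm[OF H(4)]] zm_gm[OF H(4)]
    by (simp add: centre_def Za_def Zo_def Vc_simps(1) Hom_Vc zobj_gs half_braiding_hb zobj_pa)
qed

lemma centre_transport: "braided_transport Zc (centre Vc) Zo Za"
proof (intro braided_transport.intro braided_Zc braided_transport_axioms.intro)
  show "bij_betw Zo (Obj Zc) (Obj (centre Vc))" using Zo_bij by (simp add: Zc_simps centre_simps)
  \<comment> \<open>Arrows record their endpoints, so injectivity of \<open>Za\<close> reduces to
    that of \<open>Zo\<close>.\<close>
  have "inj_on Za (Arr Zc)"
    using Zo_bij unfolding bij_betw_def by (auto simp: inj_on_def Za_def Zc_simps)
  then show "bij_betw Za (Arr Zc) (Arr (centre Vc))" by (simp add: bij_betw_def Arr_centre)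
next
  fix F assume "F \<in> Arr Zc"
  then obtain A \<phi> B where F: "F = (A, \<phi>, B)" by (cases F) auto
  show "Dom (centre Vc) (Za F) = Zo (Dom Zc F)" "Cod (centre Vc) (Za F) = Zo (Cod Zc F)"
    by (simp_all add: F Za_apply Zc_simps centre_simps)
next
  fix F H assume FH: "F \<in> Arr Zc" "H \<in> Arr Zc"
  then obtain A \<phi> B A' \<phi>' B' where F: "F = (A, \<phi>, B)" and H: "H = (A', \<phi>', B')"
    by (cases F; cases H) auto
  show "Za H \<bullet>\<^bsub>centre Vc\<^esub> Za F = Za (H \<bullet>\<^bsub>Zc\<^esub> F)"
    by (simp add: F H Za_apply Zc_simps centre_simps Vc_simps)
  have "zobj A" "zobj A'" "zobj B" "zobj B'" using FH by (auto simp: F H Zc_simps)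
  then show "Za F \<star>\<^bsub>centre Vc\<^esub> Za H = Za (F \<star>\<^bsub>Zc\<^esub> H)"
    by (simp add: F H Za_apply Zc_simps centre_simps Vc_simps Zo_tensor)
next
  fix A assume "A \<in> Obj Zc"
  then have A: "zobj A" by (simp add: Zc_simps)
  show "Idn (centre Vc) (Zo A) = Za (Idn Zc A)" "LUnit (centre Vc) (Zo A) = Za (LUnit Zc A)"
    "RUnit (centre Vc) (Zo A) = Za (RUnit Zc A)"
    using A by (simp_all add: Za_apply Zc_simps centre_simps Vc_simps Zo_tensor Zo_unit zobj_unit)
next
  fix A B assume "A \<in> Obj Zc" "B \<in> Obj Zc"
  then have AB: "zobj A" "zobj B" by (simp_all add: Zc_simps)
  then show "Zo A \<boxtimes>\<^bsub>centre Vc\<^esub> Zo B = Zo (A \<boxtimes>\<^bsub>Zc\<^esub> B)" by (simp add: Zc_simps centre_simps Zo_tensor)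
  show "Braid (centre Vc) (Zo A) (Zo B) = Za (Braid Zc A B)"
    using AB by (simp add: Za_apply Zc_simps centre_simps Zo_tensor hb_apply zobj_gs)
next
  fix A B D assume "A \<in> Obj Zc" "B \<in> Obj Zc" "D \<in> Obj Zc"
  then show "Assoc (centre Vc) (Zo A) (Zo B) (Zo D) = Za (Assoc Zc A B D)"
    by (simp add: Za_apply Zc_simps centre_simps Vc_simps Zo_tensor zobj_zt)
qed (simp add: Zc_simps centre_simps Zo_unit)

lemma Hom_centre:
  assumes "F \<in> Hom (centre Vc) P Q"
  obtains A \<phi> B where "zobj A" "zobj B" "\<phi> \<in> zm A B" "F = Za (A, \<phi>, B)" "P = Zo A" "Q = Zo B"
  using assms by (auto simp: Hom_def Arr_centre Zc_simps Za_apply centre_simps)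

section \<open>The forgetful functors\<close>

lemma centre_forget_simps:
  "centre_forget_obj (Zo A) = fst A" "centre_forget_arr (Za (A, \<phi>, B)) = (fst A, \<phi>, fst B)"
  by (simp_all add: centre_forget_obj_def centre_forget_arr_def Zo_def Za_apply)

lemma action_forget_simps:
  "action_forget_obj A = fst A" "action_forget_arr (A, \<phi>, B) = (fst A, \<phi>, fst B)"
  by (simp_all add: action_forget_obj_def action_forget_arr_def split: prod.splits)

lemma action_forget_functor: "cat_functor Zc Vc action_forget_obj action_forget_arr"
proof (intro cat_functor.intro category_Zc category_Vc cat_functor_axioms.intro)
  fix F A B assume "F \<in> Hom Zc A B"
  then show "action_forget_arr F \<in> Hom Vc (action_forget_obj A) (action_forget_obj B)"
    by (auto simp: Hom_Zc Hom_Vc action_forget_simps zobj_gs zm_gm)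
next
  fix F H A B D assume "F \<in> Hom Zc A B" "H \<in> Hom Zc B D"
  then show "action_forget_arr (H \<bullet>\<^bsub>Zc\<^esub> F) = action_forget_arr H \<bullet>\<^bsub>Vc\<^esub> action_forget_arr F"
    by (auto simp: Hom_Zc action_forget_simps Zc_simps Vc_simps)
qed (auto simp: action_forget_simps Zc_simps Vc_simps zobj_gs)

lemma centre_forget_functor: "cat_functor (centre Vc) Vc centre_forget_obj centre_forget_arr"
proof (intro cat_functor.intro braided_transport.category_C[OF centre_transport] category_Vc
    cat_functor_axioms.intro)
  fix F P Q assume "F \<in> Hom (centre Vc) P Q"
  then show "centre_forget_arr F \<in> Hom Vc (centre_forget_obj P) (centre_forget_obj Q)"
    by (rule Hom_centre) (auto simp: Hom_Vc centre_forget_simps zobj_gs zm_gm)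
next
  fix F H P Q R assume F: "F \<in> Hom (centre Vc) P Q" and H: "H \<in> Hom (centre Vc) Q R"
  obtain A \<phi> B where 1: "F = Za (A, \<phi>, B)" by (rule Hom_centre[OF F])
  obtain B' \<psi> D where 2: "H = Za (B', \<psi>, D)" by (rule Hom_centre[OF H])
  show "centre_forget_arr (H \<bullet>\<^bsub>centre Vc\<^esub> F) = centre_forget_arr H \<bullet>\<^bsub>Vc\<^esub> centre_forget_arr F"
    unfolding 1 2 by (simp add: centre_forget_arr_def Za_apply centre_simps)
qed (auto simp: centre_forget_obj_def centre_forget_arr_def centre_simps Vc_simps)

end

theorem proposition4p1:
  fixes G :: "('g, 'a) monoid_scheme" and K :: "'k ring"
    and T :: "('k, 'v) tensor_choice" and \<alpha> :: "'g \<Rightarrow> 'g \<Rightarrow> 'g \<Rightarrow> 'k"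
  assumes "algebraically_closed K"
    and "\<And>n::nat. n > 0 \<Longrightarrow> [n] \<cdot>\<^bsub>K\<^esub> \<one>\<^bsub>K\<^esub> \<noteq> \<zero>\<^bsub>K\<^esub>"
    and "group G" and "finite (carrier G)"
    and "normalised_3_cocycle G K \<alpha>"
    and "tensor_products K T"
  shows "\<exists>Fo Fa.
     braided_isomorphism (centre (VCat G K T \<alpha>)) (ZCat G K T \<alpha>) Fo Fa \<and>
     cat_functor (centre (VCat G K T \<alpha>)) (VCat G K T \<alpha>) centre_forget_obj centre_forget_arr \<and>
     cat_functor (ZCat G K T \<alpha>) (VCat G K T \<alpha>) action_forget_obj action_forget_arr \<and>
     (\<forall>A \<in> Obj (centre (VCat G K T \<alpha>)). action_forget_obj (Fo A) = centre_forget_obj A) \<and>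
     (\<forall>a \<in> Arr (centre (VCat G K T \<alpha>)). action_forget_arr (Fa a) = centre_forget_arr a)"
proof -
  interpret cocycle_setting G K T \<alpha>
    using assms by (intro cocycle_setting.intro cocycle_setting_axioms.intro)
      (auto dest: algebraically_closed.axioms)
  \<comment> \<open>The transport starts from \<open>ZCat\<close>, so its \<open>Fo\<close> and
    \<open>Fa\<close> invert \<open>Zo\<close> and \<open>Za\<close> and lead from the centre to
    \<open>ZCat\<close>.\<close>
  interpret braided_transport Zc "centre Vc" Zo Za by (rule centre_transport)
  \<comment> \<open>\<open>Zo\<close> leaves the underlying graded space unchanged, hence so does
    its inverse \<open>Fo\<close>.\<close>
  have obj: "action_forget_obj (Fo P) = centre_forget_obj P" if "P \<in> Obj (centre Vc)" for P
    using centre_forget_simps(1)[of "Fo P"] that by (simp add: action_forget_simps)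
  have arr: "action_forget_arr (Fa F) = centre_forget_arr F" if "F \<in> Arr (centre Vc)" for F
  proof -
    obtain A \<phi> B where "Fa F = (A, \<phi>, B)" by (cases "Fa F") auto
    then show ?thesis using centre_forget_simps(2)[of A \<phi> B] Fa(2)[OF that] by (simp add: action_forget_simps)
  qed
  show ?thesis
    using braided_isomorphism_C centre_forget_functor action_forget_functor obj arr by blast
qed

end
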